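(* Let $q$ be a power of an odd prime number $p$ and let $K=\mathbb{F}_q(T)$. For every pair of positive integers $(r,d)$ such that $r$ is even and $\gcd(r,q^d-1)=2$, there exists a $K$-regular Galois extension of the purely transcendental field $K(t_1,\dots,t_{r-1})$ whose Galois group is isomorphic to $PSL(r,q^d)$.
   Context: $\mathbb{F}_q$ is the finite field with $q$ elements and $T$ is an indeterminate. An extension $E$ of $K(t_1,\dots,t_{r-1})$ is $K$-regular if $K$ is algebraically closed in $E$. *)

theory Defs
  imports
    "HOL-Algebra.Algebraic_Closure_Type"
    "HOL-Algebra.Generated_Fields"
    "HOL-Algebra.Bij"
    "HOL-Library.Cardinality"
    "HOL-Library.Poly_Mapping"
    "HOL-Number_Theory.Residues"
    "Jordan_Normal_Form.Determinant"
begin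

section \<open>Field extensions inside an algebraically closed field\<close>

text \<open>
  All fields below are subsets of one algebraically closed field type, so that the roots
  computed by \<^const>\<open>ring.alg_mult\<close> and \<^const>\<open>ring.roots\<close> are the
  roots in an algebraic closure.
\<close>

abbreviation ambient :: "'a :: alg_closed_field ring"
  where "ambient \<equiv> ring_of_type_algebra"

definition algebraic_extension :: "'a :: alg_closed_field set \<Rightarrow> 'a set \<Rightarrow> bool"
  where "algebraic_extension F E \<longleftrightarrow> (\<forall>x\<in>E. ring.algebraic ambient F x)"

definition normal_extension :: "'a :: alg_closed_field set \<Rightarrow> 'a set \<Rightarrow> bool"
  where "normal_extension F E \<longleftrightarrow>
    (\<forall>x\<in>E. set_mset (ring.roots ambient (ring.Irr ambient F x)) \<subseteq> E)"

definition separable_extension :: "'a :: alg_closed_field set \<Rightarrow> 'a set \<Rightarrow> bool"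
  where "separable_extension F E \<longleftrightarrow>
    (\<forall>x\<in>E. \<forall>a. ring.alg_mult ambient (ring.Irr ambient F x) a \<le> 1)"

definition galois_extension :: "'a :: alg_closed_field set \<Rightarrow> 'a set \<Rightarrow> bool"
  where "galois_extension F E \<longleftrightarrow>
    subfield F ambient \<and> subfield E ambient \<and> F \<subseteq> E \<and>
    algebraic_extension F E \<and> normal_extension F E \<and> separable_extension F E"

definition galois_group :: "'a :: alg_closed_field set \<Rightarrow> 'a set \<Rightarrow> ('a \<Rightarrow> 'a) monoid"
  where "galois_group F E = BijGroup E
    \<lparr>carrier := {\<sigma> \<in> Bij E.
       \<sigma> \<in> Ring.ring_hom (ambient\<lparr>carrier := E\<rparr>) (ambient\<lparr>carrier := E\<rparr>) \<and> (\<forall>x\<in>F. \<sigma> x = x)}\<rparr>"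

definition regular_extension :: "'a :: alg_closed_field set \<Rightarrow> 'a set \<Rightarrow> bool"
  where "regular_extension K E \<longleftrightarrow> (\<forall>x\<in>E. ring.algebraic ambient K x \<longrightarrow> x \<in> K)"


section \<open>The rational function fields\<close>

text \<open>
  For a field \<open>k\<close> given as a type \<^typ>\<open>'k\<close>, the type \<open>'k ratfun\<close> is \<open>k(T)\<close>.
  The ambient field is an algebraic closure of the field of rational functions over \<open>k(T)\<close>
  in indeterminates \<open>t\<^sub>0, t\<^sub>1, \<dots>\<close>, so it contains an algebraic closure of
  each \<open>k(T)(t\<^sub>1, \<dots>, t\<^sub>n)\<close>,
  and hence a copy of every algebraic extension of the latter. Inside it, \<open>const_field\<close> is \<open>k(T)\<close>
  and \<open>pure_field n\<close> is \<open>k(T)(t\<^sub>1, \<dots>, t\<^sub>n)\<close>.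
\<close>

type_synonym 'k ratfun = "'k poly fract"

type_synonym 'k universe = "((nat \<Rightarrow>\<^sub>0 nat) \<Rightarrow>\<^sub>0 'k ratfun) fract alg_closure"

definition const_univ :: "'k :: field ratfun \<Rightarrow> 'k universe"
  where "const_univ c = to_ac (to_fract (Poly_Mapping.single 0 c))"

definition indet :: "nat \<Rightarrow> 'k :: field universe"
  where "indet i = to_ac (to_fract (Poly_Mapping.single (Poly_Mapping.single i 1) 1))"

definition const_field :: "'k :: field universe set"
  where "const_field = range const_univ"

definition pure_field :: "nat \<Rightarrow> 'k :: field universe set"
  where "pure_field n = generate_field ambient (const_field \<union> indet ` {1..n})"


section \<open>Projective special linear groups\<close>

definition SL :: "nat \<Rightarrow> 'a :: field set \<Rightarrow> 'a mat monoid"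
  where "SL n F =
    \<lparr>carrier = {A \<in> carrier_mat n n. elements_mat A \<subseteq> F \<and> det A = 1},
     monoid.mult = (*), one = 1\<^sub>m n\<rparr>"

definition group_center :: "('a, 'b) monoid_scheme \<Rightarrow> 'a set"
  where "group_center G = {z \<in> carrier G. \<forall>g\<in>carrier G. z \<otimes>\<^bsub>G\<^esub> g = g \<otimes>\<^bsub>G\<^esub> z}"

definition PSL :: "nat \<Rightarrow> 'a :: field set \<Rightarrow> 'a mat set monoid"
  where "PSL n F = SL n F Mod group_center (SL n F)"

text \<open>
  If \<open>Q\<close> is a positive power of the order of \<open>k\<close>, then \<open>GF Q\<close> is the
  field with \<open>Q\<close> elements inside the algebraic closure of \<open>k\<close>; see \<open>GF_subfield\<close>
  and \<open>card_GF\<close> below.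
\<close>

definition GF :: "nat \<Rightarrow> 'k :: {field, finite} alg_closure set"
  where "GF Q = {x. x ^ Q = x}"

lemma CHAR_finite_field:
  assumes "prime p" and "CARD('k :: {field, finite}) = p ^ m"
  shows "CHAR('k) = p"
proof -
  have "CHAR('k) > 0"
    by (rule finite_imp_CHAR_pos) simp
  hence pr: "prime CHAR('k)"
    by (rule prime_CHAR_semidom)
  have "CHAR('k) dvd p ^ m"
    using CHAR_dvd_CARD[where 'a = 'k] assms(2) by simp
  hence "CHAR('k) dvd p"
    using pr prime_dvd_power by blast
  thus ?thesis
    using pr assms(1) primes_dvd_imp_eq by blast
qed

lemma card_GF:
  fixes p m d :: nat
  assumes "prime p" and "m > 0" and "d > 0" and card: "CARD('k :: {field, finite}) = p ^ m"
  shows "card (GF (CARD('k) ^ d) :: 'k alg_closure set) = CARD('k) ^ d"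
proof -
  define Q where "Q = CARD('k) ^ d"
  have p2: "p \<ge> 2"
    using assms(1) prime_ge_2_nat by blast
  have Q: "Q = p ^ (m * d)"
    by (simp add: Q_def card power_mult)
  have pdvd: "p dvd Q"
    using assms(2,3) by (simp add: Q dvd_power)
  have Q1: "Q > 1"
    using p2 assms(2,3) unfolding Q by (intro one_less_power) auto
  have char: "CHAR('k alg_closure) = p"
    using CHAR_finite_field[OF assms(1) card] by simp
  define P where "P = (Polynomial.monom 1 Q - Polynomial.monom 1 1 :: 'k alg_closure poly)"
  have deg: "Polynomial.degree P = Q"
  proof (rule antisym)
    show "Polynomial.degree P \<le> Q"
      unfolding P_def using Q1
      by (intro degree_diff_le) (auto simp: Polynomial.degree_monom_eq)
    show "Polynomial.degree P \<ge> Q"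
      by (rule le_degree) (use Q1 in \<open>auto simp: P_def\<close>)
  qed
  have P0: "P \<noteq> 0"
    using deg Q1 by auto
  have roots: "{x. poly P x = 0} = GF Q"
    by (auto simp: P_def GF_def poly_monom)
  have "of_nat Q = (0 :: 'k alg_closure)"
    using pdvd char of_nat_eq_0_iff_char_dvd by metis
  hence pderiv: "pderiv P = [:-1:]"
    by (simp add: P_def pderiv_diff pderiv_monom flip: one_pCons) (simp add: monom_0 one_pCons)
  have order: "order x P = 1" if "poly P x = 0" for x
  proof (rule ccontr)
    assume "order x P \<noteq> 1"
    moreover have "order x P \<noteq> 0"
      using that P0 order_root by blast
    ultimately have "[:-x, 1:] ^ 2 dvd P"
      using order_divides[of x 2 P] by auto
    then obtain R where "P = [:-x, 1:] ^ 2 * R" ..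
    hence "P = [:-x, 1:] * ([:-x, 1:] * R)"
      by (simp only: power2_eq_square mult.assoc)
    hence "poly (pderiv P) x = 0"
      by (simp only: pderiv_mult poly_add poly_mult) simp
    thus False
      using pderiv by simp
  qed
  obtain A where A: "size A = Polynomial.degree P"
    "P = smult (Polynomial.lead_coeff P) (\<Prod>x\<in>#A. [:-x, 1:])"
    using alg_closed_imp_factorization[OF P0] by blast
  have "proots P = proots (\<Prod>x\<in>#A. [:-x, 1:])"
    using P0 by (subst A(2)) simp
  also have "\<dots> = A"
  proof (induction A)
    case (add x A)
    have "(\<Prod>x\<in>#A. [:-x, 1:]) \<noteq> 0"
      by (auto simp: prod_mset_zero_iff)
    hence "proots ([:-x, 1:] * (\<Prod>x\<in>#A. [:-x, 1:])) = {#x#} + A"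
      by (subst proots_mult) (use add.IH in auto)
    thus ?case
      by simp
  qed simp
  finally have prA: "proots P = A" .
  have "count (proots P) x = (if x \<in> GF Q then 1 else 0)" for x
    using order[of x] P0 by (auto simp: order_0I simp flip: roots)
  moreover have "finite (GF Q :: 'k alg_closure set)"
    using poly_roots_finite[OF P0] roots by simp
  ultimately have "proots P = mset_set (GF Q)"
    by (intro multiset_eqI) auto
  hence "card (GF Q :: 'k alg_closure set) = size A"
    using prA by simp
  thus ?thesis
    using A(1) deg by (simp add: Q_def)
qed

lemma GF_subfield:
  fixes p m d :: nat
  assumes "prime p" and "m > 0" and "d > 0" and card: "CARD('k :: {field, finite}) = p ^ m"
  shows "subfield (GF (CARD('k) ^ d) :: 'k alg_closure set) ambient"
proof -
  define Q where "Q = CARD('k) ^ d"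
  let ?F = "GF Q :: 'k alg_closure set"
  interpret A: field "ambient :: 'k alg_closure ring"
    by (rule field_from_type_algebra)
  have char: "CHAR('k alg_closure) = p"
    using CHAR_finite_field[OF assms(1) card] by simp
  have Q: "Q = CHAR('k alg_closure) ^ (m * d)"
    unfolding char by (simp add: Q_def card power_mult)
  have Q0: "Q > 0"
    by (simp add: Q_def)
  have add: "x + y \<in> ?F" if "x \<in> ?F" "y \<in> ?F" for x y
    using freshmans_dream'[OF _ Q, of x y] that assms(1) char by (simp add: GF_def)
  have uminus: "- x \<in> ?F" if "x \<in> ?F" for x
    using freshmans_dream'[OF _ Q, of x "- x"] that assms(1) char Q0
    by (simp add: GF_def zero_power add_eq_0_iff)
  have a_inv: "a_inv ambient x = - x" for x :: "'k alg_closure"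
    by (rule A.minus_equality) (auto simp: ring_of_type_algebra_def)
  have m_inv: "m_inv ambient x = inverse x" if "x \<noteq> 0" for x :: "'k alg_closure"
    by (rule A.comm_inv_char) (use that in \<open>auto simp: ring_of_type_algebra_def\<close>)
  have "subfield ?F ambient"
  proof (rule A.subfieldI')
    show "subring ?F ambient"
      by (rule A.subringI)
         (use add uminus in \<open>simp_all add: a_inv, simp_all add: ring_of_type_algebra_def\<close>,
          simp_all add: GF_def power_mult_distrib)
    show "m_inv ambient k \<in> ?F" if "k \<in> ?F - {\<zero>\<^bsub>ambient\<^esub>}" for k
      using that m_inv[of k]
      by (auto simp: ring_of_type_algebra_def GF_def power_inverse)
  qed
  thus ?thesis
    by (simp add: Q_def)
qed

end

theory Submission
  imports Defs "HOL-Computational_Algebra.Formal_Laurent_Series"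
begin

text \<open>
  Put \<open>Q = q\<^sup>d\<close> and let \<open>\<Phi>\<close> be the \<open>Q\<close>-Frobenius. For a vector \<open>v\<close> let \<open>D v\<close> be the matrix
  with entries \<open>(\<Phi> - 1)\<^sup>j v\<^sub>m\<close>. Its determinant is the Moore determinant of \<open>v\<close>, and on the
  hypersurface where this determinant is \<open>1\<close> one has \<open>\<Phi> (D v) = U(b) N(1) (D v)\<close> with a lower
  unitriangular \<open>U(b)\<close> that differs from the identity only in its last row \<open>b\<close>, and an upper
  unitriangular \<open>N(1)\<close>. At the generic point of the hypersurface the \<open>r - 1\<close> entries of \<open>b\<close> are
  algebraically independent, and \<open>SL(r, Q)\<close> acts on \<open>v\<close> from the right without changing \<open>b\<close>.

  To descend the constants from \<open>F\<^sub>Q\<close> to \<open>F\<^sub>q\<close>, let \<open>\<theta>\<^sub>i\<close> be the conjugates of a generator of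
  \<open>F\<^sub>Q\<close>, put \<open>e\<^sub>i = 1 - (T - \<theta>\<^sub>i)\<^sup>Q\<^sup>-\<^sup>1\<close>, and consider the cyclic system
  \<open>Frob\<^sub>q (Y\<^sub>i\<^sub>-\<^sub>1) = U(e\<^sub>i b) N(e\<^sub>i) Y\<^sub>i\<close> for \<open>i\<close> modulo \<open>d\<close>. It is invariant under the \<open>q\<close>-Frobenius
  of the constants, hence defined over \<open>F\<^sub>q(T)(b)\<close>, and at \<open>T = \<theta>\<^sub>0\<close> it degenerates to the system of
  \<open>D v\<close>. Its solution is a power series in \<open>\<epsilon> = T - \<theta>\<^sub>0\<close> whose coefficients are polynomial in \<open>v\<close>;
  therefore a relation that holds at the generic point holds at all its \<open>SL(r, Q)\<close>-translates, and
  the group acts on the field generated by the solution. All \<open>\<epsilon>\<close>-coefficients of an element that is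
  algebraic over \<open>F\<^sub>q(T)\<close> are constants, which gives regularity.

  The invariants are no larger than the base field because, by a Chevalley-Warning argument, sums
  over the group of elements of the coordinate ring of the solutions lie on a single line over the
  base field. Finally \<open>PSL(r, Q)\<close> is realised by the invariants of the centre.
\<close>

text \<open>The exponent in e_i is forced by the degeneration: for i > 0 the difference \<theta>_0 -
  \<theta>_i is a nonzero element of the field with Q elements, so its power Q - 1 is 1 and e_i
  vanishes at T = \<theta>_0, while e_0 becomes 1. All matrices of the cycle but the zeroth then
  turn into the identity, and the d equations for the q-Frobenius close up to a single one for the
  Q-Frobenius. Three obstacles shape the rest. Relations can be moved from one point of the
  hypersurface to another only if it is irreducible; this enters through an explicit generic point
  with Laurent series coordinates, so all data must be polynomial in v, and adjugates of unimodular
  matrices replace inverses. Finally the solution field lies in iterated Laurent series and not in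
  the prescribed universe, so the whole action is carried there at the end by extending an embedding
  of the base field.\<close>

no_notation vec_index (infixl "$" 100)

abbreviation keys :: "('a \<Rightarrow>\<^sub>0 'b :: zero) \<Rightarrow> 'a set" where "keys \<equiv> Poly_Mapping.keys"
abbreviation lookup :: "('a \<Rightarrow>\<^sub>0 'b :: zero) \<Rightarrow> 'a \<Rightarrow> 'b" where "lookup \<equiv> Poly_Mapping.lookup"

section \<open>Rings of functions\<close>

inductive_set alg :: "'a :: comm_ring_1 set \<Rightarrow> ('x \<Rightarrow> 'a) set \<Rightarrow> ('x \<Rightarrow> 'a) set"
  for C Z where
  const: "c \<in> C \<Longrightarrow> (\<lambda>_. c) \<in> alg C Z"
| gen: "z \<in> Z \<Longrightarrow> z \<in> alg C Z"
| add: "f \<in> alg C Z \<Longrightarrow> g \<in> alg C Z \<Longrightarrow> (\<lambda>x. f x + g x) \<in> alg C Z"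
| mult: "f \<in> alg C Z \<Longrightarrow> g \<in> alg C Z \<Longrightarrow> (\<lambda>x. f x * g x) \<in> alg C Z"

text \<open>Closure under ring operations already keeps determinants and adjugates of matrices of
  such functions inside, so unimodular matrices can be inverted without leaving the ring. Instances
  are polynomial functions, power series of these, and rings of functions on a matrix group.\<close>

locale function_ring =
  fixes S :: "('x \<Rightarrow> 'a :: comm_ring_1) set"
  assumes one: "(\<lambda>_. 1) \<in> S" and minus_one: "(\<lambda>_. - 1) \<in> S"
    and add: "f \<in> S \<Longrightarrow> g \<in> S \<Longrightarrow> (\<lambda>x. f x + g x) \<in> S"
    and mult: "f \<in> S \<Longrightarrow> g \<in> S \<Longrightarrow> (\<lambda>x. f x * g x) \<in> S"
begin

lemma zero: "(\<lambda>_. 0) \<in> S"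
  using add[OF one minus_one] by simp

lemma uminus: "f \<in> S \<Longrightarrow> (\<lambda>x. - f x) \<in> S"
  using mult[OF minus_one, of f] by simp

lemma diff: "f \<in> S \<Longrightarrow> g \<in> S \<Longrightarrow> (\<lambda>x. f x - g x) \<in> S"
  using add[OF _ uminus, of f g] by simp

lemma sum: "(\<And>i. i \<in> I \<Longrightarrow> f i \<in> S) \<Longrightarrow> (\<lambda>x. \<Sum>i\<in>I. f i x) \<in> S"
  by (induction I rule: infinite_finite_induct) (simp_all add: zero add)

lemma prod: "(\<And>i. i \<in> I \<Longrightarrow> f i \<in> S) \<Longrightarrow> (\<lambda>x. \<Prod>i\<in>I. f i x) \<in> S"
  by (induction I rule: infinite_finite_induct) (simp_all add: one mult)

lemma power: "f \<in> S \<Longrightarrow> (\<lambda>x. f x ^ n) \<in> S"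
  by (induction n) (simp_all add: one mult)

lemma of_int: "(\<lambda>_. of_int k) \<in> S"
proof (induction k rule: int_induct[where k = 0])
  case (step1 i)
  from add[OF this(2) one] show ?case by simp
next
  case (step2 i)
  from add[OF this(2) minus_one] show ?case by simp
qed (simp add: zero)

lemma det:
  assumes "\<And>x. A x \<in> carrier_mat n n"
    and "\<And>i j. i < n \<Longrightarrow> j < n \<Longrightarrow> (\<lambda>x. A x $$ (i, j)) \<in> S"
  shows "(\<lambda>x. det (A x)) \<in> S"
proof -
  have "(\<lambda>x. \<Sum>p | p permutes {0..<n}. of_int (sign p) * (\<Prod>i = 0..<n. A x $$ (i, p i))) \<in> S"
  proof (intro sum mult of_int prod)
    fix p i assume "p \<in> {p. p permutes {0..<n}}" "i \<in> {0..<n}"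
    thus "(\<lambda>x. A x $$ (i, p i)) \<in> S"
      using assms(2)[of i "p i"] permutes_in_image[of p "{0..<n}" i] by auto
  qed
  thus ?thesis
    by (simp only: det_def'[OF assms(1)])
qed

lemma mat_mult:
  assumes "\<And>x. A x \<in> carrier_mat n m" "\<And>x. B x \<in> carrier_mat m k"
    and "\<And>i j. i < n \<Longrightarrow> j < m \<Longrightarrow> (\<lambda>x. A x $$ (i, j)) \<in> S"
    and "\<And>i j. i < m \<Longrightarrow> j < k \<Longrightarrow> (\<lambda>x. B x $$ (i, j)) \<in> S"
    and "i < n" "j < k"
  shows "(\<lambda>x. (A x * B x) $$ (i, j)) \<in> S"
proof -
  have "(A x * B x) $$ (i, j) = (\<Sum>l\<in>{0..<m}. A x $$ (i, l) * B x $$ (l, j))" for x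
    using assms(1,2)[of x] assms(5,6) by (auto simp: scalar_prod_def)
  moreover have "(\<lambda>x. \<Sum>l\<in>{0..<m}. A x $$ (i, l) * B x $$ (l, j)) \<in> S"
    by (intro sum mult assms(3,4)) (use assms(5,6) in auto)
  ultimately show ?thesis
    by simp
qed

lemma adj:
  assumes "\<And>x. A x \<in> carrier_mat n n"
    and "\<And>i j. i < n \<Longrightarrow> j < n \<Longrightarrow> (\<lambda>x. A x $$ (i, j)) \<in> S"
    and "i < n" "j < n"
  shows "(\<lambda>x. adj_mat (A x) $$ (i, j)) \<in> S"
proof -
  have "adj_mat (A x) $$ (i, j) = (- 1) ^ (j + i) * det (mat_delete (A x) j i)" for x
    using assms(1)[of x] assms(3,4) by (auto simp: adj_mat_def cofactor_def)
  moreover have "(\<lambda>x. (- 1) ^ (j + i) * det (mat_delete (A x) j i)) \<in> S"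
  proof (intro mult power minus_one det[where n = "n - 1"])
    show "mat_delete (A x) j i \<in> carrier_mat (n - 1) (n - 1)" for x
      using assms(1)[of x] by (auto simp: mat_delete_def)
  next
    fix k l assume kl: "k < n - 1" "l < n - 1"
    have "mat_delete (A x) j i $$ (k, l) =
        A x $$ (if k < j then k else Suc k, if l < i then l else Suc l)" for x
      using assms(1)[of x] kl by (auto simp: mat_delete_def)
    moreover have "(\<lambda>x. A x $$ (if k < j then k else Suc k, if l < i then l else Suc l)) \<in> S"
      by (rule assms(2)) (use kl in auto)
    ultimately show "(\<lambda>x. mat_delete (A x) j i $$ (k, l)) \<in> S"
      by simp
  qed
  ultimately show ?thesis
    by simp
qed

end

lemma function_ring_alg:
  assumes "1 \<in> C" "- 1 \<in> C"
  shows "function_ring (alg C Z)"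
  by unfold_locales (use assms in \<open>auto intro: alg.intros\<close>)

lemma alg_subset:
  assumes "f \<in> alg C Z" and "function_ring S"
    and "\<And>c. c \<in> C \<Longrightarrow> (\<lambda>_. c) \<in> S" and "Z \<subseteq> S"
  shows "f \<in> S"
proof -
  interpret function_ring S by fact
  show ?thesis
    using assms(1) by (induction rule: alg.induct) (use assms(3,4) in \<open>auto intro: add mult\<close>)
qed

section \<open>Evaluation of multivariate polynomials\<close>

definition mon_eval :: "(nat \<Rightarrow> 'b :: comm_ring_1) \<Rightarrow> (nat \<Rightarrow>\<^sub>0 nat) \<Rightarrow> 'b"
  where "mon_eval v m = (\<Prod>i\<in>keys m. v i ^ lookup m i)"

definition meval :: "('a :: comm_ring_1 \<Rightarrow> 'b :: comm_ring_1) \<Rightarrow> (nat \<Rightarrow> 'b) \<Rightarrow> ((nat \<Rightarrow>\<^sub>0 nat) \<Rightarrow>\<^sub>0 'a) \<Rightarrow> 'b"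
  where "meval h v p = (\<Sum>m\<in>keys p. h (lookup p m) * mon_eval v m)"

lemma mon_eval_superset:
  assumes "finite I" "keys m \<subseteq> I"
  shows "mon_eval v m = (\<Prod>i\<in>I. v i ^ lookup m i)"
  unfolding mon_eval_def
  by (rule prod.mono_neutral_left) (use assms in \<open>auto simp: in_keys_iff\<close>)

lemma mon_eval_0 [simp]: "mon_eval v 0 = 1"
  by (simp add: mon_eval_def)

lemma mon_eval_add: "mon_eval v (m + n) = mon_eval v m * mon_eval v n"
proof -
  let ?I = "keys m \<union> keys n"
  have "keys (m + n) \<subseteq> ?I"
    by (rule keys_add)
  thus ?thesis
    by (simp add: mon_eval_superset[of ?I] lookup_add power_add prod.distrib)
qed

lemma mon_eval_single [simp]: "mon_eval v (Poly_Mapping.single i n) = v i ^ n"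
  by (cases "n = 0") (simp_all add: mon_eval_def)

lemma poly_mapping_sum_single: "p = (\<Sum>m\<in>keys p. Poly_Mapping.single m (lookup p m))"
  by (rule poly_mapping_eqI) (simp add: lookup_sum lookup_single when_def in_keys_iff)

locale coeff_hom =
  fixes h :: "'a :: comm_ring_1 \<Rightarrow> 'b :: comm_ring_1"
  assumes h_add: "h (a + b) = h a + h b" and h_mult: "h (a * b) = h a * h b"
    and h_1 [simp]: "h 1 = 1"
begin

lemma h_0 [simp]: "h 0 = 0"
proof -
  have "h 0 + h 0 = h 0 + 0"
    using h_add[of 0 0] by (simp only: add_0_right)
  thus ?thesis by (simp only: add_left_cancel)
qed

lemma h_uminus: "h (- a) = - h a"
proof -
  have "h a + h (- a) = 0"
    unfolding h_add[symmetric] by simp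
  thus ?thesis by (simp add: add_eq_0_iff)
qed

lemma h_diff: "h (a - b) = h a - h b"
  unfolding diff_conv_add_uminus h_add h_uminus ..

lemma h_power: "h (a ^ n) = h a ^ n"
  by (induction n) (simp_all add: h_mult)

lemma h_sum: "h (\<Sum>i\<in>I. f i) = (\<Sum>i\<in>I. h (f i))"
  by (induction I rule: infinite_finite_induct) (simp_all add: h_add)

lemma h_prod: "h (\<Prod>i\<in>I. f i) = (\<Prod>i\<in>I. h (f i))"
  by (induction I rule: infinite_finite_induct) (simp_all add: h_mult)

lemma meval_superset:
  assumes "finite I" "keys p \<subseteq> I"
  shows "meval h v p = (\<Sum>m\<in>I. h (lookup p m) * mon_eval v m)"
  unfolding meval_def
  by (rule sum.mono_neutral_left) (use assms in \<open>auto simp: in_keys_iff\<close>)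

lemma meval_add: "meval h v (p + q) = meval h v p + meval h v q"
proof -
  let ?I = "keys p \<union> keys q"
  have "keys (p + q) \<subseteq> ?I"
    by (rule keys_add)
  thus ?thesis
    by (simp add: meval_superset[of ?I] lookup_add h_add sum.distrib algebra_simps)
qed

lemma meval_0 [simp]: "meval h v 0 = 0"
  by (simp add: meval_def)

lemma meval_single [simp]: "meval h v (Poly_Mapping.single m c) = h c * mon_eval v m"
  by (cases "c = 0") (simp_all add: meval_def)

lemma meval_1 [simp]: "meval h v 1 = 1"
  using meval_single[of v 0 1] by simp

lemma meval_sum: "meval h v (\<Sum>i\<in>I. f i) = (\<Sum>i\<in>I. meval h v (f i))"
  by (induction I rule: infinite_finite_induct) (simp_all add: meval_add)

lemma meval_mult: "meval h v (p * q) = meval h v p * meval h v q"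
proof -
  have "p * q = (\<Sum>m\<in>keys p. \<Sum>n\<in>keys q. Poly_Mapping.single (m + n) (lookup p m * lookup q n))"
    by (subst poly_mapping_sum_single[of p], subst poly_mapping_sum_single[of q])
       (simp add: sum_product mult_single)
  also have "meval h v \<dots> = meval h v p * meval h v q"
    unfolding meval_sum meval_single h_mult mon_eval_add
    by (simp add: meval_def sum_product ac_simps)
  finally show ?thesis .
qed

lemma coeff_hom_meval: "coeff_hom (meval h v)"
  by unfold_locales (simp_all add: meval_add meval_mult)

end

text \<open>Turns membership in an inductively generated ring into an actual polynomial, whose
  monomials and degrees the genericity arguments inspect.\<close>

lemma (in coeff_hom) alg_imp_meval:
  assumes "f \<in> alg (range h) {\<lambda>v. v i | i. True}"
  shows "\<exists>p. \<forall>v. f v = meval h v p"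
  using assms
proof (induction rule: alg.induct)
  case (const c)
  then obtain a where "c = h a" by auto
  thus ?case
    by (intro exI[of _ "Poly_Mapping.single 0 a"]) simp
next
  case (gen z)
  then obtain i where "z = (\<lambda>v. v i)" by auto
  thus ?case
    by (intro exI[of _ "Poly_Mapping.single (Poly_Mapping.single i 1) 1"]) simp
next
  case (add f g)
  then obtain p p' where "\<forall>v. f v = meval h v p" "\<forall>v. g v = meval h v p'" by blast
  thus ?case by (intro exI[of _ "p + p'"]) (simp add: meval_add)
next
  case (mult f g)
  then obtain p p' where "\<forall>v. f v = meval h v p" "\<forall>v. g v = meval h v p'" by blast
  thus ?case by (intro exI[of _ "p * p'"]) (simp add: meval_mult)
qed

section \<open>Contractions on systems of formal power series\<close>

text \<open>Causality determines the coefficients of a fixed point one after the other from the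
  constant terms \<open>c\<close>. The third conjunct carries the later arguments: coefficient n
  already occurs in the n-th iterate, which arises from \<open>c\<close> by finitely many
  applications of \<open>step\<close>, so closure properties pass to the fixed point.\<close>

lemma fps_contraction:
  fixes \<Psi> :: "('i \<Rightarrow> 'a :: comm_ring_1 fps) \<Rightarrow> 'i \<Rightarrow> 'a fps" and c :: "'i \<Rightarrow> 'a"
  assumes causal: "\<And>u v n i. n > 0 \<Longrightarrow> (\<And>i k. k < n \<Longrightarrow> u i $ k = v i $ k) \<Longrightarrow> \<Psi> u i $ n = \<Psi> v i $ n"
  defines "step \<equiv> \<lambda>u i. Abs_fps (\<lambda>n. if n = 0 then c i else \<Psi> u i $ n)"
  shows "\<exists>u. (\<forall>i. u i $ 0 = c i) \<and> (\<forall>i n. n > 0 \<longrightarrow> u i $ n = \<Psi> u i $ n) \<and>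
    (\<forall>n i. u i $ n = (step ^^ n) (\<lambda>i. fps_const (c i)) i $ n)"
proof -
  define a where "a t = (step ^^ t) (\<lambda>i. fps_const (c i))" for t
  have a_Suc: "a (Suc t) i $ n = (if n = 0 then c i else \<Psi> (a t) i $ n)" for t i n
    by (simp add: a_def step_def)
  have a0: "a t i $ 0 = c i" for t i
    by (cases t) (simp_all add: a_def step_def)
  have step_eq: "n \<le> t \<Longrightarrow> a (Suc t) i $ n = a t i $ n" for t n i
  proof (induction t arbitrary: n i)
    case 0
    thus ?case by (simp add: a0)
  next
    case (Suc t)
    show ?case
    proof (cases "n = 0")
      case False
      have "\<Psi> (a (Suc t)) i $ n = \<Psi> (a t) i $ n"
      proof (rule causal)
        show "a (Suc t) i $ k = a t i $ k" if "k < n" for i k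
          using Suc.IH[of k i] Suc.prems that by linarith
      qed (use False in simp)
      thus ?thesis using False by (simp add: a_Suc[of _ i n])
    qed (simp add: a0)
  qed
  have stable: "n \<le> t \<Longrightarrow> a t i $ n = a n i $ n" for t n i
  proof (induction t)
    case (Suc t)
    show ?case
    proof (cases "n = Suc t")
      case False
      thus ?thesis using Suc step_eq[of n t i] by simp
    qed simp
  qed simp
  define u where "u i = Abs_fps (\<lambda>n. a n i $ n)" for i
  have fixpoint: "u i $ n = \<Psi> u i $ n" if "n > 0" for i n
  proof -
    have "u i $ n = \<Psi> (a (n - 1)) i $ n"
      using that a_Suc[of "n - 1" i n] by (simp add: u_def)
    also have "\<dots> = \<Psi> u i $ n"
    proof (rule causal[OF that])
      show "a (n - 1) i $ k = u i $ k" if "k < n" for i k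
        unfolding u_def fps_nth_Abs_fps by (rule stable) (use that in linarith)
    qed
    finally show ?thesis .
  qed
  show ?thesis
  proof (intro exI[of _ u] conjI allI impI)
    show "u i $ 0 = c i" for i
      by (simp add: u_def a0)
    show "u i $ n = (step ^^ n) (\<lambda>i. fps_const (c i)) i $ n" for n i
      by (simp add: u_def a_def)
  qed (rule fixpoint)
qed

lemma fps_contraction_unique:
  fixes \<Psi> :: "('i \<Rightarrow> 'a :: comm_ring_1 fps) \<Rightarrow> 'i \<Rightarrow> 'a fps"
  assumes causal: "\<And>u v n i. n > 0 \<Longrightarrow> (\<And>i k. k < n \<Longrightarrow> u i $ k = v i $ k) \<Longrightarrow> \<Psi> u i $ n = \<Psi> v i $ n"
    and "\<And>i. u i $ 0 = v i $ 0"
    and "\<And>i n. n > 0 \<Longrightarrow> u i $ n = \<Psi> u i $ n" "\<And>i n. n > 0 \<Longrightarrow> v i $ n = \<Psi> v i $ n"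
  shows "u = v"
proof -
  have "u i $ n = v i $ n" for i n
  proof (induction n arbitrary: i rule: less_induct)
    case (less n)
    show ?case
    proof (cases "n = 0")
      case False
      hence "\<Psi> u i $ n = \<Psi> v i $ n"
        by (intro causal) (use less in auto)
      thus ?thesis using assms(3,4)[of n i] False by simp
    qed (simp add: assms(2))
  qed
  thus ?thesis by (intro ext fps_ext)
qed

lemma additive_power_diff:
  fixes x y :: "'a :: comm_ring_1"
  assumes "\<And>x y :: 'a. (x + y) ^ q = x ^ q + y ^ q"
  shows "(x - y) ^ q = x ^ q - y ^ q"
  using assms[of "x - y" y] by simp

lemma additive_power_sum:
  fixes f :: "'i \<Rightarrow> 'a :: comm_ring_1"
  assumes "\<And>x y :: 'a. (x + y) ^ q = x ^ q + y ^ q" "q > 0"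
  shows "(\<Sum>i\<in>I. f i) ^ q = (\<Sum>i\<in>I. f i ^ q)"
  by (induction I rule: infinite_finite_induct) (simp_all add: assms zero_power)

text \<open>If u and v agree below n, then u - v is divisible by X^n and its q-th power by X^(nq).
  As q > 1, the Frobenius is strictly contracting for the X-adic topology; this drives every fixed
  point below.\<close>

lemma fps_power_causal:
  fixes u v :: "'a :: comm_ring_1 fps"
  assumes add: "\<And>x y :: 'a fps. (x + y) ^ q = x ^ q + y ^ q" and q: "q > 1" and n: "n > 0"
    and eq: "\<And>k. k < n \<Longrightarrow> u $ k = v $ k" and l: "l \<le> n"
  shows "(u ^ q) $ l = (v ^ q) $ l"
proof -
  define w where "w = fps_shift n (u - v)"
  have w: "u - v = fps_X ^ n * w" unfolding w_def
    by (rule fps_ext) (use eq in \<open>auto simp: fps_X_power_mult_nth\<close>)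
  hence "(u - v) ^ q = fps_X ^ (n * q) * w ^ q"
    by (simp only: w power_mult power_mult_distrib)
  moreover have "n * q > n"
    using q n by simp
  hence "l < n * q" by (rule le_less_trans[OF l])
  ultimately have "((u - v) ^ q) $ l = 0"
    by (simp add: fps_X_power_mult_nth)
  thus ?thesis
    using additive_power_diff[OF add, where x = u and y = v] by simp
qed

lemma CHAR_eq_if_hom:
  fixes h :: "'a :: comm_ring_1 \<Rightarrow> 'b :: comm_ring_1"
  assumes "\<And>n. h (of_nat n) = of_nat n" "inj h"
  shows "CHAR('b) = CHAR('a)"
proof (rule CHAR_eqI)
  have h0: "h 0 = 0" using assms(1)[of 0] by simp
  show "of_nat CHAR('a) = (0 :: 'b)"
    using assms(1)[of "CHAR('a)"] h0 by simp
  fix n assume "of_nat n = (0 :: 'b)"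
  hence "h (of_nat n) = h 0" using assms(1)[of n] h0 by simp
  hence "of_nat n = (0 :: 'a)" using assms(2) by (simp only: inj_eq)
  thus "CHAR('a) dvd n"
    by (simp add: of_nat_eq_0_iff_char_dvd)
qed

section \<open>Moore determinants\<close>

definition dfrob :: "nat \<Rightarrow> 'a :: comm_ring_1 \<Rightarrow> 'a"
  where "dfrob Q t = t ^ Q - t"

text \<open>With powers of Frob - 1 as rows, the recursion reads Frob(row j) = row j + row (j+1).
  Its matrix \<open>Nmat r 1\<close> belongs to the family \<open>Nmat r e\<close>, which reaches
  the identity at e = 0; the companion matrix for plain powers of Frob has no such deformation built
  in.\<close>

definition Dmat :: "nat \<Rightarrow> nat \<Rightarrow> (nat \<Rightarrow> 'a :: comm_ring_1) \<Rightarrow> 'a mat"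
  where "Dmat Q r v = mat r r (\<lambda>(j, m). (dfrob Q ^^ j) (v m))"

definition Moore :: "nat \<Rightarrow> nat \<Rightarrow> (nat \<Rightarrow> 'a :: comm_ring_1) \<Rightarrow> 'a mat"
  where "Moore Q r v = mat r r (\<lambda>(j, m). v m ^ (Q ^ j))"

definition Lam :: "nat \<Rightarrow> nat \<Rightarrow> (nat \<Rightarrow> 'a :: comm_ring_1) \<Rightarrow> 'a"
  where "Lam Q r v = det (Dmat Q r v)"

definition frobM :: "nat \<Rightarrow> 'a :: comm_ring_1 mat \<Rightarrow> 'a mat"
  where "frobM Q A = map_mat (\<lambda>x. x ^ Q) A"

definition Nmat :: "nat \<Rightarrow> 'a :: comm_ring_1 \<Rightarrow> 'a mat"
  where "Nmat r e = mat r r (\<lambda>(i, j). if i = j then 1 else if j = Suc i then e else 0)"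

definition Umat :: "nat \<Rightarrow> (nat \<Rightarrow> 'a :: comm_ring_1) \<Rightarrow> 'a mat"
  where "Umat r b = mat r r (\<lambda>(i, j). if i = j then 1 else if Suc i = r then b j else 0)"

text \<open>The adjugate is the inverse where \<open>Lam\<close> is 1, and it keeps the definition
  polynomial in \<open>v\<close> everywhere. Only entries with \<open>Suc l < r\<close> are
  parameters: the corner of the last row is a diagonal entry of \<open>Umat\<close>.\<close>

definition bvec :: "nat \<Rightarrow> nat \<Rightarrow> (nat \<Rightarrow> 'a :: comm_ring_1) \<Rightarrow> nat \<Rightarrow> 'a"
  where "bvec Q r v l =
    (frobM Q (Dmat Q r v) * adj_mat (Nmat r 1 * Dmat Q r v)) $$ (r - 1, l)"

lemma carriers [simp]:
  "Dmat Q r v \<in> carrier_mat r r" "Moore Q r v \<in> carrier_mat r r"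
  "Nmat r e \<in> carrier_mat r r" "Umat r b \<in> carrier_mat r r"
  "frobM Q A \<in> carrier_mat n m \<longleftrightarrow> A \<in> carrier_mat n m"
  by (auto simp: Dmat_def Moore_def Nmat_def Umat_def frobM_def)

lemma mult_index:
  assumes "A \<in> carrier_mat n m" "B \<in> carrier_mat m k" "i < n" "j < k"
  shows "(A * B) $$ (i, j) = (\<Sum>l<m. A $$ (i, l) * B $$ (l, j))"
  using assms by (auto simp: scalar_prod_def lessThan_atLeast0)

lemma det_lower_unitriangular:
  assumes "A \<in> carrier_mat n n" "\<And>i. i < n \<Longrightarrow> A $$ (i, i) = 1"
    "\<And>i j. i < j \<Longrightarrow> j < n \<Longrightarrow> A $$ (i, j) = 0"
  shows "det A = 1"
proof -
  have "diag_mat A = map (\<lambda>_. 1) [0..<n]"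
    using assms(1,2) by (auto simp: diag_mat_def)
  hence "prod_list (diag_mat A) = 1"
    by (simp add: map_replicate_const)
  thus ?thesis
    using det_lower_triangular[OF assms(3,1)] by simp
qed

lemma det_upper_unitriangular:
  assumes "A \<in> carrier_mat n n" "\<And>i. i < n \<Longrightarrow> A $$ (i, i) = 1"
    "\<And>i j. j < i \<Longrightarrow> i < n \<Longrightarrow> A $$ (i, j) = 0"
  shows "det A = 1"
  using det_lower_unitriangular[of "transpose_mat A" n] assms det_transpose[OF assms(1)]
  by auto

lemma det_Nmat [simp]: "det (Nmat r e) = 1"
  by (rule det_upper_unitriangular[of _ r]) (auto simp: Nmat_def)

lemma det_Umat [simp]: "det (Umat r b) = 1"
  by (rule det_lower_unitriangular[of _ r]) (auto simp: Umat_def)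

lemma mult_adj_unimodular:
  assumes "A \<in> carrier_mat n n" "det A = 1"
  shows "A * adj_mat A = 1\<^sub>m n" "adj_mat A * A = 1\<^sub>m n"
  using adj_mat[OF assms(1)] assms(2) by auto

context
  fixes h :: "'a :: comm_ring_1 \<Rightarrow> 'b :: comm_ring_1"
  assumes hom: "coeff_hom h"
begin

interpretation coeff_hom h by (fact hom)

lemma coeff_hom_imp_comm_ring_hom: "comm_ring_hom h"
  by unfold_locales (simp_all add: h_add h_mult)

lemma det_hom: "det (map_mat h A) = h (det A)"
  by (rule comm_ring_hom.hom_det[OF coeff_hom_imp_comm_ring_hom])

lemma mat_hom_mult:
  "A \<in> carrier_mat n m \<Longrightarrow> B \<in> carrier_mat m k \<Longrightarrow> map_mat h (A * B) = map_mat h A * map_mat h B"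
  using semiring_hom.mat_hom_mult[of h A n m B k] coeff_hom_imp_comm_ring_hom
  by (simp add: comm_ring_hom_def ring_hom_def)

lemma dfrob_hom: "h ((dfrob Q ^^ j) t) = (dfrob Q ^^ j) (h t)"
  by (induction j) (simp_all add: dfrob_def h_diff h_power)

lemma Dmat_hom: "Dmat Q r (\<lambda>m. h (v m)) = map_mat h (Dmat Q r v)"
  by (rule eq_matI) (auto simp: Dmat_def dfrob_hom)

lemma Lam_hom: "Lam Q r (\<lambda>m. h (v m)) = h (Lam Q r v)"
  by (simp add: Lam_def Dmat_hom det_hom)

lemma meval_hom:
  assumes "coeff_hom k"
  shows "h (meval k v p) = meval (\<lambda>c. h (k c)) (\<lambda>i. h (v i)) p"
  by (simp add: meval_def mon_eval_def h_sum h_mult h_prod h_power)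

end

lemma coeff_hom_power:
  assumes "\<And>x y :: 'a :: comm_ring_1. (x + y) ^ q = x ^ q + y ^ q"
  shows "coeff_hom (\<lambda>x :: 'a. x ^ q)"
  by unfold_locales (simp_all add: assms power_mult_distrib)

lemma additive_power_power:
  fixes x y :: "'a :: comm_ring_1"
  assumes "\<And>x y :: 'a. (x + y) ^ q = x ^ q + y ^ q"
  shows "(x + y) ^ (q ^ n) = x ^ (q ^ n) + y ^ (q ^ n)"
  by (induction n arbitrary: x y) (simp_all add: power_mult assms)

lemma det_frobM:
  assumes "\<And>x y :: 'a :: comm_ring_1. (x + y) ^ q = x ^ q + y ^ q"
  shows "det (frobM q (A :: 'a mat)) = det A ^ q"
  unfolding frobM_def by (rule det_hom[OF coeff_hom_power]) (rule assms)

lemma frobM_mult: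
  assumes "\<And>x y :: 'a :: comm_ring_1. (x + y) ^ q = x ^ q + y ^ q"
    and "A \<in> carrier_mat n m" "B \<in> carrier_mat m k"
  shows "frobM q (A * B :: 'a mat) = frobM q A * frobM q B"
  unfolding frobM_def by (rule mat_hom_mult[OF coeff_hom_power]) (rule assms)+

section \<open>The Frobenius equation of \<open>Dmat\<close>\<close>

lemma Dmat_rec:
  assumes "Suc j < r" "m < r"
  shows "Dmat Q r v $$ (Suc j, m) = Dmat Q r v $$ (j, m) ^ Q - Dmat Q r v $$ (j, m)"
  using assms by (simp add: Dmat_def dfrob_def)

lemma Nmat_mult_row:
  assumes "A \<in> carrier_mat r r" "m < r"
  shows "Suc j < r \<Longrightarrow> (Nmat r e * A) $$ (j, m) = A $$ (j, m) + e * A $$ (Suc j, m)"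
    and "Suc j = r \<Longrightarrow> (Nmat r e * A) $$ (j, m) = A $$ (j, m)"
proof -
  have *: "(Nmat r e * A) $$ (j, m) = (\<Sum>l\<in>{0..<r}. Nmat r e $$ (j, l) * A $$ (l, m))" if "j < r"
    using assms that by (auto simp: scalar_prod_def Nmat_def)
  show "(Nmat r e * A) $$ (j, m) = A $$ (j, m) + e * A $$ (Suc j, m)" if "Suc j < r"
  proof -
    have "(\<Sum>l\<in>{0..<r}. Nmat r e $$ (j, l) * A $$ (l, m)) =
        (\<Sum>l\<in>{j, Suc j}. Nmat r e $$ (j, l) * A $$ (l, m))"
      by (rule sum.mono_neutral_right) (use that in \<open>auto simp: Nmat_def\<close>)
    thus ?thesis using that * by (simp add: Nmat_def)
  qed
  show "(Nmat r e * A) $$ (j, m) = A $$ (j, m)" if "Suc j = r"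
  proof -
    have "(\<Sum>l\<in>{0..<r}. Nmat r e $$ (j, l) * A $$ (l, m)) =
        (\<Sum>l\<in>{j}. Nmat r e $$ (j, l) * A $$ (l, m))"
      by (rule sum.mono_neutral_right) (use that in \<open>auto simp: Nmat_def\<close>)
    thus ?thesis using that * by (simp add: Nmat_def)
  qed
qed

lemma Umat_mult_row:
  assumes "A \<in> carrier_mat r r" "m < r" "Suc j < r"
  shows "(Umat r b * A) $$ (j, m) = A $$ (j, m)"
proof -
  have "(Umat r b * A) $$ (j, m) = (\<Sum>l\<in>{0..<r}. Umat r b $$ (j, l) * A $$ (l, m))"
    using assms by (auto simp: scalar_prod_def Umat_def)
  also have "\<dots> = (\<Sum>l\<in>{j}. Umat r b $$ (j, l) * A $$ (l, m))"
    by (rule sum.mono_neutral_right) (use assms in \<open>auto simp: Umat_def\<close>)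
  finally show ?thesis using assms by (simp add: Umat_def)
qed

lemma Nmat_Dmat_row:
  assumes "Suc j < r" "m < r"
  shows "(Nmat r 1 * Dmat Q r v) $$ (j, m) = Dmat Q r v $$ (j, m) ^ Q"
  using Nmat_mult_row(1)[of "Dmat Q r v" r m j 1] assms by (simp add: Dmat_rec)

text \<open>Put X = Frob(D) (N(1) D)^-1. The first r - 1 rows of Frob(D) and of N(1) D coincide, so
  there X agrees with the identity and is lower triangular. Both matrices have determinant 1, hence
  so has X, and its corner is 1. Thus X is some \<open>Umat\<close>, whose last row
  \<open>bvec\<close> reads off.\<close>

lemma frob_Dmat:
  fixes v :: "nat \<Rightarrow> 'a :: comm_ring_1"
  assumes add: "\<And>x y :: 'a. (x + y) ^ Q = x ^ Q + y ^ Q"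
    and r: "r > 0" and lam: "Lam Q r v = 1"
  shows "frobM Q (Dmat Q r v) = Umat r (bvec Q r v) * (Nmat r 1 * Dmat Q r v)"
proof -
  let ?D = "Dmat Q r v"
  let ?W = "Nmat r 1 * ?D"
  have W: "?W \<in> carrier_mat r r" by (rule mult_carrier_mat[of _ r r]) simp_all
  have detW: "det ?W = 1"
    using lam det_mult[of "Nmat r 1" r ?D] by (simp add: Lam_def)
  let ?X = "frobM Q ?D * adj_mat ?W"
  have F: "frobM Q ?D \<in> carrier_mat r r" by simp
  have aW: "adj_mat ?W \<in> carrier_mat r r" by (rule adj_mat[OF W])
  have X: "?X \<in> carrier_mat r r" by (rule mult_carrier_mat[OF F aW])
  have XW: "?X * ?W = frobM Q ?D"
    using assoc_mult_mat[OF F aW W] mult_adj_unimodular(2)[OF W detW] right_mult_one_mat[OF F] by simp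
  have row: "?X $$ (i, j) = 1\<^sub>m r $$ (i, j)" if "Suc i < r" "j < r" for i j
  proof -
    have "?X $$ (i, j) = (\<Sum>l<r. frobM Q ?D $$ (i, l) * adj_mat ?W $$ (l, j))"
      using mult_index[OF F aW] that by simp
    also have "\<dots> = (\<Sum>l<r. ?W $$ (i, l) * adj_mat ?W $$ (l, j))"
      using that Nmat_Dmat_row[of i r _ Q v]
      by (intro sum.cong refl arg_cong2[where f = "(*)"]) (auto simp: frobM_def Dmat_def)
    also have "\<dots> = (?W * adj_mat ?W) $$ (i, j)"
      using mult_index[OF W aW] that by simp
    finally show ?thesis
      using mult_adj_unimodular(1)[OF W detW] by simp
  qed
  have "det ?X = 1"
  proof -
    have "det ?X * det ?W = det (frobM Q ?D)"
      using det_mult[OF X W] XW by simp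
    thus ?thesis using detW lam by (simp add: det_frobM[OF add] Lam_def)
  qed
  moreover have "det ?X = ?X $$ (r - 1, r - 1)"
  proof -
    have "det ?X = prod_list (diag_mat ?X)"
      by (rule det_lower_triangular[OF _ X]) (use row in auto)
    also have "diag_mat ?X = map (\<lambda>i. if i = r - 1 then ?X $$ (r - 1, r - 1) else 1) [0..<r]"
      using X row by (auto simp: diag_mat_def)
    also have "[0..<r] = [0..<r - 1] @ [r - 1]"
      using r by (metis Suc_diff_1 upt_Suc_append zero_le)
    also have "map (\<lambda>i. if i = r - 1 then ?X $$ (r - 1, r - 1) else 1) \<dots> =
        map (\<lambda>_. 1) [0..<r - 1] @ [?X $$ (r - 1, r - 1)]"
      by auto
    also have "prod_list \<dots> = ?X $$ (r - 1, r - 1)"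
      by (simp add: map_replicate_const)
    finally show ?thesis .
  qed
  ultimately have last: "?X $$ (r - 1, r - 1) = 1" by simp
  have "?X = Umat r (bvec Q r v)"
  proof (rule eq_matI)
    fix i j assume "i < dim_row (Umat r (bvec Q r v))" "j < dim_col (Umat r (bvec Q r v))"
    hence ij: "i < r" "j < r" by (auto simp: Umat_def)
    show "?X $$ (i, j) = Umat r (bvec Q r v) $$ (i, j)"
    proof (cases "Suc i = r")
      case True
      hence "i = r - 1" by simp
      thus ?thesis using ij last True by (auto simp: Umat_def bvec_def)
    next
      case False
      thus ?thesis using ij row[of i j] by (auto simp: Umat_def)
    qed
  qed (use X in \<open>auto simp: Umat_def\<close>)
  thus ?thesis using XW by simp
qed

text \<open>N(1) D is invertible, so the equation has only one solution \<open>Umat r b\<close>.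
  Values of \<open>bvec\<close> are found in this way, from an equation and not from the
  adjugate.\<close>

lemma bvec_eqI:
  fixes v :: "nat \<Rightarrow> 'a :: comm_ring_1"
  assumes "Lam Q r v = 1" and eq: "frobM Q (Dmat Q r v) = Umat r b * (Nmat r 1 * Dmat Q r v)"
    and l: "Suc l < r"
  shows "bvec Q r v l = b l"
proof -
  let ?W = "Nmat r 1 * Dmat Q r v"
  have W: "?W \<in> carrier_mat r r" by (rule mult_carrier_mat[of _ r r]) simp_all
  have detW: "det ?W = 1"
    using assms(1) det_mult[of "Nmat r 1" r "Dmat Q r v"] by (simp add: Lam_def)
  have aW: "adj_mat ?W \<in> carrier_mat r r" by (rule adj_mat[OF W])
  have "frobM Q (Dmat Q r v) * adj_mat ?W = Umat r b"
    unfolding eq using assoc_mult_mat[OF _ W aW, of "Umat r b" r] mult_adj_unimodular(1)[OF W detW]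
      right_mult_one_mat[of "Umat r b" r r] by simp
  hence "bvec Q r v l = Umat r b $$ (r - 1, l)"
    by (simp add: bvec_def)
  thus ?thesis using l by (simp add: Umat_def)
qed

section \<open>Right multiplication by matrices over the finite field\<close>

definition vmult :: "nat \<Rightarrow> (nat \<Rightarrow> 'a :: comm_ring_1) \<Rightarrow> 'a mat \<Rightarrow> nat \<Rightarrow> 'a"
  where "vmult r v g m = (if m < r then \<Sum>k<r. v k * g $$ (k, m) else v m)"

text \<open>Frob - 1 is linear over the elements fixed by the Q-Frobenius, so the entries of
  \<open>g\<close> can be pulled out of every row.\<close>

lemma Dmat_vmult:
  fixes v :: "nat \<Rightarrow> 'a :: comm_ring_1"
  assumes add: "\<And>x y :: 'a. (x + y) ^ Q = x ^ Q + y ^ Q" and Q: "Q > 0"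
    and g: "g \<in> carrier_mat r r" "frobM Q g = g"
  shows "Dmat Q r (vmult r v g) = Dmat Q r v * g"
proof -
  have gf: "g $$ (k, m) ^ Q = g $$ (k, m)" if "k < r" "m < r" for k m
    using arg_cong[OF g(2), of "\<lambda>A. A $$ (k, m)"] g(1) that by (auto simp: frobM_def)
  have *: "(dfrob Q ^^ j) (vmult r v g m) = (\<Sum>k<r. (dfrob Q ^^ j) (v k) * g $$ (k, m))"
    if "m < r" for j m
  proof (induction j)
    case (Suc j)
    have dfrob_Suc: "(dfrob Q ^^ Suc j) t = (dfrob Q ^^ j) t ^ Q - (dfrob Q ^^ j) t" for t :: 'a
      by (simp add: dfrob_def)
    show ?case
      unfolding dfrob_Suc Suc by (simp add: additive_power_sum[OF add Q] power_mult_distrib gf that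
          left_diff_distrib sum_subtractf)
  qed (simp add: vmult_def that)
  show ?thesis
    by (rule eq_matI) (use g in \<open>auto simp: Dmat_def * scalar_prod_def lessThan_atLeast0\<close>)
qed

text \<open>As Frob fixes \<open>g\<close>, right multiplication by \<open>g\<close> preserves the
  Frobenius equation with the same left factors, and uniqueness of the factorisation gives the same
  \<open>bvec\<close>. So \<open>bvec\<close> supplies invariants of the group.\<close>

lemma bvec_vmult:
  fixes v :: "nat \<Rightarrow> 'a :: comm_ring_1"
  assumes add: "\<And>x y :: 'a. (x + y) ^ Q = x ^ Q + y ^ Q" and Q: "Q > 0" and r: "r > 0"
    and g: "g \<in> carrier_mat r r" "frobM Q g = g" "det g = 1" and lam: "Lam Q r v = 1"
  shows "Lam Q r (vmult r v g) = 1"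
    and "Suc l < r \<Longrightarrow> bvec Q r (vmult r v g) l = bvec Q r v l"
proof -
  note D = Dmat_vmult[OF add Q g(1,2), of v]
  show L: "Lam Q r (vmult r v g) = 1"
    using lam g det_mult[of "Dmat Q r v" r g] by (simp add: Lam_def D)
  assume l: "Suc l < r"
  show "bvec Q r (vmult r v g) l = bvec Q r v l"
  proof (rule bvec_eqI[OF L _ l])
    have "frobM Q (Dmat Q r v * g) = frobM Q (Dmat Q r v) * g"
      using frobM_mult[OF add, of "Dmat Q r v" r r g r] g by simp
    thus "frobM Q (Dmat Q r (vmult r v g)) =
        Umat r (bvec Q r v) * (Nmat r 1 * Dmat Q r (vmult r v g))"
      unfolding D frob_Dmat[OF add r lam]
      using g(1) assoc_mult_mat[of "Nmat r 1" r r "Dmat Q r v" r g r]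
        assoc_mult_mat[of "Umat r (bvec Q r v)" r r "Nmat r 1 * Dmat Q r v" r g r]
        mult_carrier_mat[of "Nmat r 1" r r "Dmat Q r v" r] by simp
  qed
qed

text \<open>The integers \<open>dcoeff j i\<close> expand \<open>(\<Phi> - 1)\<^sup>j\<close> in powers of the Frobenius \<open>\<Phi>\<close>.\<close>

fun dcoeff :: "nat \<Rightarrow> nat \<Rightarrow> int" where
  "dcoeff 0 i = (if i = 0 then 1 else 0)"
| "dcoeff (Suc j) i = (case i of 0 \<Rightarrow> 0 | Suc k \<Rightarrow> dcoeff j k) - dcoeff j i"

lemma dcoeff_eq_0: "i > j \<Longrightarrow> dcoeff j i = 0"
  by (induction j arbitrary: i) (auto split: nat.splits)

lemma dcoeff_eq_1: "dcoeff j j = 1"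
  by (induction j) (auto simp: dcoeff_eq_0)

lemma additive_power_of_int:
  assumes "\<And>x y :: 'a :: comm_ring_1. (x + y) ^ Q = x ^ Q + y ^ Q" and "Q > 0"
  shows "(of_int k :: 'a) ^ Q = of_int k"
proof -
  have "(- 1 :: 'a) ^ Q = - 1"
    using assms(1)[of 1 "- 1"] assms(2) by (simp add: zero_power add_eq_0_iff)
  thus ?thesis
    using assms by (induction k rule: int_induct[where k = 0]) (simp_all add: zero_power additive_power_diff)
qed

lemma dfrob_expand:
  fixes t :: "'a :: comm_ring_1"
  assumes add: "\<And>x y :: 'a. (x + y) ^ Q = x ^ Q + y ^ Q" and Q: "Q > 0" and "j < r"
  shows "(dfrob Q ^^ j) t = (\<Sum>i<r. of_int (dcoeff j i) * t ^ (Q ^ i))"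
  using \<open>j < r\<close>
proof (induction j)
  case 0
  have "(\<Sum>i<r. of_int (dcoeff 0 i) * t ^ (Q ^ i)) = (\<Sum>i\<in>{0}. of_int (dcoeff 0 i) * t ^ (Q ^ i))"
    by (rule sum.mono_neutral_right) (use 0 in auto)
  thus ?case by simp
next
  case (Suc j)
  obtain s where s: "r = Suc s" using Suc.prems by (cases r) auto
  have IH: "(dfrob Q ^^ j) t = (\<Sum>i<r. of_int (dcoeff j i) * t ^ (Q ^ i))"
    using Suc by simp
  have "(\<Sum>i<r. of_int (dcoeff j i) * t ^ (Q ^ i)) ^ Q =
      (\<Sum>i<r. of_int (dcoeff j i) * t ^ (Q ^ Suc i))"
    by (simp add: additive_power_sum[OF add Q] power_mult_distrib additive_power_of_int[OF add Q]
        mult.commute flip: power_mult)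
  also have "\<dots> = (\<Sum>i<s. of_int (dcoeff j i) * t ^ (Q ^ Suc i))"
    using Suc.prems by (simp add: s dcoeff_eq_0)
  also have "\<dots> = (\<Sum>i<r. of_int (case i of 0 \<Rightarrow> 0 | Suc k \<Rightarrow> dcoeff j k) * t ^ (Q ^ i))"
    unfolding s by (subst sum.lessThan_Suc_shift) simp
  finally show ?case
    by (simp add: IH, simp add: dfrob_def left_diff_distrib flip: sum_subtractf)
qed

text \<open>Passing from powers of Frob - 1 to powers of Frob is a unitriangular change of rows with
  integer entries.\<close>

lemma Lam_eq_det_Moore:
  fixes v :: "nat \<Rightarrow> 'a :: comm_ring_1"
  assumes add: "\<And>x y :: 'a. (x + y) ^ Q = x ^ Q + y ^ Q" and Q: "Q > 0"
  shows "Lam Q r v = det (Moore Q r v)"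
proof -
  define B where "B = mat r r (\<lambda>(j, i). of_int (dcoeff j i) :: 'a)"
  have B: "B \<in> carrier_mat r r" by (simp add: B_def)
  have "det B = 1"
    by (rule det_lower_unitriangular[of _ r]) (auto simp: B_def dcoeff_eq_0 dcoeff_eq_1)
  moreover have "Dmat Q r v = B * Moore Q r v"
    by (rule eq_matI)
       (auto simp: B_def Dmat_def Moore_def dfrob_expand[OF add Q] scalar_prod_def lessThan_atLeast0)
  ultimately show ?thesis
    using det_mult[OF B, of "Moore Q r v"] by (simp add: Lam_def)
qed

text \<open>Row j of the Moore matrix scales by c^(Q^j), so \<open>Lam\<close> is homogeneous of
  degree 1 + Q + ... + Q^(r-1). This is the number N by which the generic point is
  normalised.\<close>

lemma Lam_scale:
  fixes v :: "nat \<Rightarrow> 'a :: comm_ring_1"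
  assumes add: "\<And>x y :: 'a. (x + y) ^ Q = x ^ Q + y ^ Q" and Q: "Q > 0"
  shows "Lam Q r (\<lambda>m. c * v m) = c ^ (\<Sum>j<r. Q ^ j) * Lam Q r v"
proof -
  define B where "B = mat r r (\<lambda>(j, i). if i = j then c ^ (Q ^ j) else 0)"
  have B: "B \<in> carrier_mat r r" by (simp add: B_def)
  have "det B = prod_list (diag_mat B)"
    by (rule det_lower_triangular[OF _ B]) (auto simp: B_def)
  also have "diag_mat B = map (\<lambda>j. c ^ (Q ^ j)) [0..<r]"
    by (auto simp: diag_mat_def B_def)
  also have "prod_list \<dots> = (\<Prod>j<r. c ^ (Q ^ j))"
    by (induction r) simp_all
  also have "\<dots> = c ^ (\<Sum>j<r. Q ^ j)"
    by (simp add: power_sum)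
  finally have "det B = c ^ (\<Sum>j<r. Q ^ j)" .
  moreover have "Moore Q r (\<lambda>m. c * v m) = B * Moore Q r v"
  proof (rule eq_matI)
    fix i j assume "i < dim_row (B * Moore Q r v)" "j < dim_col (B * Moore Q r v)"
    hence ij: "i < r" "j < r" by (auto simp: B_def Moore_def)
    have "(B * Moore Q r v) $$ (i, j) = (\<Sum>l\<in>{0..<r}. B $$ (i, l) * Moore Q r v $$ (l, j))"
      using ij B by (auto simp: scalar_prod_def Moore_def)
    also have "\<dots> = (\<Sum>l\<in>{i}. B $$ (i, l) * Moore Q r v $$ (l, j))"
      by (rule sum.mono_neutral_right) (use ij in \<open>auto simp: B_def\<close>)
    finally show "Moore Q r (\<lambda>m. c * v m) $$ (i, j) = (B * Moore Q r v) $$ (i, j)"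
      using ij by (simp add: B_def Moore_def power_mult_distrib)
  qed (auto simp: B_def Moore_def)
  ultimately show ?thesis
    using det_mult[OF B, of "Moore Q r v"] by (simp add: Lam_eq_det_Moore[OF add Q])
qed

text \<open>In the first coordinate, \<open>Lam\<close> is an additive polynomial. Its linear
  coefficient is the Moore determinant of the other coordinates raised to Q, because deleting row 0
  leaves only powers divisible by Q. Where that coefficient is nonzero, \<open>Lam\<close> can be
  prescribed by solving for the first coordinate.\<close>

lemma Lam_expand:
  fixes v :: "nat \<Rightarrow> 'a :: comm_ring_1"
  assumes add: "\<And>x y :: 'a. (x + y) ^ Q = x ^ Q + y ^ Q" and Q: "Q > 0" and r: "r > 0"
  shows "Lam Q r v = (\<Sum>j<r. v 0 ^ (Q ^ j) * cofactor (Moore Q r v) j 0)"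
    and "cofactor (Moore Q r v) 0 0 = Lam Q (r - 1) (\<lambda>m. v (Suc m)) ^ Q"
proof -
  show "Lam Q r v = (\<Sum>j<r. v 0 ^ (Q ^ j) * cofactor (Moore Q r v) j 0)"
    unfolding Lam_eq_det_Moore[OF add Q]
    by (subst laplace_expansion_column[of _ r 0]) (use r in \<open>auto simp: Moore_def\<close>)
  have "mat_delete (Moore Q r v) 0 0 = frobM Q (Moore Q (r - 1) (\<lambda>m. v (Suc m)))"
    by (rule eq_matI) (auto simp: mat_delete_def Moore_def frobM_def mult.commute simp flip: power_mult)
  thus "cofactor (Moore Q r v) 0 0 = Lam Q (r - 1) (\<lambda>m. v (Suc m)) ^ Q"
    by (simp add: cofactor_def det_frobM[OF add] Lam_eq_det_Moore[OF add Q])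
qed

lemma cofactor_Moore_cong:
  assumes "\<And>m. v (Suc m) = w (Suc m)" "j < r"
  shows "cofactor (Moore Q r v) j 0 = cofactor (Moore Q r w) j 0"
proof -
  have "mat_delete (Moore Q r v) j 0 = mat_delete (Moore Q r w) j 0"
    by (rule eq_matI) (use assms in \<open>auto simp: mat_delete_def Moore_def\<close>)
  thus ?thesis by (simp add: cofactor_def)
qed

text \<open>Solve a_(n+1)^Q - a_(n+1) = a_n from a_0 = 1. Then \<open>Dmat\<close> is an upper
  unitriangular Toeplitz matrix, and (Frob - 1)^r kills all coordinates below r, so this is a
  constant point of the hypersurface with b = 0. It shows that Moore determinants are nonzero
  polynomials, and it is later the starting point of a deformation.\<close>

lemma Toeplitz_point:
  fixes Q :: nat
  assumes "Q > 1"
  obtains a :: "nat \<Rightarrow> 'c :: alg_closed_field"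
  where "\<And>j m. (dfrob Q ^^ j) (a m) = (if j \<le> m then a (m - j) else 0)" "a 0 = 1"
    "\<And>r. Lam Q r a = 1"
proof -
  have ex: "\<exists>y. y ^ Q - y = x" for x :: 'c
  proof -
    let ?P = "Polynomial.monom 1 Q + [:- x, - 1:] :: 'c poly"
    have "Polynomial.degree ?P = Q"
      using assms by (subst degree_add_eq_left) (simp_all add: degree_monom_eq)
    hence "\<exists>y. poly ?P y = 0"
      using assms by (intro alg_closed_imp_poly_has_root) auto
    thus ?thesis by (auto simp: poly_monom algebra_simps)
  qed
  define next' where "next' x = (SOME y :: 'c. y ^ Q - y = x)" for x
  have next': "dfrob Q (next' x) = x" for x
    unfolding next'_def dfrob_def by (rule someI_ex[OF ex])
  define a where "a n = (next' ^^ n) 1" for n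
  have d0: "(dfrob Q ^^ j) 0 = (0 :: 'c)" for j
    using assms by (induction j) (auto simp: dfrob_def)
  have *: "(dfrob Q ^^ j) (a m) = (if j \<le> m then a (m - j) else 0)" for j m
  proof (induction m arbitrary: j)
    case 0
    show ?case
    proof (cases j)
      case (Suc i)
      have "dfrob Q (a 0) = 0" by (simp add: a_def dfrob_def)
      thus ?thesis by (simp add: Suc funpow_Suc_right d0 del: funpow.simps)
    qed simp
  next
    case (Suc m)
    show ?case
    proof (cases j)
      case (Suc i)
      have "dfrob Q (a (Suc m)) = a m" by (simp add: a_def next')
      thus ?thesis by (simp add: Suc funpow_Suc_right Suc.IH del: funpow.simps)
    qed simp
  qed
  have a0: "a 0 = 1" by (simp add: a_def)
  have "Lam Q r a = 1" for r
    unfolding Lam_def by (rule det_upper_unitriangular[of _ r]) (auto simp: Dmat_def * a0)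
  thus ?thesis using that * a0 by blast
qed

section \<open>A generic point of the hypersurface \<open>Lam = 1\<close>\<close>

type_synonym 'c mp = "(nat \<Rightarrow>\<^sub>0 nat) \<Rightarrow>\<^sub>0 'c"

definition cB :: "'c :: field \<Rightarrow> 'c mp fract"
  where "cB c = to_fract (Poly_Mapping.single 0 c)"

definition XB :: "nat \<Rightarrow> 'c :: field mp fract"
  where "XB i = to_fract (Poly_Mapping.single (Poly_Mapping.single i 1) 1)"

definition cL :: "'c :: field \<Rightarrow> 'c mp fract fls"
  where "cL c = fls_const (cB c)"

text \<open>The coefficients are constants from \<open>'c\<close>, while the points have coordinates
  in a Laurent series field over infinitely many variables. That field is large enough for a generic
  point as well as for points with prescribed \<open>bvec\<close>.\<close>

definition Pol :: "((nat \<Rightarrow> 'c :: field mp fract fls) \<Rightarrow> 'c mp fract fls) set"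
  where "Pol = alg (range cL) {\<lambda>v. v i | i. True}"

lemma coeff_hom_to_fract: "coeff_hom to_fract"
  by unfold_locales simp_all

lemma coeff_hom_cB: "coeff_hom cB"
proof
  fix a b :: 'a
  show "cB (a + b) = cB a + cB b" by (simp add: cB_def single_add)
  show "cB (a * b) = cB a * cB b"
    unfolding cB_def to_fract_mult[symmetric] mult_single by simp
qed (simp add: cB_def)

lemma coeff_hom_cL: "coeff_hom cL"
proof -
  interpret coeff_hom cB by (rule coeff_hom_cB)
  show ?thesis
    by unfold_locales (simp_all add: cL_def h_add h_mult fls_plus_const)
qed

lemma coeff_hom_fps_const_cB: "coeff_hom (\<lambda>c. fps_const (cB c))"
proof -
  interpret coeff_hom cB by (rule coeff_hom_cB)
  show ?thesis
    by unfold_locales (simp_all add: h_add h_mult)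
qed

lemma function_ring_Pol: "function_ring Pol"
proof -
  interpret coeff_hom cL by (rule coeff_hom_cL)
  show ?thesis unfolding Pol_def
    by (rule function_ring_alg) (metis h_1 h_uminus rangeI)+
qed

lemma mon_eval_XB: "mon_eval XB m = to_fract (Poly_Mapping.single m 1)"
proof -
  interpret coeff_hom "to_fract :: 'a mp \<Rightarrow> _" by (rule coeff_hom_to_fract)
  have "Poly_Mapping.single m (1 :: 'a) = (\<Prod>i\<in>keys m. Poly_Mapping.single (Poly_Mapping.single i (lookup m i)) 1)"
  proof -
    have "(\<Prod>i\<in>I. Poly_Mapping.single (f i) (1 :: 'a)) = Poly_Mapping.single (\<Sum>i\<in>I. f i) 1"
      if "finite I" for I :: "nat set" and f :: "nat \<Rightarrow> nat \<Rightarrow>\<^sub>0 nat"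
      using that by induction (simp_all add: mult_single)
    thus ?thesis
      by (subst poly_mapping_sum_single[of m]) simp
  qed
  moreover have pw: "Poly_Mapping.single (Poly_Mapping.single i n) (1 :: 'a) =
      Poly_Mapping.single (Poly_Mapping.single i 1) 1 ^ n" for i n
  proof (induction n)
    case (Suc n)
    have "Poly_Mapping.single i (Suc n) = Poly_Mapping.single i 1 + Poly_Mapping.single i n"
      by (simp flip: single_add)
    hence "Poly_Mapping.single (Poly_Mapping.single i (Suc n)) (1 :: 'a) =
        Poly_Mapping.single (Poly_Mapping.single i 1) 1 * Poly_Mapping.single (Poly_Mapping.single i n) 1"
      by (simp only: mult_single mult_1)
    thus ?case by (simp only: Suc power_Suc)
  qed simp
  ultimately have "Poly_Mapping.single m (1 :: 'a) =
      (\<Prod>i\<in>keys m. Poly_Mapping.single (Poly_Mapping.single i 1) 1 ^ lookup m i)"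
    by (simp only: pw[of _ "lookup m _"])
  thus ?thesis
    by (simp add: mon_eval_def XB_def h_prod h_power)
qed

lemma meval_XB: "meval cB XB p = to_fract p"
proof -
  interpret coeff_hom "to_fract :: 'a mp \<Rightarrow> _" by (rule coeff_hom_to_fract)
  have "meval cB XB p = to_fract (\<Sum>m\<in>keys p. Poly_Mapping.single m (lookup p m))"
    by (simp add: meval_def mon_eval_XB cB_def h_sum mult_single flip: h_mult)
  thus ?thesis using poly_mapping_sum_single[of p] by simp
qed

lemma CHAR_mp_fract: "CHAR('c :: field mp fract) = CHAR('c)"
proof (rule CHAR_eq_if_hom[of cB])
  show "inj cB" by (auto simp: inj_def cB_def dest: injD[OF inj_single])
  show "cB (of_nat n) = of_nat n" for n
  proof -
    interpret coeff_hom cB by (rule coeff_hom_cB)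
    show ?thesis by (induction n) (simp_all add: h_add)
  qed
qed

text \<open>The point \<open>\<xi>, X\<^sub>1, X\<^sub>2, \<dots>\<close>, where \<open>\<xi>\<close> is a power series of order one, is generic.\<close>

lemma meval_generic:
  fixes \<xi> :: "'c :: field mp fract fps"
  assumes \<xi>: "\<xi> $ 0 = 0" "\<xi> $ 1 \<noteq> 0"
    and p: "meval (\<lambda>c. fps_const (cB c)) (\<lambda>i. if i = 0 then \<xi> else fps_const (XB i)) p = 0"
  shows "p = 0"
proof (rule ccontr)
  assume "p \<noteq> 0"
  define x where "x = (\<lambda>i. if i = 0 then \<xi> else fps_const (XB i))"
  define M where "M = (\<lambda>m :: nat \<Rightarrow>\<^sub>0 nat. lookup m 0) ` keys p"
  have M: "finite M" "M \<noteq> {}"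
    using \<open>p \<noteq> 0\<close> by (auto simp: M_def)
  define l where "l = Min M"
  define w where "w m = (\<Prod>i\<in>keys m - {0}. XB i ^ lookup m i :: 'c mp fract)" for m
  have x_split: "mon_eval x m = \<xi> ^ lookup m 0 * fps_const (w m)" for m
  proof -
    interpret F: coeff_hom "fps_const :: 'c mp fract \<Rightarrow> _" by unfold_locales simp_all
    have "mon_eval x m = (\<Prod>i\<in>insert 0 (keys m). x i ^ lookup m i)"
      by (rule mon_eval_superset) auto
    also have "\<dots> = \<xi> ^ lookup m 0 * (\<Prod>i\<in>keys m - {0}. x i ^ lookup m i)"
      by (subst prod.insert_remove) (auto simp: x_def)
    also have "(\<Prod>i\<in>keys m - {0}. x i ^ lookup m i) = fps_const (w m)"
      unfolding w_def F.h_prod F.h_power by (rule prod.cong) (auto simp: x_def)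
    finally show ?thesis .
  qed
  have X_split: "mon_eval XB m = XB 0 ^ lookup m 0 * w m" for m
  proof -
    have "mon_eval XB m = (\<Prod>i\<in>insert 0 (keys m). XB i ^ lookup m i :: 'c mp fract)"
      by (rule mon_eval_superset) auto
    thus ?thesis by (subst (asm) prod.insert_remove) (auto simp: w_def)
  qed
  let ?K = "{m \<in> keys p. lookup m 0 = l}"
  define p' where "p' = (\<Sum>m\<in>?K. Poly_Mapping.single m (lookup p m))"
  \<comment> \<open>Only the terms of lowest degree \<open>l\<close> in variable 0 reach the
    coefficient of X^l, and in them only the leading coefficient of \<xi> matters.\<close>
  have "0 = (\<Sum>m\<in>keys p. cB (lookup p m) * ((\<xi> ^ lookup m 0) $ l * w m))"
    using arg_cong[OF p, of "\<lambda>f. f $ l"]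
    by (simp add: meval_def fps_sum_nth x_split mult.assoc flip: x_def)
  also have "\<dots> = (\<Sum>m\<in>?K. cB (lookup p m) * ((\<xi> ^ lookup m 0) $ l * w m))"
  proof (rule sum.mono_neutral_right)
    show "\<forall>m\<in>keys p - ?K. cB (lookup p m) * ((\<xi> ^ lookup m 0) $ l * w m) = 0"
    proof
      fix m assume m: "m \<in> keys p - ?K"
      hence "lookup m 0 > l" using Min_le[OF M(1), of "lookup m 0"]
        by (simp add: l_def[symmetric]) (auto simp: M_def)
      thus "cB (lookup p m) * ((\<xi> ^ lookup m 0) $ l * w m) = 0"
        using startsby_zero_power_prefix[OF \<xi>(1)] by simp
    qed
  qed auto
  also have "\<dots> = (\<Sum>m\<in>?K. cB (lookup p m) * ((\<xi> $ 1) ^ l * w m))"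
    using startsby_zero_power_nth_same[OF \<xi>(1)] by (intro sum.cong) auto
  \<comment> \<open>Multiplication by \<open>XB 0 ^ l\<close> puts back the variable that \<xi> had
    replaced, so that the sum becomes the value of \<open>p'\<close> at independent
    variables.\<close>
  finally have "0 = XB 0 ^ l * (\<Sum>m\<in>?K. cB (lookup p m) * ((\<xi> $ 1) ^ l * w m))"
    by simp
  also have "\<dots> = (\<xi> $ 1) ^ l * (\<Sum>m\<in>?K. cB (lookup p m) * mon_eval XB m)"
    by (simp add: sum_distrib_left X_split mult_ac)
  also have "(\<Sum>m\<in>?K. cB (lookup p m) * mon_eval XB m) = to_fract p'"
    by (simp add: p'_def to_fract_sum mon_eval_XB cB_def mult_single flip: to_fract_mult)
  finally have p'0: "p' = 0" using \<xi>(2) by simp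
  obtain m where m: "m \<in> keys p" "lookup m 0 = l"
    using Min_in[OF M] by (auto simp: l_def M_def)
  have "lookup p' m = (\<Sum>n\<in>?K. lookup p n when n = m)"
    by (simp add: p'_def lookup_sum lookup_single)
  also have "\<dots> = lookup p m"
    using m by (simp add: when_def sum.delta)
  finally show False using m p'0 by (simp add: in_keys_iff)
qed

lemma Lam_in_Pol: "Lam Q r \<in> Pol"
proof -
  interpret function_ring Pol by (rule function_ring_Pol)
  have "(\<lambda>v. det (Dmat Q r v)) \<in> Pol"
  proof (rule det[where n = r])
    fix i j assume "i < r" "j < r"
    moreover have "(\<lambda>v. (dfrob Q ^^ i) (v j)) \<in> Pol" for i j
    proof (induction i)
      case 0
      show ?case by (auto simp: Pol_def intro: alg.gen)
    qed (auto simp: dfrob_def intro: power diff)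
    ultimately show "(\<lambda>v. Dmat Q r v $$ (i, j)) \<in> Pol"
      by (simp add: Dmat_def)
  qed simp
  thus ?thesis by (simp add: Lam_def[abs_def])
qed

section \<open>Construction of the generic point\<close>

definition mdeg :: "(nat \<Rightarrow>\<^sub>0 nat) \<Rightarrow> nat"
  where "mdeg m = (\<Sum>i\<in>keys m. lookup m i)"

lemma mon_eval_scale: "mon_eval (\<lambda>i. c * v i) m = c ^ mdeg m * mon_eval v m"
  by (simp add: mon_eval_def mdeg_def power_mult_distrib prod.distrib power_sum)

lemma mon_eval_in_Pol: "(\<lambda>v. mon_eval v m) \<in> Pol"
proof -
  interpret function_ring Pol by (rule function_ring_Pol)
  show ?thesis unfolding mon_eval_def
    by (intro prod power) (auto simp: Pol_def intro: alg.gen)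
qed

text \<open>Solve for the linear term: \<xi> = (X - sum over j >= 1 of c_j \<xi>^(Q^j)) / c_0. The
  sum consists of Frobenius powers, hence is causal, and it does not meet the coefficient of X,
  which is therefore 1 / c_0.\<close>

lemma exists_order_one_series:
  fixes c :: "nat \<Rightarrow> 'b :: field"
  assumes add: "\<And>x y :: 'b fps. (x + y) ^ Q = x ^ Q + y ^ Q" and Q: "Q > 1" and r: "r > 0"
    and c0: "c 0 \<noteq> 0"
  obtains \<xi> where "\<xi> $ 0 = 0" "\<xi> $ 1 \<noteq> 0" "(\<Sum>j<r. \<xi> ^ (Q ^ j) * fps_const (c j)) = fps_X"
proof -
  define \<Psi> :: "(unit \<Rightarrow> 'b fps) \<Rightarrow> unit \<Rightarrow> 'b fps" where
    "\<Psi> u i = fps_const (1 / c 0) * (fps_X - (\<Sum>j\<in>{1..<r}. u i ^ (Q ^ j) * fps_const (c j)))" for u i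
  have causal: "\<Psi> u i $ n = \<Psi> v i $ n"
    if "n > 0" "\<And>i k. k < n \<Longrightarrow> u i $ k = v i $ k" for u v n i
  proof -
    have "(u i ^ (Q ^ j)) $ n = (v i ^ (Q ^ j)) $ n" if "j \<in> {1..<r}" for j
    proof (rule fps_power_causal[where n = n])
      show "Q ^ j > 1" using that Q by (intro one_less_power) auto
    qed (use \<open>n > 0\<close> \<open>\<And>i k. k < n \<Longrightarrow> u i $ k = v i $ k\<close> additive_power_power[OF add] in auto)
    thus ?thesis
      by (simp add: \<Psi>_def fps_sum_nth)
  qed
  obtain u where u: "\<And>i. u i $ 0 = 0" "\<And>i n. n > 0 \<Longrightarrow> u i $ n = \<Psi> u i $ n"
    using fps_contraction[of \<Psi> "\<lambda>_. 0", OF causal] by blast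
  define \<xi> where "\<xi> = u ()"
  have xi0: "\<xi> $ 0 = 0" by (simp add: \<xi>_def u)
  have zero: "(\<xi> ^ (Q ^ j)) $ n = 0" if "n < Q ^ j" for j n
    using startsby_zero_power_prefix[OF xi0] that by auto
  have fixp: "\<xi> = fps_const (1 / c 0) * (fps_X - (\<Sum>j\<in>{1..<r}. \<xi> ^ (Q ^ j) * fps_const (c j)))"
  proof (rule fps_ext)
    fix n
    show "\<xi> $ n = (fps_const (1 / c 0) * (fps_X - (\<Sum>j\<in>{1..<r}. \<xi> ^ (Q ^ j) * fps_const (c j)))) $ n"
    proof (cases "n = 0")
      case True
      thus ?thesis using xi0 zero[of 0] Q by (auto simp: fps_sum_nth intro!: sum.neutral)
    next
      case False
      thus ?thesis using u(2)[of n "()"] by (simp add: \<xi>_def \<Psi>_def)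
    qed
  qed
  show ?thesis
  proof (rule that[OF xi0])
    have "(\<Sum>j\<in>{1..<r}. \<xi> ^ (Q ^ j) * fps_const (c j)) $ 1 = 0"
      unfolding fps_sum_nth
    proof (rule sum.neutral, safe)
      fix j assume "j \<in> {1..<r}"
      hence "1 < Q ^ j" using Q by (intro one_less_power) auto
      thus "(\<xi> ^ Q ^ j * fps_const (c j)) $ 1 = 0" using zero[of 1 j] by simp
    qed
    hence "\<xi> $ 1 = 1 / c 0"
      by (subst fixp) simp
    thus "\<xi> $ 1 \<noteq> 0" using c0 by simp
    have "fps_const (c 0) * \<xi> = fps_X - (\<Sum>j\<in>{1..<r}. \<xi> ^ (Q ^ j) * fps_const (c j))"
      by (subst (1) fixp) (simp add: c0 flip: mult.assoc)
    moreover have "(\<Sum>j<r. \<xi> ^ (Q ^ j) * fps_const (c j)) =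
        fps_const (c 0) * \<xi> + (\<Sum>j\<in>{1..<r}. \<xi> ^ (Q ^ j) * fps_const (c j))"
      using r by (simp add: lessThan_atLeast0 sum.atLeast_Suc_lessThan mult.commute)
    ultimately show "(\<Sum>j<r. \<xi> ^ (Q ^ j) * fps_const (c j)) = fps_X" by simp
  qed
qed

text \<open>Take X_1, X_2, ... as free coordinates and solve \<open>Lam\<close> = X for the first
  coordinate by a series of order one. Substituting X^N for X and dividing all coordinates by X
  gives \<open>Lam\<close> = 1, by homogeneity. A relation at this point splits according to the
  degree of its monomials modulo N, since different residues occupy disjoint sets of exponents.
  Within a residue class, powers of \<open>Lam\<close> equalise the degrees, and these powers become
  1 on the whole hypersurface.\<close>

lemma generic_point:
  fixes Q k r :: nat
  assumes p: "prime CHAR('c :: alg_closed_field)" and Q: "Q = CHAR('c :: alg_closed_field) ^ k" "k > 0" and r: "r > 0"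
  obtains y :: "nat \<Rightarrow> 'c :: alg_closed_field mp fract fls"
  where "Lam Q r y = 1"
    and "\<And>f v. f \<in> Pol \<Longrightarrow> f y = 0 \<Longrightarrow> Lam Q r v = 1 \<Longrightarrow> f v = 0"
proof -
  have Q1: "Q > 1"
    using p Q prime_gt_1_nat[of "CHAR('c)"] by (metis one_less_power)
  have addc: "(x + y) ^ Q = x ^ Q + y ^ Q" for x y :: 'c
    by (rule freshmans_dream'[OF p Q(1)])
  have addB: "(x + y) ^ Q = x ^ Q + y ^ Q" for x y :: "'c mp fract"
    by (rule freshmans_dream'[where n = k]) (use p Q in \<open>simp_all add: CHAR_mp_fract\<close>)
  have addF: "(x + y) ^ Q = x ^ Q + y ^ Q" for x y :: "'c mp fract fps"
    by (rule freshmans_dream'[where n = k]) (use p Q in \<open>simp_all add: CHAR_mp_fract\<close>)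
  have addL: "(x + y) ^ Q = x ^ Q + y ^ Q" for x y :: "'c mp fract fls"
    by (rule freshmans_dream'[where n = k]) (use p Q in \<open>simp_all add: CHAR_mp_fract\<close>)
  interpret cB: coeff_hom "cB :: 'c \<Rightarrow> _" by (rule coeff_hom_cB)
  interpret cL: coeff_hom "cL :: 'c \<Rightarrow> _" by (rule coeff_hom_cL)
  interpret cF: coeff_hom "\<lambda>c :: 'c. fps_const (cB c)" by (rule coeff_hom_fps_const_cB)
  interpret FC: coeff_hom "fps_const :: 'c mp fract \<Rightarrow> _" by unfold_locales simp_all
  interpret Pol: function_ring "Pol :: ((nat \<Rightarrow> 'c mp fract fls) \<Rightarrow> _) set" by (rule function_ring_Pol)
  define N where "N = (\<Sum>j<r. Q ^ j)"
  have N0: "N > 0" using r Q1 by (auto simp: N_def intro!: sum_pos)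

  define c where "c j = cofactor (Moore Q r (\<lambda>m. XB m :: 'c mp fract)) j 0" for j
  have c0: "c 0 \<noteq> 0"
  proof -
    \<comment> \<open>The Toeplitz point, shifted by one index through \<open>case_nat 0 a\<close>,
      shows that the Moore determinant of X_1, ..., X_(r-1) is a nonzero polynomial.\<close>
    obtain a :: "nat \<Rightarrow> 'c" where a: "\<And>r. Lam Q r a = 1"
      using Toeplitz_point[OF Q1] by metis
    define v :: "nat \<Rightarrow> 'c mp" where "v m = Poly_Mapping.single (Poly_Mapping.single m 1) 1" for m
    interpret E: coeff_hom "meval id (case_nat 0 a) :: 'c mp \<Rightarrow> 'c"
    proof -
      interpret coeff_hom "id :: 'c \<Rightarrow> 'c" by unfold_locales simp_all
      show "coeff_hom (meval id (case_nat 0 a) :: 'c mp \<Rightarrow> 'c)" by (rule coeff_hom_meval)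
    qed
    interpret I: coeff_hom "id :: 'c \<Rightarrow> 'c" by unfold_locales simp_all
    have "meval id (case_nat 0 a) (Lam Q (r - 1) (\<lambda>m. v (Suc m))) =
        Lam Q (r - 1) (\<lambda>m. meval id (case_nat 0 a) (v (Suc m)))"
      by (rule Lam_hom[symmetric]) unfold_locales
    also have "\<dots> = 1" by (simp add: v_def a)
    finally have "Lam Q (r - 1) (\<lambda>m. v (Suc m)) \<noteq> 0" by auto
    moreover have "Lam Q (r - 1) (\<lambda>m. XB (Suc m) :: 'c mp fract) = to_fract (Lam Q (r - 1) (\<lambda>m. v (Suc m)))"
      unfolding XB_def v_def by (rule Lam_hom[OF coeff_hom_to_fract])
    ultimately show ?thesis
      using Lam_expand(2)[OF addB _ r, of XB] Q1 by (simp add: c_def)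
  qed
  obtain \<xi> where \<xi>: "\<xi> $ 0 = 0" "\<xi> $ 1 \<noteq> 0" "(\<Sum>j<r. \<xi> ^ (Q ^ j) * fps_const (c j)) = fps_X"
    using exists_order_one_series[OF addF Q1 r, of c] c0 by blast

  define x' where "x' = (\<lambda>i. if i = 0 then \<xi> else fps_const (XB i))"
  have Lam_x': "Lam Q r x' = fps_X"
  proof -
    have "cofactor (Moore Q r x') j 0 = fps_const (c j)" if "j < r" for j
    proof -
      have "cofactor (Moore Q r x') j 0 = cofactor (Moore Q r (\<lambda>i. fps_const (XB i))) j 0"
        by (rule cofactor_Moore_cong) (use that in \<open>auto simp: x'_def\<close>)
      also have "mat_delete (Moore Q r (\<lambda>i. fps_const (XB i :: 'c mp fract))) j 0 =
          map_mat fps_const (mat_delete (Moore Q r XB) j 0)"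
        by (rule eq_matI) (auto simp: mat_delete_def Moore_def)
      hence "cofactor (Moore Q r (\<lambda>i. fps_const (XB i))) j 0 = fps_const (c j)"
        by (simp only: cofactor_def c_def det_hom[OF FC.coeff_hom_axioms] FC.h_mult FC.h_power FC.h_uminus FC.h_1)
      finally show ?thesis .
    qed
    thus ?thesis
      using Lam_expand(1)[OF addF _ r, of x'] \<xi>(3) Q1 by (simp add: x'_def)
  qed

  define h where "h u = fls_compose_power (fps_to_fls u) N" for u :: "'c mp fract fps"
  have hom_h: "coeff_hom h"
    using N0 by unfold_locales (simp_all add: h_def fls_compose_power_add fls_compose_power_mult fps_to_fls_plus fls_times_fps_to_fls)
  interpret h: coeff_hom h by (rule hom_h)
  have h_const: "h (fps_const (cB a)) = cL a" for a
    using N0 by (simp add: h_def cL_def)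
  define x where "x i = h (x' i)" for i
  have h_meval: "meval cL x p = h (meval (\<lambda>c. fps_const (cB c)) x' p)" for p
    by (subst meval_hom[OF hom_h]) (unfold_locales, simp add: h_const x_def[abs_def])
  have Lam_x: "Lam Q r x = fls_X ^ N"
    unfolding x_def[abs_def] Lam_hom[OF hom_h] Lam_x' using N0 by (simp add: h_def fls_X_power_conv_shift_1)
  have x_generic: "p = 0" if "meval (\<lambda>c. fps_const (cB c)) x' p = 0" for p
    using meval_generic[OF \<xi>(1,2)] that by (simp add: x'_def)

  define \<delta> where "\<delta> = inverse (fls_X :: 'c mp fract fls)"
  have \<delta>: "\<delta> * fls_X = 1" by (simp add: \<delta>_def)
  define y where "y i = \<delta> * x i" for i
  have Lam_y: "Lam Q r y = 1"
    unfolding y_def[abs_def] using Lam_scale[OF addL, of r \<delta> x] Q1 Lam_x \<delta>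
    by (simp flip: N_def power_mult_distrib)

  show ?thesis
  proof (rule that[OF Lam_y])
    fix f v assume f: "f \<in> Pol" and fy: "f y = 0" and v: "Lam Q r v = (1 :: 'c mp fract fls)"
    obtain p where p: "\<And>v. f v = meval cL v p"
      using cL.alg_imp_meval[of f] f unfolding Pol_def by blast
    \<comment> \<open>Any common upper bound of the quotients \<open>mdeg m div N\<close> serves
      here; the sum of all degrees is one.\<close>
    define K where "K = (\<Sum>m\<in>keys p. mdeg m)"
    have K: "mdeg m div N \<le> K" if "m \<in> keys p" for m
    proof -
      have "mdeg m div N \<le> mdeg m" by simp
      also have "\<dots> \<le> K" unfolding K_def by (rule member_le_sum) (use that in auto)
      finally show ?thesis .
    qed
    \<comment> \<open>The part of \<open>f\<close> in degrees congruent to \<rho> modulo N, made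
      homogeneous of degree \<rho> + N K by powers of \<open>Lam\<close>.\<close>
    define F where "F \<rho> w = (\<Sum>m\<in>{m \<in> keys p. mdeg m mod N = \<rho>}.
      cL (lookup p m) * mon_eval w m * Lam Q r w ^ (K - mdeg m div N))" for \<rho> w
    have F_Pol: "F \<rho> \<in> Pol" for \<rho>
      unfolding F_def[abs_def]
      by (intro Pol.sum Pol.mult Pol.power mon_eval_in_Pol Lam_in_Pol) (auto simp: Pol_def intro: alg.const)
    have "\<forall>\<rho>. \<exists>P. \<forall>w. F \<rho> w = meval cL w P"
      using cL.alg_imp_meval F_Pol unfolding Pol_def by blast
    then obtain P where P: "\<And>\<rho> w. F \<rho> w = meval cL w (P \<rho>)" by metis
    define u where "u \<rho> = meval (\<lambda>c. fps_const (cB c)) x' (P \<rho>)" for \<rho>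
    have Fx: "F \<rho> x = h (u \<rho>)" for \<rho>
      by (simp add: P h_meval u_def)
    have "0 = fls_X ^ (N * K + N) * f y" using fy by simp
    also have "\<dots> = (\<Sum>m\<in>keys p. cL (lookup p m) * (fls_X ^ (N * K + N) * \<delta> ^ mdeg m) * mon_eval x m)"
      by (simp add: p meval_def y_def[abs_def] mon_eval_scale sum_distrib_left mult_ac)
    also have "\<dots> = (\<Sum>m\<in>keys p. fls_X ^ (N - mdeg m mod N) *
        (cL (lookup p m) * mon_eval x m * Lam Q r x ^ (K - mdeg m div N)))"
    proof (rule sum.cong[OF refl])
      fix m assume m: "m \<in> keys p"
      have "mdeg m mod N < N" using N0 by simp
      have "N * K + N = mdeg m + ((N - mdeg m mod N) + N * (K - mdeg m div N))"
      proof -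
        obtain e where e: "K = mdeg m div N + e" using K[OF m] le_Suc_ex by blast
        have "N * K + N = N * (mdeg m div N) + N * e + N"
          by (simp add: e algebra_simps)
        also have "\<dots> = (N * (mdeg m div N) + mdeg m mod N) + ((N - mdeg m mod N) + N * e)"
          using \<open>mdeg m mod N < N\<close> by linarith
        finally show ?thesis by (simp add: e)
      qed
      hence "(fls_X :: 'c mp fract fls) ^ (N * K + N) * \<delta> ^ mdeg m =
          fls_X ^ (N - mdeg m mod N) * (fls_X ^ N) ^ (K - mdeg m div N) * (\<delta> * fls_X) ^ mdeg m"
        by (simp only: power_add power_mult power_mult_distrib mult_ac)
      thus "cL (lookup p m) * (fls_X ^ (N * K + N) * \<delta> ^ mdeg m) * mon_eval x m =
          fls_X ^ (N - mdeg m mod N) * (cL (lookup p m) * mon_eval x m * Lam Q r x ^ (K - mdeg m div N))"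
        unfolding \<delta> Lam_x by (simp add: mult_ac)
    qed
    also have "\<dots> = (\<Sum>\<rho><N. \<Sum>m\<in>{m \<in> keys p. mdeg m mod N = \<rho>}. fls_X ^ (N - mdeg m mod N) *
        (cL (lookup p m) * mon_eval x m * Lam Q r x ^ (K - mdeg m div N)))"
      by (rule sum.group[symmetric]) (use N0 in auto)
    also have "\<dots> = (\<Sum>\<rho><N. fls_X ^ (N - \<rho>) * F \<rho> x)"
      by (simp add: F_def sum_distrib_left)
    finally have zero: "(\<Sum>\<rho><N. fls_X ^ (N - \<rho>) * h (u \<rho>)) = 0"
      by (simp add: Fx)
    \<comment> \<open>As \<open>h\<close> substitutes X^N, the exponents in the summand of \<rho>
      are congruent to -\<rho> modulo N, so summands of different residues cannot cancel.\<close>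
    have u0: "u \<rho> = 0" if \<rho>: "\<rho> < N" for \<rho>
    proof (rule fps_ext)
      fix s
      let ?t = "int (N * s + (N - \<rho>))"
      have nth: "fls_nth (fls_X ^ (N - \<sigma>) * h (u \<sigma>)) ?t = (if \<sigma> = \<rho> then u \<sigma> $ s else 0)" if "\<sigma> < N" for \<sigma>
      proof -
        have "fls_nth (fls_X ^ (N - \<sigma>) * h (u \<sigma>)) ?t = fls_nth (h (u \<sigma>)) (int N * int s + (int \<sigma> - int \<rho>))"
          using that \<rho> by (simp add: fls_X_power_times_conv_shift of_nat_diff algebra_simps)
        moreover have "int N dvd int N * int s + (int \<sigma> - int \<rho>) \<longleftrightarrow> \<sigma> = \<rho>"
        proof
          assume "int N dvd int N * int s + (int \<sigma> - int \<rho>)"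
          hence "int N dvd int \<sigma> - int \<rho>" by (simp add: dvd_add_right_iff)
          hence "int \<sigma> mod int N = int \<rho> mod int N" by (simp add: mod_eq_dvd_iff)
          thus "\<sigma> = \<rho>" using that \<rho> by simp
        qed simp
        ultimately show ?thesis
          using N0 by (auto simp: h_def fls_compose_power.rep_eq)
      qed
      have "0 = fls_nth (\<Sum>\<sigma><N. fls_X ^ (N - \<sigma>) * h (u \<sigma>)) ?t"
        using zero by simp
      also have "\<dots> = (\<Sum>\<sigma><N. if \<sigma> = \<rho> then u \<sigma> $ s else 0)"
        unfolding fls_nth_sum by (rule sum.cong) (use nth in auto)
      also have "\<dots> = u \<rho> $ s" using \<rho> by simp
      finally show "u \<rho> $ s = 0 $ s" by simp
    qed
    have "F \<rho> v = 0" if "\<rho> < N" for \<rho>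
      using u0[OF that] x_generic[of "P \<rho>"] by (simp add: u_def P)
    hence "0 = (\<Sum>\<rho><N. F \<rho> v)" by simp
    also have "\<dots> = (\<Sum>\<rho><N. \<Sum>m\<in>{m \<in> keys p. mdeg m mod N = \<rho>}. cL (lookup p m) * mon_eval v m)"
      by (simp add: F_def v)
    also have "\<dots> = (\<Sum>m\<in>keys p. cL (lookup p m) * mon_eval v m)"
      by (rule sum.group) (use N0 in auto)
    also have "\<dots> = f v" by (simp add: p meval_def)
    finally show "f v = 0" by simp
  qed
qed

section \<open>Frobenius systems over power series rings\<close>

abbreviation cpred :: "nat \<Rightarrow> nat \<Rightarrow> nat"
  where "cpred d i \<equiv> (if i = 0 then d - 1 else i - 1)"

text \<open>The system Frob(Y_(i-1)) = A_i Y_i, solved for Y_i by the adjugate. The parameter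
  \<open>v\<close> is part of the index: the whole family is then one fixed point, and the
  dependence of the solution on \<open>v\<close> can be followed through the iteration.\<close>

definition frob_step :: "nat \<Rightarrow> nat \<Rightarrow> nat \<Rightarrow> ('v \<Rightarrow> nat \<Rightarrow> 'a :: comm_ring_1 fps mat) \<Rightarrow>
    ('v \<times> nat \<times> nat \<times> nat \<Rightarrow> 'a fps) \<Rightarrow> 'v \<times> nat \<times> nat \<times> nat \<Rightarrow> 'a fps"
  where "frob_step q d r A u = (\<lambda>(v, i, j, m). if i < d \<and> j < r \<and> m < r
    then \<Sum>l<r. adj_mat (A v i) $$ (j, l) * u (v, cpred d i, l, m) ^ q else 0)"

lemma frob_step_causal:
  fixes u v :: "'v \<times> nat \<times> nat \<times> nat \<Rightarrow> 'a :: comm_ring_1 fps"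
  assumes add: "\<And>x y :: 'a fps. (x + y) ^ q = x ^ q + y ^ q" and q: "q > 1"
    and "n > 0" "\<And>i k. k < n \<Longrightarrow> u i $ k = v i $ k"
  shows "frob_step q d r A u x $ n = frob_step q d r A v x $ n"
proof -
  have "(u y ^ q) $ k = (v y ^ q) $ k" if "k \<le> n" for y k
    by (rule fps_power_causal[OF add q assms(3)]) (use that assms(4) in auto)
  thus ?thesis
    by (auto simp: frob_step_def fps_sum_nth fps_mult_nth split: prod.splits intro!: sum.cong)
qed

lemma function_ring_fps:
  assumes "function_ring (S :: ('v \<Rightarrow> 'a :: comm_ring_1) set)"
  shows "function_ring {f :: 'v \<Rightarrow> 'a fps. \<forall>n. (\<lambda>v. f v $ n) \<in> S}"
proof -
  interpret function_ring S by fact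
  show ?thesis
  proof (unfold_locales, goal_cases)
    case 1
    show ?case by (auto simp: fps_one_nth one zero)
  next
    case 2
    show ?case by (auto simp: fps_one_nth minus_one zero)
  next
    case (3 f g)
    thus ?case by (auto intro: add)
  next
    case (4 f g)
    thus ?case by (auto simp: fps_mult_nth intro!: sum mult)
  qed
qed

text \<open>Each coefficient is reached after finitely many steps built from ring operations on the
  entries of \<open>A\<close> and \<open>C\<close>, so as a function of \<open>v\<close> it stays in
  \<open>S\<close>. The equation is asserted only for n > 0, because the constant terms are
  prescribed independently of it.\<close>

lemma frob_system_exists:
  fixes A :: "'v \<Rightarrow> nat \<Rightarrow> 'a :: comm_ring_1 fps mat" and C :: "'v \<Rightarrow> nat \<Rightarrow> 'a mat"
  assumes add: "\<And>x y :: 'a fps. (x + y) ^ q = x ^ q + y ^ q" and q: "q > 1"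
    and A: "\<And>v i. A v i \<in> carrier_mat r r"
    and S: "function_ring S"
    and AS: "\<And>i j l n. i < d \<Longrightarrow> j < r \<Longrightarrow> l < r \<Longrightarrow> (\<lambda>v. A v i $$ (j, l) $ n) \<in> S"
    and CS: "\<And>i j m. i < d \<Longrightarrow> j < r \<Longrightarrow> m < r \<Longrightarrow> (\<lambda>v. C v i $$ (j, m)) \<in> S"
  shows "\<exists>Y :: 'v \<Rightarrow> nat \<Rightarrow> 'a fps mat. \<forall>i<d. (\<forall>v. Y v i \<in> carrier_mat r r) \<and> (\<forall>j<r. \<forall>m<r.
      (\<forall>v. Y v i $$ (j, m) $ 0 = C v i $$ (j, m)) \<and>
      (\<forall>v. \<forall>n>0. Y v i $$ (j, m) $ n = (adj_mat (A v i) * frobM q (Y v (cpred d i))) $$ (j, m) $ n) \<and>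
      (\<forall>n. (\<lambda>v. Y v i $$ (j, m) $ n) \<in> S))"
proof -
  interpret S: function_ring S by fact
  define SF where "SF = {f :: 'v \<Rightarrow> 'a fps. \<forall>n. (\<lambda>v. f v $ n) \<in> S}"
  interpret SF: function_ring SF unfolding SF_def by (rule function_ring_fps[OF S])
  define c where "c = (\<lambda>(v, i, j, m). if i < d \<and> j < r \<and> m < r then C v i $$ (j, m) else 0)"
  define step where "step = (\<lambda>u x. Abs_fps (\<lambda>n. if n = 0 then c x else frob_step q d r A u x $ n))"
  obtain u where u0: "\<And>x. u x $ 0 = c x" and u: "\<And>x n. n > 0 \<Longrightarrow> u x $ n = frob_step q d r A u x $ n"
    and ua: "\<And>n x. u x $ n = (step ^^ n) (\<lambda>x. fps_const (c x)) x $ n"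
    using fps_contraction[of "frob_step q d r A" c, OF frob_step_causal[OF add q]]
    unfolding step_def by blast
  have cS: "(\<lambda>v. c (v, i, j, m)) \<in> S" for i j m
    using CS[of i j m] by (cases "i < d \<and> j < r \<and> m < r") (auto simp: c_def S.zero)
  have adjSF: "(\<lambda>v. adj_mat (A v i) $$ (j, l)) \<in> SF" if "i < d" "j < r" "l < r" for i j l
    by (rule SF.adj[where n = r]) (use A AS that in \<open>auto simp: SF_def\<close>)
  have approx: "(\<lambda>v. (step ^^ t) (\<lambda>x. fps_const (c x)) (v, i, j, m)) \<in> SF" for t i j m
  proof (induction t arbitrary: i j m)
    case 0
    have "(\<lambda>v. fps_const (c (v, i, j, m)) $ n) \<in> S" for n
      using cS by (cases "n = 0") (auto simp: S.zero)
    thus ?case by (simp add: SF_def)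
  next
    case (Suc t)
    define w where "w = (step ^^ t) (\<lambda>x. fps_const (c x))"
    have w: "(\<lambda>v. w (v, i, j, m)) \<in> SF" for i j m
      using Suc by (simp add: w_def)
    have "(\<lambda>v. frob_step q d r A w (v, i, j, m)) \<in> SF"
    proof (cases "i < d \<and> j < r \<and> m < r")
      case True
      have "(\<lambda>v. \<Sum>l<r. adj_mat (A v i) $$ (j, l) * w (v, cpred d i, l, m) ^ q) \<in> SF"
        by (intro SF.sum SF.mult SF.power w adjSF) (use True in auto)
      thus ?thesis using True by (simp add: frob_step_def)
    qed (auto simp: frob_step_def SF.zero)
    hence "(\<lambda>v. step w (v, i, j, m) $ n) \<in> S" for n
      using cS[of i j m] by (cases "n = 0") (auto simp: SF_def step_def)
    hence "(\<lambda>v. step w (v, i, j, m)) \<in> SF" by (simp add: SF_def)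
    thus ?case by (simp add: w_def)
  qed
  define Y where "Y v i = mat r r (\<lambda>(j, m). u (v, i, j, m))" for v i
  have fY: "frobM q (Y v i) \<in> carrier_mat r r" for v i by (simp add: Y_def)
  show ?thesis
  proof (intro exI[of _ Y] allI impI conjI)
    fix i j m v assume ijm: "i < d" "j < r" "m < r"
    show "Y v i $$ (j, m) $ 0 = C v i $$ (j, m)"
      using ijm by (simp add: Y_def u0 c_def)
    fix n :: nat
    show "(\<lambda>v. Y v i $$ (j, m) $ n) \<in> S"
      using ijm approx[of n i j m] by (auto simp: Y_def ua SF_def)
    assume "n > 0"
    have "(adj_mat (A v i) * frobM q (Y v (cpred d i))) $$ (j, m) =
        (\<Sum>l<r. adj_mat (A v i) $$ (j, l) * frobM q (Y v (cpred d i)) $$ (l, m))"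
      by (rule mult_index[OF adj_mat(1)[OF A] fY]) (use ijm in auto)
    also have "\<dots> = (\<Sum>l<r. adj_mat (A v i) $$ (j, l) * u (v, cpred d i, l, m) ^ q)"
      using ijm by (intro sum.cong refl) (auto simp: Y_def frobM_def)
    finally show "Y v i $$ (j, m) $ n = (adj_mat (A v i) * frobM q (Y v (cpred d i))) $$ (j, m) $ n"
      using ijm u[OF \<open>n > 0\<close>, of "(v, i, j, m)"] by (simp add: Y_def frob_step_def)
  qed (simp add: Y_def)
qed

lemma coeff_hom_fps_nth_0: "coeff_hom (\<lambda>f :: 'a :: comm_ring_1 fps. f $ 0)"
  by unfold_locales simp_all

text \<open>About constant terms the recursion says nothing. If they solve the reduced system, the
  recursion holds in every degree, and multiplication by the unimodular \<open>A\<close> turns it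
  into the equation.\<close>

lemma frob_system_compat:
  fixes A Y Z :: "'a :: comm_ring_1 fps mat"
  assumes A: "A \<in> carrier_mat r r" "det A = 1" and Y: "Y \<in> carrier_mat r r" and Z: "Z \<in> carrier_mat r r"
    and q: "q > 0"
    and rec: "\<And>j m n. j < r \<Longrightarrow> m < r \<Longrightarrow> n > 0 \<Longrightarrow> Y $$ (j, m) $ n = (adj_mat A * frobM q Z) $$ (j, m) $ n"
    and compat: "frobM q (map_mat (\<lambda>f. f $ 0) Z) = map_mat (\<lambda>f. f $ 0) A * map_mat (\<lambda>f. f $ 0) Y"
  shows "frobM q Z = A * Y"
proof -
  have aA: "adj_mat A \<in> carrier_mat r r" by (rule adj_mat(1)[OF A(1)])
  have fZ: "frobM q Z \<in> carrier_mat r r" using Z by simp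
  note hm = mat_hom_mult[OF coeff_hom_fps_nth_0]
  let ?h = "map_mat (\<lambda>f :: 'a fps. f $ 0)"
  have 0: "?h (frobM q Z) = frobM q (?h Z)"
    by (rule eq_matI) (auto simp: frobM_def fps_nth_power_0)
  have "?h (adj_mat A * frobM q Z) = ?h (adj_mat A) * (?h A * ?h Y)"
    unfolding hm[OF aA fZ] 0 compat ..
  also have "\<dots> = ?h (adj_mat A * (A * Y))"
    using hm[OF A(1) Y] hm[OF aA mult_carrier_mat[OF A(1) Y]] by simp
  also have "adj_mat A * (A * Y) = Y"
    using assoc_mult_mat[OF aA A(1) Y] mult_adj_unimodular(2)[OF A] Y by simp
  finally have h0: "?h (adj_mat A * frobM q Z) = ?h Y" .
  have "adj_mat A * frobM q Z = Y"
  proof (rule eq_matI)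
    fix j m assume "j < dim_row Y" "m < dim_col Y"
    hence jm: "j < r" "m < r" using Y by auto
    show "(adj_mat A * frobM q Z) $$ (j, m) = Y $$ (j, m)"
    proof (rule fps_ext)
      fix n
      show "(adj_mat A * frobM q Z) $$ (j, m) $ n = Y $$ (j, m) $ n"
      proof (cases "n = 0")
        case True
        thus ?thesis
          using arg_cong[OF h0, of "\<lambda>M. M $$ (j, m)"] jm Y aA fZ by simp
      qed (use rec[OF jm] in auto)
    qed
  qed (use aA fZ Y in auto)
  hence "A * Y = A * (adj_mat A * frobM q Z)" by simp
  also have "\<dots> = frobM q Z"
    using assoc_mult_mat[OF A(1) aA fZ] mult_adj_unimodular(1)[OF A] fZ by simp
  finally show ?thesis ..
qed

text \<open>A solution is a fixed point of a causal map, hence determined by its constant terms.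
  This will identify the solution at a translated point with a matrix multiple of the original
  one.\<close>

lemma frob_system_unique:
  fixes A Y Z :: "nat \<Rightarrow> 'a :: comm_ring_1 fps mat"
  assumes add: "\<And>x y :: 'a fps. (x + y) ^ q = x ^ q + y ^ q" and q: "q > 1"
    and A: "\<And>i. A i \<in> carrier_mat r r" "\<And>i. det (A i) = 1"
    and Y: "\<And>i. i < d \<Longrightarrow> Y i \<in> carrier_mat r r" "\<And>i. i < d \<Longrightarrow> frobM q (Y (cpred d i)) = A i * Y i"
    and Z: "\<And>i. i < d \<Longrightarrow> Z i \<in> carrier_mat r r" "\<And>i. i < d \<Longrightarrow> frobM q (Z (cpred d i)) = A i * Z i"
    and eq: "\<And>i j m. i < d \<Longrightarrow> j < r \<Longrightarrow> m < r \<Longrightarrow> Y i $$ (j, m) $ 0 = Z i $$ (j, m) $ 0"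
    and "i < d"
  shows "Y i = Z i"
proof -
  define U where "U Y = (\<lambda>(v :: unit, i, j, m). if i < d \<and> j < r \<and> m < r then Y i $$ (j, m) else 0)"
    for Y :: "nat \<Rightarrow> 'a fps mat"
  have fixp: "U Y x = frob_step q d r (\<lambda>_. A) (U Y) x"
    if Y: "\<And>i. i < d \<Longrightarrow> Y i \<in> carrier_mat r r" "\<And>i. i < d \<Longrightarrow> frobM q (Y (cpred d i)) = A i * Y i"
    for Y x
  proof -
    obtain v i j m where x: "x = (v, i, j, m)" by (cases x) auto
    show ?thesis
    proof (cases "i < d \<and> j < r \<and> m < r")
      case True
      hence d: "cpred d i < d" by auto
      note aA = adj_mat(1)[OF A(1)[of i]]
      have "Y i = adj_mat (A i) * (A i * Y i)"
        using assoc_mult_mat[OF aA A(1)[of i] Y(1)[of i]] mult_adj_unimodular(2)[OF A(1) A(2), of i] Y(1)[of i] True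
        by simp
      also have "A i * Y i = frobM q (Y (cpred d i))" using Y(2)[of i] True by simp
      finally have "Y i $$ (j, m) = (\<Sum>l<r. adj_mat (A i) $$ (j, l) * frobM q (Y (cpred d i)) $$ (l, m))"
        using mult_index[OF aA, of "frobM q (Y (cpred d i))" r j m] Y(1)[OF d] True by simp
      also have "\<dots> = (\<Sum>l<r. adj_mat (A i) $$ (j, l) * U Y (v, cpred d i, l, m) ^ q)"
        using Y(1)[OF d] True d by (intro sum.cong refl) (auto simp: U_def frobM_def)
      finally show ?thesis using True by (simp add: x U_def frob_step_def)
    qed (auto simp: x U_def frob_step_def)
  qed
  have "U Y = U Z"
  proof (rule fps_contraction_unique[of "frob_step q d r (\<lambda>_. A)", OF frob_step_causal[OF add q]])
    show "U Y x $ 0 = U Z x $ 0" for x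
      using eq by (auto simp: U_def split: prod.splits)
    show "U Y x $ n = frob_step q d r (\<lambda>_. A) (U Y) x $ n" for x n
      using fixp[of Y, OF Y, of x] by simp
    show "U Z x $ n = frob_step q d r (\<lambda>_. A) (U Z) x $ n" for x n
      using fixp[of Z, OF Z, of x] by simp
  qed auto
  hence UYZ: "U Y ((), i, j, m) = U Z ((), i, j, m)" for j m by simp
  have "Y i $$ (j, m) = Z i $$ (j, m)" if "j < r" "m < r" for j m
    using UYZ[of j m] that \<open>i < d\<close> by (simp add: U_def)
  thus ?thesis
    using Y(1)[OF \<open>i < d\<close>] Z(1)[OF \<open>i < d\<close>] by (intro eq_matI) auto
qed

section \<open>Algebraic independence of the coefficients of the generic system\<close>

lemma bvec_in_Pol:
  assumes "l < r"
  shows "(\<lambda>v. bvec Q r v l) \<in> Pol"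
proof -
  interpret function_ring Pol by (rule function_ring_Pol)
  have dfr: "(\<lambda>v. (dfrob Q ^^ i) (v j)) \<in> Pol" for i j
  proof (induction i)
    case 0
    show ?case by (auto simp: Pol_def intro: alg.gen)
  qed (auto simp: dfrob_def intro: power diff)
  have D: "(\<lambda>v. Dmat Q r v $$ (i, j)) \<in> Pol" if "i < r" "j < r" for i j
    using dfr[of i j] that by (simp add: Dmat_def)
  have FD: "(\<lambda>v. frobM Q (Dmat Q r v) $$ (i, j)) \<in> Pol" if "i < r" "j < r" for i j
    using power[OF dfr[of i j], of Q] that by (simp add: Dmat_def frobM_def)
  have NC: "Nmat r 1 * Dmat Q r v \<in> carrier_mat r r" for v :: "nat \<Rightarrow> 'a mp fract fls"
    by (rule mult_carrier_mat[of _ r r]) simp_all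
  have N: "(\<lambda>v. (Nmat r 1 * Dmat Q r v) $$ (i, j)) \<in> Pol" if "i < r" "j < r" for i j
    by (rule mat_mult[where n = r and m = r and k = r])
       (use that D in \<open>auto simp: Nmat_def one zero\<close>)
  show ?thesis unfolding bvec_def
    by (rule mat_mult[where n = r and m = r and k = r])
       (use assms FD adj[OF NC N] adj_mat(1)[OF NC] in auto)
qed

text \<open>Deform the Toeplitz point, where b = 0, to b = (X X_1, ..., X X_(r-1)) by solving
  Frob(Y) = U(b) N(1) Y. The first r - 1 rows of this equation make each row of Y the image of the
  preceding one under Frob - 1, so Y is \<open>Dmat\<close> of its own first row. Its determinant is
  fixed by the Q-Frobenius and has constant term 1, so it is 1.\<close>

lemma exists_bvec_point:
  fixes Q k r :: nat
  assumes p: "prime CHAR('c :: alg_closed_field)" and Q: "Q = CHAR('c :: alg_closed_field) ^ k" "k > 0" and r: "r > 0"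
  obtains v :: "nat \<Rightarrow> 'c :: alg_closed_field mp fract fls"
  where "Lam Q r v = 1" "\<And>l. Suc l < r \<Longrightarrow> bvec Q r v l = fls_X * fls_const (XB (Suc l))"
proof -
  have Q1: "Q > 1"
    using p Q prime_gt_1_nat[of "CHAR('c)"] by (metis one_less_power)
  have addF: "(x + y) ^ Q = x ^ Q + y ^ Q" for x y :: "'c mp fract fps"
    by (rule freshmans_dream'[where n = k]) (use p Q in \<open>simp_all add: CHAR_mp_fract\<close>)
  interpret cB: coeff_hom "cB :: 'c \<Rightarrow> _" by (rule coeff_hom_cB)
  obtain a :: "nat \<Rightarrow> 'c" where a: "\<And>j m. (dfrob Q ^^ j) (a m) = (if j \<le> m then a (m - j) else 0)"
      "Lam Q r a = 1"
    using Toeplitz_point[OF Q1] by metis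
  define b where "b l = (fps_X * fps_const (XB (Suc l)) :: 'c mp fract fps)" for l
  define A where "A = Umat r b * Nmat r 1"
  have A: "A \<in> carrier_mat r r" "det A = 1"
    unfolding A_def by (rule mult_carrier_mat[of _ r r], simp, simp) (subst det_mult[of _ r], simp_all)
  define C where "C = map_mat cB (Dmat Q r a)"
  \<comment> \<open>A cycle of length one, as \<open>cpred 1 0\<close> is 0; with
    \<open>UNIV\<close> as function ring no dependence on a parameter is recorded.\<close>
  have "\<exists>Y :: unit \<Rightarrow> nat \<Rightarrow> 'c mp fract fps mat. \<forall>i<1. (\<forall>v. Y v i \<in> carrier_mat r r) \<and> (\<forall>j<r. \<forall>m<r.
      (\<forall>v. Y v i $$ (j, m) $ 0 = C $$ (j, m)) \<and>
      (\<forall>v. \<forall>n>0. Y v i $$ (j, m) $ n = (adj_mat A * frobM Q (Y v (cpred 1 i))) $$ (j, m) $ n) \<and>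
      (\<forall>n. (\<lambda>v. Y v i $$ (j, m) $ n) \<in> UNIV))"
    by (rule frob_system_exists[OF addF Q1]) (use A in \<open>auto intro!: function_ring.intro\<close>)
  then obtain Y' :: "unit \<Rightarrow> nat \<Rightarrow> 'c mp fract fps mat" where Y': "Y' () 0 \<in> carrier_mat r r"
    "\<And>j m. j < r \<Longrightarrow> m < r \<Longrightarrow> Y' () 0 $$ (j, m) $ 0 = C $$ (j, m)"
    "\<And>j m n. j < r \<Longrightarrow> m < r \<Longrightarrow> n > 0 \<Longrightarrow> Y' () 0 $$ (j, m) $ n = (adj_mat A * frobM Q (Y' () 0)) $$ (j, m) $ n"
    by auto
  define Y where "Y = Y' () 0"
  note Y = Y'[folded Y_def]
  have Y0: "map_mat (\<lambda>f. f $ 0) Y = C"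
    by (rule eq_matI) (use Y in \<open>auto simp: C_def Dmat_def\<close>)
  have A0: "map_mat (\<lambda>f. f $ 0) A = Nmat r 1"
  proof -
    have "map_mat (\<lambda>f. f $ 0) A = map_mat (\<lambda>f. f $ 0) (Umat r b) * map_mat (\<lambda>f. f $ 0) (Nmat r 1)"
      unfolding A_def by (rule mat_hom_mult[OF coeff_hom_fps_nth_0, of _ r r _ r]) simp_all
    also have "map_mat (\<lambda>f. f $ 0) (Umat r b) = 1\<^sub>m r"
      by (rule eq_matI) (auto simp: Umat_def b_def)
    also have "map_mat (\<lambda>f. f $ 0) (Nmat r 1) = Nmat r (1 :: 'c mp fract)"
      by (rule eq_matI) (auto simp: Nmat_def)
    finally show ?thesis by (simp add: left_mult_one_mat[of _ r r])
  qed
  have "frobM Q (Dmat Q r a) = Nmat r 1 * Dmat Q r a"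
  proof (rule eq_matI)
    fix j m assume "j < dim_row (Nmat r 1 * Dmat Q r a)" "m < dim_col (Nmat r 1 * Dmat Q r a)"
    hence jm: "j < r" "m < r" by (auto simp: Nmat_def Dmat_def)
    show "frobM Q (Dmat Q r a) $$ (j, m) = (Nmat r 1 * Dmat Q r a) $$ (j, m)"
    proof (cases "Suc j = r")
      case True
      have "dfrob Q ((dfrob Q ^^ j) (a m)) = 0"
        using a(1)[of "Suc j" m] jm True[symmetric] by simp
      thus ?thesis
        using jm True Nmat_mult_row(2)[of "Dmat Q r a" r m j 1] by (simp add: frobM_def Dmat_def dfrob_def)
    next
      case False
      thus ?thesis using jm Nmat_Dmat_row[of j r m Q a] by (simp add: frobM_def Dmat_def)
    qed
  qed (auto simp: Nmat_def Dmat_def frobM_def)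
  hence "map_mat cB (frobM Q (Dmat Q r a)) = map_mat cB (Nmat r 1) * C"
    using mat_hom_mult[OF coeff_hom_cB, of "Nmat r 1" r r "Dmat Q r a" r] by (simp add: C_def)
  moreover have "map_mat cB (frobM Q (Dmat Q r a)) = frobM Q C"
    by (rule eq_matI) (auto simp: frobM_def C_def cB.h_power)
  moreover have "map_mat cB (Nmat r 1) = Nmat r (1 :: 'c mp fract)"
    by (rule eq_matI) (auto simp: Nmat_def)
  ultimately have "frobM Q C = Nmat r 1 * C" by simp
  hence sys: "frobM Q Y = A * Y"
    by (intro frob_system_compat[OF A Y(1) Y(1)]) (use Y(3) Q1 Y0 A0 in auto)
  define w where "w m = Y $$ (0, m)" for m
  have NY: "Nmat r 1 * Y \<in> carrier_mat r r" by (rule mult_carrier_mat[OF _ Y(1)]) simp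
  have AY: "A * Y = Umat r b * (Nmat r 1 * Y)"
    unfolding A_def by (rule assoc_mult_mat[OF _ _ Y(1), of _ r r]) simp_all
  have Yw: "Y $$ (j, m) = (dfrob Q ^^ j) (w m)" if "j < r" "m < r" for j m
    using that(1)
  proof (induction j)
    case (Suc j)
    have "Y $$ (j, m) ^ Q = (Nmat r 1 * Y) $$ (j, m)"
      using arg_cong[OF sys, of "\<lambda>M. M $$ (j, m)"] Umat_mult_row[OF NY that(2) Suc.prems, of b] AY Y(1) Suc.prems that(2)
      by (simp add: frobM_def)
    also have "\<dots> = Y $$ (j, m) + Y $$ (Suc j, m)"
      using Nmat_mult_row(1)[OF Y(1) that(2) Suc.prems, of 1] by simp
    finally have "Y $$ (Suc j, m) = dfrob Q (Y $$ (j, m))"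
      by (simp add: dfrob_def algebra_simps)
    thus ?case using Suc by simp
  qed (simp add: w_def)
  have YD: "Y = Dmat Q r w"
    by (rule eq_matI) (use Y(1) Yw in \<open>auto simp: Dmat_def\<close>)
  have detY: "det Y = 1"
  proof -
    have "det Y ^ Q = det Y"
      using det_frobM[OF addF, of Y] sys det_mult[OF A(1) Y(1)] A(2) by simp
    moreover have "det Y $ 0 = 1"
    proof -
      have "det Y $ 0 = det (map_mat (\<lambda>f. f $ 0) Y)"
        by (rule det_hom[OF coeff_hom_fps_nth_0, symmetric])
      also have "\<dots> = cB (det (Dmat Q r a))"
        unfolding Y0 C_def by (rule det_hom[OF coeff_hom_cB])
      finally show ?thesis using a(2) by (simp add: Lam_def)
    qed
    \<comment> \<open>u and 1 are fixed points of the same causal map, the Q-th power, with equal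
      constant terms.\<close>
    moreover have "u = 1" if "u ^ Q = u" "u $ 0 = 1" for u :: "'c mp fract fps"
    proof -
      have "(\<lambda>_ :: unit. u) = (\<lambda>_. 1)"
      proof (rule fps_contraction_unique[of "\<lambda>u i. u i ^ Q"])
        fix f g :: "unit \<Rightarrow> 'c mp fract fps" and n i
        assume "n > 0" "\<And>i k. k < n \<Longrightarrow> f i $ k = g i $ k"
        thus "(f i ^ Q) $ n = (g i ^ Q) $ n"
          by (intro fps_power_causal[OF addF Q1, of n]) auto
      qed (use that in auto)
      thus ?thesis by metis
    qed
    ultimately show ?thesis by blast
  qed
  have hom: "coeff_hom (fps_to_fls :: 'c mp fract fps \<Rightarrow> _)"
    by unfold_locales (simp_all add: fls_times_fps_to_fls)
  have Lw: "Lam Q r w = 1" using detY by (simp add: Lam_def flip: YD)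
  show ?thesis
  proof (rule that)
    show "Lam Q r (\<lambda>m. fps_to_fls (w m)) = 1"
      by (simp add: Lam_hom[OF hom] Lw)
    fix l assume l: "Suc l < r"
    show "bvec Q r (\<lambda>m. fps_to_fls (w m)) l = fls_X * fls_const (XB (Suc l))"
    proof (rule bvec_eqI[OF _ _ l])
      show "Lam Q r (\<lambda>m. fps_to_fls (w m)) = 1"
        by (simp add: Lam_hom[OF hom] Lw)
      have D: "Dmat Q r (\<lambda>m. fps_to_fls (w m)) = map_mat fps_to_fls Y"
        unfolding YD by (rule Dmat_hom[OF hom])
      have "frobM Q (map_mat fps_to_fls Y) = map_mat fps_to_fls (frobM Q Y)"
        by (rule eq_matI) (auto simp: frobM_def fps_to_fls_power)
      also have "\<dots> = map_mat fps_to_fls (Umat r b) * (map_mat fps_to_fls (Nmat r 1) * map_mat fps_to_fls Y)"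
        unfolding sys AY using NY Y(1)
        by (subst mat_hom_mult[OF hom, of _ r r _ r], simp, simp, subst mat_hom_mult[OF hom, of _ r r _ r]) simp_all
      also have "map_mat fps_to_fls (Umat r b) = Umat r (\<lambda>l. fls_X * fls_const (XB (Suc l)))"
        by (rule eq_matI) (auto simp: Umat_def b_def fls_times_fps_to_fls)
      also have "map_mat fps_to_fls (Nmat r 1) = Nmat r (1 :: 'c mp fract fls)"
        by (rule eq_matI) (auto simp: Nmat_def)
      finally show "frobM Q (Dmat Q r (\<lambda>m. fps_to_fls (w m))) =
          Umat r (\<lambda>l. fls_X * fls_const (XB (Suc l))) * (Nmat r 1 * Dmat Q r (\<lambda>m. fps_to_fls (w m)))"
        unfolding D .
    qed
  qed
qed

text \<open>A relation at the generic point also holds where \<open>bvec\<close> takes the values X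
  X_l. There the powers of X separate the homogeneous components of \<open>P\<close>, each evaluated
  at independent variables. The shift \<open>i - 1\<close> numbers the variables from 1, as in
  \<open>pure_field\<close>.\<close>

lemma bvec_independent:
  fixes Q k r :: nat and y :: "nat \<Rightarrow> 'c :: alg_closed_field mp fract fls"
  assumes p: "prime CHAR('c :: alg_closed_field)" and Q: "Q = CHAR('c :: alg_closed_field) ^ k" "k > 0" and r: "r > 0"
    and y: "\<And>f v. f \<in> Pol \<Longrightarrow> f y = 0 \<Longrightarrow> Lam Q r v = 1 \<Longrightarrow> f v = 0"
    and P: "\<And>m. m \<in> keys P \<Longrightarrow> keys m \<subseteq> {1..<r}"
    and zero: "meval cL (\<lambda>i. bvec Q r y (i - 1)) P = 0"
  shows "P = 0"
proof (rule ccontr)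
  assume "P \<noteq> 0"
  interpret Pol: function_ring "Pol :: ((nat \<Rightarrow> 'c mp fract fls) \<Rightarrow> _) set" by (rule function_ring_Pol)
  obtain v :: "nat \<Rightarrow> 'c mp fract fls" where v: "Lam Q r v = 1"
    "\<And>l. Suc l < r \<Longrightarrow> bvec Q r v l = fls_X * fls_const (XB (Suc l))"
    using exists_bvec_point[OF p Q r] by metis
  define F where "F w = meval cL (\<lambda>i. bvec Q r w (i - 1)) P" for w
  have "F \<in> Pol"
    unfolding F_def[abs_def] meval_def mon_eval_def
    by (intro Pol.sum Pol.mult Pol.prod Pol.power bvec_in_Pol)
       (use P in \<open>fastforce simp: Pol_def intro: alg.const\<close>)+
  hence "F v = 0" by (rule y) (use zero v(1) in \<open>simp_all add: F_def\<close>)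
  moreover have mon: "mon_eval (\<lambda>i. bvec Q r v (i - 1)) m = fls_X ^ mdeg m * fls_const (mon_eval XB m)"
    if "m \<in> keys P" for m
  proof -
    interpret FC: coeff_hom "fls_const :: 'c mp fract \<Rightarrow> _" by unfold_locales (simp_all add: fls_plus_const)
    have "mon_eval (\<lambda>i. bvec Q r v (i - 1)) m = mon_eval (\<lambda>i. fls_X * fls_const (XB i)) m"
      unfolding mon_eval_def using P[OF that] v(2) by (intro prod.cong refl) (fastforce)
    thus ?thesis
      by (simp add: mon_eval_scale) (simp only: mon_eval_def FC.h_prod FC.h_power)
  qed
  obtain m where m: "m \<in> keys P" using \<open>P \<noteq> 0\<close> by (metis keys_eq_empty ex_in_conv)
  let ?K = "{n \<in> keys P. mdeg n = mdeg m}"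
  define P' where "P' = (\<Sum>n\<in>?K. Poly_Mapping.single n (lookup P n))"
  have "F v = (\<Sum>n\<in>keys P. fls_X ^ mdeg n * fls_const (cB (lookup P n) * mon_eval XB n))"
    unfolding F_def meval_def
    by (rule sum.cong[OF refl], subst mon) (simp_all add: cL_def mult_ac flip: fls_const_mult_const)
  ultimately have "(\<Sum>n\<in>keys P. fls_X ^ mdeg n * fls_const (cB (lookup P n) * mon_eval XB n)) = 0"
    by simp
  hence "0 = (\<Sum>n\<in>keys P. fls_nth (fls_X ^ mdeg n * fls_const (cB (lookup P n) * mon_eval XB n)) (int (mdeg m)))"
    by (simp only: flip: fls_nth_sum) simp
  also have "\<dots> = (\<Sum>n\<in>keys P. if mdeg n = mdeg m then cB (lookup P n) * mon_eval XB n else 0)"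
    by (rule sum.cong) (auto simp: fls_X_power_times_conv_shift)
  also have "\<dots> = (\<Sum>n\<in>?K. cB (lookup P n) * mon_eval XB n)"
    by (simp add: sum.inter_filter)
  also have "\<dots> = to_fract P'"
    by (simp add: P'_def to_fract_sum mon_eval_XB cB_def mult_single flip: to_fract_mult)
  finally have "P' = 0" by simp
  have "lookup P' m = (\<Sum>n\<in>?K. lookup P n when n = m)"
    by (simp add: P'_def lookup_sum lookup_single)
  also have "\<dots> = lookup P m"
    using m by (simp add: when_def sum.delta)
  finally show False using m \<open>P' = 0\<close> by (simp add: in_keys_iff)
qed

section \<open>Finite groups of field automorphisms\<close>

definition subfld :: "'a :: field set \<Rightarrow> bool"
  where "subfld F \<longleftrightarrow> 1 \<in> F \<and> (\<forall>x\<in>F. \<forall>y\<in>F. x - y \<in> F \<and> x * y \<in> F) \<and> (\<forall>x\<in>F. inverse x \<in> F)"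

lemma subfldI:
  assumes "1 \<in> F" "- 1 \<in> F" "\<And>x y. x \<in> F \<Longrightarrow> y \<in> F \<Longrightarrow> x + y \<in> F"
    "\<And>x y. x \<in> F \<Longrightarrow> y \<in> F \<Longrightarrow> x * y \<in> F" "\<And>x. x \<in> F \<Longrightarrow> x \<noteq> 0 \<Longrightarrow> inverse x \<in> F"
  shows "subfld F"
proof -
  have 0: "0 \<in> F" using assms(3)[OF assms(1,2)] by simp
  have "x - y \<in> F" if "x \<in> F" "y \<in> F" for x y
    using assms(3)[OF that(1) assms(4)[OF assms(2) that(2)]] by simp
  thus ?thesis using assms 0 unfolding subfld_def by (metis inverse_zero)
qed

locale subfield_set =
  fixes F :: "'a :: field set"
  assumes F: "subfld F"
begin

lemma one [simp]: "1 \<in> F" and diff: "x \<in> F \<Longrightarrow> y \<in> F \<Longrightarrow> x - y \<in> F"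
  and mult: "x \<in> F \<Longrightarrow> y \<in> F \<Longrightarrow> x * y \<in> F" and inverse: "x \<in> F \<Longrightarrow> inverse x \<in> F"
  using F by (auto simp: subfld_def)

lemma zero [simp]: "0 \<in> F"
  using diff[OF one one] by simp

lemma uminus: "x \<in> F \<Longrightarrow> - x \<in> F"
  using diff[of 0 x] by simp

lemma add: "x \<in> F \<Longrightarrow> y \<in> F \<Longrightarrow> x + y \<in> F"
  using diff[of x "- y"] uminus[of y] by simp

lemma divide: "x \<in> F \<Longrightarrow> y \<in> F \<Longrightarrow> x / y \<in> F"
  using mult[of x "inverse y"] inverse[of y] by (simp add: divide_inverse)

lemma power: "x \<in> F \<Longrightarrow> x ^ n \<in> F"
  by (induction n) (auto intro: mult)

lemma sum: "(\<And>i. i \<in> I \<Longrightarrow> f i \<in> F) \<Longrightarrow> (\<Sum>i\<in>I. f i) \<in> F"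
  by (induction I rule: infinite_finite_induct) (auto intro: add)

lemma prod: "(\<And>i. i \<in> I \<Longrightarrow> f i \<in> F) \<Longrightarrow> (\<Prod>i\<in>I. f i) \<in> F"
  by (induction I rule: infinite_finite_induct) (auto intro: mult)

end

definition fhom :: "'a :: field set \<Rightarrow> ('a \<Rightarrow> 'b :: field) \<Rightarrow> bool"
  where "fhom E h \<longleftrightarrow> h 1 = 1 \<and> (\<forall>x\<in>E. \<forall>y\<in>E. h (x + y) = h x + h y \<and> h (x * y) = h x * h y)"

locale field_hom_on = subfield_set E for E :: "'a :: field set" +
  fixes h :: "'a \<Rightarrow> 'b :: field"
  assumes h: "fhom E h"
begin

lemma h_1 [simp]: "h 1 = 1" and h_add: "x \<in> E \<Longrightarrow> y \<in> E \<Longrightarrow> h (x + y) = h x + h y"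
  and h_mult: "x \<in> E \<Longrightarrow> y \<in> E \<Longrightarrow> h (x * y) = h x * h y"
  using h by (auto simp: fhom_def)

lemma h_0 [simp]: "h 0 = 0"
proof -
  have "h 0 + h 0 = h 0 + 0" using h_add[of 0 0] by simp
  thus ?thesis by (simp only: add_left_cancel)
qed

lemma h_uminus: "x \<in> E \<Longrightarrow> h (- x) = - h x"
proof -
  assume "x \<in> E"
  hence "h x + h (- x) = 0" using h_add[of x "- x"] by (simp add: uminus)
  thus ?thesis by (simp add: add_eq_0_iff)
qed

lemma h_diff: "x \<in> E \<Longrightarrow> y \<in> E \<Longrightarrow> h (x - y) = h x - h y"
  using h_add[of x "- y"] by (simp add: uminus h_uminus)

lemma h_power: "x \<in> E \<Longrightarrow> h (x ^ n) = h x ^ n"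
  by (induction n) (auto simp: h_mult power)

lemma h_sum: "(\<And>i. i \<in> I \<Longrightarrow> f i \<in> E) \<Longrightarrow> h (\<Sum>i\<in>I. f i) = (\<Sum>i\<in>I. h (f i))"
  by (induction I rule: infinite_finite_induct) (auto simp: h_add sum)

lemma h_eq_0_iff: "x \<in> E \<Longrightarrow> h x = 0 \<longleftrightarrow> x = 0"
proof
  assume x: "x \<in> E" "h x = 0"
  show "x = 0"
  proof (rule ccontr)
    assume "x \<noteq> 0"
    hence "h (x * inverse x) = 1" by simp
    thus False using x h_mult[of x "inverse x"] by (simp add: inverse del: right_inverse)
  qed
qed simp

lemma h_inverse: "x \<in> E \<Longrightarrow> h (inverse x) = inverse (h x)"
proof (cases "x = 0")
  case False
  assume x: "x \<in> E"
  hence "h x * h (inverse x) = 1"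
    using h_mult[of x "inverse x"] False by (simp add: inverse)
  thus ?thesis by (metis inverse_unique)
qed simp

lemma inj: "inj_on h E"
proof (rule inj_onI)
  fix x y assume "x \<in> E" "y \<in> E" "h x = h y"
  hence "h (x - y) = 0" by (simp add: h_diff)
  thus "x = y" using h_eq_0_iff[of "x - y"] \<open>x \<in> E\<close> \<open>y \<in> E\<close> by (simp add: diff)
qed

lemma subfld_image: "subfld (h ` E)"
proof (rule subfldI)
  show "1 \<in> h ` E" by (metis h_1 imageI one)
  show "- 1 \<in> h ` E" by (metis h_1 h_uminus imageI one uminus)
qed (auto simp flip: h_add h_mult h_inverse intro!: imageI add mult inverse)

end

section \<open>Polynomials with coefficients in a subfield\<close>

definition coeffs_in :: "'a :: field set \<Rightarrow> 'a poly set"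
  where "coeffs_in F = {p. \<forall>i. Polynomial.coeff p i \<in> F}"

context subfield_set
begin

lemma coeffs_in_add: "p \<in> coeffs_in F \<Longrightarrow> q \<in> coeffs_in F \<Longrightarrow> p + q \<in> coeffs_in F"
  by (auto simp: coeffs_in_def add)

lemma coeffs_in_diff: "p \<in> coeffs_in F \<Longrightarrow> q \<in> coeffs_in F \<Longrightarrow> p - q \<in> coeffs_in F"
  by (auto simp: coeffs_in_def diff)

lemma coeffs_in_mult: "p \<in> coeffs_in F \<Longrightarrow> q \<in> coeffs_in F \<Longrightarrow> p * q \<in> coeffs_in F"
  by (auto simp: coeffs_in_def coeff_mult intro!: sum mult)

lemma coeffs_in_const: "c \<in> F \<Longrightarrow> [:c:] \<in> coeffs_in F"
  by (auto simp: coeffs_in_def coeff_pCons split: nat.splits)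

lemma coeffs_in_1: "1 \<in> coeffs_in F"
  using coeffs_in_const[of 1] by (simp add: one_pCons)

lemma coeffs_in_linear: "c \<in> F \<Longrightarrow> [:- c, 1:] \<in> coeffs_in F"
  by (auto simp: coeffs_in_def coeff_pCons uminus split: nat.splits)

lemma coeffs_in_monom: "c \<in> F \<Longrightarrow> Polynomial.monom c n \<in> coeffs_in F"
  by (auto simp: coeffs_in_def)

lemma coeffs_in_prod: "(\<And>i. i \<in> I \<Longrightarrow> f i \<in> coeffs_in F) \<Longrightarrow> (\<Prod>i\<in>I. f i) \<in> coeffs_in F"
  by (induction I rule: infinite_finite_induct) (auto intro: coeffs_in_mult coeffs_in_1)

lemma coeffs_in_sum: "(\<And>i. i \<in> I \<Longrightarrow> f i \<in> coeffs_in F) \<Longrightarrow> (\<Sum>i\<in>I. f i) \<in> coeffs_in F"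
  by (auto simp: coeffs_in_def coeff_sum intro!: sum)

lemma poly_in: "p \<in> coeffs_in F \<Longrightarrow> x \<in> F \<Longrightarrow> poly p x \<in> F"
  by (auto simp: poly_altdef coeffs_in_def intro!: sum mult power)

text \<open>Division by a monic polynomial only adds and multiplies coefficients, so quotient and
  remainder stay over \<open>F\<close>.\<close>

lemma monic_division:
  assumes "f \<in> coeffs_in F" "P \<in> coeffs_in F" "Polynomial.lead_coeff P = 1" "Polynomial.degree P > 0"
  shows "\<exists>q\<in>coeffs_in F. \<exists>s\<in>coeffs_in F. f = P * q + s \<and> Polynomial.degree s < Polynomial.degree P"
  using assms(1)
proof (induction "Polynomial.degree f" arbitrary: f rule: less_induct)
  case less
  show ?case
  proof (cases "Polynomial.degree f < Polynomial.degree P")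
    case True
    thus ?thesis using less.prems by (intro bexI[of _ 0] bexI[of _ f]) (auto simp: coeffs_in_def)
  next
    case False
    define m where "m = Polynomial.monom (Polynomial.lead_coeff f) (Polynomial.degree f - Polynomial.degree P)"
    define f' where "f' = f - P * m"
    have f0: "f \<noteq> 0" using False assms(4) by auto
    have m: "m \<in> coeffs_in F"
      unfolding m_def using less.prems by (intro coeffs_in_monom) (auto simp: coeffs_in_def)
    have dm: "Polynomial.degree m = Polynomial.degree f - Polynomial.degree P"
      unfolding m_def by (rule degree_monom_eq) (use f0 in simp)
    have "P \<noteq> 0" "m \<noteq> 0" using assms(4) f0 by (auto simp: m_def)
    hence "Polynomial.degree (P * m) = Polynomial.degree f"
      using False by (subst degree_mult_eq) (auto simp: dm)
    moreover have "Polynomial.lead_coeff (P * m) = Polynomial.lead_coeff f"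
      using assms(3) by (simp add: lead_coeff_mult dm) (simp add: m_def)
    ultimately have "Polynomial.coeff f' (Polynomial.degree f) = 0" "Polynomial.degree f' \<le> Polynomial.degree f"
      by (auto simp: f'_def intro: degree_diff_le)
    hence "Polynomial.degree f' < Polynomial.degree f"
      using False assms(4) by (metis coeff_0 degree_0 leading_coeff_0_iff le_neq_implies_less gr_zeroI not_less)
    then obtain q s where "q \<in> coeffs_in F" "s \<in> coeffs_in F" "f' = P * q + s" "Polynomial.degree s < Polynomial.degree P"
      using less.hyps[of f'] coeffs_in_diff[OF less.prems coeffs_in_mult[OF assms(2) m]] by (auto simp: f'_def)
    thus ?thesis
      by (intro bexI[of _ "q + m"] bexI[of _ s]) (auto simp: f'_def algebra_simps intro: coeffs_in_add m)
  qed
qed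

end

context field_hom_on
begin

lemma coeff_map: "Polynomial.coeff (map_poly h p) i = h (Polynomial.coeff p i)"
  by (simp add: coeff_map_poly)

lemma map_poly_add: "p \<in> coeffs_in E \<Longrightarrow> q \<in> coeffs_in E \<Longrightarrow> map_poly h (p + q) = map_poly h p + map_poly h q"
  by (rule poly_eqI) (auto simp: coeff_map coeffs_in_def h_add)

lemma map_poly_mult: "p \<in> coeffs_in E \<Longrightarrow> q \<in> coeffs_in E \<Longrightarrow> map_poly h (p * q) = map_poly h p * map_poly h q"
  by (rule poly_eqI) (auto simp: coeff_map coeffs_in_def h_mult coeff_mult h_sum mult)

lemma degree_map_le: "Polynomial.degree (map_poly h p) \<le> Polynomial.degree p"
  by (rule degree_le) (simp add: coeff_map coeff_eq_0)

lemma poly_map: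
  assumes "p \<in> coeffs_in E" "x \<in> E"
  shows "h (poly p x) = poly (map_poly h p) (h x)"
proof -
  have "poly (map_poly h p) (h x) = (\<Sum>i\<le>Polynomial.degree p. Polynomial.coeff (map_poly h p) i * h x ^ i)"
    unfolding poly_altdef using degree_map_le[of p]
    by (intro sum.mono_neutral_left) (auto simp: coeff_eq_0)
  also have "\<dots> = h (poly p x)"
    using assms by (simp add: poly_altdef h_sum h_mult h_power coeff_map coeffs_in_def mult power)
  finally show ?thesis ..
qed

end

text \<open>The fields may lie in any type, so that an action constructed on Laurent series can be
  carried into the universe. Infinity of \<open>F\<close> makes it possible to choose elements in
  general position.\<close>

locale galois_action = group G for G :: "('g, 'e) monoid_scheme" (structure) +
  fixes E F :: "'a :: field set" and \<alpha> :: "'g \<Rightarrow> 'a \<Rightarrow> 'a"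
  assumes fin: "finite (carrier G)" and E: "subfld E" and F: "subfld F" and FE: "F \<subseteq> E"
    and inf: "infinite F"
    and \<alpha>_closed: "g \<in> carrier G \<Longrightarrow> x \<in> E \<Longrightarrow> \<alpha> g x \<in> E"
    and \<alpha>_hom: "g \<in> carrier G \<Longrightarrow> fhom E (\<alpha> g)"
    and \<alpha>_mult: "g \<in> carrier G \<Longrightarrow> h \<in> carrier G \<Longrightarrow> x \<in> E \<Longrightarrow> \<alpha> (g \<otimes> h) x = \<alpha> g (\<alpha> h x)"
    and \<alpha>_one: "x \<in> E \<Longrightarrow> \<alpha> \<one> x = x"
    and fixed: "x \<in> F \<longleftrightarrow> x \<in> E \<and> (\<forall>g\<in>carrier G. \<alpha> g x = x)"
    and faithful: "g \<in> carrier G \<Longrightarrow> (\<And>x. x \<in> E \<Longrightarrow> \<alpha> g x = x) \<Longrightarrow> g = \<one>"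
begin

sublocale E: subfield_set E by unfold_locales (rule E)
sublocale F: subfield_set F by unfold_locales (rule F)

lemma hom_on: "g \<in> carrier G \<Longrightarrow> field_hom_on E (\<alpha> g)"
  by unfold_locales (rule \<alpha>_hom)

lemma \<alpha>_F: "x \<in> F \<Longrightarrow> g \<in> carrier G \<Longrightarrow> \<alpha> g x = x"
  using fixed by blast

lemma \<alpha>_inv: "g \<in> carrier G \<Longrightarrow> x \<in> E \<Longrightarrow> \<alpha> (inv g) (\<alpha> g x) = x"
  using \<alpha>_mult[of "inv g" g x] \<alpha>_one by simp

text \<open>A vector space over an infinite field is not a finite union of proper subspaces.\<close>

lemma avoid:
  assumes "finite I" "I \<subseteq> carrier G" and V: "V \<subseteq> E" "subfld V" "F \<subseteq> V"
    and "\<And>g. g \<in> I \<Longrightarrow> \<exists>x\<in>V. \<alpha> g x \<noteq> x"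
  shows "\<exists>x\<in>V. \<forall>g\<in>I. \<alpha> g x \<noteq> x"
  using assms(1,2,6)
proof (induction I)
  case empty
  show ?case using V F.one by (intro bexI[of _ 1]) auto
next
  case (insert k I)
  interpret V: subfield_set V by unfold_locales (rule V)
  obtain x where x: "x \<in> V" "\<forall>g\<in>I. \<alpha> g x \<noteq> x" using insert by auto
  show ?case
  proof (cases "\<alpha> k x = x")
    case False
    thus ?thesis using x by auto
  next
    case True
    obtain y where y: "y \<in> V" "\<alpha> k y \<noteq> y" using insert.prems by auto
    \<comment> \<open>For g in \<open>I\<close> that moves y, exactly the listed value of c makes g
      fix x + c y; if g fixes y, it moves x + c y for every c. The value 0 is excluded because
      \<open>k\<close> fixes x but not y.\<close>
    define bad where "bad = insert 0 ((\<lambda>g. - (\<alpha> g x - x) / (\<alpha> g y - y)) ` I)"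
    have "finite bad" using insert by (simp add: bad_def)
    then obtain c where c: "c \<in> F" "c \<notin> bad" using inf by (meson finite_subset subsetI)
    have step: "\<alpha> g (x + c * y) - (x + c * y) = (\<alpha> g x - x) + c * (\<alpha> g y - y)" if "g \<in> carrier G" for g
    proof -
      interpret h: field_hom_on E "\<alpha> g" by (rule hom_on[OF that])
      have "\<alpha> g (x + c * y) = \<alpha> g x + c * \<alpha> g y"
      proof -
        have "x \<in> E" "y \<in> E" "c \<in> E" using x y c V FE by auto
        thus ?thesis using \<alpha>_F[OF c(1) that] by (simp add: h.h_add h.h_mult E.mult)
      qed
      thus ?thesis by (simp add: algebra_simps)
    qed
    show ?thesis
    proof (intro bexI[of _ "x + c * y"] ballI)
      fix g assume g: "g \<in> insert k I"
      hence gG: "g \<in> carrier G" using insert.prems by auto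
      show "\<alpha> g (x + c * y) \<noteq> x + c * y"
      proof
        assume "\<alpha> g (x + c * y) = x + c * y"
        hence eq: "(\<alpha> g x - x) + c * (\<alpha> g y - y) = 0" using step[OF gG] by simp
        show False
        proof (cases "g \<in> I")
          case True
          hence "\<alpha> g y - y \<noteq> 0" using eq x(2) by auto
          hence "c = - (\<alpha> g x - x) / (\<alpha> g y - y)"
            using eq by (simp add: field_simps add_eq_0_iff)
          thus False using c True by (auto simp: bad_def)
        next
          case False
          hence "g = k" using g by auto
          thus False using eq True y c by (auto simp: bad_def)
        qed
      qed
    next
      show "x + c * y \<in> V" using x y c V by (auto intro!: V.add V.mult)
    qed
  qed
qed

text \<open>By faithfulness only the identity fixes all of \<open>E\<close>, so \<open>avoid\<close>
  yields an element with trivial stabiliser, that is, with as many conjugates as the group has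
  elements.\<close>

lemma exists_primitive: "\<exists>w\<in>E. \<forall>g\<in>carrier G. \<forall>h\<in>carrier G. \<alpha> g w = \<alpha> h w \<longrightarrow> g = h"
proof -
  have "\<exists>w\<in>E. \<forall>g\<in>carrier G - {\<one>}. \<alpha> g w \<noteq> w"
    by (rule avoid) (use fin E FE faithful in auto)
  then obtain w where w: "w \<in> E" "\<And>g. g \<in> carrier G \<Longrightarrow> \<alpha> g w = w \<Longrightarrow> g = \<one>" by blast
  have "g = h" if "g \<in> carrier G" "h \<in> carrier G" "\<alpha> g w = \<alpha> h w" for g h
  proof -
    have "\<alpha> (inv h \<otimes> g) w = w"
      using that w \<alpha>_mult[of "inv h" g w] \<alpha>_inv[of h w] by simp
    hence "inv h \<otimes> g = \<one>" using w(2) that by simp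
    thus ?thesis using that by (metis inv_closed inv_equality inv_inv)
  qed
  thus ?thesis using w by auto
qed

text \<open>The product runs over the orbit as a set, so its roots are simple even when
  \<open>x\<close> has a nontrivial stabiliser; this is the source of separability.\<close>

definition orbit_poly :: "'g set \<Rightarrow> 'a \<Rightarrow> 'a poly"
  where "orbit_poly H x = (\<Prod>c\<in>(\<lambda>g. \<alpha> g x) ` H. [:- c, 1:])"

lemma orbit_poly_props:
  assumes "finite H"
  shows "Polynomial.lead_coeff (orbit_poly H x) = 1" "Polynomial.degree (orbit_poly H x) = card ((\<lambda>g. \<alpha> g x) ` H)"
    "poly (orbit_poly H x) y = 0 \<longleftrightarrow> y \<in> (\<lambda>g. \<alpha> g x) ` H"
proof -
  have deg: "Polynomial.degree (\<Prod>c\<in>A. [:- c, 1:]) = card A" if "finite A" for A :: "'a set"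
    using that by induction (auto simp: degree_mult_eq prod_zero_iff simp del: mult_pCons_left)
  have "Polynomial.lead_coeff (\<Prod>c\<in>A. [:- c, 1:]) = 1" if "finite A" for A :: "'a set"
    unfolding lead_coeff_prod by simp
  thus "Polynomial.lead_coeff (orbit_poly H x) = 1"
    unfolding orbit_poly_def using assms by blast
  show "Polynomial.degree (orbit_poly H x) = card ((\<lambda>g. \<alpha> g x) ` H)"
    unfolding orbit_poly_def by (rule deg) (use assms in simp)
  show "poly (orbit_poly H x) y = 0 \<longleftrightarrow> y \<in> (\<lambda>g. \<alpha> g x) ` H"
    using assms by (auto simp: orbit_poly_def poly_prod prod_zero_iff)
qed

lemma orbit_poly_fixed:
  assumes H: "subgroup H G" and x: "x \<in> E" and k: "k \<in> H"
  shows "\<alpha> k (Polynomial.coeff (orbit_poly H x) i) = Polynomial.coeff (orbit_poly H x) i"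
    and "orbit_poly H x \<in> coeffs_in E"
proof -
  have HG: "H \<subseteq> carrier G" by (rule subgroup.subset[OF H])
  have finH: "finite H" using finite_subset[OF HG fin] .
  let ?P = "orbit_poly H x" and ?O = "(\<lambda>g. \<alpha> g x) ` H"
  have kG: "k \<in> carrier G" using k HG by auto
  show P: "?P \<in> coeffs_in E"
    unfolding orbit_poly_def using x HG by (intro E.coeffs_in_prod E.coeffs_in_linear) (auto intro: \<alpha>_closed)
  interpret h: field_hom_on E "\<alpha> k" by (rule hom_on[OF kG])
  have OE: "?O \<subseteq> E" using x HG \<alpha>_closed by auto
  have "\<alpha> k ` ?O = ?O"
  proof
    show "\<alpha> k ` ?O \<subseteq> ?O"
    proof safe
      fix g assume "g \<in> H"
      hence "\<alpha> k (\<alpha> g x) = \<alpha> (k \<otimes> g) x" using \<alpha>_mult[OF kG _ x, of g] HG by auto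
      thus "\<alpha> k (\<alpha> g x) \<in> ?O" using subgroup.m_closed[OF H k \<open>g \<in> H\<close>] by auto
    qed
    show "?O \<subseteq> \<alpha> k ` ?O"
    proof safe
      fix g assume g: "g \<in> H"
      have ig: "inv k \<otimes> g \<in> H" using subgroup.m_closed[OF H subgroup.m_inv_closed[OF H k] g] .
      have "\<alpha> k (\<alpha> (inv k \<otimes> g) x) = \<alpha> (k \<otimes> (inv k \<otimes> g)) x"
        using \<alpha>_mult[OF kG _ x, of "inv k \<otimes> g"] ig HG by auto
      also have "k \<otimes> (inv k \<otimes> g) = g"
        using kG g HG by (simp add: m_assoc[symmetric] subset_iff)
      finally show "\<alpha> g x \<in> \<alpha> k ` ?O" using ig by (metis imageI)
    qed
  qed
  moreover have "map_poly (\<alpha> k) (\<Prod>c\<in>A. [:- c, 1:]) = (\<Prod>c\<in>\<alpha> k ` A. [:- c, 1:])" if "finite A" "A \<subseteq> E" for A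
    using that
  proof induction
    case empty
    show ?case by (rule poly_eqI) (auto simp: h.coeff_map)
  next
    case (insert c A)
    have "map_poly (\<alpha> k) [:- c, 1:] = [:- \<alpha> k c, 1:]"
      using insert by (intro poly_eqI) (auto simp: h.coeff_map h.h_uminus coeff_pCons split: nat.splits)
    moreover have "\<alpha> k c \<notin> \<alpha> k ` A" using insert h.inj by (auto dest: inj_onD)
    ultimately show ?case
      using insert by (simp add: h.map_poly_mult E.coeffs_in_linear E.coeffs_in_prod subset_eq del: mult_pCons_left)
  qed
  ultimately have "map_poly (\<alpha> k) ?P = ?P"
    unfolding orbit_poly_def using finH OE by simp
  thus "\<alpha> k (Polynomial.coeff ?P i) = Polynomial.coeff ?P i"
    by (metis h.coeff_map)
qed

lemma orbit_poly_in_F: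
  assumes "x \<in> E"
  shows "orbit_poly (carrier G) x \<in> coeffs_in F"
  using orbit_poly_fixed[OF subgroup_self assms] one_closed fixed by (auto simp: coeffs_in_def)

text \<open>Lagrange interpolation at the conjugates of \<open>w\<close>: the polynomial
  \<open>L\<close> takes the value \<open>\<alpha> g x\<close> at \<open>\<alpha> g w\<close>. A
  group element permutes these conditions, and a polynomial of degree below the number of conjugates
  is determined by them, so the coefficients of \<open>L\<close> are invariant.\<close>

lemma poly_in_primitive:
  assumes w: "w \<in> E" "\<And>g h. g \<in> carrier G \<Longrightarrow> h \<in> carrier G \<Longrightarrow> \<alpha> g w = \<alpha> h w \<Longrightarrow> g = h" and x: "x \<in> E"
  shows "\<exists>f\<in>coeffs_in F. poly f w = x"
proof -
  let ?n = "card (carrier G)"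
  let ?G = "carrier G"
  define L where "L = (\<Sum>g\<in>?G. [:\<alpha> g x / (\<Prod>h\<in>?G - {g}. \<alpha> g w - \<alpha> h w):] * (\<Prod>h\<in>?G - {g}. [:- \<alpha> h w, 1:]))"
  have L: "L \<in> coeffs_in E" unfolding L_def
    using w(1) x by (intro E.coeffs_in_sum E.coeffs_in_mult E.coeffs_in_const E.coeffs_in_prod E.coeffs_in_linear
        E.divide E.prod E.diff \<alpha>_closed) auto
  have degL: "Polynomial.degree L < ?n"
  proof -
    have "Polynomial.degree ([:\<alpha> g x / (\<Prod>h\<in>?G - {g}. \<alpha> g w - \<alpha> h w):] * (\<Prod>h\<in>?G - {g}. [:- \<alpha> h w, 1:])) \<le> ?n - 1"
      if "g \<in> ?G" for g
    proof -
      have "Polynomial.degree (\<Prod>h\<in>?G - {g}. [:- \<alpha> h w, 1:]) \<le> (\<Sum>h\<in>?G - {g}. 1)"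
        by (rule order_trans[OF degree_prod_sum_le]) (use fin in auto)
      also have "\<dots> = ?n - 1" using that fin by simp
      finally show ?thesis by (rule order_trans[rotated]) (simp add: degree_smult_le)
    qed
    hence "Polynomial.degree L \<le> ?n - 1" unfolding L_def by (intro degree_sum_le fin) auto
    moreover have "?n > 0" using fin one_closed by (auto simp: card_gt_0_iff)
    ultimately show ?thesis by simp
  qed
  have Lval: "poly L (\<alpha> k w) = \<alpha> k x" if k: "k \<in> ?G" for k
  proof -
    have "poly L (\<alpha> k w) = (\<Sum>g\<in>?G. \<alpha> g x / (\<Prod>h\<in>?G - {g}. \<alpha> g w - \<alpha> h w) * (\<Prod>h\<in>?G - {g}. \<alpha> k w - \<alpha> h w))"
      by (simp add: L_def poly_sum poly_prod)
    also have "\<dots> = (\<Sum>g\<in>{k}. \<alpha> g x / (\<Prod>h\<in>?G - {g}. \<alpha> g w - \<alpha> h w) * (\<Prod>h\<in>?G - {g}. \<alpha> k w - \<alpha> h w))"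
    proof (rule sum.mono_neutral_right)
      show "\<forall>g\<in>?G - {k}. \<alpha> g x / (\<Prod>h\<in>?G - {g}. \<alpha> g w - \<alpha> h w) * (\<Prod>h\<in>?G - {g}. \<alpha> k w - \<alpha> h w) = 0"
        using k fin by (auto simp: prod_zero_iff)
    qed (use k fin in auto)
    also have "\<dots> = \<alpha> k x"
    proof -
      have "(\<Prod>h\<in>?G - {k}. \<alpha> k w - \<alpha> h w) \<noteq> 0" using fin k w(2)[of k] by (auto simp: prod_zero_iff)
      thus ?thesis by simp
    qed
    finally show ?thesis .
  qed
  have inj: "inj_on (\<lambda>g. \<alpha> g w) ?G" using w(2) by (auto simp: inj_on_def)
  have "map_poly (\<alpha> k) L = L" if k: "k \<in> ?G" for k
  proof (rule poly_eqI_degree)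
    interpret h: field_hom_on E "\<alpha> k" by (rule hom_on[OF k])
    show "poly (map_poly (\<alpha> k) L) y = poly L y" if y: "y \<in> (\<lambda>g. \<alpha> g w) ` ?G" for y
    proof -
      obtain g where g: "g \<in> ?G" "y = \<alpha> g w" using y by auto
      define g' where "g' = inv k \<otimes> g"
      have g': "g' \<in> ?G" "k \<otimes> g' = g" using g k by (auto simp: g'_def simp flip: m_assoc)
      have "poly (map_poly (\<alpha> k) L) (\<alpha> k (\<alpha> g' w)) = \<alpha> k (poly L (\<alpha> g' w))"
        by (rule h.poly_map[symmetric]) (use L w g' \<alpha>_closed in auto)
      also have "\<dots> = \<alpha> k (\<alpha> g' x)" using Lval[OF g'(1)] by simp
      finally show ?thesis
        using Lval[OF g(1)] \<alpha>_mult[OF k g'(1)] w(1) x g g' by simp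
    qed
    have "Polynomial.degree (map_poly (\<alpha> k) L) \<le> Polynomial.degree L"
      by (rule h.degree_map_le)
    thus "Polynomial.degree (map_poly (\<alpha> k) L) < card ((\<lambda>g. \<alpha> g w) ` ?G)"
      "Polynomial.degree L < card ((\<lambda>g. \<alpha> g w) ` ?G)"
      using degL card_image[OF inj] by auto
  qed
  hence "\<alpha> k (Polynomial.coeff L i) = Polynomial.coeff L i" if "k \<in> ?G" for k i
    using that field_hom_on.coeff_map[OF hom_on[OF that], of L i] by metis
  hence "L \<in> coeffs_in F" using L fixed by (auto simp: coeffs_in_def)
  moreover have "poly L w = x" using Lval[OF one_closed] w(1) x \<alpha>_one by simp
  ultimately show ?thesis by blast
qed

end

section \<open>Transport of the action and intermediate fields\<close>

context galois_action
begin

text \<open>\<open>E\<close> consists of polynomials over \<open>F\<close> in a primitive element w.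
  The orbit polynomial of w divides every polynomial over \<open>F\<close> that vanishes at w,
  because the remainder vanishes at all conjugates of w and has too small a degree. Hence w may be
  sent to any root of the image of its orbit polynomial.\<close>

lemma transport:
  fixes \<chi> :: "'a \<Rightarrow> 'b :: alg_closed_field"
  assumes \<chi>: "fhom F \<chi>"
  shows "\<exists>\<Phi>. fhom E \<Phi> \<and> (\<forall>x\<in>F. \<Phi> x = \<chi> x)"
proof -
  interpret X: field_hom_on F \<chi> by unfold_locales (rule \<chi>)
  obtain w where w: "w \<in> E" "\<And>g h. g \<in> carrier G \<Longrightarrow> h \<in> carrier G \<Longrightarrow> \<alpha> g w = \<alpha> h w \<Longrightarrow> g = h"
    using exists_primitive by blast
  let ?n = "card (carrier G)"
  have inj: "inj_on (\<lambda>g. \<alpha> g w) (carrier G)" using w(2) by (auto simp: inj_on_def)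
  have n0: "?n > 0" using fin one_closed by (auto simp: card_gt_0_iff)
  define P where "P = orbit_poly (carrier G) w"
  have P: "P \<in> coeffs_in F" "Polynomial.lead_coeff P = 1" "Polynomial.degree P = ?n"
    using orbit_poly_in_F[OF w(1)] orbit_poly_props[OF fin, of w] card_image[OF inj] by (auto simp: P_def)
  define P' where "P' = map_poly \<chi> P"
  have "Polynomial.coeff P' ?n = 1"
    using P(2,3) by (simp add: P'_def X.coeff_map)
  hence "Polynomial.degree P' > 0"
    using n0 le_degree[of P' ?n] by auto
  then obtain w' where w': "poly P' w' = 0" using alg_closed_imp_poly_has_root by blast
  have kill: "poly (map_poly \<chi> f) w' = 0" if f: "f \<in> coeffs_in F" "poly f w = 0" for f
  proof -
    obtain q s where qs: "q \<in> coeffs_in F" "s \<in> coeffs_in F" "f = P * q + s" "Polynomial.degree s < ?n"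
      using F.monic_division[OF f(1) P(1,2)] P(3) n0 by auto
    have "poly s (\<alpha> g w) = 0" if g: "g \<in> carrier G" for g
    proof -
      interpret h: field_hom_on E "\<alpha> g" by (rule hom_on[OF g])
      have Pg: "poly P (\<alpha> h w) = 0" if "h \<in> carrier G" for h
        using orbit_poly_props(3)[OF fin, of w "\<alpha> h w"] that by (auto simp: P_def)
      have "poly s w = 0" using f(2) Pg[OF one_closed] \<alpha>_one[OF w(1)] by (simp add: qs(3))
      moreover have "map_poly (\<alpha> g) s = s"
        using qs(2) \<alpha>_F[OF _ g] by (intro poly_eqI) (auto simp: h.coeff_map coeffs_in_def)
      moreover have "s \<in> coeffs_in E" using qs(2) FE by (auto simp: coeffs_in_def)
      ultimately show ?thesis using h.poly_map[of s w] w(1) by simp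
    qed
    hence "s = 0"
      using qs(4) card_image[OF inj] n0
      by (intro poly_eqI_degree[of "(\<lambda>g. \<alpha> g w) ` carrier G"]) auto
    thus ?thesis
      using w' P(1) qs by (simp add: X.map_poly_mult P'_def)
  qed
  define R where "R x = (SOME f. f \<in> coeffs_in F \<and> poly f w = x)" for x
  have R: "R x \<in> coeffs_in F" "poly (R x) w = x" if "x \<in> E" for x
  proof -
    have "R x \<in> coeffs_in F \<and> poly (R x) w = x" unfolding R_def
      by (rule someI_ex) (use poly_in_primitive[OF w that] in blast)
    thus "R x \<in> coeffs_in F" "poly (R x) w = x" by auto
  qed
  define \<Phi> where "\<Phi> x = poly (map_poly \<chi> (R x)) w'" for x
  have \<Phi>: "\<Phi> x = poly (map_poly \<chi> f) w'" if "f \<in> coeffs_in F" "poly f w = x" "x \<in> E" for x f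
  proof -
    have "poly (map_poly \<chi> (R x - f)) w' = 0"
      by (rule kill) (use that R in \<open>auto intro: F.coeffs_in_diff\<close>)
    moreover have "map_poly \<chi> ((R x - f) + f) = map_poly \<chi> (R x - f) + map_poly \<chi> f"
      by (rule X.map_poly_add) (use that R in \<open>auto intro: F.coeffs_in_diff\<close>)
    ultimately show ?thesis by (simp add: \<Phi>_def)
  qed
  have const: "\<Phi> x = \<chi> x" if "x \<in> F" for x
  proof -
    have "\<Phi> x = poly (map_poly \<chi> [:x:]) w'"
      by (rule \<Phi>) (use that FE in \<open>auto intro: F.coeffs_in_const\<close>)
    also have "map_poly \<chi> [:x:] = [:\<chi> x:]"
      by (rule poly_eqI) (simp add: X.coeff_map coeff_pCons split: nat.splits)
    finally show ?thesis by simp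
  qed
  moreover have "fhom E \<Phi>" unfolding fhom_def
  proof (intro conjI ballI)
    show "\<Phi> 1 = 1" using const[OF F.one] by simp
    fix x y assume xy: "x \<in> E" "y \<in> E"
    have "\<Phi> (x + y) = poly (map_poly \<chi> (R x + R y)) w'"
      by (rule \<Phi>) (use xy R in \<open>auto intro: F.coeffs_in_add E.add\<close>)
    thus "\<Phi> (x + y) = \<Phi> x + \<Phi> y" using R xy by (simp add: X.map_poly_add \<Phi>_def)
    have "\<Phi> (x * y) = poly (map_poly \<chi> (R x * R y)) w'"
      by (rule \<Phi>) (use xy R in \<open>auto intro: F.coeffs_in_mult E.mult\<close>)
    thus "\<Phi> (x * y) = \<Phi> x * \<Phi> y" using R xy by (simp add: X.map_poly_mult \<Phi>_def)
  qed
  ultimately show ?thesis by blast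
qed

lemma galois_action_image:
  fixes \<Phi> :: "'a \<Rightarrow> 'b :: field"
  assumes "fhom E \<Phi>"
  shows "galois_action G (\<Phi> ` E) (\<Phi> ` F) (\<lambda>g y. \<Phi> (\<alpha> g (inv_into E \<Phi> y)))"
proof -
  interpret P: field_hom_on E \<Phi> by unfold_locales (rule assms)
  interpret PF: field_hom_on F \<Phi>
    by unfold_locales (use assms FE in \<open>auto simp: fhom_def\<close>)
  have inv [simp]: "inv_into E \<Phi> (\<Phi> x) = x" if "x \<in> E" for x
    using that P.inj by simp
  show ?thesis
  proof (unfold_locales, goal_cases)
    case 1
    show ?case by (rule fin)
  next
    case 2
    show ?case by (rule P.subfld_image)
  next
    case 3
    show ?case by (rule PF.subfld_image)
  next
    case 4
    show ?case using FE by auto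
  next
    case 5
    show ?case using inf inj_on_subset[OF P.inj FE] by (simp add: finite_image_iff)
  next
    case (6 g x)
    thus ?case using \<alpha>_closed by auto
  next
    case (7 g)
    interpret h: field_hom_on E "\<alpha> g" by (rule hom_on[OF 7])
    have one: "inv_into E \<Phi> 1 = 1" using inv[of 1] by simp
    have add: "inv_into E \<Phi> (\<Phi> x + \<Phi> y) = x + y" if "x \<in> E" "y \<in> E" for x y
      using inv[of "x + y"] that by (simp add: P.h_add E.add)
    have mult: "inv_into E \<Phi> (\<Phi> x * \<Phi> y) = x * y" if "x \<in> E" "y \<in> E" for x y
      using inv[of "x * y"] that by (simp add: P.h_mult E.mult)
    show ?case
      using 7 by (auto simp: fhom_def one add mult h.h_add h.h_mult P.h_add P.h_mult \<alpha>_closed)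
  next
    case (8 g h x)
    thus ?case using \<alpha>_closed by (auto simp: \<alpha>_mult)
  next
    case (9 x)
    thus ?case by (auto simp: \<alpha>_one)
  next
    case (10 x)
    show ?case
    proof
      assume "x \<in> \<Phi> ` F"
      thus "x \<in> \<Phi> ` E \<and> (\<forall>g\<in>carrier G. \<Phi> (\<alpha> g (inv_into E \<Phi> x)) = x)"
        using FE \<alpha>_F by (auto simp: subset_eq)
    next
      assume a: "x \<in> \<Phi> ` E \<and> (\<forall>g\<in>carrier G. \<Phi> (\<alpha> g (inv_into E \<Phi> x)) = x)"
      then obtain y where y: "y \<in> E" "x = \<Phi> y" by auto
      have "\<alpha> g y = y" if "g \<in> carrier G" for g
        using a y that \<alpha>_closed[OF that y(1)] inj_onD[OF P.inj, of "\<alpha> g y" y] by auto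
      thus "x \<in> \<Phi> ` F" using y fixed by auto
    qed
  next
    case (11 g)
    have "\<alpha> g x = x" if "x \<in> E" for x
      using 11(2)[of "\<Phi> x"] that \<alpha>_closed[OF 11(1) that] inj_onD[OF P.inj, of "\<alpha> g x" x] by auto
    thus ?case by (rule faithful[OF 11(1)])
  qed
qed

definition fixed_field :: "'g set \<Rightarrow> 'a set"
  where "fixed_field Z = {x \<in> E. \<forall>z\<in>Z. \<alpha> z x = x}"

lemma subfld_fixed_field:
  assumes "Z \<subseteq> carrier G"
  shows "subfld (fixed_field Z)"
proof (rule subfldI)
  have h: "field_hom_on E (\<alpha> z)" if "z \<in> Z" for z using assms that hom_on by auto
  note hh = field_hom_on.h_add[OF h] field_hom_on.h_mult[OF h] field_hom_on.h_1[OF h]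
    field_hom_on.h_uminus[OF h] field_hom_on.h_inverse[OF h]
  show "1 \<in> fixed_field Z" "- 1 \<in> fixed_field Z"
    using E.one E.uminus[OF E.one] by (auto simp: fixed_field_def hh)
  show "x + y \<in> fixed_field Z" "x * y \<in> fixed_field Z" if "x \<in> fixed_field Z" "y \<in> fixed_field Z" for x y
    using that by (auto simp: fixed_field_def hh E.add E.mult)
  show "inverse x \<in> fixed_field Z" if "x \<in> fixed_field Z" for x
    using that by (auto simp: fixed_field_def hh E.inverse)
qed

text \<open>The orbit polynomial of a primitive element under \<open>Z\<close> has coefficients in
  the fixed field of \<open>Z\<close>. An element that is trivial on this field sends the primitive
  element to another root, hence to a conjugate under \<open>Z\<close>.\<close>

lemma trivial_on_fixed_field:
  assumes Z: "subgroup Z G" and g: "g \<in> carrier G" "\<And>x. x \<in> fixed_field Z \<Longrightarrow> \<alpha> g x = x"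
  shows "g \<in> Z"
proof -
  obtain w where w: "w \<in> E" "\<And>g h. g \<in> carrier G \<Longrightarrow> h \<in> carrier G \<Longrightarrow> \<alpha> g w = \<alpha> h w \<Longrightarrow> g = h"
    using exists_primitive by blast
  have ZG: "Z \<subseteq> carrier G" by (rule subgroup.subset[OF Z])
  have finZ: "finite Z" using finite_subset[OF ZG fin] .
  let ?P = "orbit_poly Z w"
  interpret h: field_hom_on E "\<alpha> g" by (rule hom_on[OF g(1)])
  have oneZ: "\<one> \<in> Z" by (rule subgroup.one_closed[OF Z])
  have PE: "?P \<in> coeffs_in E" by (rule orbit_poly_fixed(2)[OF Z w(1) oneZ])
  hence "Polynomial.coeff ?P i \<in> fixed_field Z" for i
    using orbit_poly_fixed(1)[OF Z w(1)] by (auto simp: fixed_field_def coeffs_in_def)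
  hence "map_poly (\<alpha> g) ?P = ?P" using g(2) by (intro poly_eqI) (simp add: h.coeff_map)
  moreover have "poly ?P w = 0"
    using orbit_poly_props(3)[OF finZ, of w w] oneZ \<alpha>_one[OF w(1)] by force
  ultimately have "poly ?P (\<alpha> g w) = 0" using h.poly_map[OF PE w(1)] by simp
  then obtain z where "z \<in> Z" "\<alpha> g w = \<alpha> z w"
    using orbit_poly_props(3)[OF finZ, of w "\<alpha> g w"] by auto
  thus ?thesis using w(2)[of g z] g ZG by auto
qed

lemma fixed_field_stable:
  assumes Z: "Z \<lhd> G" and "g \<in> carrier G" "x \<in> fixed_field Z"
  shows "\<alpha> g x \<in> fixed_field Z"
proof -
  have ZG: "Z \<subseteq> carrier G" by (rule subgroup.subset[OF normal_imp_subgroup[OF Z]])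
  have "\<alpha> z (\<alpha> g x) = \<alpha> g x" if z: "z \<in> Z" for z
  proof -
    have z': "inv g \<otimes> z \<otimes> g \<in> Z" using normal.inv_op_closed1[OF Z assms(2) z] .
    have zG: "z \<in> carrier G" using z ZG by auto
    have xE: "x \<in> E" using assms by (auto simp: fixed_field_def)
    have "\<alpha> z (\<alpha> g x) = \<alpha> (z \<otimes> g) x" using \<alpha>_mult[OF zG assms(2) xE] by simp
    also have "z \<otimes> g = g \<otimes> (inv g \<otimes> z \<otimes> g)"
      using zG assms(2) by (simp flip: m_assoc)
    also have "\<alpha> (g \<otimes> (inv g \<otimes> z \<otimes> g)) x = \<alpha> g (\<alpha> (inv g \<otimes> z \<otimes> g) x)"
      by (rule \<alpha>_mult) (use zG assms(2) xE in auto)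
    also have "\<alpha> (inv g \<otimes> z \<otimes> g) x = x" using z' assms(3) by (auto simp: fixed_field_def)
    finally show ?thesis .
  qed
  thus ?thesis using assms \<alpha>_closed by (auto simp: fixed_field_def)
qed

text \<open>\<sigma> sends every x to a conjugate, but the group element doing so may depend on x.
  Applied to w + c x for infinitely many c, this gives two values of c with the same group element,
  which then agrees with \<sigma> on both w and x. If only elements of \<open>Z\<close> fix w, the
  group element is determined up to \<open>Z\<close> by w alone, and \<open>Z\<close> acts trivially
  here.\<close>

lemma automorphism_is_action:
  assumes Z: "Z \<lhd> G" and \<sigma>: "fhom (fixed_field Z) \<sigma>" "\<And>x. x \<in> F \<Longrightarrow> \<sigma> x = x"
  shows "\<exists>g\<in>carrier G. \<forall>x\<in>fixed_field Z. \<sigma> x = \<alpha> g x"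
proof -
  note Zs = normal_imp_subgroup[OF Z]
  have ZG: "Z \<subseteq> carrier G" by (rule subgroup.subset[OF Zs])
  let ?K = "fixed_field Z"
  have KE: "?K \<subseteq> E" by (auto simp: fixed_field_def)
  have FK: "F \<subseteq> ?K" using FE \<alpha>_F ZG by (auto simp: fixed_field_def)
  interpret K: subfield_set ?K by unfold_locales (rule subfld_fixed_field[OF ZG])
  interpret s: field_hom_on ?K \<sigma> by unfold_locales (rule \<sigma>)
  have "\<exists>w\<in>?K. \<forall>g\<in>carrier G - Z. \<alpha> g w \<noteq> w"
  proof (rule avoid)
    show "\<exists>x\<in>?K. \<alpha> g x \<noteq> x" if "g \<in> carrier G - Z" for g
      using trivial_on_fixed_field[OF Zs, of g] that by blast
  qed (use fin KE FK K.F in auto)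
  then obtain w where w: "w \<in> ?K" "\<And>g. g \<in> carrier G \<Longrightarrow> \<alpha> g w = w \<Longrightarrow> g \<in> Z" by blast
  have conj: "\<exists>g\<in>carrier G. \<sigma> x = \<alpha> g x" if x: "x \<in> ?K" for x
  proof -
    have xE: "x \<in> E" using x KE by auto
    let ?P = "orbit_poly (carrier G) x"
    have PF: "?P \<in> coeffs_in F" by (rule orbit_poly_in_F[OF xE])
    hence PK: "?P \<in> coeffs_in ?K" using FK by (auto simp: coeffs_in_def)
    have "map_poly \<sigma> ?P = ?P" using PF \<sigma>(2) by (intro poly_eqI) (auto simp: s.coeff_map coeffs_in_def)
    moreover have "poly ?P x = 0"
      using orbit_poly_props(3)[OF fin, of x x] \<alpha>_one[OF xE] by force
    ultimately have "poly ?P (\<sigma> x) = 0" using s.poly_map[OF PK x] by simp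
    thus ?thesis using orbit_poly_props(3)[OF fin, of x "\<sigma> x"] by auto
  qed
  have both: "\<exists>g\<in>carrier G. \<sigma> x = \<alpha> g x \<and> \<sigma> w = \<alpha> g w" if x: "x \<in> ?K" for x
  proof -
    have wc: "w + c * x \<in> ?K" if "c \<in> F" for c using w(1) x that FK by (auto intro!: K.add K.mult)
    define \<gamma> where "\<gamma> c = (SOME g. g \<in> carrier G \<and> \<sigma> (w + c * x) = \<alpha> g (w + c * x))" for c
    have \<gamma>: "\<gamma> c \<in> carrier G" "\<sigma> (w + c * x) = \<alpha> (\<gamma> c) (w + c * x)" if "c \<in> F" for c
    proof -
      have "\<gamma> c \<in> carrier G \<and> \<sigma> (w + c * x) = \<alpha> (\<gamma> c) (w + c * x)" unfolding \<gamma>_def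
        by (rule someI_ex) (use conj[OF wc[OF that]] in blast)
      thus "\<gamma> c \<in> carrier G" "\<sigma> (w + c * x) = \<alpha> (\<gamma> c) (w + c * x)" by auto
    qed
    have "\<not> inj_on \<gamma> F"
    proof
      assume "inj_on \<gamma> F"
      moreover have "finite (\<gamma> ` F)" using finite_subset[OF _ fin, of "\<gamma> ` F"] \<gamma> by auto
      ultimately show False using inf finite_imageD by blast
    qed
    then obtain c c' where c: "c \<in> F" "c' \<in> F" "c \<noteq> c'" "\<gamma> c = \<gamma> c'" by (auto simp: inj_on_def)
    let ?g = "\<gamma> c"
    have gG: "?g \<in> carrier G" using \<gamma>(1)[OF c(1)] .
    interpret h: field_hom_on E "\<alpha> ?g" by (rule hom_on[OF gG])
    have ex: "\<sigma> w + a * \<sigma> x = \<alpha> ?g w + a * \<alpha> ?g x" if a: "a \<in> F" "\<gamma> a = ?g" for a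
    proof -
      have aK: "a \<in> ?K" using a FK by auto
      have "\<sigma> (w + a * x) = \<sigma> w + a * \<sigma> x"
        using w(1) x aK \<sigma>(2)[OF a(1)] by (simp add: s.h_add s.h_mult K.mult)
      moreover have "\<alpha> ?g (w + a * x) = \<alpha> ?g w + a * \<alpha> ?g x"
        using w(1) x aK KE \<alpha>_F[OF a(1) gG] by (simp add: h.h_add h.h_mult E.mult subset_eq)
      ultimately show ?thesis using \<gamma>(2)[OF a(1)] a(2) by simp
    qed
    have "(c - c') * \<sigma> x = (\<sigma> w + c * \<sigma> x) - (\<sigma> w + c' * \<sigma> x)"
      by (simp add: algebra_simps)
    also have "\<dots> = (\<alpha> ?g w + c * \<alpha> ?g x) - (\<alpha> ?g w + c' * \<alpha> ?g x)"
      unfolding ex[OF c(1) refl] ex[OF c(2) c(4)[symmetric]] ..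
    also have "\<dots> = (c - c') * \<alpha> ?g x"
      by (simp add: algebra_simps)
    finally have "(c - c') * \<sigma> x = (c - c') * \<alpha> ?g x" .
    hence "\<sigma> x = \<alpha> ?g x" using c(3) by simp
    moreover have "\<sigma> w = \<alpha> ?g w" using ex[OF c(1) refl] calculation by simp
    ultimately show ?thesis using gG by auto
  qed
  obtain g where g: "g \<in> carrier G" "\<sigma> w = \<alpha> g w" using conj[OF w(1)] by auto
  have "\<sigma> x = \<alpha> g x" if x: "x \<in> ?K" for x
  proof -
    obtain k where k: "k \<in> carrier G" "\<sigma> x = \<alpha> k x" "\<sigma> w = \<alpha> k w" using both[OF x] by auto
    have wE: "w \<in> E" and xE: "x \<in> E" using w x KE by auto
    have "\<alpha> (inv g \<otimes> k) w = w"
      using \<alpha>_mult[of "inv g" k w] \<alpha>_inv[of g w] g k wE by simp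
    hence "inv g \<otimes> k \<in> Z" using w(2)[of "inv g \<otimes> k"] g k by auto
    hence "\<alpha> (inv g \<otimes> k) x = x" using x by (auto simp: fixed_field_def)
    hence "\<alpha> g (\<alpha> (inv g \<otimes> k) x) = \<alpha> g x" by simp
    moreover have "\<alpha> g (\<alpha> (inv g \<otimes> k) x) = \<alpha> (g \<otimes> (inv g \<otimes> k)) x"
      using \<alpha>_mult[of g "inv g \<otimes> k" x] g k xE by simp
    moreover have "g \<otimes> (inv g \<otimes> k) = k" using g k by (simp flip: m_assoc)
    ultimately show ?thesis using k by simp
  qed
  thus ?thesis using g by blast
qed

end

section \<open>Comparison with the notions of the algebra library\<close>

lemma ambient_simps [simp]:
  "carrier (ambient :: 'a :: alg_closed_field ring) = UNIV"
  "\<zero>\<^bsub>ambient :: 'a ring\<^esub> = 0" "\<one>\<^bsub>ambient :: 'a ring\<^esub> = 1"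
  "x \<oplus>\<^bsub>ambient\<^esub> y = (x + y :: 'a)" "x \<otimes>\<^bsub>ambient\<^esub> y = (x * y :: 'a)"
  by (auto simp: ring_of_type_algebra_def)

lemma ambient_field: "Ring.field (ambient :: 'a :: alg_closed_field ring)"
  by (rule field_from_type_algebra)

lemma ambient_a_inv [simp]: "a_inv ambient x = (- x :: 'a :: alg_closed_field)"
proof -
  interpret A: Ring.field "ambient :: 'a ring" by (rule ambient_field)
  show ?thesis by (rule A.minus_equality) auto
qed

lemma ambient_m_inv: "x \<noteq> 0 \<Longrightarrow> m_inv ambient x = (inverse x :: 'a :: alg_closed_field)"
proof -
  interpret A: Ring.field "ambient :: 'a ring" by (rule ambient_field)
  show "x \<noteq> 0 \<Longrightarrow> m_inv ambient x = inverse x" by (rule A.comm_inv_char) auto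
qed

lemma ambient_nat_pow [simp]: "x [^]\<^bsub>ambient\<^esub> (n :: nat) = (x ^ n :: 'a :: alg_closed_field)"
proof -
  interpret A: Ring.field "ambient :: 'a ring" by (rule ambient_field)
  show ?thesis by (induction n) (auto simp: mult.commute)
qed

lemma subfld_imp_subfield:
  assumes "subfld (F :: 'a :: alg_closed_field set)"
  shows "subfield F ambient"
proof -
  interpret A: Ring.field "ambient :: 'a ring" by (rule ambient_field)
  interpret F: subfield_set F by unfold_locales (rule assms)
  show ?thesis
  proof (rule A.subfieldI')
    show "subring F ambient"
      by (rule A.subringI) (auto simp: F.add F.mult F.uminus)
    show "m_inv ambient k \<in> F" if "k \<in> F - {\<zero>\<^bsub>ambient\<^esub>}" for k
      using that by (auto simp: ambient_m_inv F.inverse)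
  qed
qed

lemma subfield_imp_subfld:
  assumes "subfield (F :: 'a :: alg_closed_field set) ambient"
  shows "subfld F"
proof -
  interpret A: Ring.field "ambient :: 'a ring" by (rule ambient_field)
  note sr = subfieldE(1)[OF assms]
  show ?thesis
  proof (rule subfldI)
    show "1 \<in> F" using subringE(3)[OF sr] by simp
    show "- 1 \<in> F" using subringE(5)[OF sr, of 1] subringE(3)[OF sr] by simp
    show "x + y \<in> F" if "x \<in> F" "y \<in> F" for x y using subringE(7)[OF sr that] by simp
    show "x * y \<in> F" if "x \<in> F" "y \<in> F" for x y using subringE(6)[OF sr that] by simp
    show "inverse x \<in> F" if "x \<in> F" "x \<noteq> 0" for x
      using A.subfield_m_inv(1)[OF assms, of x] that by (simp add: ambient_m_inv)
  qed
qed

text \<open>Lists in \<open>ring.eval\<close> start with the leading coefficient and those in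
  \<open>Poly\<close> with the constant one, hence the reversal.\<close>

lemma eval_eq_poly: "ring.eval ambient l t = poly (Poly (rev l)) (t :: 'a :: alg_closed_field)"
proof -
  interpret A: Ring.field "ambient :: 'a ring" by (rule ambient_field)
  show ?thesis
    by (induction l) (auto simp: Poly_append poly_monom algebra_simps)
qed

lemma univ_poly_carrier_iff:
  "l \<in> carrier (univ_poly ambient F) \<longleftrightarrow>
    set l \<subseteq> F \<and> (l \<noteq> [] \<longrightarrow> hd l \<noteq> (0 :: 'a :: alg_closed_field))"
  by (auto simp: univ_poly_def polynomial_def)

lemma algebraic_iff_poly:
  assumes "subfld (F :: 'a :: alg_closed_field set)"
  shows "ring.algebraic ambient F x \<longleftrightarrow> (\<exists>p\<in>coeffs_in F. p \<noteq> 0 \<and> poly p x = 0)"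
proof -
  interpret A: Ring.field "ambient :: 'a ring" by (rule ambient_field)
  interpret F: subfield_set F by unfold_locales (rule assms)
  note sf = subfld_imp_subfield[OF assms]
  show ?thesis
  proof
    assume "A.algebraic F x"
    hence "(A.algebraic over F) x" by (simp add: over_def)
    then obtain l where l: "l \<in> carrier (univ_poly ambient F)" "l \<noteq> []" "A.eval l x = 0"
      using A.algebraicE[OF subfieldE(1)[OF sf], of x] by auto
    have "Poly (rev l) \<noteq> 0"
    proof
      assume "Poly (rev l) = 0"
      then obtain n where "rev l = replicate n 0" by (auto simp: Poly_eq_0)
      hence "l = replicate n 0" by (metis rev_replicate rev_rev_ident)
      thus False using l by (cases n) (auto simp: univ_poly_carrier_iff)
    qed
    moreover have "Poly (rev l) \<in> coeffs_in F"
      unfolding coeffs_in_def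
    proof (intro CollectI allI)
      fix i
      have "set (rev l) \<subseteq> F" using l(1) by (simp add: univ_poly_carrier_iff)
      thus "Polynomial.coeff (Poly (rev l)) i \<in> F"
        using nth_mem[of i "rev l"] by (auto simp: nth_default_def simp del: set_rev)
    qed
    ultimately show "\<exists>p\<in>coeffs_in F. p \<noteq> 0 \<and> poly p x = 0"
      using l(3) by (auto simp: eval_eq_poly)
  next
    assume "\<exists>p\<in>coeffs_in F. p \<noteq> 0 \<and> poly p x = 0"
    then obtain p where p: "p \<in> coeffs_in F" "p \<noteq> 0" "poly p x = 0" by auto
    have "(A.algebraic over F) x"
    proof (rule A.algebraicI[of "rev (coeffs p)"])
      have "set (coeffs p) \<subseteq> F" using p(1) by (auto simp: coeffs_def coeffs_in_def)
      thus "rev (coeffs p) \<in> carrier (univ_poly ambient F)"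
        using p(2) by (auto simp: univ_poly_carrier_iff hd_rev last_coeffs_eq_coeff_degree)
    qed (use p in \<open>auto simp: eval_eq_poly\<close>)
    thus "A.algebraic F x" by (simp add: over_def)
  qed
qed

text \<open>Over a finite field, the product of all x - c plus 1 has no root. Infinity is used below
  to pass from equal polynomial functions to equal polynomials.\<close>

lemma infinite_alg_closed: "infinite (UNIV :: 'a :: alg_closed_field set)"
proof
  assume fin: "finite (UNIV :: 'a set)"
  let ?P = "(\<Prod>c\<in>UNIV. [:- c, 1:]) + 1 :: 'a poly"
  have deg: "Polynomial.degree (\<Prod>c\<in>A. [:- c, 1:]) = card A" if "finite A" for A :: "'a set"
    using that by induction (auto simp: degree_mult_eq prod_zero_iff simp del: mult_pCons_left)
  have "Polynomial.degree ?P = card (UNIV :: 'a set)"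
    using deg[OF fin] fin by (subst degree_add_eq_left) (auto simp: card_gt_0_iff)
  hence "Polynomial.degree ?P > 0" using fin by (simp add: card_gt_0_iff)
  then obtain x where "poly ?P x = 0" using alg_closed_imp_poly_has_root by blast
  moreover have "poly (\<Prod>c\<in>UNIV. [:- c, 1:]) x = 0" using fin by (simp add: poly_prod prod_zero_iff)
  ultimately show False by simp
qed

text \<open>The minimal polynomial divides the product over \<open>Orb\<close>, whose roots are
  simple and lie in \<open>Orb\<close>. Normality, separability and algebraicity all follow from
  this one divisibility.\<close>

lemma Irr_dvd:
  fixes F :: "'a :: alg_closed_field set" and Orb :: "'a set"
  assumes F: "subfld F" and fin: "finite Orb" and P: "(\<Prod>c\<in>Orb. [:- c, 1:]) \<in> coeffs_in F" and x: "x \<in> Orb"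
  shows "set_mset (ring.roots ambient (ring.Irr ambient F x)) \<subseteq> Orb"
    and "ring.alg_mult ambient (ring.Irr ambient F x) a \<le> 1"
    and "ring.algebraic ambient F x"
proof -
  interpret A: Ring.field "ambient :: 'a ring" by (rule ambient_field)
  note sf = subfld_imp_subfield[OF F]
  define P where "P = (\<Prod>c\<in>Orb. [:- c, 1:])"
  have P0: "P \<noteq> 0" using fin by (auto simp: P_def prod_zero_iff)
  have PF: "P \<in> coeffs_in F" using P by (simp add: P_def)
  have Proot: "poly P y = 0 \<longleftrightarrow> y \<in> Orb" for y using fin by (auto simp: P_def poly_prod prod_zero_iff)
  define l where "l = rev (coeffs P)"
  have lF: "l \<in> carrier (univ_poly ambient F)"
    using P0 PF by (auto simp: l_def univ_poly_carrier_iff hd_rev last_coeffs_eq_coeff_degree coeffs_def coeffs_in_def)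
  have l0: "l \<noteq> []" using P0 by (simp add: l_def)
  have el: "A.eval l t = poly P t" for t by (simp add: l_def eval_eq_poly)
  show alg: "A.algebraic F x"
    using algebraic_iff_poly[OF F] PF P0 Proot x by blast
  hence algo: "(A.algebraic over F) x" by (simp add: over_def)
  let ?I = "A.Irr F x"
  have I: "?I \<in> carrier (univ_poly ambient F)" using A.IrrE(1)[OF sf _ algo] by simp
  hence IU: "?I \<in> carrier (univ_poly ambient UNIV)" by (auto simp: univ_poly_carrier_iff)
  have lU: "l \<in> carrier (univ_poly ambient UNIV)" using lF by (auto simp: univ_poly_carrier_iff)
  have div: "?I pdivides\<^bsub>ambient\<^esub> l"
    by (rule A.Irr_minimal[OF sf _ algo lF]) (use Proot x in \<open>auto simp: el\<close>)
  have I0: "?I \<noteq> []"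
    using A.IrrE(3)[OF sf _ algo] A.IrrE(2)[OF sf _ algo] by (auto simp: ring_irreducible_def univ_poly_zero)
  interpret U: domain "univ_poly (ambient :: 'a ring) UNIV"
    using A.univ_poly_is_domain[OF A.carrier_is_subring] by simp
  have hom: "A.eval (p \<otimes>\<^bsub>univ_poly ambient UNIV\<^esub> q) t = A.eval p t * A.eval q t"
    if "p \<in> carrier (univ_poly ambient UNIV)" "q \<in> carrier (univ_poly ambient UNIV)" for p q t
    using A.eval_is_hom[OF A.carrier_is_subring, of t] that by (auto simp: Ring.ring_hom_def)
  obtain q where q: "q \<in> carrier (univ_poly ambient UNIV)" "l = ?I \<otimes>\<^bsub>univ_poly ambient UNIV\<^esub> q"
    using div by (auto simp: pdivides_def factor_def)
  show "set_mset (A.roots ?I) \<subseteq> Orb"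
  proof
    fix a assume "a \<in># A.roots ?I"
    hence "A.is_root ?I a" using A.roots_mem_iff_is_root[of ?I] IU by simp
    hence "A.eval ?I a = 0" by (simp add: A.is_root_def)
    hence "A.eval l a = 0" using q(2) hom[OF IU q(1), of a] by simp
    thus "a \<in> Orb" by (simp add: el Proot)
  qed
  show "A.alg_mult ?I a \<le> 1"
  proof (rule ccontr)
    assume "\<not> A.alg_mult ?I a \<le> 1"
    hence "2 \<le> A.alg_mult ?I a" by simp
    let ?la = "[1, - a]"
    have la: "?la \<in> carrier (univ_poly ambient UNIV)" by (simp add: univ_poly_carrier_iff)
    have "(?la [^]\<^bsub>univ_poly ambient UNIV\<^esub> (2 :: nat)) pdivides\<^bsub>ambient\<^esub> ?I"
      using A.le_alg_mult_imp_pdivides[of a ?I 2] IU \<open>2 \<le> _\<close> by simp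
    then obtain s where s: "s \<in> carrier (univ_poly ambient UNIV)"
      "?I = (?la [^]\<^bsub>univ_poly ambient UNIV\<^esub> (2 :: nat)) \<otimes>\<^bsub>univ_poly ambient UNIV\<^esub> s"
      by (auto simp: pdivides_def factor_def)
    have la2: "?la [^]\<^bsub>univ_poly ambient UNIV\<^esub> (2 :: nat) = ?la \<otimes>\<^bsub>univ_poly ambient UNIV\<^esub> ?la"
      using la by (simp add: numeral_2_eq_2 U.nat_pow_Suc)
    have ela: "A.eval ?la t = t - a" for t by (simp add: eval_eq_poly)
    have Pt: "poly P t = (t - a) * (t - a) * A.eval s t * A.eval q t" for t
      using hom[OF IU q(1), of t] q(2) s hom[OF _ s(1), of "?la \<otimes>\<^bsub>univ_poly ambient UNIV\<^esub> ?la" t] la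
        hom[OF la la, of t] by (simp add: la2 ela flip: el)
    have lin: "poly [:- a, 1:] t = t - a" for t by simp
    have "poly (P - [:- a, 1:] * [:- a, 1:] * Poly (rev s) * Poly (rev q)) t = 0" for t
      by (simp only: poly_diff poly_mult lin Pt eval_eq_poly diff_self)
    hence "UNIV = {t. poly (P - [:- a, 1:] * [:- a, 1:] * Poly (rev s) * Poly (rev q)) t = 0}" by auto
    hence "infinite {t. poly (P - [:- a, 1:] * [:- a, 1:] * Poly (rev s) * Poly (rev q)) t = 0}"
      using infinite_alg_closed by simp
    hence "P - [:- a, 1:] * [:- a, 1:] * Poly (rev s) * Poly (rev q) = 0"
      using poly_roots_finite by blast
    hence eq: "P = [:- a, 1:] * ([:- a, 1:] * (Poly (rev s) * Poly (rev q)))" by (simp add: mult.assoc del: mult_pCons_left)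
    hence "poly P a = 0" by (simp del: mult_pCons_left)
    hence aOrb: "a \<in> Orb" by (simp add: Proot)
    \<comment> \<open>After cancelling one factor x - a on both sides, the remaining product omits
      \<open>a\<close> and nevertheless would vanish there.\<close>
    have "P = [:- a, 1:] * (\<Prod>c\<in>Orb - {a}. [:- c, 1:])"
      unfolding P_def using fin aOrb by (simp add: prod.remove del: mult_pCons_left)
    hence "(\<Prod>c\<in>Orb - {a}. [:- c, 1:]) = [:- a, 1:] * (Poly (rev s) * Poly (rev q))"
      using eq mult_left_cancel[of "[:- a, 1:]"] by (simp del: mult_pCons_left)
    hence "poly (\<Prod>c\<in>Orb - {a}. [:- c, 1:]) a = 0" by (simp del: mult_pCons_left)
    thus False using fin by (auto simp: poly_prod prod_zero_iff)
  qed
qed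

text \<open>Orbits of the group stay inside the fixed field of the normal subgroup \<open>Z\<close>,
  so orbit polynomials give all properties of a Galois extension. Restriction to this field maps the
  group onto the automorphism group, with kernel exactly \<open>Z\<close>.\<close>

lemma galois_quotient:
  fixes G (structure) and E F :: "'a :: alg_closed_field set"
  assumes "galois_action G E F \<alpha>" and Z: "Z \<lhd> G"
  defines "K \<equiv> galois_action.fixed_field E \<alpha> Z"
  shows "galois_extension F K" "galois_group F K \<cong> G Mod Z"
proof -
  interpret galois_action G E F \<alpha> by fact
  note Zs = normal_imp_subgroup[OF Z]
  have ZG: "Z \<subseteq> carrier G" by (rule subgroup.subset[OF Zs])
  have KE: "K \<subseteq> E" by (auto simp: K_def fixed_field_def)
  have FK: "F \<subseteq> K" using FE \<alpha>_F ZG by (auto simp: K_def fixed_field_def)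
  have Kf: "subfld K" unfolding K_def by (rule subfld_fixed_field[OF ZG])
  interpret K: subfield_set K by unfold_locales (rule Kf)
  have st: "\<alpha> g x \<in> K" if "g \<in> carrier G" "x \<in> K" for g x
    using fixed_field_stable[OF Z] that by (simp add: K_def)
  have *: "set_mset (ring.roots ambient (ring.Irr ambient F x)) \<subseteq> K"
    "ring.alg_mult ambient (ring.Irr ambient F x) a \<le> 1" "ring.algebraic ambient F x" if x: "x \<in> K" for x a
  proof -
    let ?O = "(\<lambda>g. \<alpha> g x) ` carrier G"
    have xE: "x \<in> E" using x KE by auto
    have "x \<in> ?O" using \<alpha>_one[OF xE] by force
    moreover have "(\<Prod>c\<in>?O. [:- c, 1:]) \<in> coeffs_in F"
      using orbit_poly_in_F[OF xE] by (simp add: orbit_poly_def)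
    moreover have "?O \<subseteq> K" using st x by auto
    ultimately show "set_mset (ring.roots ambient (ring.Irr ambient F x)) \<subseteq> K"
        "ring.alg_mult ambient (ring.Irr ambient F x) a \<le> 1" "ring.algebraic ambient F x"
      using Irr_dvd[OF F, of ?O x] fin by (auto 4 3)
  qed
  show "galois_extension F K"
    unfolding galois_extension_def algebraic_extension_def normal_extension_def separable_extension_def
    using subfld_imp_subfield[OF F] subfld_imp_subfield[OF Kf] FK * by blast
  \<comment> \<open>Elements of \<open>Bij\<close> are extensional functions, hence the
    restriction.\<close>
  define \<rho> where "\<rho> g = restrict (\<alpha> g) K" for g
  let ?H = "galois_group F K"
  have carH: "carrier ?H = {\<sigma> \<in> Bij K. fhom K \<sigma> \<and> (\<forall>x\<in>F. \<sigma> x = x)}"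
  proof -
    have "\<sigma> \<in> Ring.ring_hom (ambient\<lparr>carrier := K\<rparr>) (ambient\<lparr>carrier := K\<rparr>) \<longleftrightarrow> fhom K \<sigma>" if "\<sigma> \<in> Bij K" for \<sigma>
      using Bij_imp_funcset[OF that] by (auto simp: Ring.ring_hom_def fhom_def)
    thus ?thesis by (auto simp: galois_group_def)
  qed
  have \<rho>Bij: "\<rho> g \<in> Bij K" if g: "g \<in> carrier G" for g
  proof -
    have "bij_betw (\<alpha> g) K K"
    proof (rule bij_betwI[where g = "\<alpha> (inv g)"])
      show "\<alpha> g \<in> K \<rightarrow> K" "\<alpha> (inv g) \<in> K \<rightarrow> K" using st g by auto
      show "\<alpha> (inv g) (\<alpha> g x) = x" if "x \<in> K" for x using \<alpha>_inv[OF g] that KE by auto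
      show "\<alpha> g (\<alpha> (inv g) x) = x" if "x \<in> K" for x
        using \<alpha>_inv[of "inv g" x] that KE g by auto
    qed
    thus ?thesis by (auto simp: Bij_def \<rho>_def bij_betw_restrict_eq)
  qed
  have \<rho>H: "\<rho> g \<in> carrier ?H" if g: "g \<in> carrier G" for g
  proof -
    interpret h: field_hom_on E "\<alpha> g" by (rule hom_on[OF g])
    have "fhom K (\<rho> g)"
      using KE by (auto simp: fhom_def \<rho>_def K.add K.mult h.h_add h.h_mult subset_eq)
    thus ?thesis using \<rho>Bij[OF g] FK \<alpha>_F[OF _ g] by (auto simp: carH \<rho>_def)
  qed
  have mult_H: "\<rho> g \<otimes>\<^bsub>?H\<^esub> \<rho> h = compose K (\<rho> g) (\<rho> h)" if "g \<in> carrier G" "h \<in> carrier G" for g h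
    using \<rho>Bij that by (simp add: galois_group_def BijGroup_def)
  have surj: "\<rho> ` carrier G = carrier ?H"
  proof
    show "carrier ?H \<subseteq> \<rho> ` carrier G"
    proof
      fix \<sigma> assume s: "\<sigma> \<in> carrier ?H"
      hence "fhom (fixed_field Z) \<sigma>" "\<And>x. x \<in> F \<Longrightarrow> \<sigma> x = x"
        by (simp_all add: carH) (simp add: K_def)
      then obtain g where g: "g \<in> carrier G" "\<forall>x\<in>K. \<sigma> x = \<alpha> g x"
        using automorphism_is_action[OF Z] unfolding K_def by metis
      have "\<sigma> = \<rho> g"
        by (rule extensionalityI[where A = K]) (use s g Bij_imp_extensional in \<open>auto simp: carH \<rho>_def\<close>)
      thus "\<sigma> \<in> \<rho> ` carrier G" using g by auto
    qed
  qed (use \<rho>H in auto)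
  have \<rho>_mult: "\<rho> (g \<otimes> h) = \<rho> g \<otimes>\<^bsub>?H\<^esub> \<rho> h" if "g \<in> carrier G" "h \<in> carrier G" for g h
    unfolding mult_H[OF that] using that st KE by (auto simp: \<rho>_def compose_def restrict_def \<alpha>_mult fun_eq_iff subset_eq)
  have oneH: "\<one>\<^bsub>?H\<^esub> = \<rho> \<one>"
    using KE by (auto simp: galois_group_def BijGroup_def \<rho>_def \<alpha>_one restrict_def fun_eq_iff subset_eq)
  have grp: "group ?H"
  proof (rule groupI)
    fix x y z assume "x \<in> carrier ?H" "y \<in> carrier ?H" "z \<in> carrier ?H"
    then obtain g h k where ghk: "g \<in> carrier G" "h \<in> carrier G" "k \<in> carrier G" "x = \<rho> g" "y = \<rho> h" "z = \<rho> k"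
      using surj by (metis imageE)
    show "x \<otimes>\<^bsub>?H\<^esub> y \<in> carrier ?H" using ghk \<rho>H by (simp flip: \<rho>_mult)
    show "x \<otimes>\<^bsub>?H\<^esub> y \<otimes>\<^bsub>?H\<^esub> z = x \<otimes>\<^bsub>?H\<^esub> (y \<otimes>\<^bsub>?H\<^esub> z)"
      using ghk by (simp add: m_assoc flip: \<rho>_mult)
    show "\<one>\<^bsub>?H\<^esub> \<otimes>\<^bsub>?H\<^esub> x = x" using ghk by (simp add: oneH flip: \<rho>_mult)
    show "\<exists>y\<in>carrier ?H. y \<otimes>\<^bsub>?H\<^esub> x = \<one>\<^bsub>?H\<^esub>"
      using ghk \<rho>H by (intro bexI[of _ "\<rho> (inv g)"]) (auto simp: oneH simp flip: \<rho>_mult)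
  qed (use \<rho>H in \<open>simp add: oneH\<close>)
  have "\<rho> \<in> hom G ?H"
    by (rule homI) (rule \<rho>H \<rho>_mult, assumption+)+
  hence "group_hom G ?H \<rho>"
    unfolding group_hom_def group_hom_axioms_def using grp is_group by blast
  then interpret gh: group_hom G ?H \<rho> .
  have "kernel G ?H \<rho> = Z"
  proof
    show "kernel G ?H \<rho> \<subseteq> Z"
    proof
      fix g assume "g \<in> kernel G ?H \<rho>"
      hence g: "g \<in> carrier G" "\<rho> g = \<rho> \<one>" unfolding kernel_def oneH by simp_all
      show "g \<in> Z"
      proof (rule trivial_on_fixed_field[OF Zs g(1)])
        fix x assume "x \<in> fixed_field Z"
        hence x: "x \<in> K" by (simp add: K_def)
        have "\<rho> g x = \<rho> \<one> x" using g by simp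
        thus "\<alpha> g x = x" using x KE \<alpha>_one by (auto simp: \<rho>_def)
      qed
    qed
    show "Z \<subseteq> kernel G ?H \<rho>"
    proof
      fix z assume z: "z \<in> Z"
      have "\<rho> z = \<rho> \<one>" unfolding \<rho>_def
        by (rule restrict_ext) (use z \<alpha>_one in \<open>auto simp: K_def fixed_field_def\<close>)
      thus "z \<in> kernel G ?H \<rho>" unfolding kernel_def oneH using z ZG by blast
    qed
  qed
  hence "G Mod Z \<cong> ?H" using gh.FactGroup_iso[OF surj] by simp
  thus "?H \<cong> G Mod Z"
    by (rule group.iso_sym[OF normal.factorgroup_is_group[OF Z]])
qed

section \<open>Galois actions from rings of functions on a group\<close>

text \<open>\<open>E\<close> consists of the values at the identity of fractions from
  \<open>R\<close>. By \<open>spread\<close>, a relation at the identity holds at every g, so moving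
  the evaluation point to g is a well defined automorphism, and \<open>transl\<close> keeps it
  inside \<open>E\<close>. That nothing beyond \<open>F\<close> is invariant comes from
  \<open>trace\<close>: if B is constant on the group and v has nonzero sum, the sums of B v and of
  v both lie in F c, and their quotient is the value of B.\<close>

lemma galois_action_of_function_ring:
  fixes G (structure) and R :: "('g \<Rightarrow> 'n :: field) set" and F :: "'n set"
  assumes G: "group G" "finite (carrier G)" and R: "function_ring R"
    and F: "subfld F" "infinite F" and const: "\<And>c. c \<in> F \<Longrightarrow> (\<lambda>_. c) \<in> R"
    and transl: "\<And>f g. f \<in> R \<Longrightarrow> g \<in> carrier G \<Longrightarrow> \<exists>f'\<in>R. \<forall>x\<in>carrier G. f' x = f (x \<otimes> g)"
    and spread: "\<And>f g. f \<in> R \<Longrightarrow> f \<one> = 0 \<Longrightarrow> g \<in> carrier G \<Longrightarrow> f g = 0"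
    and trace: "\<And>f. f \<in> R \<Longrightarrow> \<exists>a\<in>F. (\<Sum>g\<in>carrier G. f g) = a * c"
    and sep: "\<And>g. g \<in> carrier G \<Longrightarrow> g \<noteq> \<one> \<Longrightarrow> \<exists>f\<in>R. f g \<noteq> f \<one>"
  defines "E \<equiv> {f \<one> / h \<one> | f h. f \<in> R \<and> h \<in> R \<and> h \<one> \<noteq> 0}"
  shows "\<exists>\<alpha>. galois_action G E F \<alpha>"
    and "\<And>x. x \<in> E \<Longrightarrow> (\<And>f h g. f \<in> R \<Longrightarrow> h \<in> R \<Longrightarrow> f \<one> = x * h \<one> \<Longrightarrow> g \<in> carrier G \<Longrightarrow> f g = x * h g)
      \<Longrightarrow> x \<in> F"
proof -
  interpret group G by fact
  interpret R: function_ring R by fact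
  interpret F: subfield_set F by unfold_locales fact
  note fin = G(2)
  have nz: "h g \<noteq> 0" if h: "h \<in> R" "h \<one> \<noteq> 0" and g: "g \<in> carrier G" for h g
  proof
    assume "h g = 0"
    obtain h' where h': "h' \<in> R" "\<forall>x\<in>carrier G. h' x = h (x \<otimes> g)" using transl[OF h(1) g] by auto
    have "h' \<one> = 0" using h'(2) g \<open>h g = 0\<close> by simp
    hence "h' (inv g) = 0" using spread[OF h'(1)] g by simp
    thus False using h'(2) g h(2) by simp
  qed
  have cross: "f g / h g = f' g / h' g"
    if "f \<in> R" "h \<in> R" "f' \<in> R" "h' \<in> R" "h \<one> \<noteq> 0" "h' \<one> \<noteq> 0" "f \<one> / h \<one> = f' \<one> / h' \<one>" "g \<in> carrier G"
    for f h f' h' g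
  proof -
    have "(\<lambda>x. f x * h' x - f' x * h x) \<in> R" using that by (intro R.diff R.mult)
    moreover have "f \<one> * h' \<one> - f' \<one> * h \<one> = 0" using that by (simp add: field_simps)
    ultimately have "f g * h' g - f' g * h g = 0" using spread[of "\<lambda>x. f x * h' x - f' x * h x" g] that by simp
    thus ?thesis using nz[of h g] nz[of h' g] that by (simp add: field_simps)
  qed
  define \<alpha> where "\<alpha> g x = (SOME y. \<exists>f\<in>R. \<exists>h\<in>R. h \<one> \<noteq> 0 \<and> x = f \<one> / h \<one> \<and> y = f g / h g)" for g x
  have \<alpha>: "\<alpha> g (f \<one> / h \<one>) = f g / h g" if "f \<in> R" "h \<in> R" "h \<one> \<noteq> 0" "g \<in> carrier G" for f h g
  proof -
    have "\<exists>f'\<in>R. \<exists>h'\<in>R. h' \<one> \<noteq> 0 \<and> f \<one> / h \<one> = f' \<one> / h' \<one> \<and> \<alpha> g (f \<one> / h \<one>) = f' g / h' g"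
      unfolding \<alpha>_def by (rule someI_ex) (use that in blast)
    thus ?thesis using cross[of f h _ _ g] that by metis
  qed
  have Eelim: "\<exists>f\<in>R. \<exists>h\<in>R. h \<one> \<noteq> 0 \<and> x = f \<one> / h \<one>" if "x \<in> E" for x
    using that by (auto simp: E_def)
  have Eintro: "f \<one> / h \<one> \<in> E" if "f \<in> R" "h \<in> R" "h \<one> \<noteq> 0" for f h
    using that by (auto simp: E_def)
  have FE: "F \<subseteq> E"
  proof
    fix x assume "x \<in> F"
    thus "x \<in> E" using Eintro[OF const[of x] R.one] by simp
  qed
  have subE: "subfld E"
  proof (rule subfldI)
    show "1 \<in> E" "- 1 \<in> E" using FE F.one F.uminus[OF F.one] by auto
    fix x y assume x: "x \<in> E" and y: "y \<in> E"
    obtain f h where f: "f \<in> R" "h \<in> R" "h \<one> \<noteq> 0" "x = f \<one> / h \<one>" using Eelim[OF x] by auto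
    obtain f' h' where f': "f' \<in> R" "h' \<in> R" "h' \<one> \<noteq> 0" "y = f' \<one> / h' \<one>" using Eelim[OF y] by auto
    have "x + y = (f \<one> * h' \<one> + f' \<one> * h \<one>) / (h \<one> * h' \<one>)"
      unfolding f(4) f'(4) using f(3) f'(3) by (rule add_frac_eq)
    thus "x + y \<in> E"
      using Eintro[of "\<lambda>g. f g * h' g + f' g * h g" "\<lambda>g. h g * h' g"] f f' by (simp add: R.add R.mult)
    have "x * y = (f \<one> * f' \<one>) / (h \<one> * h' \<one>)" using f f' by simp
    thus "x * y \<in> E"
      using Eintro[of "\<lambda>g. f g * f' g" "\<lambda>g. h g * h' g"] f f' by (simp add: R.mult)
  next
    fix x assume x: "x \<in> E" "x \<noteq> 0"
    obtain f h where f: "f \<in> R" "h \<in> R" "h \<one> \<noteq> 0" "x = f \<one> / h \<one>" using Eelim[OF x(1)] by auto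
    thus "inverse x \<in> E" using Eintro[of h f] x(2) by auto
  qed
  have cl: "\<alpha> g x \<in> E" if gx: "g \<in> carrier G" "x \<in> E" for g x
  proof -
    obtain f h where f: "f \<in> R" "h \<in> R" "h \<one> \<noteq> 0" "x = f \<one> / h \<one>" using Eelim[OF gx(2)] by auto
    obtain f' where f': "f' \<in> R" "\<forall>x\<in>carrier G. f' x = f (x \<otimes> g)" using transl[OF f(1) gx(1)] by auto
    obtain h' where h': "h' \<in> R" "\<forall>x\<in>carrier G. h' x = h (x \<otimes> g)" using transl[OF f(2) gx(1)] by auto
    have "f' \<one> = f g" "h' \<one> = h g" using f' h' gx(1) by auto
    thus ?thesis using Eintro[of f' h'] f' h' \<alpha>[OF f(1-3) gx(1)] f(4) nz[OF f(2,3) gx(1)] by simp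
  qed
  have comp: "\<alpha> (g \<otimes> k) x = \<alpha> g (\<alpha> k x)" if gx: "g \<in> carrier G" "k \<in> carrier G" "x \<in> E" for g k x
  proof -
    obtain f h where f: "f \<in> R" "h \<in> R" "h \<one> \<noteq> 0" "x = f \<one> / h \<one>" using Eelim[OF gx(3)] by auto
    obtain f' where f': "f' \<in> R" "\<forall>x\<in>carrier G. f' x = f (x \<otimes> k)" using transl[OF f(1) gx(2)] by auto
    obtain h' where h': "h' \<in> R" "\<forall>x\<in>carrier G. h' x = h (x \<otimes> k)" using transl[OF f(2) gx(2)] by auto
    have eq: "f' \<one> = f k" "h' \<one> = h k" using f' h' gx(2) by auto
    have "\<alpha> k x = f' \<one> / h' \<one>" using \<alpha>[OF f(1-3) gx(2)] f(4) eq by simp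
    moreover have "h' \<one> \<noteq> 0" using eq nz[OF f(2,3) gx(2)] by simp
    ultimately have "\<alpha> g (\<alpha> k x) = f' g / h' g" using \<alpha>[OF f'(1) h'(1) _ gx(1)] by simp
    also have "\<dots> = f (g \<otimes> k) / h (g \<otimes> k)" using f' h' gx(1) by simp
    finally show ?thesis using \<alpha>[OF f(1-3), of "g \<otimes> k"] f(4) gx by simp
  qed
  have hom: "fhom E (\<alpha> g)" if g: "g \<in> carrier G" for g
    unfolding fhom_def
  proof (intro conjI ballI)
    show "\<alpha> g 1 = 1" using \<alpha>[OF R.one R.one _ g] by simp
    fix x y assume x: "x \<in> E" and y: "y \<in> E"
    obtain f h where f: "f \<in> R" "h \<in> R" "h \<one> \<noteq> 0" "x = f \<one> / h \<one>" using Eelim[OF x] by auto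
    obtain f' h' where f': "f' \<in> R" "h' \<in> R" "h' \<one> \<noteq> 0" "y = f' \<one> / h' \<one>" using Eelim[OF y] by auto
    have n: "h g \<noteq> 0" "h' g \<noteq> 0" using nz[OF f(2,3) g] nz[OF f'(2,3) g] by auto
    have e: "\<alpha> g x = f g / h g" "\<alpha> g y = f' g / h' g" using \<alpha>[OF f(1-3) g] \<alpha>[OF f'(1-3) g] f(4) f'(4) by auto
    have "x + y = (f \<one> * h' \<one> + f' \<one> * h \<one>) / (h \<one> * h' \<one>)"
      unfolding f(4) f'(4) using f(3) f'(3) by (rule add_frac_eq)
    moreover have "\<alpha> g ((f \<one> * h' \<one> + f' \<one> * h \<one>) / (h \<one> * h' \<one>)) = (f g * h' g + f' g * h g) / (h g * h' g)"
      using \<alpha>[of "\<lambda>g. f g * h' g + f' g * h g" "\<lambda>g. h g * h' g", OF _ _ _ g] f f' by (simp add: R.add R.mult)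
    ultimately show "\<alpha> g (x + y) = \<alpha> g x + \<alpha> g y" using e add_frac_eq[OF n, of "f g" "f' g"] by simp
    have "x * y = (f \<one> * f' \<one>) / (h \<one> * h' \<one>)" using f f' by simp
    moreover have "\<alpha> g ((f \<one> * f' \<one>) / (h \<one> * h' \<one>)) = (f g * f' g) / (h g * h' g)"
      using \<alpha>[of "\<lambda>g. f g * f' g" "\<lambda>g. h g * h' g", OF _ _ _ g] f f' by (simp add: R.mult)
    ultimately show "\<alpha> g (x * y) = \<alpha> g x * \<alpha> g y" using e by simp
  qed
  \<comment> \<open>If all sums over the group vanished, so would the sum of a function in
    \<open>R\<close> that is nonzero at the identity only; products of separating functions provide
    one.\<close>
  have "\<exists>v\<in>R. (\<Sum>g\<in>carrier G. v g) \<noteq> 0"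
  proof (rule ccontr)
    assume "\<not> (\<exists>v\<in>R. (\<Sum>g\<in>carrier G. v g) \<noteq> 0)"
    hence zero: "(\<Sum>g\<in>carrier G. f g) = 0" if "f \<in> R" for f using that by blast
    define \<phi> where "\<phi> h = (SOME f. f \<in> R \<and> f h \<noteq> f \<one>)" for h
    have \<phi>: "\<phi> h \<in> R" "\<phi> h h \<noteq> \<phi> h \<one>" if "h \<in> carrier G - {\<one>}" for h
    proof -
      have "\<exists>f. f \<in> R \<and> f h \<noteq> f \<one>" using sep[of h] that by blast
      hence "\<phi> h \<in> R \<and> \<phi> h h \<noteq> \<phi> h \<one>" unfolding \<phi>_def by (rule someI_ex)
      thus "\<phi> h \<in> R" "\<phi> h h \<noteq> \<phi> h \<one>" by auto
    qed
    have gen: "(\<Sum>g\<in>carrier G. f g * (\<Prod>h\<in>D. \<phi> h g - \<phi> h h)) = 0"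
      if "finite D" "D \<subseteq> carrier G - {\<one>}" "f \<in> R" for D f
      using that
    proof (induction D arbitrary: f)
      case empty
      thus ?case using zero by simp
    next
      case (insert k D)
      have "(\<Sum>g\<in>carrier G. f g * (\<Prod>h\<in>insert k D. \<phi> h g - \<phi> h h)) =
          (\<Sum>g\<in>carrier G. (f g * \<phi> k g) * (\<Prod>h\<in>D. \<phi> h g - \<phi> h h)) -
          \<phi> k k * (\<Sum>g\<in>carrier G. f g * (\<Prod>h\<in>D. \<phi> h g - \<phi> h h))"
        using insert.hyps by (simp add: sum_subtractf sum_distrib_left algebra_simps)
      also have "\<dots> = 0"
        using insert.IH[of "\<lambda>g. f g * \<phi> k g"] insert.IH[of f] insert.prems \<phi>(1)[of k] by (simp add: R.mult)
      finally show ?case .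
    qed
    have "0 = (\<Sum>g\<in>carrier G. \<Prod>h\<in>carrier G - {\<one>}. \<phi> h g - \<phi> h h)"
      using gen[of "carrier G - {\<one>}" "\<lambda>_. 1"] fin R.one by simp
    also have "\<dots> = (\<Sum>g\<in>{\<one>}. \<Prod>h\<in>carrier G - {\<one>}. \<phi> h g - \<phi> h h)"
      by (rule sum.mono_neutral_right) (use fin in \<open>auto simp: prod_zero_iff\<close>)
    finally have "(\<Prod>h\<in>carrier G - {\<one>}. \<phi> h \<one> - \<phi> h h) = 0" by simp
    then obtain h where "h \<in> carrier G - {\<one>}" "\<phi> h \<one> = \<phi> h h" using fin by (auto simp: prod_zero_iff)
    thus False using \<phi>(2)[of h] by simp
  qed
  then obtain v where v: "v \<in> R" "(\<Sum>g\<in>carrier G. v g) \<noteq> 0" by blast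
  have inv_const: "B \<one> \<in> F" if B: "B \<in> R" "\<And>g. g \<in> carrier G \<Longrightarrow> B g = B \<one>" for B
  proof -
    obtain a where a: "a \<in> F" "(\<Sum>g\<in>carrier G. v g) = a * c" using trace[OF v(1)] by auto
    obtain b where b: "b \<in> F" "(\<Sum>g\<in>carrier G. B g * v g) = b * c" using trace[OF R.mult[OF B(1) v(1)]] by auto
    have "b * c = (\<Sum>g\<in>carrier G. B \<one> * v g)"
      unfolding b(2)[symmetric]
    proof (rule sum.cong[OF refl])
      fix g assume g: "g \<in> carrier G"
      show "B g * v g = B \<one> * v g" unfolding B(2)[OF g] ..
    qed
    hence "b * c = B \<one> * (a * c)"
      by (simp only: a(2) flip: sum_distrib_left)
    moreover have "a \<noteq> 0" "c \<noteq> 0" using a(2) v(2) by auto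
    ultimately have "B \<one> * a = b" by (metis mult.assoc mult_right_cancel)
    hence "B \<one> = b / a" using \<open>a \<noteq> 0\<close> by (metis nonzero_mult_div_cancel_right)
    thus ?thesis using a b F.divide by simp
  qed
  have fixed: "x \<in> F" if x: "x \<in> E" "\<And>g. g \<in> carrier G \<Longrightarrow> \<alpha> g x = x" for x
  proof -
    obtain f h where f: "f \<in> R" "h \<in> R" "h \<one> \<noteq> 0" "x = f \<one> / h \<one>" using Eelim[OF x(1)] by auto
    define \<tau> where "\<tau> g = (SOME h'. h' \<in> R \<and> (\<forall>x\<in>carrier G. h' x = h (x \<otimes> g)))" for g
    have \<tau>: "\<tau> g \<in> R" "\<And>x. x \<in> carrier G \<Longrightarrow> \<tau> g x = h (x \<otimes> g)" if "g \<in> carrier G" for g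
    proof -
      have "\<exists>h'. h' \<in> R \<and> (\<forall>x\<in>carrier G. h' x = h (x \<otimes> g))" using transl[OF f(2) that] by blast
      hence "\<tau> g \<in> R \<and> (\<forall>x\<in>carrier G. \<tau> g x = h (x \<otimes> g))"
        unfolding \<tau>_def by (rule someI_ex)
      thus "\<tau> g \<in> R" "\<And>x. x \<in> carrier G \<Longrightarrow> \<tau> g x = h (x \<otimes> g)" by auto
    qed
    \<comment> \<open>The denominator is replaced by its norm, the product of its translates, which
      is constant on the group. The numerator \<open>A\<close> is adjusted accordingly and is x
      times this constant.\<close>
    define H where "H y = (\<Prod>g\<in>carrier G. \<tau> g y)" for y
    define A where "A y = f y * (\<Prod>g\<in>carrier G - {\<one>}. \<tau> g y)" for y
    have HR: "H \<in> R" unfolding H_def[abs_def] by (intro R.prod \<tau>)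
    have AR: "A \<in> R" unfolding A_def[abs_def] by (intro R.prod R.mult f \<tau>) auto
    have Hk: "H k = (\<Prod>g\<in>carrier G. h g)" if k: "k \<in> carrier G" for k
    proof -
      have "H k = (\<Prod>g\<in>carrier G. h (k \<otimes> g))" unfolding H_def by (rule prod.cong) (use \<tau> k in auto)
      also have "\<dots> = (\<Prod>g\<in>carrier G. h g)"
        by (rule prod.reindex_bij_witness[where i = "\<lambda>g. inv k \<otimes> g" and j = "\<lambda>g. k \<otimes> g"])
           (use k in \<open>auto simp flip: m_assoc\<close>)
      finally show ?thesis .
    qed
    have H1: "H \<one> \<noteq> 0" using Hk[OF one_closed] nz[OF f(2,3)] fin by (simp add: prod_zero_iff)
    have Ak: "A k = x * H k" if k: "k \<in> carrier G" for k
    proof -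
      have "H k = h k * (\<Prod>g\<in>carrier G - {\<one>}. \<tau> g k)"
        unfolding H_def using fin \<tau>(2)[OF one_closed k] k by (simp add: prod.remove[of _ \<one>])
      moreover have "f k = x * h k" using x(2)[OF k] \<alpha>[OF f(1-3) k] f(4) nz[OF f(2,3) k] by (simp add: field_simps)
      ultimately show ?thesis by (simp add: A_def)
    qed
    have "H \<one> \<in> F" by (rule inv_const[OF HR]) (simp add: Hk)
    moreover have "A \<one> \<in> F" by (rule inv_const[OF AR]) (simp add: Ak Hk)
    moreover have "x = A \<one> / H \<one>" using Ak[OF one_closed] H1 by simp
    ultimately show ?thesis using F.divide by simp
  qed
  have "galois_action G E F \<alpha>"
  proof (unfold_locales, goal_cases)
    case 1 show ?case by (rule fin)
  next
    case 2 show ?case by (rule subE)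
  next
    case 3 show ?case by (rule F)
  next
    case 4 show ?case by (rule FE)
  next
    case 5 show ?case by (rule F)
  next
    case (6 g x) thus ?case by (rule cl)
  next
    case (7 g) thus ?case by (rule hom)
  next
    case (8 g h x) thus ?case by (rule comp)
  next
    case (9 x)
    then obtain f h where "f \<in> R" "h \<in> R" "h \<one> \<noteq> 0" "x = f \<one> / h \<one>" using Eelim by blast
    thus ?case using \<alpha>[of f h \<one>] by simp
  next
    case (10 x)
    have "\<alpha> g x = x" if "x \<in> F" "g \<in> carrier G" for g
      using \<alpha>[OF const[OF that(1)] R.one _ that(2)] by simp
    thus ?case using fixed[of x] FE by auto
  next
    case (11 g)
    show ?case
    proof (rule ccontr)
      assume "g \<noteq> \<one>"
      then obtain f where f: "f \<in> R" "f g \<noteq> f \<one>" using sep[OF 11(1)] by auto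
      have "\<alpha> g (f \<one> / 1) = f \<one> / 1" using 11(2)[of "f \<one> / 1"] Eintro[OF f(1) R.one] by simp
      thus False using \<alpha>[OF f(1) R.one _ 11(1)] f(2) by simp
    qed
  qed
  thus "\<exists>\<alpha>. galois_action G E F \<alpha>" by blast
  \<comment> \<open>An element that may be treated as a constant in all relations is fixed by the
    group. The criterion will be applied to series with constant coefficients.\<close>
  fix x assume x: "x \<in> E" "\<And>f h g. f \<in> R \<Longrightarrow> h \<in> R \<Longrightarrow> f \<one> = x * h \<one> \<Longrightarrow> g \<in> carrier G \<Longrightarrow> f g = x * h g"
  show "x \<in> F"
  proof (rule fixed[OF x(1)])
    fix g assume g: "g \<in> carrier G"
    obtain f h where f: "f \<in> R" "h \<in> R" "h \<one> \<noteq> 0" "x = f \<one> / h \<one>" using Eelim[OF x(1)] by auto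
    hence "f g = x * h g" using x(2)[of f h g] g by simp
    thus "\<alpha> g x = x" using \<alpha>[OF f(1-3) g] f(4) nz[OF f(2,3) g] by simp
  qed
qed

section \<open>Sums over finite vector spaces\<close>

text \<open>x^m - 1 has at most m roots, so some nonzero v in \<open>K\<close> has v^m different
  from 1; multiplication by v permutes \<open>K\<close> and multiplies the sum by v^m. For m = 0
  every term is 1, also at 0, and the sum is the cardinality.\<close>

lemma power_sum_zero:
  fixes \<kappa> :: "'c :: field \<Rightarrow> 'n :: field"
  assumes \<kappa>: "coeff_hom \<kappa>" "inj \<kappa>" and K: "finite K" "\<And>x y. x \<in> K \<Longrightarrow> y \<in> K \<Longrightarrow> x * y \<in> K"
    "\<And>x. x \<in> K \<Longrightarrow> inverse x \<in> K" and char: "of_nat (card K) = (0 :: 'n)" and m: "m < card K - 1"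
  shows "(\<Sum>v\<in>K. \<kappa> v ^ m) = 0"
proof (cases "m = 0")
  case False
  interpret coeff_hom \<kappa> by fact
  let ?P = "Polynomial.monom 1 m - 1 :: 'c poly"
  have P0: "?P \<noteq> 0"
  proof
    assume "?P = 0"
    hence "Polynomial.coeff ?P m = 0" by simp
    thus False using False by simp
  qed
  have "Polynomial.degree ?P \<le> m" by (rule degree_diff_le) (auto simp: degree_monom_le)
  hence "card {x. poly ?P x = 0} \<le> m" using card_poly_roots_bound[OF P0] by linarith
  moreover have "card (K - {0}) \<ge> card K - 1" using K(1) by (cases "0 \<in> K") auto
  ultimately have "\<not> K - {0} \<subseteq> {x. poly ?P x = 0}"
    using m card_mono[OF poly_roots_finite[OF P0], of "K - {0}"] by linarith
  then obtain v where v: "v \<in> K" "v \<noteq> 0" "v ^ m \<noteq> 1" by (auto simp: poly_monom)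
  have "(\<Sum>x\<in>K. \<kappa> x ^ m) = (\<Sum>x\<in>K. \<kappa> (v * x) ^ m)"
    by (rule sum.reindex_bij_witness[where i = "\<lambda>x. v * x" and j = "\<lambda>x. inverse v * x"])
       (use v K in \<open>auto simp: mult.assoc[symmetric]\<close>)
  also have "\<dots> = \<kappa> v ^ m * (\<Sum>x\<in>K. \<kappa> x ^ m)"
    by (simp add: h_mult power_mult_distrib sum_distrib_left)
  finally have "(\<kappa> v ^ m - 1) * (\<Sum>x\<in>K. \<kappa> x ^ m) = 0" by (simp add: algebra_simps)
  moreover have "\<kappa> v ^ m \<noteq> 1"
  proof
    assume "\<kappa> v ^ m = 1"
    hence "\<kappa> (v ^ m) = \<kappa> 1" by (simp add: h_power)
    thus False using v(3) injD[OF \<kappa>(2)] by blast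
  qed
  ultimately show ?thesis by simp
qed (use char in simp)

lemma sum_PiE_insert:
  assumes "finite I" "k \<notin> I" "finite K"
  shows "(\<Sum>v\<in>PiE (insert k I) (\<lambda>_. K). f v) = (\<Sum>x\<in>K. \<Sum>v\<in>PiE I (\<lambda>_. K). f (v(k := x)))"
proof -
  have "(\<Sum>v\<in>PiE (insert k I) (\<lambda>_. K). f v) = (\<Sum>(x, v)\<in>K \<times> PiE I (\<lambda>_. K). f (v(k := x)))"
    unfolding PiE_insert_eq using inj_combinator[OF assms(2), of "\<lambda>_. K"]
    by (subst sum.reindex) (auto simp: case_prod_unfold)
  thus ?thesis by (simp add: sum.cartesian_product)
qed

text \<open>Expand the product in the variable \<open>k\<close>, with \<open>U\<close> the set of
  factors that contribute it. If \<open>U\<close> has fewer than |K| - 1 elements, the power sum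
  vanishes; otherwise so few factors are left that the induction hypothesis covers the other
  variables.\<close>

lemma chevalley_warning:
  fixes \<kappa> :: "'c :: field \<Rightarrow> 'n :: field"
  assumes \<kappa>: "coeff_hom \<kappa>" "inj \<kappa>" and K: "finite K" "\<And>x y. x \<in> K \<Longrightarrow> y \<in> K \<Longrightarrow> x * y \<in> K"
    "\<And>x. x \<in> K \<Longrightarrow> inverse x \<in> K" and char: "of_nat (card K) = (0 :: 'n)"
    and "finite I" "finite J" "card J < card I * (card K - 1)"
  shows "(\<Sum>v\<in>PiE I (\<lambda>_. K). \<Prod>j\<in>J. \<Sum>k\<in>I. \<kappa> (v k) * L j k) = 0"
  using assms(7-)
proof (induction I arbitrary: J)
  case (insert k I)
  let ?S = "\<lambda>J. \<Sum>v\<in>PiE I (\<lambda>_. K). \<Prod>j\<in>J. \<Sum>k\<in>I. \<kappa> (v k) * L j k"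
  have "(\<Sum>v\<in>PiE (insert k I) (\<lambda>_. K). \<Prod>j\<in>J. \<Sum>l\<in>insert k I. \<kappa> (v l) * L j l) =
      (\<Sum>x\<in>K. \<Sum>v\<in>PiE I (\<lambda>_. K). \<Prod>j\<in>J. \<kappa> x * L j k + (\<Sum>l\<in>I. \<kappa> (v l) * L j l))"
  proof -
    have "(\<Sum>l\<in>I. \<kappa> ((v(k := x)) l) * L j l) = (\<Sum>l\<in>I. \<kappa> (v l) * L j l)" for v x j
      by (rule sum.cong) (use insert.hyps in auto)
    thus ?thesis using insert.hyps K(1) by (simp add: sum_PiE_insert)
  qed
  also have "\<dots> = (\<Sum>x\<in>K. \<Sum>v\<in>PiE I (\<lambda>_. K). \<Sum>U\<in>Pow J. \<kappa> x ^ card U * (\<Prod>j\<in>U. L j k) *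
      (\<Prod>j\<in>J - U. \<Sum>l\<in>I. \<kappa> (v l) * L j l))"
    using insert.prems by (simp add: prod_add prod.distrib)
  also have "\<dots> = (\<Sum>x\<in>K. \<Sum>U\<in>Pow J. \<Sum>v\<in>PiE I (\<lambda>_. K). \<kappa> x ^ card U * (\<Prod>j\<in>U. L j k) *
      (\<Prod>j\<in>J - U. \<Sum>l\<in>I. \<kappa> (v l) * L j l))"
    by (intro sum.cong refl sum.swap)
  also have "\<dots> = (\<Sum>U\<in>Pow J. \<Sum>x\<in>K. \<Sum>v\<in>PiE I (\<lambda>_. K). \<kappa> x ^ card U * (\<Prod>j\<in>U. L j k) *
      (\<Prod>j\<in>J - U. \<Sum>l\<in>I. \<kappa> (v l) * L j l))"
    by (rule sum.swap)
  also have "\<dots> = (\<Sum>U\<in>Pow J. (\<Sum>x\<in>K. \<kappa> x ^ card U) * (\<Prod>j\<in>U. L j k) * ?S (J - U))"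
    by (intro sum.cong refl, subst sum_product[symmetric]) (simp only: sum_distrib_right)
  also have "\<dots> = 0"
  proof (rule sum.neutral, safe)
    fix U assume U: "U \<subseteq> J"
    show "(\<Sum>x\<in>K. \<kappa> x ^ card U) * (\<Prod>j\<in>U. L j k) * ?S (J - U) = 0"
    proof (cases "card U < card K - 1")
      case True
      thus ?thesis using power_sum_zero[OF \<kappa> K char True] by simp
    next
      case False
      have "card (J - U) = card J - card U"
        using U insert.prems by (simp add: card_Diff_subset finite_subset)
      also have "\<dots> < card I * (card K - 1)"
        using False insert.prems insert.hyps card_mono[OF insert.prems(1) U] by (auto simp: algebra_simps)
      finally have "?S (J - U) = 0" using insert.IH[of "J - U"] insert.prems by simp
      thus ?thesis by simp
    qed
  qed
  finally show ?case .
qed simp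

text \<open>By \<open>red\<close>, a factor z^q is replaced by a linear form, which lowers the total
  degree, so every monomial reduces to exponents at most q - 1. Of these, only the monomial with all
  exponents equal to q - 1 escapes \<open>vanish\<close>, and its sum is c.\<close>

lemma trace_line:
  fixes z :: "'i \<Rightarrow> 'x \<Rightarrow> 'n :: field" and F :: "'n set" and U :: "'x set"
  assumes F: "subfld F" and I: "finite I" and q: "q > 1"
    and red: "\<And>a. a \<in> I \<Longrightarrow> \<exists>M. (\<forall>b\<in>I. M b \<in> F) \<and> (\<forall>v\<in>U. z a v ^ q = (\<Sum>b\<in>I. M b * z b v))"
    and vanish: "\<And>e :: 'i \<Rightarrow> nat. (\<Sum>a\<in>I. e a) < card I * (q - 1) \<Longrightarrow> (\<Sum>v\<in>U. \<Prod>a\<in>I. z a v ^ e a) = 0"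
  shows "\<exists>c. \<forall>f\<in>alg F (z ` I). \<exists>a\<in>F. (\<Sum>v\<in>U. f v) = a * c"
proof -
  interpret F: subfield_set F by unfold_locales fact
  define mon where "mon e v = (\<Prod>a\<in>I. z a v ^ e a)" for e :: "'i \<Rightarrow> nat" and v
  define c where "c = (\<Sum>v\<in>U. mon (\<lambda>_. q - 1) v)"
  define L where "L = {a * c | a. a \<in> F}"
  have L_add: "x + y \<in> L" if "x \<in> L" "y \<in> L" for x y
    using that F.add by (auto simp: L_def simp flip: distrib_right)
  have L_scale: "s * x \<in> L" if "s \<in> F" "x \<in> L" for s x
    using that F.mult by (auto simp: L_def simp flip: mult.assoc)
  have L_0: "0 \<in> L" using F.zero by (auto simp: L_def)
  have L_sum: "(\<Sum>b\<in>B. g b) \<in> L" if "\<And>b. b \<in> B \<Longrightarrow> g b \<in> L" for B :: "'i set" and g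
    using that by (induction B rule: infinite_finite_induct) (auto intro: L_0 L_add)
  have mon_mult: "z a v * mon e v = mon (e(a := Suc (e a))) v" if "a \<in> I" for a e v
    using that I by (simp add: mon_def prod.remove[of I a])
  have mon_in: "(\<Sum>v\<in>U. mon e v) \<in> L" for e
  proof (induction "\<Sum>a\<in>I. e a" arbitrary: e rule: less_induct)
    case less
    show ?case
    proof (cases "\<exists>a\<in>I. e a \<ge> q")
      case True
      then obtain a where a: "a \<in> I" "e a \<ge> q" by auto
      obtain M where M: "\<And>b. b \<in> I \<Longrightarrow> M b \<in> F" "\<And>v. v \<in> U \<Longrightarrow> z a v ^ q = (\<Sum>b\<in>I. M b * z b v)"
        using red[OF a(1)] by auto
      define e' where "e' = e(a := e a - q)"
      have split: "mon e v = z a v ^ q * mon e' v" for v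
      proof -
        have "z a v ^ e a = z a v ^ q * z a v ^ (e a - q)" using a(2) by (simp flip: power_add)
        moreover have "(\<Prod>b\<in>I - {a}. z b v ^ e' b) = (\<Prod>b\<in>I - {a}. z b v ^ e b)"
          by (rule prod.cong) (auto simp: e'_def)
        ultimately show ?thesis using a(1) I by (simp add: mon_def prod.remove[of I a] e'_def)
      qed
      have "(\<Sum>v\<in>U. mon e v) = (\<Sum>v\<in>U. \<Sum>b\<in>I. M b * mon (e'(b := Suc (e' b))) v)"
        by (rule sum.cong[OF refl]) (simp add: split M(2) sum_distrib_right mult.assoc mon_mult)
      also have "\<dots> = (\<Sum>b\<in>I. M b * (\<Sum>v\<in>U. mon (e'(b := Suc (e' b))) v))"
        by (subst sum.swap) (simp add: sum_distrib_left)
      also have "\<dots> \<in> L"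
      proof (intro L_sum L_scale M(1))
        fix b assume b: "b \<in> I"
        have "(\<Sum>i\<in>I. (e'(b := Suc (e' b))) i) = Suc (\<Sum>i\<in>I. e' i)"
          using b I by (simp add: sum.remove[of I b])
        moreover have "(\<Sum>i\<in>I. e' i) + q = (\<Sum>i\<in>I. e i)"
          using a I by (simp add: sum.remove[of I a] e'_def)
        ultimately have "(\<Sum>i\<in>I. (e'(b := Suc (e' b))) i) < (\<Sum>i\<in>I. e i)" using q by linarith
        thus "(\<Sum>v\<in>U. mon (e'(b := Suc (e' b))) v) \<in> L" by (rule less)
      qed
      finally show ?thesis .
    next
      case False
      hence le: "e a \<le> q - 1" if "a \<in> I" for a using that by fastforce
      show ?thesis
      proof (cases "\<forall>a\<in>I. e a = q - 1")
        case True
        hence "mon e v = mon (\<lambda>_. q - 1) v" for v unfolding mon_def by (intro prod.cong) auto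
        hence "(\<Sum>v\<in>U. mon e v) = 1 * c" by (simp add: c_def)
        thus ?thesis using F.one unfolding L_def by blast
      next
        case False
        then obtain a where "a \<in> I" "e a < q - 1" using le by (meson le_neq_implies_less)
        hence "(\<Sum>a\<in>I. e a) < (\<Sum>a\<in>I. q - 1)" using le I by (intro sum_strict_mono_ex1) auto
        hence "(\<Sum>v\<in>U. mon e v) = 0" unfolding mon_def by (intro vanish) simp
        thus ?thesis using L_0 by simp
      qed
    qed
  qed
  \<comment> \<open>The induction over \<open>alg\<close> needs an invariant that respects products:
    \<open>W\<close> collects the functions whose products with all monomials have sums on the line,
    and each element of the algebra maps \<open>W\<close> into itself.\<close>
  define W where "W = {h. \<forall>e. (\<Sum>v\<in>U. h v * mon e v) \<in> L}"
  have "\<forall>h\<in>W. (\<lambda>v. f v * h v) \<in> W" if "f \<in> alg F (z ` I)" for f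
    using that
  proof (induction rule: alg.induct)
    case (const s)
    thus ?case by (auto simp: W_def mult.assoc intro: L_scale simp flip: sum_distrib_left)
  next
    case (gen f)
    then obtain a where a: "a \<in> I" "f = z a" by auto
    have eq: "f v * h v * mon e v = h v * mon (e(a := Suc (e a))) v" for h e v
      using mon_mult[OF a(1), of v e] a(2) by (simp add: mult_ac)
    show ?case by (simp only: W_def mem_Collect_eq eq) blast
  next
    case (add f g)
    thus ?case by (simp add: W_def distrib_right sum.distrib L_add)
  next
    case (mult f g)
    thus ?case by (auto simp: mult.assoc)
  qed
  moreover have "(\<lambda>_. 1) \<in> W" using mon_in by (simp add: W_def)
  ultimately have "f \<in> W" if "f \<in> alg F (z ` I)" for f using that by fastforce
  hence "(\<Sum>v\<in>U. f v * mon (\<lambda>_. 0) v) \<in> L" if "f \<in> alg F (z ` I)" for f using that unfolding W_def by blast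
  hence "(\<Sum>v\<in>U. f v) \<in> L" if "f \<in> alg F (z ` I)" for f using that by (simp add: mon_def)
  thus ?thesis by (intro exI[of _ c] ballI) (auto simp: L_def)
qed

section \<open>The solution torsor of a Frobenius system\<close>

text \<open>The i-th matrix results from one matrix of polynomials \<open>P\<close> over
  \<open>F\<close> by inserting the conjugate \<theta>^(q^i); this expresses that the system is
  defined over \<open>F\<close>. Of the constants, \<open>F\<close> is only assumed to contain the
  field with q elements.\<close>

locale frob_torsor =
  fixes \<kappa> :: "'c :: field \<Rightarrow> 'n :: field" and q d r :: nat and \<theta> :: 'c and F :: "'n set"
    and A Y :: "nat \<Rightarrow> 'n mat" and P :: "nat \<Rightarrow> nat \<Rightarrow> 'n poly"
  assumes \<kappa>: "coeff_hom \<kappa>" and q1: "q > 1" and d0: "d > 0" and r0: "r > 0"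
    and addc: "(x + y :: 'c) ^ q = x ^ q + y ^ q" and addn: "(u + v :: 'n) ^ q = u ^ q + v ^ q"
    and cardq: "card {x :: 'c. x ^ q = x} = q" and cardQ: "card {x :: 'c. x ^ (q ^ d) = x} = q ^ d"
    and \<theta>Q: "\<theta> ^ (q ^ d) = \<theta>" and \<theta>inj: "inj_on (\<lambda>i. \<theta> ^ (q ^ i)) {..<d}"
    and charn: "of_nat q = (0 :: 'n)"
    and F: "subfld F" and Fq: "x ^ q = x \<Longrightarrow> \<kappa> x \<in> F"
    and A: "i < d \<Longrightarrow> A i \<in> carrier_mat r r"
    and AP: "i < d \<Longrightarrow> j < r \<Longrightarrow> l < r \<Longrightarrow> A i $$ (j, l) = poly (P j l) (\<kappa> (\<theta> ^ (q ^ i)))"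
    and P: "j < r \<Longrightarrow> l < r \<Longrightarrow> P j l \<in> coeffs_in F"
    and Y: "i < d \<Longrightarrow> Y i \<in> carrier_mat r r" and detY: "i < d \<Longrightarrow> det (Y i) = 1"
    and sys: "i < d \<Longrightarrow> frobM q (Y (cpred d i)) = A i * Y i"
begin

sublocale K: coeff_hom \<kappa> by (rule \<kappa>)
sublocale F: subfield_set F by unfold_locales (rule F)

abbreviation "Gq \<equiv> {x :: 'c. x ^ q = x}"
abbreviation "GQ \<equiv> {x :: 'c. x ^ (q ^ d) = x}"

definition "Mat = {V \<in> carrier_mat r r. \<forall>l<r. \<forall>m<r. V $$ (l, m) \<in> GQ}"

definition lift :: "nat \<Rightarrow> 'c mat \<Rightarrow> 'n mat"
  where "lift i V = map_mat (\<lambda>x. \<kappa> x ^ (q ^ i)) V"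

text \<open>Further solutions, obtained from \<open>Y\<close> by a matrix over the field with q^d
  elements. The twist by q^i makes the cycle of components consistent.\<close>

definition yv :: "nat \<Rightarrow> 'c mat \<Rightarrow> 'n mat"
  where "yv i V = Y i * lift i V"

text \<open>
  Unlike the entries of \<open>yv\<close>, their traces \<open>zc\<close> over the conjugates satisfy relations
  over \<open>F\<close>: the \<open>q\<close>-th power of a trace is an \<open>F\<close>-linear combination of traces.
\<close>

definition zc :: "'c \<Rightarrow> nat \<Rightarrow> nat \<Rightarrow> 'c mat \<Rightarrow> 'n"
  where "zc c j m V = (\<Sum>i<d. \<kappa> c ^ (q ^ i) * yv i V $$ (j, m))"

definition "Ind = {..<d} \<times> {..<r} \<times> {..<r}"

text \<open>The traces against 1, \<theta>, ..., \<theta>^(d-1) span all others over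
  \<open>F\<close>. Their number d r^2 is also the number of coordinates of a matrix over the field
  with q elements, which makes the degree bounds in \<open>trace_line\<close> and
  \<open>chevalley_warning\<close> match.\<close>

definition zI :: "nat \<times> nat \<times> nat \<Rightarrow> 'c mat \<Rightarrow> 'n"
  where "zI = (\<lambda>(k, j, m). zc (\<theta> ^ k) j m)"

definition "R = alg F (zI ` Ind)"

section \<open>The fields with q and with q^d elements\<close>

lemma q0: "q > 0" using q1 by simp

lemma addc_pow: "(x + y :: 'c) ^ (q ^ i) = x ^ (q ^ i) + y ^ (q ^ i)"
  by (rule additive_power_power[OF addc])

lemma addn_pow: "(x + y :: 'n) ^ (q ^ i) = x ^ (q ^ i) + y ^ (q ^ i)"
  by (rule additive_power_power[OF addn])

lemma pow_pos: "q ^ i > 0" using q0 by simp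

lemma sumc_pow: "(\<Sum>i\<in>I. f i :: 'c) ^ (q ^ n) = (\<Sum>i\<in>I. f i ^ (q ^ n))"
  by (rule additive_power_sum[OF addc_pow pow_pos])

lemma sumn_pow: "(\<Sum>i\<in>I. f i :: 'n) ^ (q ^ n) = (\<Sum>i\<in>I. f i ^ (q ^ n))"
  by (rule additive_power_sum[OF addn_pow pow_pos])

lemma \<kappa>_eq_iff: "\<kappa> x = \<kappa> y \<longleftrightarrow> x = y"
proof
  assume "\<kappa> x = \<kappa> y"
  hence 0: "\<kappa> (x - y) = 0" by (simp add: K.h_diff)
  show "x = y"
  proof (rule ccontr)
    assume "x \<noteq> y"
    hence "\<kappa> ((x - y) * inverse (x - y)) = 1" by simp
    thus False using 0 unfolding K.h_mult by simp
  qed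
qed simp

lemma inj_\<kappa>: "inj \<kappa>"
  using \<kappa>_eq_iff by (auto simp: inj_def)

lemma GqD: "x \<in> Gq \<Longrightarrow> x ^ (q ^ i) = x"
  by (induction i) (auto simp: power_mult)

lemma Gq_sub: "Gq \<subseteq> GQ" using GqD by auto

lemma GQ_fld: "x \<in> GQ \<Longrightarrow> y \<in> GQ \<Longrightarrow> x * y \<in> GQ" "x \<in> GQ \<Longrightarrow> inverse x \<in> GQ" "1 \<in> GQ"
  "x \<in> GQ \<Longrightarrow> x ^ n \<in> GQ"
proof -
  assume x: "x \<in> GQ"
  have "(x ^ n) ^ (q ^ d) = (x ^ (q ^ d)) ^ n" by (simp only: power_mult[symmetric] mult.commute)
  thus "x ^ n \<in> GQ" using x by simp
qed (simp_all add: power_mult_distrib power_inverse)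

lemma GQ_sum: "(\<And>i. i \<in> I \<Longrightarrow> f i \<in> GQ) \<Longrightarrow> (\<Sum>i\<in>I. f i) \<in> GQ"
  by (simp add: sumc_pow)

lemma Gq_fld: "x \<in> Gq \<Longrightarrow> y \<in> Gq \<Longrightarrow> x * y \<in> Gq" "x \<in> Gq \<Longrightarrow> inverse x \<in> Gq"
  by (auto simp: power_mult_distrib power_inverse)

lemma finGq: "finite Gq" using cardq q0 by (metis card.infinite less_numeral_extra(3))
lemma finGQ: "finite GQ" using cardQ pow_pos by (metis card.infinite less_numeral_extra(3))

lemma \<theta>_GQ: "\<theta> ^ k \<in> GQ" by (rule GQ_fld(4)) (use \<theta>Q in simp)

text \<open>A polynomial over the field with q elements that vanishes at \<theta> vanishes at its d
  distinct conjugates, so in degree below d it is zero.\<close>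

lemma basis_unique:
  assumes "\<And>k. k < d \<Longrightarrow> v k \<in> Gq" "\<And>k. k < d \<Longrightarrow> w k \<in> Gq"
    and "(\<Sum>k<d. v k * \<theta> ^ k) = (\<Sum>k<d. w k * \<theta> ^ k)" and "k < d"
  shows "v k = w k"
proof -
  define p where "p = (\<Sum>k<d. Polynomial.monom (v k - w k) k)"
  have cp: "Polynomial.coeff p k = (if k < d then v k - w k else 0)" for k
    by (simp add: p_def coeff_sum)
  have "p = 0"
  proof (rule poly_eqI_degree[of "(\<lambda>i. \<theta> ^ (q ^ i)) ` {..<d}"])
    fix x assume "x \<in> (\<lambda>i. \<theta> ^ (q ^ i)) ` {..<d}"
    then obtain i where x: "x = \<theta> ^ (q ^ i)" by auto
    have "poly p x = (\<Sum>k<d. (v k - w k) * (\<theta> ^ k) ^ (q ^ i))"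
      by (simp add: p_def poly_sum poly_monom x mult.commute flip: power_mult)
    also have "\<dots> = (\<Sum>k<d. (v k * \<theta> ^ k) ^ (q ^ i)) - (\<Sum>k<d. (w k * \<theta> ^ k) ^ (q ^ i))"
      using assms(1,2) GqD by (simp add: power_mult_distrib left_diff_distrib sum_subtractf)
    also have "\<dots> = 0" using assms(3) by (simp flip: sumc_pow)
    finally show "poly p x = poly 0 x" by simp
  next
    have "Polynomial.degree p \<le> d - 1" by (rule degree_le) (use d0 in \<open>auto simp: cp\<close>)
    thus "Polynomial.degree p < card ((\<lambda>i. \<theta> ^ (q ^ i)) ` {..<d})"
      "Polynomial.degree 0 < card ((\<lambda>i. \<theta> ^ (q ^ i)) ` {..<d})"
      using d0 card_image[OF \<theta>inj] by auto
  qed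
  thus ?thesis using cp[of k] \<open>k < d\<close> by simp
qed

text \<open>The q^d combinations are distinct elements of a set with q^d elements, so they exhaust
  it.\<close>

lemma basis_exists:
  assumes "c \<in> GQ"
  shows "\<exists>v\<in>PiE {..<d} (\<lambda>_. Gq). c = (\<Sum>k<d. v k * \<theta> ^ k)"
proof -
  let ?f = "\<lambda>v. \<Sum>k<d. v k * \<theta> ^ k"
  let ?D = "PiE {..<d} (\<lambda>_. Gq)"
  have "inj_on ?f ?D"
  proof (rule inj_onI)
    fix v w assume v: "v \<in> ?D" and w: "w \<in> ?D" and "?f v = ?f w"
    hence "v k = w k" if "k < d" for k
      using basis_unique[of v w k] that by (auto simp: PiE_def Pi_def)
    thus "v = w" using v w by (intro PiE_ext[OF v w]) auto
  qed
  hence "card (?f ` ?D) = q ^ d" using cardq by (simp add: card_image card_PiE)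
  moreover have "?f ` ?D \<subseteq> GQ"
  proof
    fix x assume "x \<in> ?f ` ?D"
    then obtain v where v: "v \<in> ?D" "x = ?f v" by auto
    have "v k * \<theta> ^ k \<in> GQ" if "k < d" for k
      using v that Gq_sub \<theta>_GQ[of k] by (intro GQ_fld(1)) auto
    thus "x \<in> GQ" unfolding v(2) by (intro GQ_sum) auto
  qed
  ultimately have "?f ` ?D = GQ" using card_subset_eq[OF finGQ] cardQ by simp
  thus ?thesis using assms by blast
qed

lemma lift_carrier: "V \<in> carrier_mat r r \<Longrightarrow> lift i V \<in> carrier_mat r r"
  by (simp add: lift_def)

lemma yv_carrier: "i < d \<Longrightarrow> V \<in> carrier_mat r r \<Longrightarrow> yv i V \<in> carrier_mat r r"
  unfolding yv_def using Y lift_carrier by (rule mult_carrier_mat)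

lemma coeff_hom_lift: "coeff_hom (\<lambda>x. \<kappa> x ^ (q ^ i))"
  by unfold_locales (simp_all add: K.h_add K.h_mult addn_pow power_mult_distrib)

lemma function_ring_R: "function_ring R"
  unfolding R_def by (rule function_ring_alg) (auto intro: F.uminus)

sublocale R: function_ring R by (rule function_ring_R)

lemma const_R: "c \<in> F \<Longrightarrow> (\<lambda>_. c) \<in> R"
  unfolding R_def by (rule alg.const)

lemma zc_expand:
  assumes "v \<in> PiE {..<d} (\<lambda>_. Gq)" "c = (\<Sum>k<d. v k * \<theta> ^ k)"
  shows "zc c j m V = (\<Sum>k<d. \<kappa> (v k) * zc (\<theta> ^ k) j m V)"
proof -
  have "\<kappa> c ^ (q ^ i) = (\<Sum>k<d. \<kappa> (v k) * \<kappa> (\<theta> ^ k) ^ (q ^ i))" for i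
  proof -
    have "\<kappa> (v k) ^ (q ^ i) = \<kappa> (v k)" if "k < d" for k
      using assms(1) that GqD[of "v k" i] by (metis K.h_power PiE_mem lessThan_iff)
    thus ?thesis unfolding assms(2) by (simp add: K.h_sum K.h_mult sumn_pow power_mult_distrib)
  qed
  hence "zc c j m V = (\<Sum>i<d. \<Sum>k<d. \<kappa> (v k) * (\<kappa> (\<theta> ^ k) ^ (q ^ i) * yv i V $$ (j, m)))"
    by (simp add: zc_def sum_distrib_right mult.assoc)
  also have "\<dots> = (\<Sum>k<d. \<kappa> (v k) * zc (\<theta> ^ k) j m V)"
    by (subst sum.swap) (simp add: zc_def sum_distrib_left)
  finally show ?thesis .
qed

section \<open>Linear relations for Frobenius powers of traces\<close>

definition "Lin = {f. \<exists>M. (\<forall>b\<in>Ind. M b \<in> F) \<and> (\<forall>V. f V = (\<Sum>b\<in>Ind. M b * zI b V))}"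

lemma finite_Ind: "finite Ind" by (simp add: Ind_def)

lemma Lin_add: "f \<in> Lin \<Longrightarrow> g \<in> Lin \<Longrightarrow> (\<lambda>V. f V + g V) \<in> Lin"
  unfolding Lin_def
proof safe
  fix M N assume "\<forall>b\<in>Ind. M b \<in> F" "\<forall>V. f V = (\<Sum>b\<in>Ind. M b * zI b V)"
    "\<forall>b\<in>Ind. N b \<in> F" "\<forall>V. g V = (\<Sum>b\<in>Ind. N b * zI b V)"
  thus "\<exists>M'. (\<forall>b\<in>Ind. M' b \<in> F) \<and> (\<forall>V. f V + g V = (\<Sum>b\<in>Ind. M' b * zI b V))"
    by (intro exI[of _ "\<lambda>b. M b + N b"]) (simp add: F.add distrib_right sum.distrib)
qed

lemma Lin_scale: "f \<in> Lin \<Longrightarrow> c \<in> F \<Longrightarrow> (\<lambda>V. c * f V) \<in> Lin"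
  unfolding Lin_def
proof safe
  fix M assume "c \<in> F" "\<forall>b\<in>Ind. M b \<in> F" "\<forall>V. f V = (\<Sum>b\<in>Ind. M b * zI b V)"
  thus "\<exists>M'. (\<forall>b\<in>Ind. M' b \<in> F) \<and> (\<forall>V. c * f V = (\<Sum>b\<in>Ind. M' b * zI b V))"
    by (intro exI[of _ "\<lambda>b. c * M b"]) (simp add: F.mult sum_distrib_left mult.assoc)
qed

lemma Lin_0: "(\<lambda>_. 0) \<in> Lin"
  unfolding Lin_def by (auto intro!: exI[of _ "\<lambda>_. 0"])

lemma Lin_sum: "(\<And>i. i \<in> I \<Longrightarrow> f i \<in> Lin) \<Longrightarrow> (\<lambda>V. \<Sum>i\<in>I. f i V) \<in> Lin"
  by (induction I rule: infinite_finite_induct) (simp_all add: Lin_0 Lin_add)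

lemma zI_Lin: "a \<in> Ind \<Longrightarrow> zI a \<in> Lin"
  unfolding Lin_def
  by (auto intro!: exI[of _ "\<lambda>b. if b = a then 1 else 0"] simp: finite_Ind if_distrib[of "\<lambda>x. x * _"] cong: if_cong)

lemma zc_Lin:
  assumes "c \<in> GQ" "j < r" "m < r"
  shows "zc c j m \<in> Lin"
proof -
  obtain v where v: "v \<in> PiE {..<d} (\<lambda>_. Gq)" "c = (\<Sum>k<d. v k * \<theta> ^ k)"
    using basis_exists[OF assms(1)] by blast
  have "zc (\<theta> ^ k) j m \<in> Lin" if "k < d" for k
    using zI_Lin[of "(k, j, m)"] that assms by (simp add: zI_def Ind_def)
  hence "(\<lambda>V. \<Sum>k<d. \<kappa> (v k) * zc (\<theta> ^ k) j m V) \<in> Lin"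
    using v(1) Fq by (intro Lin_sum Lin_scale) (auto simp: PiE_def Pi_def)
  moreover have "zc c j m = (\<lambda>V. \<Sum>k<d. \<kappa> (v k) * zc (\<theta> ^ k) j m V)"
    by (rule ext) (rule zc_expand[OF v])
  ultimately show ?thesis by simp
qed

lemma Lin_R: "f \<in> Lin \<Longrightarrow> f \<in> R"
proof -
  assume "f \<in> Lin"
  then obtain M where M: "\<forall>b\<in>Ind. M b \<in> F" "f = (\<lambda>V. \<Sum>b\<in>Ind. M b * zI b V)"
    by (auto simp: Lin_def)
  show "f \<in> R" unfolding M(2)
    by (intro R.sum R.mult const_R) (use M in \<open>auto simp: R_def intro: alg.gen\<close>)
qed

lemma zc_R: "c \<in> GQ \<Longrightarrow> j < r \<Longrightarrow> m < r \<Longrightarrow> zc c j m \<in> R"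
  by (rule Lin_R[OF zc_Lin])

lemma MatD: "V \<in> Mat \<Longrightarrow> V \<in> carrier_mat r r" by (simp add: Mat_def)

lemma cpred_pow:
  fixes x :: "'b :: comm_ring_1"
  assumes "x ^ (q ^ d) = x" "i < d"
  shows "(x ^ (q ^ cpred d i)) ^ q = x ^ (q ^ i)"
proof (cases i)
  case 0
  have "(x ^ (q ^ (d - 1))) ^ q = x ^ (q ^ Suc (d - 1))"
    by (simp only: power_mult[symmetric] power_Suc2)
  thus ?thesis using 0 assms d0 by simp
next
  case (Suc j)
  thus ?thesis by (simp add: power_mult[symmetric] mult.commute)
qed

lemma bij_cpred: "bij_betw (cpred d) {..<d} {..<d}"
  by (rule bij_betwI[where g = "\<lambda>i. if i = d - 1 then 0 else Suc i"]) (use d0 in auto)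

lemma frob_lift:
  assumes "V \<in> Mat" "i < d"
  shows "frobM q (lift (cpred d i) V) = lift i V"
proof (rule eq_matI)
  fix j m assume "j < dim_row (lift i V)" "m < dim_col (lift i V)"
  hence jm: "j < r" "m < r" "V $$ (j, m) \<in> GQ" using assms(1) by (auto simp: lift_def Mat_def)
  have "\<kappa> (V $$ (j, m)) ^ (q ^ d) = \<kappa> (V $$ (j, m))" using jm(3) by (simp flip: K.h_power)
  thus "frobM q (lift (cpred d i) V) $$ (j, m) = lift i V $$ (j, m)"
    using jm assms MatD[OF assms(1)] cpred_pow[of "\<kappa> (V $$ (j, m))" i]
    by (simp add: frobM_def lift_def)
qed (auto simp: frobM_def lift_def)

lemma frob_yv:
  assumes "V \<in> Mat" "i < d"
  shows "frobM q (yv (cpred d i) V) = A i * yv i V"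
proof -
  have c: "cpred d i < d" using assms(2) d0 by auto
  note V = MatD[OF assms(1)]
  have "frobM q (yv (cpred d i) V) = frobM q (Y (cpred d i)) * frobM q (lift (cpred d i) V)"
    unfolding yv_def by (rule frobM_mult[OF addn Y[OF c] lift_carrier[OF V]])
  also have "\<dots> = A i * Y i * lift i V" using sys[OF assms(2)] frob_lift[OF assms] by simp
  also have "\<dots> = A i * yv i V" unfolding yv_def
    by (rule assoc_mult_mat[OF A[OF assms(2)] Y[OF assms(2)] lift_carrier[OF V]])
  finally show ?thesis .
qed

text \<open>Raising to the power q moves each summand one place along the cycle, where the system
  turns Frob of one component into A_i times the next. The powers of \<theta>^(q^i) in A_i are
  absorbed into the trace coefficient, so only coefficients of \<open>P\<close>, hence elements of
  \<open>F\<close>, remain outside.\<close>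

lemma zc_frob:
  assumes V: "V \<in> Mat" and c: "c \<in> GQ" and jm: "j < r" "m < r"
  shows "zc c j m V ^ q = (\<Sum>l<r. \<Sum>t\<le>Polynomial.degree (P j l). Polynomial.coeff (P j l) t * zc (c * \<theta> ^ t) l m V)"
proof -
  have "zc c j m V ^ q = (\<Sum>i<d. (\<kappa> c ^ (q ^ i)) ^ q * (yv i V $$ (j, m)) ^ q)"
    unfolding zc_def by (simp add: additive_power_sum[OF addn q0] power_mult_distrib)
  also have "\<dots> = (\<Sum>i<d. (\<kappa> c ^ (q ^ cpred d i)) ^ q * (yv (cpred d i) V $$ (j, m)) ^ q)"
    by (rule sum.reindex_bij_betw[OF bij_cpred, symmetric])
  also have "\<dots> = (\<Sum>i<d. \<kappa> c ^ (q ^ i) * (\<Sum>l<r. poly (P j l) (\<kappa> (\<theta> ^ (q ^ i))) * yv i V $$ (l, m)))"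
  proof (rule sum.cong[OF refl])
    fix i assume "i \<in> {..<d}"
    hence i: "i < d" by simp
    hence ci: "cpred d i < d" using d0 by auto
    have "\<kappa> c ^ (q ^ d) = \<kappa> c" using c by (simp flip: K.h_power)
    hence "(\<kappa> c ^ (q ^ cpred d i)) ^ q = \<kappa> c ^ (q ^ i)"
      by (rule cpred_pow[OF _ i])
    moreover have "(yv (cpred d i) V $$ (j, m)) ^ q = frobM q (yv (cpred d i) V) $$ (j, m)"
      using yv_carrier[OF ci MatD[OF V]] jm by (simp add: frobM_def)
    moreover have "(A i * yv i V) $$ (j, m) = (\<Sum>l<r. A i $$ (j, l) * yv i V $$ (l, m))"
      by (rule mult_index[OF A[OF i] yv_carrier[OF i MatD[OF V]] jm])
    ultimately show "(\<kappa> c ^ (q ^ cpred d i)) ^ q * (yv (cpred d i) V $$ (j, m)) ^ q =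
        \<kappa> c ^ (q ^ i) * (\<Sum>l<r. poly (P j l) (\<kappa> (\<theta> ^ (q ^ i))) * yv i V $$ (l, m))"
      using frob_yv[OF V i] AP[OF i jm(1)] by simp
  qed
  also have "\<dots> = (\<Sum>i<d. \<Sum>l<r. \<Sum>t\<le>Polynomial.degree (P j l).
      Polynomial.coeff (P j l) t * (\<kappa> (c * \<theta> ^ t) ^ (q ^ i) * yv i V $$ (l, m)))"
    by (simp add: poly_altdef sum_distrib_left sum_distrib_right K.h_mult K.h_power power_mult_distrib mult_ac
        flip: power_mult)
  also have "\<dots> = (\<Sum>l<r. \<Sum>i<d. \<Sum>t\<le>Polynomial.degree (P j l).
      Polynomial.coeff (P j l) t * (\<kappa> (c * \<theta> ^ t) ^ (q ^ i) * yv i V $$ (l, m)))"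
    by (rule sum.swap)
  also have "\<dots> = (\<Sum>l<r. \<Sum>t\<le>Polynomial.degree (P j l). \<Sum>i<d.
      Polynomial.coeff (P j l) t * (\<kappa> (c * \<theta> ^ t) ^ (q ^ i) * yv i V $$ (l, m)))"
    by (intro sum.cong refl sum.swap)
  finally show ?thesis by (simp only: zc_def sum_distrib_left)
qed

lemma zI_red:
  assumes "a \<in> Ind"
  shows "\<exists>M. (\<forall>b\<in>Ind. M b \<in> F) \<and> (\<forall>V\<in>Mat. zI a V ^ q = (\<Sum>b\<in>Ind. M b * zI b V))"
proof -
  obtain k j m where a: "a = (k, j, m)" "k < d" "j < r" "m < r" using assms by (auto simp: Ind_def)
  have "(\<lambda>V. \<Sum>l<r. \<Sum>t\<le>Polynomial.degree (P j l). Polynomial.coeff (P j l) t * zc (\<theta> ^ k * \<theta> ^ t) l m V) \<in> Lin"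
  proof (intro Lin_sum Lin_scale zc_Lin)
    fix l t assume "l \<in> {..<r}"
    thus "Polynomial.coeff (P j l) t \<in> F" using P[OF a(3), of l] by (auto simp: coeffs_in_def)
  qed (use a \<theta>_GQ in \<open>auto simp flip: power_add\<close>)
  then obtain M where "\<forall>b\<in>Ind. M b \<in> F"
    "\<And>V. (\<Sum>l<r. \<Sum>t\<le>Polynomial.degree (P j l). Polynomial.coeff (P j l) t * zc (\<theta> ^ k * \<theta> ^ t) l m V) = (\<Sum>b\<in>Ind. M b * zI b V)"
    unfolding Lin_def by blast
  thus ?thesis using zc_frob[OF _ \<theta>_GQ a(3,4)] by (intro exI[of _ M]) (simp add: a(1) zI_def)
qed

section \<open>Coordinates over the field with q elements and sums over all matrices\<close>

definition "Vof v = mat r r (\<lambda>(l, m). \<Sum>k<d. v (k, l, m) * \<theta> ^ k)"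

abbreviation "Cub \<equiv> PiE Ind (\<lambda>_. Gq)"

lemma Vof_Mat: "v \<in> Cub \<Longrightarrow> Vof v \<in> Mat"
proof -
  assume v: "v \<in> Cub"
  have "v (k, l, m) * \<theta> ^ k \<in> GQ" if "k < d" "l < r" "m < r" for k l m
    using v that Gq_sub \<theta>_GQ[of k] by (intro GQ_fld(1)) (auto simp: Ind_def)
  hence "(\<Sum>k<d. v (k, l, m) * \<theta> ^ k) \<in> GQ" if "l < r" "m < r" for l m
    using that by (intro GQ_sum) auto
  thus ?thesis by (simp add: Mat_def Vof_def)
qed

lemma bij_Vof: "bij_betw Vof Cub Mat"
proof (rule bij_betw_imageI)
  show "inj_on Vof Cub"
  proof (rule inj_onI)
    fix v w assume v: "v \<in> Cub" and w: "w \<in> Cub" and eq: "Vof v = Vof w"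
    have "v (k, l, m) = w (k, l, m)" if "(k, l, m) \<in> Ind" for k l m
    proof (rule basis_unique[of "\<lambda>k. v (k, l, m)" "\<lambda>k. w (k, l, m)"])
      have "Vof v $$ (l, m) = Vof w $$ (l, m)" using eq by simp
      thus "(\<Sum>k<d. v (k, l, m) * \<theta> ^ k) = (\<Sum>k<d. w (k, l, m) * \<theta> ^ k)"
        using that by (simp add: Vof_def Ind_def)
    qed (use that v w in \<open>auto simp: Ind_def PiE_def Pi_def\<close>)
    thus "v = w" by (intro PiE_ext[OF v w]) auto
  qed
  show "Vof ` Cub = Mat"
  proof
    show "Mat \<subseteq> Vof ` Cub"
    proof
      fix V assume V: "V \<in> Mat"
      define b where "b l m = (SOME v. v \<in> PiE {..<d} (\<lambda>_. Gq) \<and> V $$ (l, m) = (\<Sum>k<d. v k * \<theta> ^ k))" for l m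
      have b: "b l m \<in> PiE {..<d} (\<lambda>_. Gq) \<and> V $$ (l, m) = (\<Sum>k<d. b l m k * \<theta> ^ k)" if "l < r" "m < r" for l m
      proof -
        have "\<exists>v. v \<in> PiE {..<d} (\<lambda>_. Gq) \<and> V $$ (l, m) = (\<Sum>k<d. v k * \<theta> ^ k)"
          using basis_exists[of "V $$ (l, m)"] V that by (auto simp: Mat_def)
        thus ?thesis unfolding b_def by (rule someI_ex)
      qed
      define v where "v = restrict (\<lambda>(k, l, m). b l m k) Ind"
      have "v \<in> Cub" unfolding v_def using b by (auto simp: Ind_def PiE_def Pi_def)
      moreover have "Vof v = V"
        by (rule eq_matI) (use V b in \<open>auto simp: Vof_def v_def Ind_def Mat_def intro!: sum.cong\<close>)
      ultimately show "V \<in> Vof ` Cub" by blast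
    qed
  qed (use Vof_Mat in auto)
qed

text \<open>The twist by q^i leaves elements of the field with q elements unchanged, so each trace
  is a linear form in these coordinates, as Chevalley-Warning requires.\<close>

lemma zI_Vof:
  assumes v: "v \<in> Cub" and a: "(k, j, m) \<in> Ind"
  shows "zI (k, j, m) (Vof v) = (\<Sum>b\<in>Ind. \<kappa> (v b) *
    (case b of (k', l, m') \<Rightarrow> if m' = m then \<Sum>i<d. \<kappa> (\<theta> ^ (k + k')) ^ (q ^ i) * Y i $$ (j, l) else 0))"
proof -
  have jm: "k < d" "j < r" "m < r" using a by (auto simp: Ind_def)
  have lift: "lift i (Vof v) $$ (l, m) = (\<Sum>k'<d. \<kappa> (v (k', l, m)) * \<kappa> (\<theta> ^ k') ^ (q ^ i))" if "l < r" for l i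
  proof -
    have "\<kappa> (v (k', l, m)) ^ (q ^ i) = \<kappa> (v (k', l, m))" if "k' < d" for k'
      using v that \<open>l < r\<close> jm GqD[of "v (k', l, m)" i] by (auto simp: Ind_def PiE_def Pi_def simp flip: K.h_power)
    thus ?thesis using that jm
      by (simp add: lift_def Vof_def K.h_sum K.h_mult sumn_pow power_mult_distrib)
  qed
  have "zI (k, j, m) (Vof v) = (\<Sum>i<d. \<kappa> (\<theta> ^ k) ^ (q ^ i) * (\<Sum>l<r. Y i $$ (j, l) * (\<Sum>k'<d. \<kappa> (v (k', l, m)) * \<kappa> (\<theta> ^ k') ^ (q ^ i))))"
    unfolding zI_def prod.case zc_def yv_def
  proof (intro sum.cong refl arg_cong2[where f = "(*)"])
    fix i assume "i \<in> {..<d}"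
    hence "(Y i * lift i (Vof v)) $$ (j, m) = (\<Sum>l<r. Y i $$ (j, l) * lift i (Vof v) $$ (l, m))"
      using mult_index[OF Y lift_carrier[OF MatD[OF Vof_Mat[OF v]]] jm(2,3)] by simp
    thus "(Y i * lift i (Vof v)) $$ (j, m) = (\<Sum>l<r. Y i $$ (j, l) * (\<Sum>k'<d. \<kappa> (v (k', l, m)) * \<kappa> (\<theta> ^ k') ^ (q ^ i)))"
      by (simp add: lift)
  qed
  also have "\<dots> = (\<Sum>i<d. \<Sum>l<r. \<Sum>k'<d. \<kappa> (v (k', l, m)) * (\<kappa> (\<theta> ^ (k + k')) ^ (q ^ i) * Y i $$ (j, l)))"
    by (simp add: sum_distrib_left power_add K.h_mult power_mult_distrib mult_ac)
  also have "\<dots> = (\<Sum>l<r. \<Sum>i<d. \<Sum>k'<d. \<kappa> (v (k', l, m)) * (\<kappa> (\<theta> ^ (k + k')) ^ (q ^ i) * Y i $$ (j, l)))"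
    by (rule sum.swap)
  also have "\<dots> = (\<Sum>l<r. \<Sum>k'<d. \<Sum>i<d. \<kappa> (v (k', l, m)) * (\<kappa> (\<theta> ^ (k + k')) ^ (q ^ i) * Y i $$ (j, l)))"
    by (intro sum.cong refl sum.swap)
  also have "\<dots> = (\<Sum>k'<d. \<Sum>l<r. \<kappa> (v (k', l, m)) * (\<Sum>i<d. \<kappa> (\<theta> ^ (k + k')) ^ (q ^ i) * Y i $$ (j, l)))"
    by (subst sum.swap) (simp only: sum_distrib_left)
  also have "\<dots> = (\<Sum>k'<d. \<Sum>l<r. \<Sum>m'<r. \<kappa> (v (k', l, m')) *
      (if m' = m then \<Sum>i<d. \<kappa> (\<theta> ^ (k + k')) ^ (q ^ i) * Y i $$ (j, l) else 0))"
    using jm by (simp add: if_distrib[of "\<lambda>x. _ * x"] cong: if_cong)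
  also have "\<dots> = (\<Sum>b\<in>Ind. \<kappa> (v b) *
    (case b of (k', l, m') \<Rightarrow> if m' = m then \<Sum>i<d. \<kappa> (\<theta> ^ (k + k')) ^ (q ^ i) * Y i $$ (j, l) else 0))"
    by (simp add: Ind_def sum.cartesian_product case_prod_unfold)
  finally show ?thesis .
qed

lemma vanish:
  assumes "(\<Sum>a\<in>Ind. e a) < card Ind * (q - 1)"
  shows "(\<Sum>v\<in>Cub. \<Prod>a\<in>Ind. zI a (Vof v) ^ e a) = 0"
proof -
  define L where "L = (\<lambda>((k, j, m :: nat), t :: nat) (k', l, m'). if m' = m then \<Sum>i<d. \<kappa> (\<theta> ^ (k + k')) ^ (q ^ i) * Y i $$ (j, l) else 0)"
  \<comment> \<open>Every linear form is repeated according to its exponent, so that the cardinality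
    of \<open>J\<close> is the degree of the monomial.\<close>
  define J where "J = (SIGMA a:Ind. {..<e a})"
  have J: "finite J" "card J < card Ind * (card Gq - 1)"
    using assms finite_Ind by (auto simp: J_def cardq)
  have "(\<Sum>v\<in>Cub. \<Prod>a\<in>Ind. zI a (Vof v) ^ e a) = (\<Sum>v\<in>Cub. \<Prod>j\<in>J. \<Sum>b\<in>Ind. \<kappa> (v b) * L j b)"
  proof (rule sum.cong[OF refl])
    fix v assume v: "v \<in> Cub"
    have "(\<Prod>j\<in>J. \<Sum>b\<in>Ind. \<kappa> (v b) * L j b) = (\<Prod>a\<in>Ind. \<Prod>t<e a. \<Sum>b\<in>Ind. \<kappa> (v b) * L (a, t) b)"
      unfolding J_def by (subst prod.Sigma) (auto simp: finite_Ind)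
    also have "\<dots> = (\<Prod>a\<in>Ind. \<Prod>t<e a. zI a (Vof v))"
    proof (intro prod.cong refl)
      fix a t assume "a \<in> Ind"
      moreover obtain k j m where "a = (k, j, m)" by (cases a) auto
      ultimately show "(\<Sum>b\<in>Ind. \<kappa> (v b) * L (a, t) b) = zI a (Vof v)"
        using zI_Vof[OF v, of k j m] by (simp add: L_def)
    qed
    finally show "(\<Prod>a\<in>Ind. zI a (Vof v) ^ e a) = (\<Prod>j\<in>J. \<Sum>b\<in>Ind. \<kappa> (v b) * L j b)" by simp
  qed
  also have "\<dots> = 0"
    by (rule chevalley_warning[OF \<kappa> inj_\<kappa> finGq _ _ _ finite_Ind J])
       (use charn cardq Gq_fld in auto)
  finally show ?thesis .
qed

lemma trace_Mat: "\<exists>c. \<forall>f\<in>R. \<exists>a\<in>F. (\<Sum>V\<in>Mat. f V) = a * c"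
proof -
  have "\<exists>c. \<forall>f\<in>alg F ((\<lambda>a v. zI a (Vof v)) ` Ind). \<exists>a\<in>F. (\<Sum>v\<in>Cub. f v) = a * c"
  proof (rule trace_line[OF F finite_Ind q1])
    fix a assume "a \<in> Ind"
    then obtain M where M: "\<forall>b\<in>Ind. M b \<in> F" "\<forall>V\<in>Mat. zI a V ^ q = (\<Sum>b\<in>Ind. M b * zI b V)"
      using zI_red by blast
    thus "\<exists>M. (\<forall>b\<in>Ind. M b \<in> F) \<and> (\<forall>v\<in>Cub. zI a (Vof v) ^ q = (\<Sum>b\<in>Ind. M b * zI b (Vof v)))"
      using Vof_Mat by blast
  qed (rule vanish)
  then obtain c where c: "\<And>f. f \<in> alg F ((\<lambda>a v. zI a (Vof v)) ` Ind) \<Longrightarrow> \<exists>a\<in>F. (\<Sum>v\<in>Cub. f v) = a * c"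
    by blast
  have "(\<lambda>v. f (Vof v)) \<in> alg F ((\<lambda>a v. zI a (Vof v)) ` Ind)" if "f \<in> R" for f
    using that unfolding R_def by (induction rule: alg.induct) (auto intro: alg.intros)
  moreover have "(\<Sum>V\<in>Mat. f V) = (\<Sum>v\<in>Cub. f (Vof v))" for f :: "'c mat \<Rightarrow> 'n"
    by (rule sum.reindex_bij_betw[OF bij_Vof, symmetric])
  ultimately show ?thesis using c by (intro exI[of _ c]) auto
qed

text \<open>Orthogonality of the characters c^(q^i) of the multiplicative group. For different
  exponents, replacing c by \<theta> c multiplies the sum by a factor other than 1; for equal ones
  the sum is q^d - 1, which is -1 in this characteristic.\<close>

lemma pow_char_sum:
  assumes "i < d" "i' < d"
  shows "(\<Sum>c\<in>GQ - {0}. \<kappa> c ^ (q ^ i) * \<kappa> (inverse c) ^ (q ^ i')) = (if i = i' then - 1 else 0)"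
proof (cases "i = i'")
  case True
  have "(\<Sum>c\<in>GQ - {0}. \<kappa> c ^ (q ^ i) * \<kappa> (inverse c) ^ (q ^ i')) = (\<Sum>c\<in>GQ - {0}. 1)"
  proof (rule sum.cong[OF refl])
    fix c assume "c \<in> GQ - {0}"
    hence "\<kappa> c * \<kappa> (inverse c) = 1" unfolding K.h_mult[symmetric] by simp
    thus "\<kappa> c ^ (q ^ i) * \<kappa> (inverse c) ^ (q ^ i') = 1"
      unfolding True[symmetric] power_mult_distrib[symmetric] by simp
  qed
  also have "\<dots> = of_nat (q ^ d - 1)"
    using finGQ cardQ pow_pos[of d] by (simp add: card_Diff_subset)
  also have "\<dots> = - 1" using charn d0 pow_pos[of d] by (simp add: of_nat_diff zero_power)
  finally show ?thesis using True by simp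
next
  case False
  let ?S = "\<Sum>c\<in>GQ - {0}. \<kappa> c ^ (q ^ i) * \<kappa> (inverse c) ^ (q ^ i')"
  have ne: "\<theta> ^ (q ^ i) \<noteq> \<theta> ^ (q ^ i')" using \<theta>inj False assms by (auto simp: inj_on_def)
  have t0: "\<theta> \<noteq> 0" using ne q0 by (auto simp: zero_power)
  have tQ: "\<theta> \<in> GQ" using \<theta>Q by simp
  have "?S = (\<Sum>c\<in>GQ - {0}. \<kappa> (\<theta> * c) ^ (q ^ i) * \<kappa> (inverse (\<theta> * c)) ^ (q ^ i'))"
    by (rule sum.reindex_bij_witness[where i = "\<lambda>c. \<theta> * c" and j = "\<lambda>c. inverse \<theta> * c"])
       (use t0 tQ GQ_fld(1)[of \<theta>] GQ_fld(1)[of "inverse \<theta>"] GQ_fld(2)[of \<theta>] in \<open>auto simp: mult.assoc[symmetric]\<close>)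
  also have "\<dots> = \<kappa> \<theta> ^ (q ^ i) * \<kappa> (inverse \<theta>) ^ (q ^ i') * ?S"
    by (simp add: K.h_mult power_mult_distrib sum_distrib_left mult_ac)
  finally have "(1 - \<kappa> \<theta> ^ (q ^ i) * \<kappa> (inverse \<theta>) ^ (q ^ i')) * ?S = 0" by (simp add: algebra_simps)
  moreover have "\<kappa> \<theta> ^ (q ^ i) * \<kappa> (inverse \<theta>) ^ (q ^ i') \<noteq> 1"
  proof
    assume "\<kappa> \<theta> ^ (q ^ i) * \<kappa> (inverse \<theta>) ^ (q ^ i') = 1"
    hence "\<kappa> (\<theta> ^ (q ^ i) * inverse \<theta> ^ (q ^ i')) = \<kappa> 1" by (simp add: K.h_mult K.h_power)
    hence "\<theta> ^ (q ^ i) * inverse \<theta> ^ (q ^ i') = 1" by (simp only: \<kappa>_eq_iff)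
    thus False using ne t0 by (simp add: power_inverse field_simps)
  qed
  ultimately show ?thesis using False by simp
qed

definition tr :: "'c \<Rightarrow> (nat \<times> 'c mat \<Rightarrow> 'n) \<Rightarrow> 'c mat \<Rightarrow> 'n"
  where "tr c f V = (\<Sum>i<d. \<kappa> c ^ (q ^ i) * f (i, V))"

text \<open>Components of solutions are not elements of \<open>R\<close>, only their traces are. In
  \<open>S\<close> ring operations can be performed on components before the trace is taken.\<close>

definition "S = {f. \<forall>c\<in>GQ. \<exists>h\<in>R. \<forall>V\<in>Mat. h V = tr c f V}"

lemma tr_const: "c \<in> GQ \<Longrightarrow> tr c (\<lambda>_. 1) V \<in> F"
proof -
  assume c: "c \<in> GQ"
  have "(\<Sum>i<d. c ^ (q ^ i)) ^ q = (\<Sum>i<d. (c ^ (q ^ i)) ^ q)"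
    by (rule additive_power_sum[OF addc q0])
  also have "\<dots> = (\<Sum>i<d. (c ^ (q ^ cpred d i)) ^ q)"
    by (rule sum.reindex_bij_betw[OF bij_cpred, symmetric])
  also have "\<dots> = (\<Sum>i<d. c ^ (q ^ i))"
    using c by (intro sum.cong refl cpred_pow) auto
  finally have "\<kappa> (\<Sum>i<d. c ^ (q ^ i)) \<in> F" by (rule Fq)
  thus ?thesis by (simp add: tr_def K.h_sum K.h_power)
qed

text \<open>Orthogonality removes the mixed terms of the expanded product. The trace of a product
  becomes a combination of products of traces, which makes \<open>S\<close> closed under
  multiplication.\<close>

lemma tr_mult:
  "(\<Sum>c\<in>GQ - {0}. tr (a * c) f V * tr (inverse c) g V) = - tr a (\<lambda>x. f x * g x) V"
proof -
  have "(\<Sum>c\<in>GQ - {0}. tr (a * c) f V * tr (inverse c) g V) =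
      (\<Sum>c\<in>GQ - {0}. \<Sum>i<d. \<Sum>i'<d. \<kappa> a ^ (q ^ i) * f (i, V) * g (i', V) * (\<kappa> c ^ (q ^ i) * \<kappa> (inverse c) ^ (q ^ i')))"
    unfolding tr_def sum_product by (intro sum.cong refl) (simp add: K.h_mult power_mult_distrib mult_ac)
  also have "\<dots> = (\<Sum>i<d. \<Sum>c\<in>GQ - {0}. \<Sum>i'<d. \<kappa> a ^ (q ^ i) * f (i, V) * g (i', V) * (\<kappa> c ^ (q ^ i) * \<kappa> (inverse c) ^ (q ^ i')))"
    by (rule sum.swap)
  also have "\<dots> = (\<Sum>i<d. \<Sum>i'<d. \<Sum>c\<in>GQ - {0}. \<kappa> a ^ (q ^ i) * f (i, V) * g (i', V) * (\<kappa> c ^ (q ^ i) * \<kappa> (inverse c) ^ (q ^ i')))"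
    by (intro sum.cong refl sum.swap)
  also have "\<dots> = (\<Sum>i<d. \<Sum>i'<d. \<kappa> a ^ (q ^ i) * f (i, V) * g (i', V) * (if i = i' then - 1 else 0))"
    by (intro sum.cong refl) (simp only: sum_distrib_left[symmetric] pow_char_sum lessThan_iff)
  also have "\<dots> = - tr a (\<lambda>x. f x * g x) V"
    by (simp add: tr_def if_distrib[of "\<lambda>x. _ * x"] sum_negf mult_ac cong: if_cong)
  finally show ?thesis .
qed

lemma function_ring_S: "function_ring S"
proof
  have cst: "\<exists>h\<in>R. \<forall>V\<in>Mat. h V = tr c (\<lambda>_. 1) V" if "c \<in> GQ" for c
  proof (intro bexI ballI)
    show "(\<lambda>_. tr c (\<lambda>_. 1) (0\<^sub>m r r)) \<in> R" by (rule const_R[OF tr_const[OF that]])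
    show "tr c (\<lambda>_. 1) (0\<^sub>m r r) = tr c (\<lambda>_. 1) V" for V by (simp add: tr_def)
  qed
  show "(\<lambda>_. 1) \<in> S" using cst by (simp add: S_def)
  have neg: "tr c (\<lambda>_. - 1) V = - tr c (\<lambda>_. 1) V" for c V by (simp add: tr_def sum_negf)
  have "\<exists>h\<in>R. \<forall>V\<in>Mat. h V = - tr c (\<lambda>_. 1) V" if c: "c \<in> GQ" for c
  proof -
    obtain h where "h \<in> R" "\<forall>V\<in>Mat. h V = tr c (\<lambda>_. 1) V" using cst[OF c] by blast
    thus ?thesis by (intro bexI[of _ "\<lambda>V. - h V"]) (auto intro: R.uminus)
  qed
  thus "(\<lambda>_. - 1) \<in> S" by (simp add: S_def neg)
next
  fix f g assume f: "f \<in> S" and g: "g \<in> S"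
  have add: "tr c (\<lambda>x. f x + g x) V = tr c f V + tr c g V" for c V
    by (simp add: tr_def distrib_left sum.distrib)
  have "\<exists>h\<in>R. \<forall>V\<in>Mat. h V = tr c f V + tr c g V" if c: "c \<in> GQ" for c
  proof -
    obtain h where h: "h \<in> R" "\<forall>V\<in>Mat. h V = tr c f V" using f c unfolding S_def by blast
    obtain k where k: "k \<in> R" "\<forall>V\<in>Mat. k V = tr c g V" using g c unfolding S_def by blast
    show ?thesis using h k by (intro bexI[of _ "\<lambda>V. h V + k V"]) (auto intro: R.add)
  qed
  thus "(\<lambda>x. f x + g x) \<in> S" by (simp add: S_def add)
  have "\<exists>h\<in>R. \<forall>V\<in>Mat. h V = tr c (\<lambda>x. f x * g x) V" if c: "c \<in> GQ" for c
  proof -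
    have "\<forall>a. \<exists>h. a \<in> GQ \<longrightarrow> h \<in> R \<and> (\<forall>V\<in>Mat. h V = tr a f V)" using f unfolding S_def by blast
    then obtain h where h0: "\<forall>a. a \<in> GQ \<longrightarrow> h a \<in> R \<and> (\<forall>V\<in>Mat. h a V = tr a f V)"
      using choice[of "\<lambda>a h. a \<in> GQ \<longrightarrow> h \<in> R \<and> (\<forall>V\<in>Mat. h V = tr a f V)"] by blast
    have h: "\<And>a. a \<in> GQ \<Longrightarrow> h a \<in> R" "\<And>a V. a \<in> GQ \<Longrightarrow> V \<in> Mat \<Longrightarrow> h a V = tr a f V" using h0 by blast+
    have "\<forall>a. \<exists>h. a \<in> GQ \<longrightarrow> h \<in> R \<and> (\<forall>V\<in>Mat. h V = tr a g V)" using g unfolding S_def by blast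
    then obtain k where k0: "\<forall>a. a \<in> GQ \<longrightarrow> k a \<in> R \<and> (\<forall>V\<in>Mat. k a V = tr a g V)"
      using choice[of "\<lambda>a h. a \<in> GQ \<longrightarrow> h \<in> R \<and> (\<forall>V\<in>Mat. h V = tr a g V)"] by blast
    have k: "\<And>a. a \<in> GQ \<Longrightarrow> k a \<in> R" "\<And>a V. a \<in> GQ \<Longrightarrow> V \<in> Mat \<Longrightarrow> k a V = tr a g V" using k0 by blast+
    have GG: "c * a \<in> GQ" "inverse a \<in> GQ" if "a \<in> GQ - {0}" for a
      using that c GQ_fld(1)[of c a] GQ_fld(2)[of a] by auto
    show ?thesis
    proof (intro bexI ballI)
      show "(\<lambda>V. - (\<Sum>a\<in>GQ - {0}. h (c * a) V * k (inverse a) V)) \<in> R"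
        by (intro R.uminus R.sum R.mult h(1) k(1) GG)
      fix V assume V: "V \<in> Mat"
      have "(\<Sum>a\<in>GQ - {0}. h (c * a) V * k (inverse a) V) = (\<Sum>a\<in>GQ - {0}. tr (c * a) f V * tr (inverse a) g V)"
        by (rule sum.cong[OF refl]) (simp only: h(2)[OF GG(1) V] k(2)[OF GG(2) V])
      thus "- (\<Sum>a\<in>GQ - {0}. h (c * a) V * k (inverse a) V) = tr c (\<lambda>x. f x * g x) V"
        by (simp add: tr_mult)
    qed
  qed
  thus "(\<lambda>x. f x * g x) \<in> S" by (simp add: S_def)
qed

lemma det_yv:
  assumes "i < d" "V \<in> carrier_mat r r"
  shows "det (yv i V) = \<kappa> (det V) ^ (q ^ i)"
  unfolding yv_def using det_mult[OF Y lift_carrier, of i V i] detY[of i] assms det_hom[OF coeff_hom_lift, of i V]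
  by (simp add: lift_def)

lemma det_GQ: "V \<in> Mat \<Longrightarrow> det V \<in> GQ"
proof -
  assume V: "V \<in> Mat"
  have "det V ^ (q ^ d) = det (frobM (q ^ d) V)" by (rule det_frobM[OF addc_pow, symmetric])
  also have "frobM (q ^ d) V = V" by (rule eq_matI) (use V in \<open>auto simp: frobM_def Mat_def\<close>)
  finally show ?thesis by simp
qed

text \<open>On the field with q^d elements, 1 - t^(q^d - 1) is 1 at t = 0 and 0 elsewhere. Up to
  conjugation the determinant of a component of the solution is det V, so t = det V - 1 makes this a
  polynomial in its entries. The result is the same for every index, so it is recovered from one
  trace by dividing by the nonzero trace of a constant.\<close>

lemma indicator_R: "\<exists>h\<in>R. \<forall>V\<in>Mat. h V = (if det V = 1 then 1 else 0)"
proof -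
  interpret S: function_ring S by (rule function_ring_S)
  \<comment> \<open>The default \<open>1\<^sub>m r\<close> only provides the right dimensions at
    arguments that no trace in question uses.\<close>
  define W where "W = (\<lambda>(i, V). if i < d \<and> V \<in> Mat then yv i V else 1\<^sub>m r)"
  have entries: "(\<lambda>x. W x $$ (j, m)) \<in> S" if "j < r" "m < r" for j m
    unfolding S_def
  proof (intro CollectI ballI)
    fix c assume c: "c \<in> GQ"
    show "\<exists>h\<in>R. \<forall>V\<in>Mat. h V = tr c (\<lambda>x. W x $$ (j, m)) V"
      using zc_R[OF c that] by (intro bexI[of _ "zc c j m"]) (auto simp: tr_def zc_def W_def)
  qed
  have carr: "W x \<in> carrier_mat r r" for x
    using yv_carrier MatD by (auto simp: W_def split: prod.splits)
  define f where "f x = 1 - (det (W x) - 1) ^ (q ^ d - 1)" for x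
  have fS: "f \<in> S" unfolding f_def[abs_def]
    by (intro S.diff S.one S.power S.det[where n = r] carr entries)
  have fV: "f (i, V) = (if det V = 1 then 1 else 0)" if "i < d" "V \<in> Mat" for i V
  proof -
    define t where "t = det V - 1"
    have t: "t \<in> GQ" using det_GQ[OF that(2)] addc_pow[of t 1 d] by (simp add: t_def eq_diff_eq)
    have "det (W (i, V)) - 1 = \<kappa> t ^ (q ^ i)"
      using that det_yv[OF that(1) MatD[OF that(2)]] addn_pow[of "\<kappa> t" 1 i]
      by (simp add: W_def t_def K.h_diff)
    also have "\<dots> ^ (q ^ d - 1) = \<kappa> (t ^ (q ^ d - 1)) ^ (q ^ i)"
      by (simp add: K.h_power mult.commute flip: power_mult)
    also have "t ^ (q ^ d - 1) = (if t = 0 then 0 else 1)"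
    proof (cases "t = 0")
      case False
      have "t * t ^ (q ^ d - 1) = t ^ (q ^ d)" using pow_pos[of d] by (metis Suc_diff_1 power_Suc)
      thus ?thesis using t False by simp
    next
      case True
      have "q ^ d > 1" using q1 d0 by (rule one_less_power)
      thus ?thesis using True by (simp add: zero_power)
    qed
    finally show ?thesis using q0 by (auto simp: f_def t_def)
  qed
  \<comment> \<open>The trace is a nonzero polynomial of degree at most q^(d-1), too small for q^d
    roots.\<close>
  have "\<exists>a\<in>GQ. (\<Sum>i<d. a ^ (q ^ i)) \<noteq> 0"
  proof (rule ccontr)
    assume "\<not> ?thesis"
    hence all: "(\<Sum>i<d. a ^ (q ^ i)) = 0" if "a \<in> GQ" for a using that by blast
    define p where "p = (\<Sum>i<d. Polynomial.monom (1 :: 'c) (q ^ i))"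
    have pv: "poly p x = (\<Sum>i<d. x ^ (q ^ i))" for x by (simp add: p_def poly_sum poly_monom)
    have "Polynomial.degree p \<le> q ^ (d - 1)" unfolding p_def
      by (rule degree_sum_le) (use q1 in \<open>auto simp: degree_monom_eq intro!: power_increasing\<close>)
    also have "\<dots> < q ^ d" using q1 d0 by (intro power_strict_increasing) auto
    finally have "Polynomial.degree p < card GQ" using cardQ by simp
    hence "p = 0" using all by (intro poly_eqI_degree[of GQ]) (auto simp: pv cardQ q0)
    moreover have "Polynomial.coeff p (q ^ 0) = (\<Sum>i<d. if i = 0 then 1 else 0)"
      unfolding p_def coeff_sum using q1 by (intro sum.cong) (auto simp: power_inject_exp)
    ultimately show False using d0 by simp
  qed
  then obtain a where a: "a \<in> GQ" "(\<Sum>i<d. a ^ (q ^ i)) \<noteq> 0" by blast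
  define s where "s = \<kappa> (\<Sum>i<d. a ^ (q ^ i))"
  have s0: "s \<noteq> 0" using a(2) \<kappa>_eq_iff[of _ 0] by (auto simp: s_def)
  have sF: "s \<in> F" using tr_const[OF a(1)] by (simp add: tr_def s_def K.h_sum K.h_power)
  obtain h where h: "h \<in> R" "\<And>V. V \<in> Mat \<Longrightarrow> h V = tr a f V" using fS a(1) unfolding S_def by blast
  show ?thesis
  proof (intro bexI ballI)
    show "(\<lambda>V. inverse s * h V) \<in> R" by (intro R.mult const_R h F.inverse sF)
    fix V assume V: "V \<in> Mat"
    have "h V = s * (if det V = 1 then 1 else 0)"
      using fV[OF _ V] by (simp add: h(2)[OF V] tr_def s_def K.h_sum K.h_power)
    thus "inverse s * h V = (if det V = 1 then 1 else 0)" using s0 by simp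
  qed
qed

text \<open>Multiplication by the indicator turns a sum over matrices of determinant 1 into a sum
  over all matrices, where the coordinates range freely.\<close>

lemma trace_SL: "\<exists>c. \<forall>f\<in>R. \<exists>a\<in>F. (\<Sum>V\<in>{V \<in> Mat. det V = 1}. f V) = a * c"
proof -
  obtain c where c: "\<And>f. f \<in> R \<Longrightarrow> \<exists>a\<in>F. (\<Sum>V\<in>Mat. f V) = a * c" using trace_Mat by blast
  obtain h where h: "h \<in> R" "\<forall>V\<in>Mat. h V = (if det V = 1 then 1 else 0)" using indicator_R by blast
  have fin: "finite Mat" using bij_betw_finite[OF bij_Vof] finite_Ind finGq by (simp add: finite_PiE)
  have "(\<Sum>V\<in>{V \<in> Mat. det V = 1}. f V) = (\<Sum>V\<in>Mat. f V * h V)" for f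
    using h(2) fin by (auto simp: sum.inter_filter intro!: sum.cong)
  thus ?thesis using c R.mult[OF _ h(1)] by (intro exI[of _ c]) auto
qed

text \<open>Orthogonality recovers the entries of the zeroth component from the traces, with
  coefficients that need not lie in \<open>F\<close>. As \<open>Y 0\<close> is invertible, these
  entries determine V.\<close>

lemma separates:
  assumes "V \<in> Mat" "V \<noteq> 1\<^sub>m r"
  shows "\<exists>f\<in>R. f V \<noteq> f (1\<^sub>m r)"
proof (rule ccontr)
  assume "\<not> ?thesis"
  hence eq: "f V = f (1\<^sub>m r)" if "f \<in> R" for f using that by blast
  have one: "1\<^sub>m r \<in> Mat" using GQ_fld(3) pow_pos[of d] by (auto simp: Mat_def zero_power)
  have rec: "yv 0 W $$ (j, m) = - (\<Sum>c\<in>GQ - {0}. \<kappa> (inverse c) * zc c j m W)" for W j m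
  proof -
    have "(\<Sum>c\<in>GQ - {0}. \<kappa> (inverse c) * zc c j m W) =
        (\<Sum>c\<in>GQ - {0}. \<Sum>i<d. yv i W $$ (j, m) * (\<kappa> c ^ (q ^ i) * \<kappa> (inverse c) ^ (q ^ 0)))"
      by (simp add: zc_def sum_distrib_left mult_ac)
    also have "\<dots> = (\<Sum>i<d. \<Sum>c\<in>GQ - {0}. yv i W $$ (j, m) * (\<kappa> c ^ (q ^ i) * \<kappa> (inverse c) ^ (q ^ 0)))"
      by (rule sum.swap)
    also have "\<dots> = (\<Sum>i<d. yv i W $$ (j, m) * (if i = 0 then - 1 else 0))"
      using d0 by (intro sum.cong refl) (simp only: sum_distrib_left[symmetric] pow_char_sum lessThan_iff)
    also have "\<dots> = - yv 0 W $$ (j, m)" using d0 by (simp add: if_distrib[of "\<lambda>x. _ * x"] cong: if_cong)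
    finally show ?thesis by simp
  qed
  have "yv 0 V $$ (j, m) = yv 0 (1\<^sub>m r) $$ (j, m)" if "j < r" "m < r" for j m
    unfolding rec by (intro arg_cong[where f = uminus] sum.cong refl arg_cong2[where f = "(*)"] eq zc_R) (use that in auto)
  hence yy: "yv 0 V = yv 0 (1\<^sub>m r)"
    using yv_carrier[OF d0 MatD[OF assms(1)]] yv_carrier[OF d0 MatD[OF one]] by (intro eq_matI) auto
  have lV: "lift 0 W = adj_mat (Y 0) * yv 0 W" if "W \<in> carrier_mat r r" for W
    unfolding yv_def using assoc_mult_mat[OF adj_mat(1)[OF Y[OF d0]] Y[OF d0] lift_carrier[OF that, of 0]]
      mult_adj_unimodular(2)[OF Y[OF d0] detY[OF d0]] lift_carrier[OF that, of 0] by simp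
  have ll: "lift 0 V = lift 0 (1\<^sub>m r)" using yy lV[OF MatD[OF assms(1)]] lV[OF MatD[OF one]] by simp
  have "\<kappa> (V $$ (j, m)) = \<kappa> (1\<^sub>m r $$ (j, m))" if "j < r" "m < r" for j m
    using that MatD[OF assms(1)] arg_cong[OF ll, of "\<lambda>M. M $$ (j, m)"] by (auto simp: lift_def)
  hence "V = 1\<^sub>m r" using MatD[OF assms(1)] by (intro eq_matI) (auto simp: \<kappa>_eq_iff)
  thus False using assms(2) by simp
qed

text \<open>The twisted entries of \<open>g\<close> are absorbed into the trace coefficients, so a
  translated trace is a sum of traces.\<close>

lemma translate:
  assumes "f \<in> R" "g \<in> Mat"
  shows "\<exists>f'\<in>R. \<forall>V\<in>Mat. f' V = f (V * g)"
  using assms(1) unfolding R_def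
proof (induction rule: alg.induct)
  case (const c)
  thus ?case by (intro bexI[of _ "\<lambda>_. c"]) (auto intro: alg.const)
next
  case (gen z)
  then obtain k j m where z: "z = zc (\<theta> ^ k) j m" "k < d" "j < r" "m < r" by (auto simp: Ind_def zI_def)
  have gm: "\<theta> ^ k * g $$ (l, m) \<in> GQ" if "l < r" for l
    using assms(2) that z by (intro GQ_fld(1) \<theta>_GQ) (auto simp: Mat_def)
  show ?case
  proof (intro bexI ballI)
    show "(\<lambda>V. \<Sum>l<r. zc (\<theta> ^ k * g $$ (l, m)) j l V) \<in> alg F (zI ` Ind)"
      unfolding R_def[symmetric] by (intro R.sum zc_R gm z) auto
    fix V assume V: "V \<in> Mat"
    have "yv i (V * g) $$ (j, m) = (\<Sum>l<r. yv i V $$ (j, l) * \<kappa> (g $$ (l, m)) ^ (q ^ i))" if i: "i < d" for i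
    proof -
      have "lift i (V * g) = lift i V * lift i g"
        unfolding lift_def by (rule mat_hom_mult[OF coeff_hom_lift MatD[OF V] MatD[OF assms(2)]])
      hence "yv i (V * g) = yv i V * lift i g"
        unfolding yv_def using assoc_mult_mat[OF Y[OF i] lift_carrier[OF MatD[OF V]] lift_carrier[OF MatD[OF assms(2)]]] by simp
      hence "yv i (V * g) $$ (j, m) = (\<Sum>l<r. yv i V $$ (j, l) * lift i g $$ (l, m))"
        using mult_index[OF yv_carrier[OF i MatD[OF V]] lift_carrier[OF MatD[OF assms(2)]] z(3,4)] by simp
      thus ?thesis using MatD[OF assms(2)] z(4) by (simp add: lift_def)
    qed
    hence "z (V * g) = (\<Sum>i<d. \<Sum>l<r. \<kappa> (\<theta> ^ k * g $$ (l, m)) ^ (q ^ i) * yv i V $$ (j, l))"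
      by (simp add: z(1) zc_def sum_distrib_left K.h_mult power_mult_distrib mult_ac)
    also have "\<dots> = (\<Sum>l<r. zc (\<theta> ^ k * g $$ (l, m)) j l V)"
      unfolding zc_def by (rule sum.swap)
    finally show "(\<Sum>l<r. zc (\<theta> ^ k * g $$ (l, m)) j l V) = z (V * g)" ..
  qed
next
  case (add f f')
  then obtain h h' where "h \<in> alg F (zI ` Ind)" "\<forall>V\<in>Mat. h V = f (V * g)" "h' \<in> alg F (zI ` Ind)" "\<forall>V\<in>Mat. h' V = f' (V * g)"
    by blast
  thus ?case by (intro bexI[of _ "\<lambda>V. h V + h' V"]) (auto intro: alg.add)
next
  case (mult f f')
  then obtain h h' where "h \<in> alg F (zI ` Ind)" "\<forall>V\<in>Mat. h V = f (V * g)" "h' \<in> alg F (zI ` Ind)" "\<forall>V\<in>Mat. h' V = f' (V * g)"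
    by blast
  thus ?case by (intro bexI[of _ "\<lambda>V. h V * h' V"]) (auto intro: alg.mult)
qed

end

section \<open>The generic Frobenius system\<close>

lemma coeff_hom_fps_to_fls: "coeff_hom fps_to_fls"
  by unfold_locales (simp_all add: fls_times_fps_to_fls)

lemma coeff_hom_fls_const: "coeff_hom fls_const"
  by unfold_locales (simp_all add: fls_plus_const)

lemma coeff_hom_poly: "coeff_hom (\<lambda>p. poly p x)"
  by unfold_locales simp_all

lemma coeff_hom_comp:
  assumes "coeff_hom f" "coeff_hom g"
  shows "coeff_hom (\<lambda>x. f (g x))"
proof -
  interpret f: coeff_hom f by fact
  interpret g: coeff_hom g by fact
  show ?thesis by unfold_locales (simp_all add: f.h_add f.h_mult g.h_add g.h_mult)
qed

lemma Umat_hom: "coeff_hom h \<Longrightarrow> map_mat h (Umat r b) = Umat r (\<lambda>l. h (b l))"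
proof -
  assume "coeff_hom h"
  then interpret coeff_hom h .
  show ?thesis by (rule eq_matI) (auto simp: Umat_def)
qed

lemma Nmat_hom: "coeff_hom h \<Longrightarrow> map_mat h (Nmat r e) = Nmat r (h e)"
proof -
  assume "coeff_hom h"
  then interpret coeff_hom h .
  show ?thesis by (rule eq_matI) (auto simp: Nmat_def)
qed

lemma Umat_cong: "(\<And>l. Suc l < r \<Longrightarrow> b l = c l) \<Longrightarrow> Umat r b = Umat r c"
  by (rule eq_matI) (auto simp: Umat_def)

lemma frobM_frobM: "frobM a (frobM b M) = frobM (b * a) M"
  by (rule eq_matI) (auto simp: frobM_def power_mult)

text \<open>Values lie in iterated Laurent series: the inner variable belongs to the generic point
  \<open>y\<close>, the outer one is \<epsilon>. Besides \<open>y1\<close>, genericity is all that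
  is assumed about \<open>y\<close>.\<close>

locale frob_family =
  fixes m d r q Q :: nat and \<theta> :: "'c :: alg_closed_field" and y :: "nat \<Rightarrow> 'c mp fract fls"
  assumes p: "prime CHAR('c)" and q: "q = CHAR('c) ^ m" and m0: "m > 0" and Q: "Q = q ^ d"
    and d0: "d > 0" and r0: "r > 0"
    and \<theta>Q: "\<theta> ^ Q = \<theta>" and \<theta>inj: "inj_on (\<lambda>i. \<theta> ^ (q ^ i)) {..<d}"
    and y1: "Lam Q r y = 1"
    and generic: "f \<in> Pol \<Longrightarrow> f y = 0 \<Longrightarrow> Lam Q r v = 1 \<Longrightarrow> f v = 0"
begin

definition \<kappa> :: "'c \<Rightarrow> 'c mp fract fls fls" where "\<kappa> c = fls_const (cL c)"

definition T :: "'c mp fract fls fls" where "T = \<kappa> \<theta> + fls_X"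

definition efps :: "nat \<Rightarrow> 'c mp fract fls fps"
  where "efps i = 1 - (fps_const (cL \<theta>) + fps_X - fps_const (cL (\<theta> ^ (q ^ i)))) ^ (Q - 1)"

definition Afps :: "(nat \<Rightarrow> 'c mp fract fls) \<Rightarrow> nat \<Rightarrow> 'c mp fract fls fps mat"
  where "Afps v i = Umat r (\<lambda>l. efps i * fps_const (bvec Q r v l)) * Nmat r (efps i)"

text \<open>The solution of the system reduced at \<epsilon> = 0: there the matrices with i > 0 are
  the identity, so each component is the q-Frobenius of the preceding one.\<close>

definition Cmat :: "(nat \<Rightarrow> 'c mp fract fls) \<Rightarrow> nat \<Rightarrow> 'c mp fract fls mat"
  where "Cmat v i = frobM (q ^ i) (Dmat Q r v)"

definition \<beta> :: "nat \<Rightarrow> 'c mp fract fls fls"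
  where "\<beta> i = fls_const (bvec Q r y (i - 1))"

sublocale cL: coeff_hom "cL :: 'c \<Rightarrow> _" by (rule coeff_hom_cL)
sublocale Pol: function_ring "Pol :: ((nat \<Rightarrow> 'c mp fract fls) \<Rightarrow> _) set" by (rule function_ring_Pol)

lemma coeff_hom_\<kappa>: "coeff_hom \<kappa>"
  unfolding \<kappa>_def by (rule coeff_hom_comp[OF coeff_hom_fls_const coeff_hom_cL])

sublocale \<kappa>: coeff_hom \<kappa> by (rule coeff_hom_\<kappa>)

lemma q1: "q > 1" using prime_gt_1_nat[OF p] m0 unfolding q by (rule one_less_power)
lemma q0: "q > 0" using q1 by simp
lemma Q1: "Q > 1" using q1 d0 unfolding Q by (rule one_less_power)
lemma Q0: "Q > 0" using Q1 by simp

lemma addc: "(a + b :: 'c) ^ q = a ^ q + b ^ q"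
  by (rule freshmans_dream'[OF p q])

lemma addL: "(a + b :: 'c mp fract fls) ^ q = a ^ q + b ^ q"
  by (rule freshmans_dream'[where n = m]) (use p q in \<open>simp_all add: CHAR_mp_fract\<close>)

lemma addP: "(a + b :: 'c mp fract fls fps) ^ q = a ^ q + b ^ q"
  by (rule freshmans_dream'[where n = m]) (use p q in \<open>simp_all add: CHAR_mp_fract\<close>)

lemma addN: "(a + b :: 'c mp fract fls fls) ^ q = a ^ q + b ^ q"
  by (rule freshmans_dream'[where n = m]) (use p q in \<open>simp_all add: CHAR_mp_fract\<close>)

lemma addL_Q: "(a + b :: 'c mp fract fls) ^ Q = a ^ Q + b ^ Q"
  unfolding Q by (rule additive_power_power[OF addL])

lemma addP_Q: "(a + b :: 'c mp fract fls fps) ^ Q = a ^ Q + b ^ Q"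
  unfolding Q by (rule additive_power_power[OF addP])

lemma Afps_carrier [simp]: "Afps v i \<in> carrier_mat r r"
  unfolding Afps_def by (rule mult_carrier_mat[of _ r r]) simp_all

lemma det_Afps [simp]: "det (Afps v i) = 1"
  unfolding Afps_def using det_mult[of "Umat r (\<lambda>l. efps i * fps_const (bvec Q r v l))" r "Nmat r (efps i)"] by simp

lemma Pol_const: "(\<lambda>_. cL c) \<in> Pol"
  unfolding Pol_def by (rule alg.const) simp

lemma efps_Pol: "(\<lambda>v. efps i $ n) \<in> Pol"
proof -
  interpret PF: function_ring "{f :: (nat \<Rightarrow> 'c mp fract fls) \<Rightarrow> _ fps. \<forall>n. (\<lambda>v. f v $ n) \<in> Pol}"
    by (rule function_ring_fps[OF function_ring_Pol])
  have c: "(\<lambda>_. fps_const (cL c)) \<in> {f :: (nat \<Rightarrow> 'c mp fract fls) \<Rightarrow> _ fps. \<forall>n. (\<lambda>v. f v $ n) \<in> Pol}" for c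
    using Pol_const Pol.zero by auto
  have x: "(\<lambda>_. fps_X) \<in> {f :: (nat \<Rightarrow> 'c mp fract fls) \<Rightarrow> _ fps. \<forall>n. (\<lambda>v. f v $ n) \<in> Pol}"
    using Pol.one Pol.zero by (auto simp: fps_X_def)
  have "(\<lambda>v. efps i) \<in> {f :: (nat \<Rightarrow> 'c mp fract fls) \<Rightarrow> _ fps. \<forall>n. (\<lambda>v. f v $ n) \<in> Pol}"
    unfolding efps_def by (intro PF.diff PF.one PF.power PF.add c x)
  thus ?thesis by simp
qed

lemma Afps_Pol:
  assumes "j < r" "l < r"
  shows "(\<lambda>v. Afps v i $$ (j, l) $ n) \<in> Pol"
proof -
  let ?PF = "{f :: (nat \<Rightarrow> 'c mp fract fls) \<Rightarrow> _ fps. \<forall>n. (\<lambda>v. f v $ n) \<in> Pol}"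
  interpret PF: function_ring ?PF by (rule function_ring_fps[OF function_ring_Pol])
  have e: "(\<lambda>_. efps i) \<in> ?PF" using efps_Pol by simp
  have b: "(\<lambda>v. fps_const (bvec Q r v l)) \<in> ?PF" if "l < r" for l
  proof (intro CollectI allI)
    fix n
    show "(\<lambda>v :: nat \<Rightarrow> 'c mp fract fls. fps_const (bvec Q r v l) $ n) \<in> Pol"
      using bvec_in_Pol[OF that, of Q] Pol.zero by (cases "n = 0") simp_all
  qed
  have "(\<lambda>v. Afps v i $$ (j, l)) \<in> ?PF" unfolding Afps_def
  proof (rule PF.mat_mult[where n = r and m = r and k = r])
    fix a c :: nat assume ac: "a < r" "c < r"
    show "(\<lambda>v. Umat r (\<lambda>l. efps i * fps_const (bvec Q r v l)) $$ (a, c)) \<in> ?PF"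
    proof -
      have "Umat r (\<lambda>l. efps i * fps_const (bvec Q r v l)) $$ (a, c) =
          (if a = c then 1 else if Suc a = r then efps i * fps_const (bvec Q r v c) else 0)" for v
        using ac by (simp add: Umat_def)
      thus ?thesis using PF.one PF.zero PF.mult[OF e b[OF ac(2)]]
        by (cases "a = c"; cases "Suc a = r") (simp_all only: if_True if_False refl simp_thms)
    qed
    show "(\<lambda>v. Nmat r (efps i) $$ (a, c)) \<in> ?PF"
    proof -
      have "Nmat r (efps i) $$ (a, c) = (if a = c then 1 else if c = Suc a then efps i else 0)"
        using ac by (simp add: Nmat_def)
      thus ?thesis using PF.one PF.zero e by presburger
    qed
  qed (use assms in auto)
  thus ?thesis by simp
qed

lemma Dmat_Pol:
  assumes "j < r" "l < r"
  shows "(\<lambda>v :: nat \<Rightarrow> 'c mp fract fls. Dmat Q r v $$ (j, l)) \<in> Pol"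
proof -
  have "(\<lambda>v :: nat \<Rightarrow> 'c mp fract fls. (dfrob Q ^^ i) (v j)) \<in> Pol" for i j
  proof (induction i)
    case 0
    show ?case by (auto simp: Pol_def intro: alg.gen)
  next
    case (Suc i)
    show ?case unfolding funpow.simps comp_def dfrob_def[of Q "(dfrob Q ^^ i) _"] by (intro Pol.diff Pol.power Suc)
  qed
  from this[of j l] show ?thesis using assms by (simp add: Dmat_def)
qed

text \<open>Chosen once for all points \<open>v\<close>, including those off the hypersurface, so
  that every coefficient is a polynomial function of \<open>v\<close>. The full equation is obtained
  only where \<open>Lam\<close> is 1.\<close>

definition Yfps :: "(nat \<Rightarrow> 'c mp fract fls) \<Rightarrow> nat \<Rightarrow> 'c mp fract fls fps mat"
  where "Yfps = (SOME Y. \<forall>i<d. (\<forall>v. Y v i \<in> carrier_mat r r) \<and> (\<forall>j<r. \<forall>m<r.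
      (\<forall>v. Y v i $$ (j, m) $ 0 = Cmat v i $$ (j, m)) \<and>
      (\<forall>v. \<forall>n>0. Y v i $$ (j, m) $ n = (adj_mat (Afps v i) * frobM q (Y v (cpred d i))) $$ (j, m) $ n) \<and>
      (\<forall>n. (\<lambda>v. Y v i $$ (j, m) $ n) \<in> Pol)))"

lemma Yfps:
  assumes "i < d"
  shows "Yfps v i \<in> carrier_mat r r"
    and "j < r \<Longrightarrow> l < r \<Longrightarrow> Yfps v i $$ (j, l) $ 0 = Cmat v i $$ (j, l)"
    and "j < r \<Longrightarrow> l < r \<Longrightarrow> n > 0 \<Longrightarrow>
      Yfps v i $$ (j, l) $ n = (adj_mat (Afps v i) * frobM q (Yfps v (cpred d i))) $$ (j, l) $ n"
    and "j < r \<Longrightarrow> l < r \<Longrightarrow> (\<lambda>v. Yfps v i $$ (j, l) $ n) \<in> Pol"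
proof -
  have "(\<lambda>v. Cmat v i $$ (j, m)) \<in> Pol" if "j < r" "m < r" for i j m
    using Pol.power[OF Dmat_Pol[OF that], of "q ^ i"] that
    by (simp add: Cmat_def frobM_def Dmat_def)
  hence "\<exists>Y. \<forall>i<d. (\<forall>v. Y v i \<in> carrier_mat r r) \<and> (\<forall>j<r. \<forall>m<r.
      (\<forall>v. Y v i $$ (j, m) $ 0 = Cmat v i $$ (j, m)) \<and>
      (\<forall>v. \<forall>n>0. Y v i $$ (j, m) $ n = (adj_mat (Afps v i) * frobM q (Y v (cpred d i))) $$ (j, m) $ n) \<and>
      (\<forall>n. (\<lambda>v. Y v i $$ (j, m) $ n) \<in> Pol))"
    by (intro frob_system_exists[OF addP q1 Afps_carrier function_ring_Pol Afps_Pol])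
  hence *: "\<forall>i<d. (\<forall>v. Yfps v i \<in> carrier_mat r r) \<and> (\<forall>j<r. \<forall>m<r.
      (\<forall>v. Yfps v i $$ (j, m) $ 0 = Cmat v i $$ (j, m)) \<and>
      (\<forall>v. \<forall>n>0. Yfps v i $$ (j, m) $ n = (adj_mat (Afps v i) * frobM q (Yfps v (cpred d i))) $$ (j, m) $ n) \<and>
      (\<forall>n. (\<lambda>v. Yfps v i $$ (j, m) $ n) \<in> Pol))"
    unfolding Yfps_def by (rule someI_ex)
  note ** = *[rule_format, OF assms]
  show "Yfps v i \<in> carrier_mat r r" using ** by blast
  show "j < r \<Longrightarrow> l < r \<Longrightarrow> Yfps v i $$ (j, l) $ 0 = Cmat v i $$ (j, l)" using ** by blast
  show "j < r \<Longrightarrow> l < r \<Longrightarrow> n > 0 \<Longrightarrow>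
      Yfps v i $$ (j, l) $ n = (adj_mat (Afps v i) * frobM q (Yfps v (cpred d i))) $$ (j, l) $ n" using ** by blast
  show "j < r \<Longrightarrow> l < r \<Longrightarrow> (\<lambda>v. Yfps v i $$ (j, l) $ n) \<in> Pol" using ** by blast
qed

lemma cpred_less: "i < d \<Longrightarrow> cpred d i < d"
  by auto

lemma efps_0: "i < d \<Longrightarrow> efps i $ 0 = (if i = 0 then 1 else 0)"
proof -
  assume i: "i < d"
  let ?t = "\<theta> - \<theta> ^ (q ^ i)"
  have e: "efps i $ 0 = cL (1 - ?t ^ (Q - 1))"
    by (simp add: efps_def fps_nth_power_0 cL.h_diff cL.h_power)
  show ?thesis
  proof (cases "i = 0")
    case True
    thus ?thesis using e Q1 by (simp add: zero_power)
  next
    case False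
    hence ne: "?t \<noteq> 0" using inj_onD[OF \<theta>inj, of 0 i] i by auto
    have addcQ: "(a + b :: 'c) ^ Q = a ^ Q + b ^ Q" for a b
      unfolding Q by (rule additive_power_power[OF addc])
    have "?t ^ Q = \<theta> ^ Q - (\<theta> ^ (q ^ i)) ^ Q" by (rule additive_power_diff[OF addcQ])
    also have "(\<theta> ^ (q ^ i)) ^ Q = (\<theta> ^ Q) ^ (q ^ i)" by (simp only: power_mult[symmetric] mult.commute)
    finally have "?t ^ Q = ?t" unfolding \<theta>Q .
    moreover have "?t ^ Q = ?t * ?t ^ (Q - 1)" using Q0 by (metis Suc_diff_1 power_Suc)
    ultimately have "?t * ?t ^ (Q - 1) = ?t * 1" by simp
    hence "?t ^ (Q - 1) = 1" using ne by (simp only: mult_cancel_left) simp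
    thus ?thesis using e False by simp
  qed
qed

lemma Afps_0: "i < d \<Longrightarrow> map_mat (\<lambda>f. f $ 0) (Afps v i) =
    (if i = 0 then Umat r (bvec Q r v) * Nmat r 1 else 1\<^sub>m r)"
proof -
  assume i: "i < d"
  have "map_mat (\<lambda>f. f $ 0) (Afps v i) = Umat r (\<lambda>l. efps i $ 0 * bvec Q r v l) * Nmat r (efps i $ 0)"
    unfolding Afps_def
    by (subst mat_hom_mult[OF coeff_hom_fps_nth_0, of _ r r _ r])
       (simp_all add: Umat_hom[OF coeff_hom_fps_nth_0] Nmat_hom[OF coeff_hom_fps_nth_0])
  moreover have "Umat r (\<lambda>l. 0) * Nmat r 0 = (1\<^sub>m r :: 'c mp fract fls mat)"
  proof -
    have "Umat r (\<lambda>l. 0) = (1\<^sub>m r :: 'c mp fract fls mat)" by (rule eq_matI) (auto simp: Umat_def)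
    moreover have "Nmat r 0 = (1\<^sub>m r :: 'c mp fract fls mat)" by (rule eq_matI) (auto simp: Nmat_def)
    ultimately show ?thesis by simp
  qed
  ultimately show ?thesis using efps_0[OF i] by simp
qed

lemma Yfps_0: "i < d \<Longrightarrow> map_mat (\<lambda>f. f $ 0) (Yfps v i) = Cmat v i"
  using Yfps(1)[of i v] Yfps(2)[of i _ _ v] by (intro eq_matI) (auto simp: Cmat_def frobM_def Dmat_def)

text \<open>Only constant terms need checking. For i > 0 they are successive q-Frobenius powers of
  \<open>Dmat\<close>; at i = 0 the cycle closes with q^d = Q, and the condition is the Frobenius
  equation of \<open>Dmat\<close>.\<close>

lemma Yfps_sys:
  assumes i: "i < d" and v: "Lam Q r v = 1"
  shows "frobM q (Yfps v (cpred d i)) = Afps v i * Yfps v i"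
proof (rule frob_system_compat[OF Afps_carrier det_Afps Yfps(1)[OF i] Yfps(1)[OF cpred_less[OF i]] q0])
  show "Yfps v i $$ (j, l) $ n = (adj_mat (Afps v i) * frobM q (Yfps v (cpred d i))) $$ (j, l) $ n"
    if "j < r" "l < r" "n > 0" for j l n
    using Yfps(3)[OF i that] .
  show "frobM q (map_mat (\<lambda>f. f $ 0) (Yfps v (cpred d i))) = map_mat (\<lambda>f. f $ 0) (Afps v i) * map_mat (\<lambda>f. f $ 0) (Yfps v i)"
  proof (cases "i = 0")
    case True
    have "q ^ (d - 1) * q = Q" using d0 unfolding Q by (cases d) simp_all
    hence "frobM q (Cmat v (d - 1)) = frobM Q (Dmat Q r v)" unfolding Cmat_def frobM_frobM by simp
    also have "\<dots> = Umat r (bvec Q r v) * (Nmat r 1 * Dmat Q r v)" by (rule frob_Dmat[OF addL_Q r0 v])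
    also have "\<dots> = (Umat r (bvec Q r v) * Nmat r 1) * Dmat Q r v"
      by (rule assoc_mult_mat[symmetric, of _ r r _ r _ r]) simp_all
    moreover have "Cmat v 0 = Dmat Q r v" unfolding Cmat_def by (rule eq_matI) (auto simp: frobM_def)
    ultimately show ?thesis using True d0 i by (simp add: Yfps_0 Afps_0)
  next
    case False
    have "q ^ (i - 1) * q = q ^ i" using False by (cases i) simp_all
    hence "frobM q (Cmat v (i - 1)) = Cmat v i" unfolding Cmat_def frobM_frobM by simp
    thus ?thesis using False i by (simp add: Yfps_0 Afps_0 Cmat_def left_mult_one_mat[of _ r r])
  qed
qed

text \<open>The matrices of the system have determinant 1, so the zeroth determinant u is fixed by
  the Q-Frobenius. If u - 1 were nonzero, its power Q - 1 would be 1, against its vanishing constant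
  term.\<close>

lemma det_Yfps:
  assumes i: "i < d" and v: "Lam Q r v = 1"
  shows "det (Yfps v i) = 1"
proof -
  have step: "det (Yfps v i) = det (Yfps v (cpred d i)) ^ q" if "i < d" for i
    using arg_cong[OF Yfps_sys[OF that v], of det] det_mult[OF Afps_carrier Yfps(1)[OF that], of v i v]
    by (simp add: det_frobM[OF addP])
  have k: "det (Yfps v k) = det (Yfps v 0) ^ (q ^ k)" if "k < d" for k
    using that
  proof (induction k)
    case (Suc k)
    thus ?case using step[of "Suc k"] by (simp add: power_mult[symmetric] mult.commute)
  qed simp
  let ?u = "det (Yfps v 0)"
  have "?u = (?u ^ (q ^ (d - 1))) ^ q" using step[of 0] k[of "d - 1"] d0 by simp
  also have "\<dots> = ?u ^ Q" unfolding Q using d0 by (cases d) (simp_all add: power_mult[symmetric] mult.commute)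
  finally have uQ: "?u ^ Q = ?u" ..
  have u0: "?u $ 0 = 1"
  proof -
    have "?u $ 0 = det (map_mat (\<lambda>f. f $ 0) (Yfps v 0))" by (simp add: det_hom[OF coeff_hom_fps_nth_0])
    also have "map_mat (\<lambda>f. f $ 0) (Yfps v 0) = Dmat Q r v"
      unfolding Yfps_0[OF d0] Cmat_def by (rule eq_matI) (auto simp: frobM_def)
    finally show ?thesis using v by (simp add: Lam_def)
  qed
  have "?u - 1 = 0"
  proof (rule ccontr)
    assume ne: "?u - 1 \<noteq> 0"
    have "(?u - 1) ^ Q = ?u - 1" using additive_power_diff[OF addP_Q, of ?u 1] uQ by simp
    hence "(?u - 1) * (?u - 1) ^ (Q - 1) = (?u - 1) * 1" using Q0 by (simp add: power_eq_if)
    hence "(?u - 1) ^ (Q - 1) = 1" using ne by (simp only: mult_cancel_left) simp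
    hence "((?u - 1) ^ (Q - 1)) $ 0 = 1" by simp
    thus False using u0 Q1 by (simp add: fps_nth_power_0 zero_power)
  qed
  hence "?u = 1" by simp
  thus ?thesis using k[OF i] by simp
qed

section \<open>The special linear group acting on the solution\<close>

definition Gmat where "Gmat = {V \<in> carrier_mat r r. (\<forall>l<r. \<forall>k<r. (V $$ (l, k) :: 'c) ^ Q = V $$ (l, k)) \<and> det V = 1}"

abbreviation yG :: "'c mat \<Rightarrow> nat \<Rightarrow> 'c mp fract fls" where "yG V \<equiv> vmult r y (map_mat cL V)"

lemma map_cL:
  assumes "V \<in> Gmat"
  shows "map_mat cL V \<in> carrier_mat r r" "frobM Q (map_mat cL V) = map_mat cL V" "det (map_mat cL V) = 1"
proof -
  show "map_mat cL V \<in> carrier_mat r r" using assms by (simp add: Gmat_def)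
  show "frobM Q (map_mat cL V) = map_mat cL V"
    using assms by (intro eq_matI) (auto simp: frobM_def Gmat_def simp flip: cL.h_power)
  show "det (map_mat cL V) = 1" using assms by (simp add: det_hom[OF coeff_hom_cL] Gmat_def)
qed

lemma Lam_yG: "V \<in> Gmat \<Longrightarrow> Lam Q r (yG V) = 1"
  by (rule bvec_vmult(1)[OF addL_Q Q0 r0 map_cL y1])

lemma Afps_yG: "V \<in> Gmat \<Longrightarrow> Afps (yG V) i = Afps y i"
proof -
  assume V: "V \<in> Gmat"
  have "Umat r (\<lambda>l. efps i * fps_const (bvec Q r (yG V) l)) = Umat r (\<lambda>l. efps i * fps_const (bvec Q r y l))"
    by (rule Umat_cong) (simp add: bvec_vmult(2)[OF addL_Q Q0 r0 map_cL[OF V] y1])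
  thus ?thesis by (simp add: Afps_def)
qed

definition liftP :: "nat \<Rightarrow> 'c mat \<Rightarrow> 'c mp fract fls fps mat"
  where "liftP i V = map_mat (\<lambda>x. fps_const (cL (x ^ (q ^ i)))) V"

text \<open>\<open>bvec\<close> is the same at \<open>y\<close> and at its translate, so both sides
  solve the same system; their constant terms agree, and the solution is unique. Moving the point by
  V thus multiplies the solution by the twisted V.\<close>

lemma Yfps_yG:
  assumes V: "V \<in> Gmat" and i: "i < d"
  shows "Yfps (yG V) i = Yfps y i * liftP i V"
proof (rule frob_system_unique[where A = "Afps y" and d = d and Y = "Yfps (yG V)" and Z = "\<lambda>i. Yfps y i * liftP i V", OF addP q1])
  have Vc: "V \<in> carrier_mat r r" using V by (simp add: Gmat_def)
  have lc: "liftP i V \<in> carrier_mat r r" for i using Vc by (simp add: liftP_def)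
  show "Yfps (yG V) i \<in> carrier_mat r r" if "i < d" for i by (rule Yfps(1)[OF that])
  show Yl: "Yfps y i * liftP i V \<in> carrier_mat r r" if "i < d" for i by (rule mult_carrier_mat[OF Yfps(1)[OF that] lc])
  show "frobM q (Yfps (yG V) (cpred d i)) = Afps y i * Yfps (yG V) i" if "i < d" for i
    using Yfps_sys[OF that Lam_yG[OF V]] by (simp add: Afps_yG[OF V])
  show "frobM q (Yfps y (cpred d i) * liftP (cpred d i) V) = Afps y i * (Yfps y i * liftP i V)" if i: "i < d" for i
  proof -
    have "frobM q (liftP (cpred d i) V) = liftP i V"
    proof (rule eq_matI)
      fix a b assume "a < dim_row (liftP i V)" "b < dim_col (liftP i V)"
      hence ab: "a < r" "b < r" using lc[of i] by auto
      have "(V $$ (a, b) ^ (q ^ cpred d i)) ^ q = V $$ (a, b) ^ (q ^ i)"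
      proof (cases "i = 0")
        case True
        have "(V $$ (a, b) ^ (q ^ (d - 1))) ^ q = V $$ (a, b) ^ Q"
          unfolding Q using d0 by (cases d) (simp_all add: power_mult[symmetric] mult.commute)
        thus ?thesis using True V ab by (simp add: Gmat_def)
      next
        case False
        thus ?thesis by (cases i) (simp_all add: power_mult[symmetric] mult.commute)
      qed
      hence "(fps_const (cL (V $$ (a, b) ^ (q ^ cpred d i)))) ^ q = fps_const (cL (V $$ (a, b) ^ (q ^ i)))"
        by (simp only: fps_const_power cL.h_power[symmetric])
      thus "frobM q (liftP (cpred d i) V) $$ (a, b) = liftP i V $$ (a, b)"
        using ab Vc by (simp add: liftP_def frobM_def)
    qed (use lc in \<open>auto simp: frobM_def liftP_def\<close>)
    hence "frobM q (Yfps y (cpred d i) * liftP (cpred d i) V) = (Afps y i * Yfps y i) * liftP i V"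
      using frobM_mult[OF addP Yfps(1)[OF cpred_less[OF i]] lc] Yfps_sys[OF i y1] by simp
    also have "\<dots> = Afps y i * (Yfps y i * liftP i V)"
      by (rule assoc_mult_mat[OF Afps_carrier Yfps(1)[OF i] lc])
    finally show ?thesis .
  qed
  show "Yfps (yG V) i $$ (j, l) $ 0 = (Yfps y i * liftP i V) $$ (j, l) $ 0" if "i < d" "j < r" "l < r" for i j l
  proof -
    have "map_mat (\<lambda>f. f $ 0) (Yfps y i * liftP i V) = Cmat y i * map_mat (\<lambda>f. f $ 0) (liftP i V)"
      unfolding Yfps_0[OF that(1), symmetric] by (rule mat_hom_mult[OF coeff_hom_fps_nth_0 Yfps(1)[OF that(1)] lc])
    also have "map_mat (\<lambda>f. f $ 0) (liftP i V) = frobM (q ^ i) (map_mat cL V)"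
      by (rule eq_matI) (auto simp: liftP_def frobM_def cL.h_power)
    also have "Cmat y i * frobM (q ^ i) (map_mat cL V) = frobM (q ^ i) (Dmat Q r y * map_mat cL V)"
      unfolding Cmat_def by (rule frobM_mult[OF additive_power_power[OF addL], symmetric, of _ r r _ r]) (use map_cL[OF V] in simp_all)
    also have "\<dots> = Cmat (yG V) i"
      unfolding Cmat_def Dmat_vmult[OF addL_Q Q0 map_cL(1,2)[OF V]] ..
    finally have "map_mat (\<lambda>f. f $ 0) (Yfps y i * liftP i V) = Cmat (yG V) i" .
    hence "map_mat (\<lambda>f. f $ 0) (Yfps y i * liftP i V) $$ (j, l) = Cmat (yG V) i $$ (j, l)" by simp
    thus ?thesis
      using Yfps(2)[OF that, of "yG V"] carrier_matD[OF Yl[OF that(1)]] that by (simp del: index_mult_mat(1))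
  qed
qed (use i in simp_all)

section \<open>The system over Laurent series and its field of definition\<close>

definition YN :: "nat \<Rightarrow> 'c mp fract fls fls mat" where "YN i = map_mat fps_to_fls (Yfps y i)"
definition AN :: "nat \<Rightarrow> 'c mp fract fls fls mat" where "AN i = map_mat fps_to_fls (Afps y i)"

lemma YN: "i < d \<Longrightarrow> YN i \<in> carrier_mat r r" "i < d \<Longrightarrow> det (YN i) = 1"
    "i < d \<Longrightarrow> frobM q (YN (cpred d i)) = AN i * YN i"
proof -
  assume i: "i < d"
  show "YN i \<in> carrier_mat r r" using Yfps(1)[OF i] by (simp add: YN_def)
  show "det (YN i) = 1" by (simp add: YN_def det_hom[OF coeff_hom_fps_to_fls] det_Yfps[OF i y1])
  have "frobM q (YN (cpred d i)) = map_mat fps_to_fls (frobM q (Yfps y (cpred d i)))"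
    by (rule eq_matI) (auto simp: YN_def frobM_def fps_to_fls_power)
  also have "\<dots> = AN i * YN i"
    unfolding Yfps_sys[OF i y1] AN_def YN_def by (rule mat_hom_mult[OF coeff_hom_fps_to_fls Afps_carrier Yfps(1)[OF i]])
  finally show "frobM q (YN (cpred d i)) = AN i * YN i" .
qed

text \<open>The polynomial 1 - (T - Z)^(Q-1), whose value at Z = \<theta>^(q^i) is
  \<open>efps i\<close>. Its coefficients involve T only, so the system is defined over any subfield
  containing T and the relevant \<beta>_i.\<close>

definition ePol :: "'c mp fract fls fls poly" where "ePol = 1 - [:T, - 1:] ^ (Q - 1)"
definition Apol :: "'c mp fract fls fls poly mat"
  where "Apol = Umat r (\<lambda>l. ePol * [:\<beta> (Suc l):]) * Nmat r ePol"

lemma AN_poly: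
  assumes "j < r" "l < r"
  shows "AN i $$ (j, l) = poly (Apol $$ (j, l)) (\<kappa> (\<theta> ^ (q ^ i)))"
proof -
  let ?x = "\<kappa> (\<theta> ^ (q ^ i))"
  interpret c: coeff_hom "fps_to_fls :: 'c mp fract fls fps \<Rightarrow> _" by (rule coeff_hom_fps_to_fls)
  have e: "fps_to_fls (efps i) = poly ePol ?x"
    by (simp add: efps_def ePol_def c.h_diff c.h_power c.h_add T_def \<kappa>_def fls_X_conv_shift_1)
  have "AN i = Umat r (\<lambda>l. poly ePol ?x * \<beta> (Suc l)) * Nmat r (poly ePol ?x)"
    unfolding AN_def Afps_def
    by (subst mat_hom_mult[OF coeff_hom_fps_to_fls, of _ r r _ r])
       (simp_all add: Umat_hom[OF coeff_hom_fps_to_fls] Nmat_hom[OF coeff_hom_fps_to_fls] c.h_mult e \<beta>_def)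
  also have "\<dots> = map_mat (\<lambda>p. poly p ?x) Apol"
    unfolding Apol_def
    by (subst mat_hom_mult[OF coeff_hom_poly, of _ r r _ r])
       (simp_all add: Umat_hom[OF coeff_hom_poly] Nmat_hom[OF coeff_hom_poly] mult.commute)
  finally show ?thesis using assms by (simp add: Apol_def Umat_def Nmat_def)
qed

lemma Apol_coeffs:
  assumes F: "subfld F" "T \<in> F" "\<And>i. 1 \<le> i \<Longrightarrow> i < r \<Longrightarrow> \<beta> i \<in> F" and "j < r" "l < r"
  shows "Apol $$ (j, l) \<in> coeffs_in F"
proof -
  interpret F: subfield_set F by unfold_locales (rule F)
  have pw: "p ^ n \<in> coeffs_in F" if "p \<in> coeffs_in F" for p n
    using that by (induction n) (auto intro: F.coeffs_in_1 F.coeffs_in_mult)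
  have z: "0 \<in> coeffs_in F" by (simp add: coeffs_in_def)
  have "[:T, - 1:] \<in> coeffs_in F" using F(2) by (auto simp: coeffs_in_def coeff_pCons F.uminus split: nat.splits)
  hence e: "ePol \<in> coeffs_in F" unfolding ePol_def by (intro F.coeffs_in_diff F.coeffs_in_1 pw)
  have "Umat r (\<lambda>l. ePol * [:\<beta> (Suc l):]) $$ (a, b) \<in> coeffs_in F" if "a < r" "b < r" for a b
  proof -
    have "ePol * [:\<beta> (Suc b):] \<in> coeffs_in F" if "Suc b < r"
      using that by (intro F.coeffs_in_mult e F.coeffs_in_const F) auto
    thus ?thesis using that F.coeffs_in_1 z by (auto simp: Umat_def)
  qed
  moreover have "Nmat r ePol $$ (a, b) \<in> coeffs_in F" if "a < r" "b < r" for a b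
    using that e F.coeffs_in_1 z by (auto simp: Nmat_def)
  ultimately show ?thesis unfolding Apol_def using assms(4,5)
    by (subst mult_index[of _ r r _ r]) (auto intro!: F.coeffs_in_sum F.coeffs_in_mult)
qed

end

section \<open>Extending homomorphisms\<close>

lemma map_poly_coeff_hom:
  assumes "coeff_hom h"
  shows "coeff_hom (map_poly h)"
proof -
  interpret coeff_hom h by fact
  have "map_poly h (p * q) = map_poly h p * map_poly h q" for p q
    by (rule poly_eqI) (simp add: coeff_map_poly coeff_mult h_sum h_mult)
  moreover have "map_poly h (p + q) = map_poly h p + map_poly h q" for p q
    by (rule poly_eqI) (simp add: coeff_map_poly h_add)
  ultimately show ?thesis by unfold_locales simp_all
qed

text \<open>An algebraically closed field has no further algebraic elements above it: split off a
  root and use induction on the degree.\<close>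

lemma root_in_image:
  fixes h :: "'c :: alg_closed_field \<Rightarrow> 'n :: field"
  assumes h: "coeff_hom h" and "p \<noteq> 0" "poly (map_poly h p) x = 0"
  shows "x \<in> range h"
  using assms(2,3)
proof (induction "Polynomial.degree p" arbitrary: p)
  case 0
  then obtain c where c: "p = [:c:]" "c \<noteq> 0" by (metis degree_0_id pCons_eq_0_iff)
  interpret coeff_hom h by (rule h)
  have "h c * h (inverse c) = 1" unfolding h_mult[symmetric] using c by simp
  thus ?case using 0 c by (auto simp: map_poly_pCons)
next
  case (Suc n)
  interpret coeff_hom h by (rule h)
  interpret M: coeff_hom "map_poly h" by (rule map_poly_coeff_hom[OF h])
  obtain a where a: "poly p a = 0" using alg_closed_imp_poly_has_root[of p] Suc by auto
  then obtain s where s: "p = [:- a, 1:] * s" by (metis dvdE poly_eq_0_iff_dvd)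
  have s0: "s \<noteq> 0" using s Suc by auto
  have "Polynomial.degree p = 1 + Polynomial.degree s" unfolding s using s0 by (subst degree_mult_eq) auto
  hence "n = Polynomial.degree s" using Suc(2) by simp
  moreover have "(x - h a) * poly (map_poly h s) x = 0"
  proof -
    have "map_poly h p = map_poly h [:- a, 1:] * map_poly h s" unfolding s by (rule M.h_mult)
    moreover have "map_poly h [:- a, 1:] = [:- h a, 1:]" by (simp add: map_poly_pCons h_uminus)
    ultimately show ?thesis using Suc(4) by (simp del: mult_pCons_left)
  qed
  ultimately show ?case using Suc(1)[of s] s0 by auto
qed

text \<open>Stated for a subring \<open>S\<close>, because the evaluation at the \<beta>_i is known
  to be injective only on polynomials in t_1, ..., t_(r-1).\<close>

lemma fract_extension:
  fixes h :: "'a :: idom \<Rightarrow> 'b :: field"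
  assumes h: "coeff_hom h" and S: "1 \<in> S" "- 1 \<in> S" "\<And>x y. x \<in> S \<Longrightarrow> y \<in> S \<Longrightarrow> x + y \<in> S"
    "\<And>x y. x \<in> S \<Longrightarrow> y \<in> S \<Longrightarrow> x * y \<in> S" and inj: "\<And>x. x \<in> S \<Longrightarrow> h x = 0 \<Longrightarrow> x = 0"
  defines "W \<equiv> {to_fract a / to_fract b | a b. a \<in> S \<and> b \<in> S \<and> b \<noteq> 0}"
  shows "subfld W" "\<exists>\<psi>. fhom W \<psi> \<and> (\<forall>a\<in>S. \<forall>b\<in>S. b \<noteq> 0 \<longrightarrow> \<psi> (to_fract a / to_fract b) = h a / h b)"
proof -
  interpret coeff_hom h by (rule h)
  interpret tf: coeff_hom "to_fract :: 'a \<Rightarrow> _" by (rule coeff_hom_to_fract)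
  have tf0: "to_fract (x :: 'a) = 0 \<longleftrightarrow> x = 0" for x by simp
  have W: "to_fract a / to_fract b \<in> W" if "a \<in> S" "b \<in> S" "b \<noteq> 0" for a b
    using that by (auto simp: W_def)
  have Welim: "\<exists>a\<in>S. \<exists>b\<in>S. b \<noteq> 0 \<and> x = to_fract a / to_fract b" if "x \<in> W" for x
    using that by (auto simp: W_def)
  have addW: "to_fract a / to_fract b + to_fract a' / to_fract b' = to_fract (a * b' + a' * b) / to_fract (b * b')"
    if "b \<noteq> 0" "b' \<noteq> 0" for a b a' b' :: 'a
    unfolding tf.h_add tf.h_mult by (rule add_frac_eq) (use that in auto)
  have multW: "to_fract a / to_fract b * (to_fract a' / to_fract b') = to_fract (a * a') / to_fract (b * b')" for a b a' b' :: 'a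
    unfolding tf.h_mult by (rule times_divide_times_eq)
  show "subfld W"
  proof (rule subfldI)
    show "1 \<in> W" using W[of 1 1] S by simp
    show "- 1 \<in> W" using W[of "- 1" 1] S by (simp add: tf.h_uminus)
    fix x y assume x: "x \<in> W" and y: "y \<in> W"
    obtain a b where a: "a \<in> S" "b \<in> S" "b \<noteq> 0" "x = to_fract a / to_fract b" using Welim[OF x] by auto
    obtain a' b' where a': "a' \<in> S" "b' \<in> S" "b' \<noteq> 0" "y = to_fract a' / to_fract b'" using Welim[OF y] by auto
    show "x + y \<in> W" unfolding a(4) a'(4) addW[OF a(3) a'(3)] by (intro W S a a') (use a a' in simp)
    show "x * y \<in> W" unfolding a(4) a'(4) multW by (intro W S a a') (use a a' in simp)
  next
    fix x assume x: "x \<in> W" "x \<noteq> 0"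
    obtain a b where a: "a \<in> S" "b \<in> S" "b \<noteq> 0" "x = to_fract a / to_fract b" using Welim[OF x(1)] by auto
    hence "a \<noteq> 0" using x(2) by auto
    hence "to_fract b / to_fract a \<in> W" using a by (intro W)
    thus "inverse x \<in> W" using a by simp
  qed
  define \<psi> where "\<psi> x = (SOME z. \<exists>a\<in>S. \<exists>b\<in>S. b \<noteq> 0 \<and> x = to_fract a / to_fract b \<and> z = h a / h b)" for x
  have hnz: "h b \<noteq> 0" if "b \<in> S" "b \<noteq> 0" for b using inj that by blast
  have \<psi>: "\<psi> (to_fract a / to_fract b) = h a / h b" if ab: "a \<in> S" "b \<in> S" "b \<noteq> 0" for a b
  proof -
    have "\<exists>z. \<exists>a'\<in>S. \<exists>b'\<in>S. b' \<noteq> 0 \<and> to_fract a / to_fract b = to_fract a' / to_fract b' \<and> z = h a' / h b'"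
      using ab by blast
    hence "\<exists>a'\<in>S. \<exists>b'\<in>S. b' \<noteq> 0 \<and> to_fract a / to_fract b = to_fract a' / to_fract b' \<and> \<psi> (to_fract a / to_fract b) = h a' / h b'"
      unfolding \<psi>_def by (rule someI_ex)
    then obtain a' b' where ab': "a' \<in> S" "b' \<in> S" "b' \<noteq> 0" "to_fract a / to_fract b = to_fract a' / to_fract b'"
      "\<psi> (to_fract a / to_fract b) = h a' / h b'" by blast
    have "to_fract a * to_fract b' = to_fract a' * to_fract b"
      using ab'(4) ab(3) ab'(3) by (simp add: frac_eq_eq)
    hence "a * b' = a' * b" by (simp flip: to_fract_mult)
    hence "h a * h b' = h a' * h b" by (simp flip: h_mult)
    thus ?thesis using ab'(5) hnz[OF ab(2,3)] hnz[OF ab'(2,3)] by (simp add: frac_eq_eq)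
  qed
  have "fhom W \<psi>" unfolding fhom_def
  proof (intro conjI ballI)
    show "\<psi> 1 = 1" using \<psi>[of 1 1] S by simp
    fix x y assume x: "x \<in> W" and y: "y \<in> W"
    obtain a b where a: "a \<in> S" "b \<in> S" "b \<noteq> 0" "x = to_fract a / to_fract b" using Welim[OF x] by auto
    obtain a' b' where a': "a' \<in> S" "b' \<in> S" "b' \<noteq> 0" "y = to_fract a' / to_fract b'" using Welim[OF y] by auto
    have n: "h b \<noteq> 0" "h b' \<noteq> 0" using hnz a a' by auto
    have "\<psi> (x + y) = h (a * b' + a' * b) / h (b * b')"
      unfolding a(4) a'(4) addW[OF a(3) a'(3)] by (intro \<psi> S a a') (use a a' in simp)
    also have "\<dots> = \<psi> x + \<psi> y" unfolding a(4) a'(4) \<psi>[OF a(1-3)] \<psi>[OF a'(1-3)] h_add h_mult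
      by (rule add_frac_eq[OF n, symmetric])
    finally show "\<psi> (x + y) = \<psi> x + \<psi> y" .
    have "\<psi> (x * y) = h (a * a') / h (b * b')"
      unfolding a(4) a'(4) multW by (intro \<psi> S a a') (use a a' in simp)
    also have "\<dots> = \<psi> x * \<psi> y" unfolding a(4) a'(4) \<psi>[OF a(1-3)] \<psi>[OF a'(1-3)] h_mult
      by (rule times_divide_times_eq[symmetric])
    finally show "\<psi> (x * y) = \<psi> x * \<psi> y" .
  qed
  thus "\<exists>\<psi>. fhom W \<psi> \<and> (\<forall>a\<in>S. \<forall>b\<in>S. b \<noteq> 0 \<longrightarrow> \<psi> (to_fract a / to_fract b) = h a / h b)"
    using \<psi> by blast
qed

section \<open>The special linear group\<close>

lemma SL_carrier_iff:
  "V \<in> carrier (SL n (GF Q)) \<longleftrightarrow> V \<in> carrier_mat n n \<and> (\<forall>i<n. \<forall>j<n. V $$ (i, j) ^ Q = V $$ (i, j)) \<and> det V = 1"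
  by (auto simp: SL_def GF_def)

lemma SL_carrier_frobM:
  "V \<in> carrier (SL n (GF Q)) \<longleftrightarrow> V \<in> carrier_mat n n \<and> frobM Q V = V \<and> det V = 1"
  unfolding SL_carrier_iff
proof (intro conj_cong refl)
  assume V: "V \<in> carrier_mat n n"
  show "(\<forall>i<n. \<forall>j<n. V $$ (i, j) ^ Q = V $$ (i, j)) \<longleftrightarrow> frobM Q V = V"
  proof
    assume "frobM Q V = V"
    hence "frobM Q V $$ (i, j) = V $$ (i, j)" for i j by simp
    moreover have "frobM Q V $$ (i, j) = V $$ (i, j) ^ Q" if "i < n" "j < n" for i j
      using V that by (simp add: frobM_def)
    ultimately show "\<forall>i<n. \<forall>j<n. V $$ (i, j) ^ Q = V $$ (i, j)" by metis
  qed (use V in \<open>auto simp: frobM_def intro!: eq_matI\<close>)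
qed

lemma group_SL:
  assumes add: "\<And>x y :: 'k :: {field, finite} alg_closure. (x + y) ^ Q = x ^ Q + y ^ Q" and Q: "Q > 0"
  shows "group (SL n (GF Q :: 'k alg_closure set))"
proof (rule groupI)
  let ?G = "SL n (GF Q :: 'k alg_closure set)"
  have ops: "x \<otimes>\<^bsub>?G\<^esub> y = x * y" "\<one>\<^bsub>?G\<^esub> = 1\<^sub>m n" for x y by (simp_all add: SL_def)
  have one: "frobM Q (1\<^sub>m n) = (1\<^sub>m n :: 'k alg_closure mat)"
    by (rule eq_matI) (use Q in \<open>auto simp: frobM_def zero_power\<close>)
  thus "\<one>\<^bsub>?G\<^esub> \<in> carrier ?G" by (simp add: SL_carrier_frobM ops)
  fix x y z
  assume x: "x \<in> carrier ?G"
  note xc = x[unfolded SL_carrier_frobM]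
  show "\<one>\<^bsub>?G\<^esub> \<otimes>\<^bsub>?G\<^esub> x = x" using xc left_mult_one_mat[of x n n] by (simp add: ops)
  have ax: "adj_mat x \<in> carrier_mat n n" using adj_mat(1) xc by blast
  note inv = mult_adj_unimodular[of x n]
  have "adj_mat x \<in> carrier ?G"
    unfolding SL_carrier_frobM
  proof (intro conjI)
    \<comment> \<open>Frob of the adjugate is another right inverse of x, hence equal to the
      adjugate, whose entries therefore lie in \<open>GF Q\<close>.\<close>
    have "frobM Q (x * adj_mat x) = x * frobM Q (adj_mat x)"
      using frobM_mult[OF add _ ax, of x n] xc by simp
    hence "x * frobM Q (adj_mat x) = 1\<^sub>m n" using inv xc one by simp
    hence "adj_mat x * (x * frobM Q (adj_mat x)) = adj_mat x" using ax by simp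
    moreover have "adj_mat x * (x * frobM Q (adj_mat x)) = (adj_mat x * x) * frobM Q (adj_mat x)"
      by (rule assoc_mult_mat[symmetric, of _ n n _ n _ n]) (use ax xc in simp_all)
    ultimately show "frobM Q (adj_mat x) = adj_mat x" using inv xc ax by simp
    have "det x * det (adj_mat x) = 1" using det_mult[of x n "adj_mat x"] ax xc inv by simp
    thus "det (adj_mat x) = 1" using xc by simp
  qed (rule ax)
  moreover have "adj_mat x \<otimes>\<^bsub>?G\<^esub> x = \<one>\<^bsub>?G\<^esub>" using inv xc by (simp add: ops)
  ultimately show "\<exists>y\<in>carrier ?G. y \<otimes>\<^bsub>?G\<^esub> x = \<one>\<^bsub>?G\<^esub>" by blast
  assume y: "y \<in> carrier ?G"
  note yc = y[unfolded SL_carrier_frobM]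
  show "x \<otimes>\<^bsub>?G\<^esub> y \<in> carrier ?G"
    unfolding ops SL_carrier_frobM using xc yc frobM_mult[OF add, of x n n y n] det_mult[of x n y] by auto
  assume z: "z \<in> carrier ?G"
  note zc = z[unfolded SL_carrier_frobM]
  show "x \<otimes>\<^bsub>?G\<^esub> y \<otimes>\<^bsub>?G\<^esub> z = x \<otimes>\<^bsub>?G\<^esub> (y \<otimes>\<^bsub>?G\<^esub> z)"
    unfolding ops by (rule assoc_mult_mat[of _ n n _ n _ n]) (use xc yc zc in simp_all)
qed

lemma (in group) group_center_normal: "group_center G \<lhd> G"
proof -
  have comm: "inv z \<otimes> g = g \<otimes> inv z" if "z \<in> carrier G" "\<forall>g\<in>carrier G. z \<otimes> g = g \<otimes> z" "g \<in> carrier G" for z g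
  proof -
    have "z \<otimes> inv g = inv g \<otimes> z" using that by auto
    hence "inv (z \<otimes> inv g) = inv (inv g \<otimes> z)" by (rule arg_cong)
    thus ?thesis using that(1,3) inv_mult_group[of z "inv g"] inv_mult_group[of "inv g" z] by simp
  qed
  have sub: "subgroup (group_center G) G"
  proof (rule subgroupI)
    show "group_center G \<subseteq> carrier G" by (auto simp: group_center_def)
    have "\<one> \<in> group_center G" by (simp add: group_center_def)
    thus "group_center G \<noteq> {}" by blast
    fix a assume a: "a \<in> group_center G"
    thus "inv a \<in> group_center G" using comm[of a] by (simp add: group_center_def)
    fix b assume b: "b \<in> group_center G"
    have "a \<otimes> b \<otimes> g = g \<otimes> (a \<otimes> b)" if g: "g \<in> carrier G" for g
    proof -
      have ab: "a \<in> carrier G" "b \<in> carrier G" "b \<otimes> g = g \<otimes> b" "a \<otimes> g = g \<otimes> a"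
        using a b g by (auto simp: group_center_def)
      have "a \<otimes> b \<otimes> g = a \<otimes> g \<otimes> b" using ab(1-3) g by (simp add: m_assoc)
      thus ?thesis using ab(1,2) g unfolding ab(4) by (simp add: m_assoc)
    qed
    moreover have "a \<in> carrier G" "b \<in> carrier G" using a b by (auto simp: group_center_def)
    ultimately show "a \<otimes> b \<in> group_center G" unfolding group_center_def by blast
  qed
  show ?thesis
  proof (rule normal_invI[OF sub])
    fix x h assume x: "x \<in> carrier G" and h: "h \<in> group_center G"
    have hc: "h \<in> carrier G" "h \<otimes> x = x \<otimes> h" using x h by (auto simp: group_center_def)
    have "x \<otimes> h \<otimes> inv x = h \<otimes> x \<otimes> inv x" unfolding hc(2) ..
    also have "\<dots> = h" using x hc(1) by (simp add: m_assoc)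
    finally show "x \<otimes> h \<otimes> inv x \<in> group_center G" using h by simp
  qed
qed

section \<open>The rational function field inside the universe\<close>

definition vars_in :: "nat set \<Rightarrow> ((nat \<Rightarrow>\<^sub>0 nat) \<Rightarrow>\<^sub>0 'a :: comm_ring_1) set"
  where "vars_in J = {p. \<forall>m\<in>keys p. keys m \<subseteq> J}"

lemma vars_in_closed:
  fixes a b :: "(nat \<Rightarrow>\<^sub>0 nat) \<Rightarrow>\<^sub>0 'a :: comm_ring_1" and c :: 'a
  shows "Poly_Mapping.single 0 c \<in> vars_in J" "i \<in> J \<Longrightarrow> Poly_Mapping.single (Poly_Mapping.single i 1) c \<in> vars_in J"
    "(1 :: (nat \<Rightarrow>\<^sub>0 nat) \<Rightarrow>\<^sub>0 'a) \<in> vars_in J" "(- 1 :: (nat \<Rightarrow>\<^sub>0 nat) \<Rightarrow>\<^sub>0 'a) \<in> vars_in J"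
    "a \<in> vars_in J \<Longrightarrow> b \<in> vars_in J \<Longrightarrow> a + b \<in> vars_in J"
    "a \<in> vars_in J \<Longrightarrow> b \<in> vars_in J \<Longrightarrow> a * b \<in> vars_in J"
proof -
  show s: "Poly_Mapping.single 0 c \<in> vars_in J" for c :: 'a by (simp add: vars_in_def)
  show "i \<in> J \<Longrightarrow> Poly_Mapping.single (Poly_Mapping.single i 1) c \<in> vars_in J" by (simp add: vars_in_def)
  show "(1 :: (nat \<Rightarrow>\<^sub>0 nat) \<Rightarrow>\<^sub>0 'a) \<in> vars_in J" "(- 1 :: (nat \<Rightarrow>\<^sub>0 nat) \<Rightarrow>\<^sub>0 'a) \<in> vars_in J" using s[of 1] s[of "- 1"] by (simp_all add: single_uminus)
  assume ab: "a \<in> vars_in J" "b \<in> vars_in J"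
  show "a + b \<in> vars_in J" using ab keys_add[of a b] by (auto simp: vars_in_def)
  show "a * b \<in> vars_in J" unfolding vars_in_def
  proof (intro CollectI ballI)
    fix m assume "m \<in> keys (a * b)"
    then obtain m1 m2 where "m1 \<in> keys a" "m2 \<in> keys b" "m = m1 + m2" using keys_mult[of a b] by auto
    thus "keys m \<subseteq> J" using ab keys_add[of m1 m2] by (fastforce simp: vars_in_def)
  qed
qed

lemma coeff_hom_const_univ: "coeff_hom const_univ"
proof
  fix a b :: "'a ratfun"
  show "const_univ (a + b) = const_univ a + const_univ b"
    unfolding const_univ_def single_add to_fract_add to_ac_add ..
  have "Poly_Mapping.single 0 (a * b) = Poly_Mapping.single (0 :: nat \<Rightarrow>\<^sub>0 nat) a * Poly_Mapping.single 0 b"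
    by (simp add: mult_single)
  thus "const_univ (a * b) = const_univ a * const_univ b"
    unfolding const_univ_def by (simp only: to_fract_mult to_ac_mult)
qed (simp add: const_univ_def)

lemma to_ac_meval: "to_ac (to_fract p) = meval const_univ indet p"
proof -
  have h: "coeff_hom (\<lambda>x :: 'a ratfun mp fract. to_ac x)" by unfold_locales simp_all
  have "to_ac (to_fract p) = to_ac (meval cB XB p)" by (simp only: meval_XB)
  also have "\<dots> = meval (\<lambda>c. to_ac (cB c)) (\<lambda>i. to_ac (XB i)) p" by (rule meval_hom[OF h coeff_hom_cB])
  also have "(\<lambda>c :: 'a ratfun. to_ac (cB c)) = const_univ" by (rule ext) (simp only: cB_def const_univ_def)
  also have "(\<lambda>i. to_ac (XB i :: 'a ratfun mp fract)) = indet" by (rule ext) (simp only: XB_def indet_def)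
  finally show ?thesis .
qed

lemma subfld_const_field: "subfld const_field"
proof -
  interpret coeff_hom "const_univ :: 'a ratfun \<Rightarrow> _" by (rule coeff_hom_const_univ)
  have "fhom UNIV (const_univ :: 'a ratfun \<Rightarrow> _)" by (simp add: fhom_def h_add h_mult)
  moreover have "subfld (UNIV :: 'a ratfun set)" by (simp add: subfld_def)
  ultimately interpret field_hom_on "UNIV :: 'a ratfun set" const_univ by unfold_locales
  show ?thesis unfolding const_field_def by (rule subfld_image)
qed

text \<open>Replaces the generated field by explicit fractions, on which a homomorphism can be
  defined through its values on polynomials.\<close>

lemma pure_field_eq:
  "pure_field n = to_ac ` {to_fract a / to_fract b | a b. a \<in> vars_in {1..n} \<and> b \<in> vars_in {1..n} \<and> b \<noteq> 0}"
  (is "_ = to_ac ` ?W")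
proof -
  interpret A: Ring.field "ambient :: 'a universe ring" by (rule ambient_field)
  let ?H = "const_field \<union> indet ` {1..n} :: 'a universe set"
  have sfW: "subfld ?W"
    by (rule fract_extension(1)[OF coeff_hom_to_fract]) (simp_all only: vars_in_closed to_fract_eq_0_iff)
  have sf: "subfld (to_ac ` ?W)"
  proof -
    have "fhom ?W to_ac" unfolding fhom_def by simp
    with sfW interpret field_hom_on ?W to_ac by unfold_locales
    show ?thesis by (rule subfld_image)
  qed
  have inW: "to_ac (to_fract a) \<in> to_ac ` ?W" if "a \<in> vars_in {1..n}" for a
  proof (rule imageI)
    have "to_fract a / to_fract 1 \<in> ?W"
      by (intro CollectI exI[of _ a] exI[of _ 1] conjI refl that vars_in_closed) simp
    thus "to_fract a \<in> ?W" by simp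
  qed
  have HW: "?H \<subseteq> to_ac ` ?W"
  proof
    fix x assume "x \<in> ?H"
    then consider c where "x = const_univ c" | i where "i \<in> {1..n}" "x = indet i" by (auto simp: const_field_def)
    thus "x \<in> to_ac ` ?W"
      by cases (simp_all only: const_univ_def indet_def inW vars_in_closed)
  qed
  have "pure_field n \<subseteq> to_ac ` ?W" unfolding pure_field_def
    by (rule A.generate_field_min_subfield1[OF _ subfld_imp_subfield[OF sf] HW]) simp
  moreover have "to_ac ` ?W \<subseteq> pure_field n"
  proof -
    have "subfield (pure_field n) (ambient :: 'a universe ring)"
      unfolding pure_field_def by (rule A.generate_field_is_subfield) simp
    hence "subfld (pure_field n :: 'a universe set)" by (rule subfield_imp_subfld)
    then interpret G: subfield_set "pure_field n :: 'a universe set" by unfold_locales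
    have gen: "x \<in> pure_field n" if "x \<in> ?H" for x
      unfolding pure_field_def by (rule generate_field.incl[OF that])
    have "to_ac (to_fract p) \<in> pure_field n" if "p \<in> vars_in {1..n}" for p :: "'a ratfun mp"
      using that unfolding to_ac_meval meval_def mon_eval_def
      by (intro G.sum G.mult G.prod G.power gen) (fastforce simp: vars_in_def const_field_def)+
    thus ?thesis by (auto intro!: G.divide)
  qed
  ultimately show ?thesis by blast
qed

section \<open>Laurent series with coefficients in an algebraically closed subfield\<close>

locale closed_coeffs =
  fixes h :: "'c :: alg_closed_field \<Rightarrow> 'l :: field"
  assumes h: "coeff_hom h"
begin

sublocale coeff_hom h by (rule h)

definition S :: "'l fls set" where "S = {x. \<forall>n. fls_nth x n \<in> range h}"

lemma range_add: "a \<in> range h \<Longrightarrow> b \<in> range h \<Longrightarrow> a + b \<in> range h"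
  by (auto simp flip: h_add)

lemma range_mult: "a \<in> range h \<Longrightarrow> b \<in> range h \<Longrightarrow> a * b \<in> range h"
  by (auto simp flip: h_mult)

lemma range_0 [simp]: "0 \<in> range h" and range_1 [simp]: "1 \<in> range h"
  by (metis h_0 rangeI, metis h_1 rangeI)

lemma range_sum: "(\<And>i. i \<in> I \<Longrightarrow> f i \<in> range h) \<Longrightarrow> (\<Sum>i\<in>I. f i) \<in> range h"
  by (induction I rule: infinite_finite_induct) (simp_all add: range_add)

lemma S_const: "fls_const (h c) \<in> S"
  by (simp add: S_def)

lemma S_X: "fls_X \<in> S"
  by (simp add: S_def)

lemma S_shift: "x \<in> S \<Longrightarrow> fls_shift n x \<in> S"
  by (simp add: S_def)

lemma S_add: "x \<in> S \<Longrightarrow> y \<in> S \<Longrightarrow> x + y \<in> S"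
  by (simp add: S_def range_add)

lemma S_mult: "x \<in> S \<Longrightarrow> y \<in> S \<Longrightarrow> x * y \<in> S"
proof -
  assume x: "x \<in> S" and y: "y \<in> S"
  have "fls_nth (x * y) n \<in> range h" for n
    unfolding fls_times_nth(2)[of x y n] by (intro range_sum range_mult) (use x y in \<open>auto simp: S_def\<close>)
  thus ?thesis by (simp add: S_def)
qed

lemma S_0: "0 \<in> S" and S_1: "1 \<in> S" and S_minus_1: "- 1 \<in> S"
  using S_const[of 0] S_const[of 1] S_const[of "- 1"] coeff_hom.h_uminus[OF coeff_hom_fls_const, of 1]
  by (simp_all add: h_uminus)

lemma S_pcompose:
  assumes "\<And>i. Polynomial.coeff p i \<in> S" "a \<in> S" "b \<in> S"
  shows "Polynomial.coeff (pcompose p [:a, b:]) i \<in> S"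
  using assms(1)
proof (induction p arbitrary: i)
  case 0
  show ?case by (simp add: S_0)
next
  case (pCons c p)
  have c: "c \<in> S" using pCons.prems[of 0] by simp
  have IH: "Polynomial.coeff (pcompose p [:a, b:]) i \<in> S" for i
    by (rule pCons.IH) (use pCons.prems[of "Suc _"] in simp)
  have "Polynomial.coeff (pcompose (pCons c p) [:a, b:]) i = (case i of 0 \<Rightarrow> c | Suc _ \<Rightarrow> 0) +
      (a * Polynomial.coeff (pcompose p [:a, b:]) i +
        (case i of 0 \<Rightarrow> 0 | Suc k \<Rightarrow> b * Polynomial.coeff (pcompose p [:a, b:]) k))"
    by (simp add: pcompose_pCons coeff_pCons split: nat.splits)
  also have "\<dots> \<in> S"
    by (intro S_add S_mult assms IH) (auto split: nat.splits intro!: c S_0 S_mult assms IH)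
  finally show ?case .
qed

text \<open>Divide the polynomial by the lowest power of the series variable occurring in its
  coefficients. The constant terms then form a nonzero polynomial over the closed constants with
  root \<open>g $ 0\<close>.\<close>

lemma const_coeff_closed:
  assumes p: "p \<noteq> 0" "\<And>i. Polynomial.coeff p i \<in> S" "poly p (fps_to_fls g) = 0"
  shows "g $ 0 \<in> range h"
proof -
  define I where "I = {i. Polynomial.coeff p i \<noteq> 0}"
  have fin: "finite I" unfolding I_def by (rule finite_subset[of _ "{..Polynomial.degree p}"]) (auto intro: le_degree)
  have ne: "I \<noteq> {}" using p(1) by (auto simp: I_def poly_eq_iff)
  define M where "M = Min ((\<lambda>i. fls_subdegree (Polynomial.coeff p i)) ` I)"
  have "M \<in> (\<lambda>i. fls_subdegree (Polynomial.coeff p i)) ` I" unfolding M_def using fin ne by (intro Min_in) auto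
  then obtain i0 where i0: "i0 \<in> I" "fls_subdegree (Polynomial.coeff p i0) = M" by auto
  have Mle: "M \<le> fls_subdegree (Polynomial.coeff p i)" if "i \<in> I" for i
    unfolding M_def using fin that by (intro Min_le) auto
  define s where "s i = fls_regpart (fls_shift M (Polynomial.coeff p i))" for i
  have s: "fps_to_fls (s i) = fls_shift M (Polynomial.coeff p i)" for i
  proof (cases "i \<in> I")
    case True
    hence "fls_subdegree (fls_shift M (Polynomial.coeff p i)) \<ge> 0"
      using Mle[OF True] by (subst fls_shift_subdegree) (auto simp: I_def)
    thus ?thesis unfolding s_def by simp
  qed (simp add: I_def s_def)
  have "\<forall>i. \<exists>c. s i $ 0 = h c" using p(2) by (auto simp: s_def S_def)
  then obtain c where c: "\<And>i. s i $ 0 = h (c i)" by metis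
  define P where "P = (\<Sum>i\<le>Polynomial.degree p. Polynomial.monom (c i) i)"
  have Pc: "Polynomial.coeff P i = (if i \<le> Polynomial.degree p then c i else 0)" for i
    by (simp add: P_def coeff_sum)
  have "fls_nth (Polynomial.coeff p i0) M \<noteq> 0" using i0 nth_fls_subdegree_nonzero by (auto simp: I_def)
  hence "s i0 $ 0 \<noteq> 0" by (simp add: s_def)
  hence "c i0 \<noteq> 0" using c[of i0] by auto
  moreover have "i0 \<le> Polynomial.degree p" using i0(1) by (auto simp: I_def intro: le_degree)
  ultimately have P0: "P \<noteq> 0" using Pc[of i0] by auto
  interpret f: coeff_hom "fps_to_fls :: 'l fps \<Rightarrow> _" by (rule coeff_hom_fps_to_fls)
  have "fps_to_fls (\<Sum>i\<le>Polynomial.degree p. s i * g ^ i) = (\<Sum>i\<le>Polynomial.degree p. fls_shift M (Polynomial.coeff p i) * fps_to_fls g ^ i)"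
    by (simp only: f.h_sum f.h_mult f.h_power s)
  also have "\<dots> = (\<Sum>i\<le>Polynomial.degree p. fls_shift M 1 * (Polynomial.coeff p i * fps_to_fls g ^ i))"
    by (simp add: fls_shifted_times_simps)
  also have "\<dots> = fls_shift M 1 * poly p (fps_to_fls g)"
    by (simp only: poly_altdef sum_distrib_left)
  also have "\<dots> = 0" using p(3) by simp
  finally have "(\<Sum>i\<le>Polynomial.degree p. s i * g ^ i) = 0" by simp
  hence "(\<Sum>i\<le>Polynomial.degree p. s i * g ^ i) $ 0 = 0" by simp
  hence "(\<Sum>i\<le>Polynomial.degree p. h (c i) * (g $ 0) ^ i) = 0"
    by (simp add: fps_sum_nth fps_nth_power_0 c)
  moreover have "poly (map_poly h P) (g $ 0) = (\<Sum>i\<le>Polynomial.degree p. h (c i) * (g $ 0) ^ i)"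
  proof -
    have "map_poly h P = (\<Sum>i\<le>Polynomial.degree p. Polynomial.monom (h (c i)) i)"
      by (rule poly_eqI) (simp add: coeff_map_poly Pc coeff_sum)
    thus ?thesis by (simp add: poly_sum poly_monom)
  qed
  ultimately show ?thesis using root_in_image[OF h P0] by simp
qed

text \<open>Write g = a + X g'. The substitution gives a nonzero polynomial over \<open>S\<close>
  with root g', to which the induction on the coefficient index applies.\<close>

lemma series_coeffs_closed:
  assumes "p \<noteq> 0" "\<And>i. Polynomial.coeff p i \<in> S" "poly p (fps_to_fls g) = 0"
  shows "g $ n \<in> range h"
  using assms
proof (induction n arbitrary: p g)
  case 0
  thus ?case by (rule const_coeff_closed)
next
  case (Suc n)
  obtain a where a: "g $ 0 = h a" using const_coeff_closed[OF Suc.prems] by auto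
  define p' where "p' = pcompose p [:fls_const (h a), fls_X:]"
  have g: "fps_to_fls g = fls_const (h a) + fls_X * fps_to_fls (fps_shift 1 g)"
  proof -
    have "g = fps_const (h a) + fps_X * fps_shift 1 g"
      by (rule fps_ext) (simp add: a)
    hence "fps_to_fls g = fps_to_fls (fps_const (h a)) + fps_to_fls fps_X * fps_to_fls (fps_shift 1 g)"
      by (metis fps_to_fls_plus fls_times_fps_to_fls)
    thus ?thesis by simp
  qed
  have "fps_shift 1 g $ n \<in> range h"
  proof (rule Suc.IH)
    show "p' \<noteq> 0" unfolding p'_def using Suc.prems(1) by (subst pcompose_eq_0_iff) auto
    show "Polynomial.coeff p' i \<in> S" for i unfolding p'_def by (intro S_pcompose Suc.prems S_const S_X)
    show "poly p' (fps_to_fls (fps_shift 1 g)) = 0"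
      using Suc.prems(3) unfolding p'_def g by (simp add: poly_pcompose mult.commute)
  qed
  thus ?case by simp
qed

text \<open>A shift by a power of the variable reduces the claim to power series. Inverses in
  \<open>S\<close> are then obtained as roots of linear polynomials.\<close>

lemma S_algebraic:
  assumes "p \<noteq> 0" "\<And>i. Polynomial.coeff p i \<in> S" "poly p x = 0"
  shows "x \<in> S"
proof (cases "x = 0")
  case False
  define N where "N = fls_subdegree x"
  define g where "g = fls_regpart (fls_shift N x)"
  have g: "fps_to_fls g = fls_shift N x"
    unfolding g_def by (rule fls_regpart_to_fls_trivial) (use False in \<open>simp add: N_def fls_shift_subdegree\<close>)
  have x: "x = fls_shift (- N) 1 * fps_to_fls g"
    unfolding g by (simp add: fls_shifted_times_simps)
  have "g $ n \<in> range h" for n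
  proof (rule series_coeffs_closed)
    let ?p = "pcompose p [:0, fls_shift (- N) 1:]"
    show "?p \<noteq> 0" using assms(1) by (subst pcompose_eq_0_iff) auto
    show "Polynomial.coeff ?p i \<in> S" for i by (intro S_pcompose assms S_0 S_shift S_1)
    show "poly ?p (fps_to_fls g) = 0" using assms(3) x by (simp add: poly_pcompose mult.commute)
  qed
  hence "fps_to_fls g \<in> S" by (simp add: S_def)
  thus ?thesis unfolding x by (intro S_mult S_shift S_1)
qed (simp add: S_0)

lemma subfld_S: "subfld S"
proof (rule subfldI)
  fix x assume x: "x \<in> S" "x \<noteq> 0"
  show "inverse x \<in> S"
  proof (rule S_algebraic[of "[:- 1, x:]"])
    show "Polynomial.coeff [:- 1, x:] i \<in> S" for i
      using x S_minus_1 S_0 by (simp add: coeff_pCons split: nat.splits)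
  qed (use x in simp_all)
qed (simp_all add: S_1 S_minus_1 S_add S_mult)

end

section \<open>Galois action on the solution field\<close>

context frob_family
begin

sublocale S: closed_coeffs "cL :: 'c \<Rightarrow> _"
  by unfold_locales

abbreviation "S \<equiv> S.S"

sublocale SF: subfield_set S
  by unfold_locales (rule S.subfld_S)

lemma \<kappa>_S: "\<kappa> c \<in> S" unfolding \<kappa>_def by (rule S.S_const)

lemma T_S: "T \<in> S" unfolding T_def by (intro S.S_add \<kappa>_S S.S_X)

definition PF :: "((nat \<Rightarrow> 'c mp fract fls) \<Rightarrow> 'c mp fract fls fps) set"
  where "PF = {f. \<forall>n. (\<lambda>v. f v $ n) \<in> Pol}"

sublocale PF: function_ring PF
  unfolding PF_def by (rule function_ring_fps[OF function_ring_Pol])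

definition U :: "('c mat \<Rightarrow> 'c mp fract fls fls) set"
  where "U = {f. \<exists>w\<in>PF. \<forall>V\<in>Gmat. f V = fps_to_fls (w (yG V))}"

lemma U_I: "w \<in> PF \<Longrightarrow> (\<And>V. V \<in> Gmat \<Longrightarrow> f V = fps_to_fls (w (yG V))) \<Longrightarrow> f \<in> U"
  by (auto simp: U_def)

sublocale U: function_ring U
proof
  interpret f: coeff_hom "fps_to_fls :: 'c mp fract fls fps \<Rightarrow> _" by (rule coeff_hom_fps_to_fls)
  show "(\<lambda>_. 1) \<in> U" by (rule U_I[OF PF.one]) simp
  show "(\<lambda>_. - 1) \<in> U" by (rule U_I[OF PF.minus_one]) (simp add: f.h_uminus)
  fix f g assume "f \<in> U" "g \<in> U"
  then obtain w z where w: "w \<in> PF" "z \<in> PF" "\<And>V. V \<in> Gmat \<Longrightarrow> f V = fps_to_fls (w (yG V))"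
    "\<And>V. V \<in> Gmat \<Longrightarrow> g V = fps_to_fls (z (yG V))" unfolding U_def by blast
  show "(\<lambda>V. f V + g V) \<in> U" by (rule U_I[OF PF.add[OF w(1,2)]]) (simp add: w)
  show "(\<lambda>V. f V * g V) \<in> U" by (rule U_I[OF PF.mult[OF w(1,2)]]) (simp add: w f.h_mult)
qed

lemma one_Gmat: "1\<^sub>m r \<in> Gmat"
  using Q0 by (auto simp: Gmat_def zero_power)

lemma yG_one: "yG (1\<^sub>m r) = y"
proof
  fix n
  have "(\<Sum>k<r. y k * map_mat cL (1\<^sub>m r) $$ (k, n)) = (\<Sum>k<r. if k = n then y k else 0)" if "n < r"
    using that by (intro sum.cong) auto
  thus "yG (1\<^sub>m r) n = y n" by (simp add: vmult_def)
qed

text \<open>Each \<epsilon>-coefficient is a polynomial that vanishes at the generic point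
  \<open>y\<close>, hence also at \<open>yG V\<close>, which lies on the same hypersurface.\<close>

lemma U_spread:
  assumes "f \<in> U" "f (1\<^sub>m r) = 0" "V \<in> Gmat"
  shows "f V = 0"
proof -
  obtain w where w: "w \<in> PF" "\<And>V. V \<in> Gmat \<Longrightarrow> f V = fps_to_fls (w (yG V))" using assms(1) unfolding U_def by blast
  have "w y = 0" using w(2)[OF one_Gmat] assms(2) by (simp add: yG_one)
  hence "w (yG V) $ n = 0" for n
    using generic[of "\<lambda>v. w v $ n" "yG V"] w(1) Lam_yG[OF assms(3)] by (simp add: PF_def)
  hence "w (yG V) = 0" by (intro fps_ext) simp
  thus ?thesis using w(2)[OF assms(3)] by simp
qed

lemma U_series: "(\<And>n. g $ n \<in> range cL) \<Longrightarrow> (\<lambda>_. fps_to_fls g) \<in> U"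
proof (rule U_I)
  assume g: "\<And>n. g $ n \<in> range cL"
  show "(\<lambda>_. g) \<in> PF" unfolding PF_def
  proof (intro CollectI allI)
    fix n
    obtain c where "g $ n = cL c" using g[of n] by auto
    thus "(\<lambda>v. g $ n) \<in> Pol" using Pol_const[of c] by simp
  qed
qed simp

text \<open>\<open>bvec\<close> is invariant under the group, so the constant \<beta>_i is also the
  value of one polynomial at every \<open>yG V\<close>.\<close>

lemma U_\<beta>: "1 \<le> i \<Longrightarrow> i < r \<Longrightarrow> (\<lambda>_. \<beta> i) \<in> U"
proof (rule U_I)
  assume i: "1 \<le> i" "i < r"
  show "(\<lambda>v. fps_const (bvec Q r v (i - 1))) \<in> PF" unfolding PF_def
  proof (intro CollectI allI)
    fix n
    have "i - 1 < r" using i by simp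
    thus "(\<lambda>v :: nat \<Rightarrow> 'c mp fract fls. fps_const (bvec Q r v (i - 1)) $ n) \<in> Pol"
      using bvec_in_Pol[of "i - 1" r Q] Pol.zero by (cases "n = 0") simp_all
  qed
  fix V assume V: "V \<in> Gmat"
  have "Suc (i - 1) < r" using i by simp
  thus "\<beta> i = fps_to_fls (fps_const (bvec Q r (yG V) (i - 1)))"
    unfolding \<beta>_def by (simp only: bvec_vmult(2)[OF addL_Q Q0 r0 map_cL[OF V] y1] fps_const_to_fls)
qed

text \<open>The twisted product is the solution at the point \<open>yG V\<close>, and its
  coefficients are polynomial in that point.\<close>

lemma U_Y:
  assumes "i < d" "j < r" "l < r"
  shows "(\<lambda>V. (YN i * map_mat (\<lambda>x. \<kappa> x ^ (q ^ i)) V) $$ (j, l)) \<in> U"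
proof (rule U_I)
  show "(\<lambda>v. Yfps v i $$ (j, l)) \<in> PF" using Yfps(4)[OF assms] by (simp add: PF_def)
  fix V assume V: "V \<in> Gmat"
  have Vc: "V \<in> carrier_mat r r" using V by (simp add: Gmat_def)
  have "map_mat (\<lambda>x. \<kappa> x ^ (q ^ i)) V = map_mat fps_to_fls (liftP i V)"
  proof (rule eq_matI)
    fix a b assume "a < dim_row (map_mat fps_to_fls (liftP i V))" "b < dim_col (map_mat fps_to_fls (liftP i V))"
    hence ab: "a < dim_row V" "b < dim_col V" by (auto simp: liftP_def)
    have "\<kappa> (V $$ (a, b)) ^ (q ^ i) = \<kappa> (V $$ (a, b) ^ (q ^ i))" by (simp only: \<kappa>.h_power)
    also have "\<dots> = fps_to_fls (fps_const (cL (V $$ (a, b) ^ (q ^ i))))" by (simp only: \<kappa>_def fps_const_to_fls)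
    finally show "map_mat (\<lambda>x. \<kappa> x ^ (q ^ i)) V $$ (a, b) = map_mat fps_to_fls (liftP i V) $$ (a, b)"
      using ab by (simp add: liftP_def)
  qed (simp_all add: liftP_def)
  hence "YN i * map_mat (\<lambda>x. \<kappa> x ^ (q ^ i)) V = map_mat fps_to_fls (Yfps y i * liftP i V)"
    unfolding YN_def using Vc
    by (subst mat_hom_mult[OF coeff_hom_fps_to_fls Yfps(1)[OF assms(1)], of _ r]) (simp_all add: liftP_def)
  also have "\<dots> = map_mat fps_to_fls (Yfps (yG V) i)" unfolding Yfps_yG[OF V assms(1)] ..
  finally have "(YN i * map_mat (\<lambda>x. \<kappa> x ^ (q ^ i)) V) $$ (j, l) = map_mat fps_to_fls (Yfps (yG V) i) $$ (j, l)"
    by (rule arg_cong)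
  also have "\<dots> = fps_to_fls (Yfps (yG V) i $$ (j, l))"
    using carrier_matD[OF Yfps(1)[OF assms(1), of "yG V"]] assms by simp
  finally show "(YN i * map_mat (\<lambda>x. \<kappa> x ^ (q ^ i)) V) $$ (j, l) = fps_to_fls (Yfps (yG V) i $$ (j, l))" .
qed

text \<open>Constant denominators are allowed in \<open>D\<close> so that it contains the base field.\<close>

definition D :: "('c mat \<Rightarrow> 'c mp fract fls fls) set"
  where "D = {f. \<exists>b. b \<noteq> 0 \<and> (\<lambda>_. b) \<in> U \<and> (\<lambda>V. b * f V) \<in> U}"

lemma U_sub_D: "f \<in> U \<Longrightarrow> f \<in> D"
  using U.one by (auto simp: D_def intro!: exI[of _ 1])

sublocale D: function_ring D
proof
  show "(\<lambda>_. 1) \<in> D" "(\<lambda>_. - 1) \<in> D" by (intro U_sub_D U.one U.minus_one)+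
  fix f g assume f: "f \<in> D" and g: "g \<in> D"
  obtain a where a: "a \<noteq> 0" "(\<lambda>_. a) \<in> U" "(\<lambda>V. a * f V) \<in> U" using f unfolding D_def by blast
  obtain b where b: "b \<noteq> 0" "(\<lambda>_. b) \<in> U" "(\<lambda>V. b * g V) \<in> U" using g unfolding D_def by blast
  have ab: "a * b \<noteq> 0" "(\<lambda>_. a * b) \<in> U" using a(1) b(1) U.mult[OF a(2) b(2)] by auto
  have "(\<lambda>V. b * (a * f V) + a * (b * g V)) \<in> U" by (intro U.add U.mult a b)
  also have "(\<lambda>V. b * (a * f V) + a * (b * g V)) = (\<lambda>V. a * b * (f V + g V))" by (simp add: algebra_simps)
  finally show "(\<lambda>V. f V + g V) \<in> D" unfolding D_def using ab by blast
  have "(\<lambda>V. (a * f V) * (b * g V)) \<in> U" by (intro U.mult a b)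
  also have "(\<lambda>V. (a * f V) * (b * g V)) = (\<lambda>V. a * b * (f V * g V))" by (simp add: algebra_simps)
  finally show "(\<lambda>V. f V * g V) \<in> D" unfolding D_def using ab by blast
qed

lemma D_spread:
  assumes "f \<in> D" "f (1\<^sub>m r) = 0" "V \<in> Gmat"
  shows "f V = 0"
proof -
  obtain b where b: "b \<noteq> 0" "(\<lambda>V. b * f V) \<in> U" using assms(1) unfolding D_def by blast
  have "b * f V = 0" by (rule U_spread[OF b(2) _ assms(3)]) (simp add: assms(2))
  thus ?thesis using b by simp
qed

text \<open>The elements by which relations on the group may be multiplied as if they were
  constants. The base field and all of \<open>S\<close> will be found inside.\<close>

definition DC where "DC = {x. (\<lambda>_. x) \<in> D}"

lemma subfld_DC: "subfld DC"
proof (rule subfldI)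
  fix x assume x: "x \<in> DC" "x \<noteq> 0"
  obtain b where b: "b \<noteq> 0" "(\<lambda>_. b) \<in> U" "(\<lambda>V. b * x) \<in> U" using x(1) unfolding DC_def D_def by blast
  have "(b * x) * inverse x = b" using x(2) by simp
  hence "(\<lambda>_. (b * x) * inverse x) \<in> U" using b(2) by (simp only:)
  thus "inverse x \<in> DC" unfolding DC_def D_def using b x(2) by (auto intro!: exI[of _ "b * x"])
qed (auto simp: DC_def intro: D.one D.minus_one D.add D.mult)

lemma \<beta>_DC: "1 \<le> i \<Longrightarrow> i < r \<Longrightarrow> \<beta> i \<in> DC"
  unfolding DC_def by (intro CollectI U_sub_D U_\<beta>)

text \<open>Power series with constant coefficients already lie in \<open>U\<close>; negative powers
  of \<epsilon> are harmless, since \<epsilon> is a permitted denominator.\<close>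

lemma S_DC: "x \<in> S \<Longrightarrow> x \<in> DC"
proof -
  assume x: "x \<in> S"
  interpret DC: subfield_set DC by unfold_locales (rule subfld_DC)
  define N where "N = fls_subdegree x"
  define g where "g = fls_regpart (fls_shift N x)"
  have g: "fps_to_fls g = fls_shift N x"
    unfolding g_def by (rule fls_regpart_to_fls_trivial) (cases "x = 0", simp_all add: N_def fls_shift_subdegree)
  have gU: "(\<lambda>_. fps_to_fls g) \<in> U"
    by (rule U_series) (use x in \<open>auto simp: g_def S.S_def\<close>)
  have X: "fls_X \<in> DC" unfolding DC_def
  proof (intro CollectI U_sub_D)
    have "(\<lambda>_. fps_to_fls (fps_X :: 'c mp fract fls fps)) \<in> U" by (rule U_series) (auto simp: fps_X_def)
    thus "(\<lambda>_. fls_X) \<in> U" by simp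
  qed
  have Xi: "fls_shift n 1 \<in> DC" for n
  proof (cases "n \<ge> 0")
    case True
    hence "fls_shift n 1 = inverse (fls_X :: 'c mp fract fls fls) ^ nat n"
      by (simp add: fls_inverse_X fls_X_inv_power_conv_shift_1)
    thus ?thesis using X by (simp add: DC.power DC.inverse)
  next
    case False
    hence "fls_shift n 1 = (fls_X :: 'c mp fract fls fls) ^ nat (- n)"
      by (simp add: fls_X_power_conv_shift_1)
    thus ?thesis using X by (simp add: DC.power)
  qed
  have "x = fls_shift (- N) 1 * fps_to_fls g"
    unfolding g by (simp add: fls_shifted_times_simps)
  moreover have "fps_to_fls g \<in> DC" unfolding DC_def using gU by (intro CollectI U_sub_D)
  ultimately show "x \<in> DC" using DC.mult[OF Xi] by metis
qed

text \<open>The torsor supplies translation, separation and the trace line, genericity supplies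
  spreading. The second conclusion prepares regularity: for x in \<open>S\<close>, a relation f = x
  h at the identity holds at every group element with the same x, as \<open>S\<close> lies in
  \<open>DC\<close>.\<close>

lemma galois_of_base:
  fixes G (structure) and F :: "'c mp fract fls fls set"
  assumes G: "group G" "carrier G = Gmat" "\<And>V W. V \<otimes> W = V * W" "\<one> = 1\<^sub>m r"
    and cards: "card {x :: 'c. x ^ q = x} = q" "card {x :: 'c. x ^ (q ^ d) = x} = q ^ d"
    and F: "subfld F" "infinite F" "F \<subseteq> DC" "T \<in> F" "\<And>i. 1 \<le> i \<Longrightarrow> i < r \<Longrightarrow> \<beta> i \<in> F"
      "\<And>x. x ^ q = x \<Longrightarrow> \<kappa> x \<in> F"
  shows "\<exists>E \<alpha>. galois_action G E F \<alpha> \<and> E \<inter> S \<subseteq> F"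
proof -
  have charn: "of_nat q = (0 :: 'c mp fract fls fls)"
    unfolding q using m0 by (simp add: of_nat_eq_0_iff_char_dvd CHAR_mp_fract)
  interpret X: frob_torsor \<kappa> q d r \<theta> F AN YN "\<lambda>j l. Apol $$ (j, l)"
  proof (unfold_locales, goal_cases)
    case 1 show ?case by (rule q1)
  next
    case 2 show ?case by (rule d0)
  next
    case 3 show ?case by (rule r0)
  next
    case (4 x y) show ?case by (rule addc)
  next
    case (5 u v) show ?case by (rule addN)
  next
    case 6 show ?case by (rule cards)
  next
    case 7 show ?case by (rule cards)
  next
    case 8 show ?case using \<theta>Q by (simp add: Q)
  next
    case 9 show ?case by (rule \<theta>inj)
  next
    case 10 show ?case by (rule charn)
  next
    case 11 show ?case by (rule F)
  next
    case (12 x) thus ?case by (rule F)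
  next
    case (13 i) show ?case unfolding AN_def by simp
  next
    case (14 i j l) thus ?case by (intro AN_poly)
  next
    case (15 j l) thus ?case by (intro Apol_coeffs F)
  next
    case (16 i) thus ?case by (rule YN)
  next
    case (17 i) thus ?case by (rule YN)
  next
    case (18 i) thus ?case by (rule YN)
  qed
  have Gm: "Gmat = {V \<in> X.Mat. det V = 1}" unfolding Gmat_def X.Mat_def by (auto simp: Q)
  have finG: "finite Gmat"
  proof -
    have "finite X.Mat" using bij_betw_finite[OF X.bij_Vof] X.finite_Ind X.finGq by (simp add: finite_PiE)
    thus ?thesis by (simp add: Gm)
  qed
  have RD: "f \<in> D" if "f \<in> X.R" for f
  proof (rule alg_subset[OF that[unfolded X.R_def] D.function_ring_axioms])
    show "(\<lambda>_. c) \<in> D" if "c \<in> F" for c using that F(3) by (auto simp: DC_def)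
    have "X.zc c j l \<in> U" if "j < r" "l < r" for c j l
    proof -
      have "(\<lambda>_. \<kappa> c ^ n) \<in> U" for n
      proof (rule U.power)
        have "(\<lambda>_. fps_to_fls (fps_const (cL c))) \<in> U" by (rule U_series) simp
        thus "(\<lambda>_. \<kappa> c) \<in> U" by (simp add: \<kappa>_def)
      qed
      hence "(\<lambda>V. \<Sum>i<d. \<kappa> c ^ (q ^ i) * (YN i * map_mat (\<lambda>x. \<kappa> x ^ (q ^ i)) V) $$ (j, l)) \<in> U"
        by (intro U.sum U.mult U_Y that) auto
      thus ?thesis unfolding X.zc_def[abs_def] X.yv_def X.lift_def .
    qed
    thus "X.zI ` X.Ind \<subseteq> D" by (auto simp: X.zI_def X.Ind_def intro!: U_sub_D)
  qed
  interpret R: function_ring X.R by (rule X.function_ring_R)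
  obtain c where c: "\<forall>f\<in>X.R. \<exists>a\<in>F. (\<Sum>V\<in>Gmat. f V) = a * c" using X.trace_SL unfolding Gm by blast
  define E where "E = {f \<one> / h \<one> | f h. f \<in> X.R \<and> h \<in> X.R \<and> h \<one> \<noteq> 0}"
  have transl: "\<exists>f'\<in>X.R. \<forall>x\<in>carrier G. f' x = f (x \<otimes> g)" if "f \<in> X.R" "g \<in> carrier G" for f g
    using X.translate[OF that(1), of g] that(2) unfolding G(2,3) Gm by blast
  have spread: "f g = 0" if "f \<in> X.R" "f \<one> = 0" "g \<in> carrier G" for f g
    using D_spread[OF RD[OF that(1)]] that(2,3) unfolding G by simp
  have trace: "\<exists>a\<in>F. (\<Sum>g\<in>carrier G. f g) = a * c" if "f \<in> X.R" for f
    using c that unfolding G(2) by blast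
  have sep: "\<exists>f\<in>X.R. f g \<noteq> f \<one>" if "g \<in> carrier G" "g \<noteq> \<one>" for g
    using X.separates[of g] that unfolding G(2,4) Gm by blast
  have finc: "finite (carrier G)" using finG G(2) by simp
  note act = galois_action_of_function_ring[where G = G and R = X.R and F = F and c = c,
      OF G(1) finc X.function_ring_R F(1,2), folded E_def]
  have "\<exists>\<alpha>. galois_action G E F \<alpha>"
    by (rule act(1)) (use X.const_R transl spread trace sep in blast)+
  moreover have "x \<in> F" if x: "x \<in> E" "x \<in> S" for x
  proof (rule act(2)[OF _ _ _ _ _ x(1)])
    fix f h g assume f: "f \<in> X.R" "h \<in> X.R" "f \<one> = x * h \<one>" "g \<in> carrier G"
    have "(\<lambda>V. f V - x * h V) \<in> D"
      using S_DC[OF x(2)] by (intro D.diff[OF RD[OF f(1)] D.mult[OF _ RD[OF f(2)]]]) (simp add: DC_def)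
    hence "f g - x * h g = 0" by (rule D_spread) (use f in \<open>simp_all add: G\<close>)
    thus "f g = x * h g" by simp
  qed (use X.const_R transl spread trace sep in blast)+
  ultimately show ?thesis by blast
qed

text \<open>The \<beta>_i do not involve \<epsilon>, so each \<epsilon>-coefficient of the relation
  is a relation between values of \<open>bvec\<close> with coefficients in the constants.\<close>

lemma \<beta>_independent:
  assumes M: "finite M" "\<And>\<mu>. \<mu> \<in> M \<Longrightarrow> keys \<mu> \<subseteq> {1..<r}" "\<And>\<mu>. \<mu> \<in> M \<Longrightarrow> s \<mu> \<in> S"
    and zero: "(\<Sum>\<mu>\<in>M. s \<mu> * mon_eval \<beta> \<mu>) = 0" and "\<mu> \<in> M"
  shows "s \<mu> = 0"
proof (rule fls_eqI)
  fix n
  interpret fc: coeff_hom "fls_const :: 'c mp fract fls \<Rightarrow> _" by (rule coeff_hom_fls_const)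
  define b where "b i = bvec Q r y (i - 1)" for i
  have mon: "mon_eval \<beta> \<nu> = fls_const (mon_eval b \<nu>)" for \<nu>
    by (simp only: mon_eval_def fc.h_prod fc.h_power \<beta>_def b_def)
  have "\<forall>\<mu>\<in>M. \<exists>c. fls_nth (s \<mu>) n = cL c" using M(3) by (auto simp: S.S_def)
  then obtain c where c: "\<And>\<mu>. \<mu> \<in> M \<Longrightarrow> fls_nth (s \<mu>) n = cL (c \<mu>)" by metis
  define P where "P = (\<Sum>\<mu>\<in>M. Poly_Mapping.single \<mu> (c \<mu>))"
  have "P = 0"
  proof (rule bvec_independent[where y = y and Q = Q and r = r and k = "m * d"])
    show "prime CHAR('c)" by (rule p)
    show "Q = CHAR('c) ^ (m * d)" by (simp add: Q q power_mult)
    show "m * d > 0" using m0 d0 by simp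
    show "r > 0" by (rule r0)
    show "f v = 0" if "f \<in> Pol" "f y = 0" "Lam Q r v = 1" for f v using generic that .
    show "keys \<nu> \<subseteq> {1..<r}" if "\<nu> \<in> keys P" for \<nu>
    proof -
      have "keys P \<subseteq> (\<Union>\<mu>\<in>M. keys (Poly_Mapping.single \<mu> (c \<mu>)))" unfolding P_def by (rule keys_sum)
      thus ?thesis using that M(2) by (auto split: if_splits)
    qed
    have "meval cL b P = (\<Sum>\<mu>\<in>M. fls_nth (s \<mu>) n * mon_eval b \<mu>)"
      unfolding P_def by (simp add: cL.meval_sum cL.meval_single c)
    also have "\<dots> = fls_nth (\<Sum>\<mu>\<in>M. s \<mu> * mon_eval \<beta> \<mu>) n"
      by (simp add: mon fls_nth_sum fls_mult_const_nth)
    finally show "meval cL (\<lambda>i. bvec Q r y (i - 1)) P = 0" unfolding zero b_def by simp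
  qed
  hence "lookup P \<mu> = 0" by simp
  moreover have "lookup P \<mu> = c \<mu>"
    unfolding P_def using assms(5) M(1) by (simp add: lookup_sum lookup_single when_def)
  ultimately show "fls_nth (s \<mu>) n = fls_nth 0 n" using c[OF assms(5)] by simp
qed

text \<open>An element algebraic over the closed constants is itself constant, but T has coefficient
  1 at \<epsilon>.\<close>

lemma T_transcendental:
  assumes "p \<noteq> 0" shows "poly (map_poly \<kappa> p) T \<noteq> 0"
proof
  assume "poly (map_poly \<kappa> p) T = 0"
  then obtain c where "T = \<kappa> c" using root_in_image[OF coeff_hom_\<kappa> assms] by blast
  hence "fls_nth T 1 = fls_nth (\<kappa> c) 1" by simp
  thus False by (simp add: T_def \<kappa>_def)
qed

lemma inj_T_power: "inj (\<lambda>n. T ^ n)"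
proof (rule injI, rule ccontr)
  fix a b :: nat assume eq: "T ^ a = T ^ b" and "a \<noteq> b"
  let ?p = "Polynomial.monom (1 :: 'c) a - Polynomial.monom 1 b"
  interpret M: coeff_hom "map_poly \<kappa>" by (rule map_poly_coeff_hom[OF coeff_hom_\<kappa>])
  have "Polynomial.coeff ?p a = 1" using \<open>a \<noteq> b\<close> by simp
  hence "?p \<noteq> 0" by (metis coeff_0 zero_neq_one)
  moreover have "poly (map_poly \<kappa> ?p) T = T ^ a - T ^ b"
    by (simp add: M.h_diff map_poly_monom poly_monom)
  ultimately show False using T_transcendental[of ?p] eq by simp
qed

end

section \<open>The rational base field\<close>

text \<open>The base field is mapped in two stages: \<tau> sends the variable of k(T) to \<theta> +
  \<epsilon>, and \<psi> sends t_i to \<beta>_i. The last property, that only elements of k(T) are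
  sent into \<open>S\<close>, follows by comparing coefficients in x h1(b) = h1(a), as the monomials
  in the \<beta>_i are independent over \<open>S\<close>.\<close>

lemma (in frob_family) rational_base:
  fixes \<iota> :: "'k :: field \<Rightarrow> 'c"
  assumes \<iota>: "coeff_hom \<iota>"
  defines "W \<equiv> {to_fract a / to_fract b | a b :: 'k ratfun mp. a \<in> vars_in {1..r - 1} \<and> b \<in> vars_in {1..r - 1} \<and> b \<noteq> 0}"
  obtains \<tau> :: "'k ratfun \<Rightarrow> 'c mp fract fls fls" and \<psi>
  where "subfld W" "fhom W \<psi>" "\<And>c. to_fract (Poly_Mapping.single 0 c) \<in> W"
    "\<And>c. \<psi> (to_fract (Poly_Mapping.single 0 c)) = \<tau> c"
    "range \<tau> \<subseteq> S" "\<psi> ` W \<subseteq> DC" "T \<in> range \<tau>" "\<And>x. \<kappa> (\<iota> x) \<in> range \<tau>"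
    "\<And>i. 1 \<le> i \<Longrightarrow> i < r \<Longrightarrow> \<beta> i \<in> \<psi> ` W" "\<psi> ` W \<inter> S \<subseteq> range \<tau>"
proof -
  have k\<iota>: "coeff_hom (\<lambda>x. \<kappa> (\<iota> x))" by (rule coeff_hom_comp[OF coeff_hom_\<kappa> \<iota>])
  interpret \<iota>: coeff_hom \<iota> by (rule \<iota>)
  interpret k\<iota>: coeff_hom "\<lambda>x. \<kappa> (\<iota> x)" by (rule k\<iota>)
  define h0 where "h0 p = poly (map_poly (\<lambda>x. \<kappa> (\<iota> x)) p) T" for p
  have h0: "coeff_hom h0"
    unfolding h0_def[abs_def] by (rule coeff_hom_comp[OF coeff_hom_poly map_poly_coeff_hom[OF k\<iota>]])
  have inj\<iota>: "\<iota> x = 0 \<longleftrightarrow> x = 0" for x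
  proof
    assume "\<iota> x = 0"
    hence "\<iota> (x * inverse x) = 0" by (simp add: \<iota>.h_mult)
    thus "x = 0" by (cases "x = 0") auto
  qed simp
  have h0_inj: "p = 0" if "h0 p = 0" for p
  proof (rule ccontr)
    assume "p \<noteq> 0"
    hence "map_poly \<iota> p \<noteq> 0" by (auto simp: poly_eq_iff coeff_map_poly inj\<iota>)
    moreover have "map_poly (\<lambda>x. \<kappa> (\<iota> x)) p = map_poly \<kappa> (map_poly \<iota> p)"
      by (rule poly_eqI) (simp add: coeff_map_poly)
    ultimately show False using T_transcendental that by (simp add: h0_def)
  qed
  define W0 where "W0 = {to_fract a / to_fract b | a b :: 'k poly. a \<in> UNIV \<and> b \<in> UNIV \<and> b \<noteq> 0}"
  have W0: "x \<in> W0" for x :: "'k ratfun"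
  proof (cases x)
    case (Fract a b)
    thus ?thesis unfolding W0_def Fract_conv_to_fract by blast
  qed
  have "\<exists>\<tau>. fhom W0 \<tau> \<and> (\<forall>a\<in>UNIV. \<forall>b\<in>UNIV. b \<noteq> 0 \<longrightarrow> \<tau> (to_fract a / to_fract b) = h0 a / h0 b)"
    unfolding W0_def by (rule fract_extension(2)[OF h0]) (use h0_inj in auto)
  then obtain \<tau> where \<tau>0: "fhom W0 \<tau>" "\<And>a b. b \<noteq> 0 \<Longrightarrow> \<tau> (to_fract a / to_fract b) = h0 a / h0 b" by blast
  have \<tau>: "coeff_hom \<tau>" using \<tau>0(1) W0 by unfold_locales (auto simp: fhom_def)
  interpret \<tau>: coeff_hom \<tau> by (rule \<tau>)
  interpret h0: coeff_hom h0 by (rule h0)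
  have \<tau>_poly: "\<tau> (to_fract a) = h0 a" for a using \<tau>0(2)[of 1 a] by simp
  have \<tau>_inj: "\<tau> x = 0 \<longleftrightarrow> x = 0" for x
  proof
    assume "\<tau> x = 0"
    hence "\<tau> (x * inverse x) = 0" by (simp add: \<tau>.h_mult)
    thus "x = 0" by (cases "x = 0") auto
  qed simp
  have h0S: "h0 p \<in> S" for p
    unfolding h0_def by (rule SF.poly_in) (auto simp: coeffs_in_def coeff_map_poly \<kappa>_S T_S)
  have \<tau>S: "\<tau> x \<in> S" for x
  proof (cases x)
    case (Fract a b)
    thus ?thesis unfolding Fract_conv_to_fract using \<tau>0(2)[of b a] by (simp add: SF.divide h0S)
  qed
  define J where "J = {1..r - 1}"
  have J: "J = {1..<r}" using r0 by (auto simp: J_def)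
  define h1 where "h1 = meval \<tau> \<beta>"
  have h1: "coeff_hom h1" unfolding h1_def by (rule \<tau>.coeff_hom_meval)
  interpret h1: coeff_hom h1 by (rule h1)
  have h1_inj: "p = 0" if p: "p \<in> vars_in J" "h1 p = 0" for p
  proof (rule ccontr)
    assume "p \<noteq> 0"
    then obtain \<mu> where \<mu>: "\<mu> \<in> keys p" by fastforce
    have "\<tau> (lookup p \<mu>) = 0"
      by (rule \<beta>_independent[where M = "keys p" and s = "\<lambda>\<mu>. \<tau> (lookup p \<mu>)"])
         (use p \<mu> in \<open>auto simp: vars_in_def J \<tau>S h1_def meval_def\<close>)
    thus False using \<mu> by (simp add: \<tau>_inj in_keys_iff)
  qed
  have Wsub: "subfld W" unfolding W_def
    by (rule fract_extension(1)[OF coeff_hom_to_fract]) (simp_all only: vars_in_closed to_fract_eq_0_iff)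
  have "\<exists>\<psi>. fhom W \<psi> \<and> (\<forall>a\<in>vars_in J. \<forall>b\<in>vars_in J. b \<noteq> 0 \<longrightarrow> \<psi> (to_fract a / to_fract b) = h1 a / h1 b)"
    unfolding W_def J_def[symmetric]
    by (rule fract_extension(2)[OF h1]) (simp_all only: vars_in_closed h1_inj)
  then obtain \<psi> where \<psi>: "fhom W \<psi>"
    "\<And>a b. a \<in> vars_in J \<Longrightarrow> b \<in> vars_in J \<Longrightarrow> b \<noteq> 0 \<Longrightarrow> \<psi> (to_fract a / to_fract b) = h1 a / h1 b" by blast
  have W_poly: "to_fract a \<in> W" if "a \<in> vars_in J" for a
  proof -
    have "to_fract a / to_fract 1 \<in> W" unfolding W_def J_def[symmetric]
      by (intro CollectI exI[of _ a] exI[of _ 1] conjI refl that vars_in_closed) simp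
    thus ?thesis by simp
  qed
  have \<psi>_poly: "\<psi> (to_fract a) = h1 a" if "a \<in> vars_in J" for a
    using \<psi>(2)[OF that vars_in_closed(3)] by simp
  have Welim: "\<exists>a\<in>vars_in J. \<exists>b\<in>vars_in J. b \<noteq> 0 \<and> \<psi> w = h1 a / h1 b" if "w \<in> W" for w
  proof -
    from that obtain a b where "a \<in> vars_in J" "b \<in> vars_in J" "b \<noteq> 0" "w = to_fract a / to_fract b"
      unfolding W_def J_def[symmetric] by blast
    thus ?thesis using \<psi>(2)[of a b] by blast
  qed
  interpret DC: subfield_set DC by unfold_locales (rule subfld_DC)
  have h1_DC: "h1 p \<in> DC" if "p \<in> vars_in J" for p
    unfolding h1_def meval_def mon_eval_def
    by (intro DC.sum DC.mult DC.prod DC.power S_DC \<tau>S \<beta>_DC) (use that in \<open>fastforce simp: vars_in_def J\<close>)+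
  show ?thesis
  proof (rule that[of \<psi> \<tau>])
    show "subfld W" by (rule Wsub)
    show "fhom W \<psi>" by (rule \<psi>)
    show "to_fract (Poly_Mapping.single 0 c) \<in> W" for c by (intro W_poly vars_in_closed)
    show "\<psi> (to_fract (Poly_Mapping.single 0 c)) = \<tau> c" for c
      by (subst \<psi>_poly) (simp_all add: vars_in_closed h1_def)
    show "range \<tau> \<subseteq> S" using \<tau>S by blast
    show "\<psi> ` W \<subseteq> DC"
    proof
      fix x assume "x \<in> \<psi> ` W"
      then obtain a b where "a \<in> vars_in J" "b \<in> vars_in J" "x = h1 a / h1 b" using Welim by blast
      thus "x \<in> DC" by (simp add: DC.divide h1_DC)
    qed
    have "\<tau> (to_fract [:0, 1:]) = T" by (simp add: \<tau>_poly h0_def map_poly_pCons)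
    thus "T \<in> range \<tau>" by (metis rangeI)
    have "\<tau> (to_fract [:x:]) = \<kappa> (\<iota> x)" for x by (simp add: \<tau>_poly h0_def map_poly_pCons)
    thus "\<kappa> (\<iota> x) \<in> range \<tau>" for x by (metis rangeI)
    show "\<beta> i \<in> \<psi> ` W" if "1 \<le> i" "i < r" for i
    proof -
      have "Poly_Mapping.single (Poly_Mapping.single i 1) 1 \<in> vars_in J"
        by (rule vars_in_closed) (use that in \<open>simp add: J\<close>)
      moreover have "h1 (Poly_Mapping.single (Poly_Mapping.single i 1) 1) = \<beta> i" by (simp add: h1_def)
      ultimately show ?thesis using W_poly \<psi>_poly by (metis imageI)
    qed
    show "\<psi> ` W \<inter> S \<subseteq> range \<tau>"
    proof
      fix x assume x: "x \<in> \<psi> ` W \<inter> S"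
      then obtain a b where ab: "a \<in> vars_in J" "b \<in> vars_in J" "b \<noteq> 0" "x = h1 a / h1 b" using Welim by blast
      obtain \<mu> where \<mu>: "\<mu> \<in> keys b" using ab(3) by fastforce
      let ?M = "keys a \<union> keys b"
      have "h1 b \<noteq> 0" using h1_inj[OF ab(2)] ab(3) by blast
      hence "h1 a - x * h1 b = 0" using ab(4) by simp
      moreover have "h1 a = (\<Sum>\<mu>\<in>?M. \<tau> (lookup a \<mu>) * mon_eval \<beta> \<mu>)" "h1 b = (\<Sum>\<mu>\<in>?M. \<tau> (lookup b \<mu>) * mon_eval \<beta> \<mu>)"
        unfolding h1_def by (rule \<tau>.meval_superset; simp)+
      ultimately have "(\<Sum>\<mu>\<in>?M. (\<tau> (lookup a \<mu>) - x * \<tau> (lookup b \<mu>)) * mon_eval \<beta> \<mu>) = 0"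
        by (simp add: sum_subtractf sum_distrib_left algebra_simps)
      hence "\<tau> (lookup a \<mu>) - x * \<tau> (lookup b \<mu>) = 0"
        by (rule \<beta>_independent[where M = ?M and s = "\<lambda>\<mu>. \<tau> (lookup a \<mu>) - x * \<tau> (lookup b \<mu>)", rotated 3])
           (use ab(1,2) \<mu> x in \<open>auto simp: vars_in_def J intro!: SF.diff SF.mult \<tau>S\<close>)
      moreover have nz: "lookup b \<mu> \<noteq> 0" using \<mu> by (simp add: in_keys_iff)
      ultimately have "x * \<tau> (lookup b \<mu>) = \<tau> (lookup a \<mu> / lookup b \<mu>) * \<tau> (lookup b \<mu>)"
        unfolding \<tau>.h_mult[symmetric] by simp
      moreover have "\<tau> (lookup b \<mu>) \<noteq> 0" using nz \<tau>_inj by simp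
      ultimately have "x = \<tau> (lookup a \<mu> / lookup b \<mu>)" by simp
      thus "x \<in> range \<tau>" by blast
    qed
  qed
qed

section \<open>Finite field prerequisites and transfer to the universe\<close>

lemma algebraic_preimage:
  assumes E: "subfld E" "fhom E \<Phi>" and K: "K \<subseteq> E" "0 \<in> K" and x: "x \<in> E"
    and p: "p \<in> coeffs_in (\<Phi> ` K)" "p \<noteq> 0" "poly p (\<Phi> x) = 0"
  shows "\<exists>p'\<in>coeffs_in K. p' \<noteq> 0 \<and> poly p' x = 0"
proof -
  interpret field_hom_on E \<Phi> by unfold_locales (rule E)+
  have injK: "inj_on \<Phi> K" by (rule inj_on_subset[OF inj K(1)])
  have inv0: "inv_into K \<Phi> 0 = 0" using inv_into_f_f[OF injK K(2)] by simp
  define p' where "p' = map_poly (inv_into K \<Phi>) p"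
  have c: "Polynomial.coeff p' i = inv_into K \<Phi> (Polynomial.coeff p i)" for i
    by (simp add: p'_def coeff_map_poly inv0)
  have pK: "Polynomial.coeff p i \<in> \<Phi> ` K" for i using p(1) by (simp add: coeffs_in_def)
  have p'K: "p' \<in> coeffs_in K" unfolding coeffs_in_def using c inv_into_into[OF pK] by simp
  have p'E: "p' \<in> coeffs_in E" using p'K K(1) by (auto simp: coeffs_in_def)
  have "map_poly \<Phi> p' = p" by (rule poly_eqI) (simp add: coeff_map c f_inv_into_f[OF pK])
  hence "\<Phi> (poly p' x) = 0" using poly_map[OF p'E x] p(3) by simp
  hence "poly p' x = 0" using h_eq_0_iff[OF poly_in[OF p'E x]] by simp
  moreover have "p' \<noteq> 0" using \<open>map_poly \<Phi> p' = p\<close> p(2) by auto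
  ultimately show ?thesis using p'K by blast
qed

text \<open>Multiplication by a nonzero element permutes the nonzero elements; compare the two
  products.\<close>

lemma finite_field_power_card:
  fixes a :: "'k :: {field, finite}"
  shows "a ^ CARD('k) = a"
proof (cases "a = 0")
  case False
  have "(\<Prod>x\<in>UNIV - {0}. x) = (\<Prod>x\<in>UNIV - {0}. a * x)"
    by (rule prod.reindex_bij_witness[where i = "\<lambda>x. a * x" and j = "\<lambda>x. x / a"]) (use False in auto)
  also have "\<dots> = a ^ (CARD('k) - 1) * (\<Prod>x\<in>UNIV - {0}. x)"
    by (simp add: prod.distrib card_Diff_singleton)
  finally have "a ^ (CARD('k) - 1) = 1" by (simp add: prod_zero_iff)
  moreover have "CARD('k) > 0" by simp
  ultimately show ?thesis by (metis Suc_diff_1 power_Suc mult.right_neutral)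
qed (simp add: zero_power)

text \<open>The fields with q^s elements for 0 < s < d have fewer than q^d elements together, so
  some \<theta> avoids them all. As the Frobenius is injective, equality of two conjugates would put
  \<theta> into one of these fields.\<close>

lemma exists_distinct_conjugates:
  assumes "prime p" "m > 0" "d > 0" and q: "q = p ^ m" and card: "CARD('k :: {field, finite}) = q"
  shows "\<exists>\<theta> :: 'k alg_closure. \<theta> ^ (q ^ d) = \<theta> \<and> inj_on (\<lambda>i. \<theta> ^ (q ^ i)) {..<d}"
proof -
  have q2: "q \<ge> 2" using prime_ge_2_nat[OF assms(1)] assms(2) unfolding q by (metis le_trans self_le_power le_simps(1) one_le_numeral order.trans)
  have cGF: "card (GF (q ^ s) :: 'k alg_closure set) = q ^ s" if "s > 0" for s
    using card_GF[OF assms(1,2) that, where 'k = 'k] card q by simp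
  let ?B = "\<Union>s\<in>{1..<d}. GF (q ^ s) :: 'k alg_closure set"
  have fin: "finite (GF (q ^ s) :: 'k alg_closure set)" if "s > 0" for s
    using cGF[OF that] q2 by (metis card.infinite not_numeral_le_zero power_not_zero)
  have "card ?B \<le> (\<Sum>s\<in>{1..<d}. card (GF (q ^ s) :: 'k alg_closure set))" by (rule card_UN_le) simp
  also have "\<dots> = (\<Sum>s\<in>{1..<d}. q ^ s)" by (rule sum.cong) (auto simp: cGF)
  also have "\<dots> < q ^ d"
    using assms(3)
  proof (induction d)
    case (Suc d)
    show ?case
    proof (cases "d = 0")
      case False
      hence "(\<Sum>s\<in>{1..<Suc d}. q ^ s) = (\<Sum>s\<in>{1..<d}. q ^ s) + q ^ d" by simp
      also have "\<dots> < q ^ d + q ^ d" using Suc.IH False by simp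
      also have "\<dots> = 2 * q ^ d" by simp
      also have "\<dots> \<le> q ^ Suc d" using q2 by simp
      finally show ?thesis .
    qed (use q2 in simp)
  qed simp
  finally have "card ?B < card (GF (q ^ d) :: 'k alg_closure set)" using cGF[OF assms(3)] by simp
  moreover have "finite ?B" using fin by auto
  ultimately have "\<not> GF (q ^ d) \<subseteq> ?B" using card_mono by (metis not_le)
  then obtain \<theta> :: "'k alg_closure" where \<theta>d: "\<theta> \<in> GF (q ^ d)" "\<theta> \<notin> ?B" by blast
  hence \<theta>: "\<theta> \<in> GF (q ^ d)" "\<And>s. s > 0 \<Longrightarrow> s < d \<Longrightarrow> \<theta> \<notin> GF (q ^ s)" by auto
  have ch: "CHAR('k alg_closure) = p" using CHAR_finite_field[OF assms(1), of m] card q by simp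
  have add: "(x + y :: 'k alg_closure) ^ q = x ^ q + y ^ q" for x y
    by (rule freshmans_dream'[where n = m]) (use ch assms(1) q in simp_all)
  have False if ij: "i < j" "j < d" "\<theta> ^ (q ^ i) = \<theta> ^ (q ^ j)" for i j
  proof -
    have "(\<theta> ^ (q ^ (j - i)) - \<theta>) ^ (q ^ i) = (\<theta> ^ (q ^ (j - i))) ^ (q ^ i) - \<theta> ^ (q ^ i)"
      by (rule additive_power_diff[OF additive_power_power[OF add]])
    also have "(\<theta> ^ (q ^ (j - i))) ^ (q ^ i) = \<theta> ^ (q ^ j)"
      using ij(1) by (simp add: power_mult[symmetric] power_add[symmetric])
    finally have "\<theta> ^ (q ^ (j - i)) - \<theta> = 0" using ij(3) by simp
    hence "\<theta> \<in> GF (q ^ (j - i))" by (simp add: GF_def)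
    thus False using \<theta>(2)[of "j - i"] ij by simp
  qed
  hence "inj_on (\<lambda>i. \<theta> ^ (q ^ i)) {..<d}"
    by (intro inj_onI) (metis lessThan_iff linorder_neqE_nat)
  thus ?thesis using \<theta>(1) by (auto simp: GF_def)
qed

text \<open>The inverse of \<psi>, followed by the embedding into the universe, extends from
  \<open>F\<close> to \<open>E\<close> and carries the action along. It takes
  \<open>range \<tau>\<close> to \<open>const_field\<close>, so regularity can be checked on the
  Laurent series side, and it passes to the subfield fixed by the centre.\<close>

lemma PSL_regular_realization:
  fixes p m q r d :: nat
  assumes p: "prime p" and m: "m > 0" and q: "q = p ^ m" and card: "CARD('k :: {field, finite}) = q"
    and r: "r > 0" and d: "d > 0"
  shows "\<exists>E :: 'k universe set.
       galois_extension (pure_field (r - 1)) E \<and>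
       regular_extension const_field E \<and>
       galois_group (pure_field (r - 1)) E \<cong> PSL r (GF (q ^ d) :: 'k alg_closure set)"
proof -
  have ch: "CHAR('k alg_closure) = p" using CHAR_finite_field[OF p, of m] card q by simp
  define Q where "Q = q ^ d"
  have Qp: "Q = CHAR('k alg_closure) ^ (m * d)" unfolding ch by (simp add: Q_def q power_mult)
  have pc: "prime CHAR('k alg_closure)" using p ch by simp
  have md: "m * d > 0" using m d by simp
  obtain \<theta> :: "'k alg_closure" where \<theta>: "\<theta> ^ (q ^ d) = \<theta>" "inj_on (\<lambda>i. \<theta> ^ (q ^ i)) {..<d}"
    using exists_distinct_conjugates[OF p m d q card] by blast
  obtain y :: "nat \<Rightarrow> 'k alg_closure mp fract fls" where y: "Lam Q r y = 1"
    "\<And>f v. f \<in> Pol \<Longrightarrow> f y = 0 \<Longrightarrow> Lam Q r v = 1 \<Longrightarrow> f v = 0"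
    using generic_point[OF pc Qp md r] by metis
  interpret X: frob_family m d r q Q \<theta> y
    by unfold_locales (use pc ch q m d r \<theta> y Q_def in simp_all)
  have \<iota>: "coeff_hom (to_ac :: 'k \<Rightarrow> _)" by unfold_locales simp_all
  define W where "W = {to_fract a / to_fract b | a b :: 'k ratfun mp. a \<in> vars_in {1..r - 1} \<and> b \<in> vars_in {1..r - 1} \<and> b \<noteq> 0}"
  obtain \<psi> and \<tau> :: "'k ratfun \<Rightarrow> _" where W: "subfld W" "fhom W \<psi>" "\<And>c. to_fract (Poly_Mapping.single 0 c) \<in> W"
    "\<And>c. \<psi> (to_fract (Poly_Mapping.single 0 c)) = \<tau> c"
    "range \<tau> \<subseteq> X.S" "\<psi> ` W \<subseteq> X.DC" "X.T \<in> range \<tau>" "\<And>x. X.\<kappa> (to_ac x) \<in> range \<tau>"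
    "\<And>i. 1 \<le> i \<Longrightarrow> i < r \<Longrightarrow> X.\<beta> i \<in> \<psi> ` W" "\<psi> ` W \<inter> X.S \<subseteq> range \<tau>"
    by (rule X.rational_base[OF \<iota>, folded W_def]) (rule that; assumption)
  interpret W: field_hom_on W \<psi> by unfold_locales (rule W)+
  define F where "F = \<psi> ` W"
  have Fsub: "subfld F" unfolding F_def by (rule W.subfld_image)
  interpret F: subfield_set F by unfold_locales (rule Fsub)
  have \<tau>F: "range \<tau> \<subseteq> F" unfolding F_def using W(3,4) by (metis image_subset_iff imageI)
  have TF: "X.T \<in> F" using W(7) \<tau>F by blast
  have infF: "infinite F"
  proof -
    have "range (\<lambda>n. X.T ^ n) \<subseteq> F" using F.power[OF TF] by blast
    moreover have "infinite (range (\<lambda>n. X.T ^ n))" using X.inj_T_power finite_imageD by blast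
    ultimately show ?thesis using finite_subset by blast
  qed
  have cQ: "card {x :: 'k alg_closure. x ^ (q ^ s) = x} = q ^ s" if "s > 0" for s
    using card_GF[OF p m that, where 'k = 'k] card q by (simp add: GF_def)
  have cq: "card {x :: 'k alg_closure. x ^ q = x} = q" using cQ[of 1] by simp
  \<comment> \<open>One set with q elements is contained in another: the solutions of x^q = x are
    exactly the elements of the ground field, whose images under \<kappa> lie in
    \<open>F\<close>.\<close>
  have range_ac: "{x :: 'k alg_closure. x ^ q = x} = range (to_ac :: 'k \<Rightarrow> _)"
  proof (rule card_subset_eq[symmetric])
    show "finite {x :: 'k alg_closure. x ^ q = x}" using cq X.q0 by (metis card.infinite less_numeral_extra(3))
    show "range (to_ac :: 'k \<Rightarrow> _) \<subseteq> {x :: 'k alg_closure. x ^ q = x}"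
    proof safe
      fix a :: 'k
      show "to_ac a ^ q = to_ac a" unfolding to_ac_power[symmetric] to_ac_eq_iff card[symmetric]
        by (rule finite_field_power_card)
    qed
    show "card (range (to_ac :: 'k \<Rightarrow> _)) = card {x :: 'k alg_closure. x ^ q = x}"
      using card_image[OF inj_to_ac[where 'a = 'k]] card cq by simp
  qed
  define G where "G = SL r (GF Q :: 'k alg_closure set)"
  have grp: "group G" unfolding G_def
    by (rule group_SL) (use additive_power_power[OF X.addc] X.Q0 Q_def in auto)
  then interpret G: group G .
  have "\<exists>E \<alpha>. galois_action G E F \<alpha> \<and> E \<inter> X.S \<subseteq> F"
  proof (rule X.galois_of_base[OF grp _ _ _ cq cQ[OF d] Fsub infF _ TF])
    show "carrier G = X.Gmat" unfolding G_def X.Gmat_def by (auto simp: SL_carrier_iff)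
    show "V \<otimes>\<^bsub>G\<^esub> V' = V * V'" "\<one>\<^bsub>G\<^esub> = 1\<^sub>m r" for V V' by (simp_all add: G_def SL_def)
    show "F \<subseteq> X.DC" unfolding F_def by (rule W)
    show "X.\<beta> i \<in> F" if "1 \<le> i" "i < r" for i unfolding F_def by (rule W(9)[OF that])
    show "X.\<kappa> x \<in> F" if "x ^ q = x" for x
    proof -
      have "x \<in> range (to_ac :: 'k \<Rightarrow> _)" using range_ac that by blast
      thus ?thesis using W(8) \<tau>F by blast
    qed
  qed
  then obtain E \<alpha> where E: "galois_action G E F \<alpha>" "E \<inter> X.S \<subseteq> F" by blast
  interpret E: galois_action G E F \<alpha> by (rule E)
  define \<chi> where "\<chi> x = (to_ac (inv_into W \<psi> x) :: 'k universe)" for x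
  have \<chi>\<psi>: "\<chi> (\<psi> w) = to_ac w" if "w \<in> W" for w
    using that by (simp add: \<chi>_def inv_into_f_f[OF W.inj])
  have "fhom F \<chi>" unfolding fhom_def
  proof (intro conjI ballI)
    show "\<chi> 1 = 1" using \<chi>\<psi>[OF W.one] by simp
    fix x z assume "x \<in> F" "z \<in> F"
    then obtain a b where ab: "a \<in> W" "b \<in> W" "x = \<psi> a" "z = \<psi> b" by (auto simp: F_def)
    show "\<chi> (x + z) = \<chi> x + \<chi> z" "\<chi> (x * z) = \<chi> x * \<chi> z"
      using ab \<chi>\<psi>[OF W.add[OF ab(1,2)]] \<chi>\<psi>[OF W.mult[OF ab(1,2)]] by (simp_all add: W.h_add W.h_mult \<chi>\<psi>)
  qed
  then obtain \<Phi> where \<Phi>: "fhom E \<Phi>" "\<And>x. x \<in> F \<Longrightarrow> \<Phi> x = \<chi> x" using E.transport by blast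
  have "\<Phi> ` F = to_ac ` W" using \<Phi>(2) \<chi>\<psi> by (auto simp: F_def image_iff)
  hence pure: "\<Phi> ` F = pure_field (r - 1)" unfolding pure_field_eq W_def .
  have \<Phi>\<tau>: "\<Phi> (\<tau> c) = const_univ c" for c
    using \<Phi>(2)[of "\<tau> c"] \<tau>F \<chi>\<psi>[OF W(3)[of c]] W(4)[of c] by (auto simp: const_univ_def)
  have const: "const_field = \<Phi> ` range \<tau>" by (auto simp: const_field_def \<Phi>\<tau> image_iff)
  have reg: "regular_extension const_field (\<Phi> ` E)"
    unfolding regular_extension_def
  proof (intro ballI impI)
    fix z assume z: "z \<in> \<Phi> ` E" "ring.algebraic ambient const_field z"
    then obtain x where x: "x \<in> E" "z = \<Phi> x" by blast
    obtain f where f: "f \<in> coeffs_in const_field" "f \<noteq> 0" "poly f z = 0"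
      using z(2) algebraic_iff_poly[OF subfld_const_field] by blast
    have "0 = \<psi> (to_fract (Poly_Mapping.single 0 0))" by simp
    hence "0 \<in> range \<tau>" unfolding W(4) by blast
    hence "\<exists>f'\<in>coeffs_in (range \<tau>). f' \<noteq> 0 \<and> poly f' x = 0"
      by (intro algebraic_preimage[OF E.E \<Phi>(1) _ _ x(1) f(1)[unfolded const] f(2) f(3)[unfolded x(2)]])
         (use \<tau>F E.FE in auto)
    then obtain f' where f': "f' \<in> coeffs_in (range \<tau>)" "f' \<noteq> 0" "poly f' x = 0" by blast
    \<comment> \<open>An element algebraic over k(T) is a series with constant coefficients. Within
      \<open>E\<close> such a series lies in \<open>F\<close>, and within \<open>F\<close> it comes
      from k(T).\<close>
    have "x \<in> X.S" by (rule X.S.S_algebraic[OF f'(2) _ f'(3)]) (use f'(1) W(5) in \<open>auto simp: coeffs_in_def\<close>)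
    hence "x \<in> F" using x(1) E(2) by blast
    hence "x \<in> range \<tau>" using \<open>x \<in> X.S\<close> W(10) by (auto simp: F_def)
    thus "z \<in> const_field" unfolding const x(2) by blast
  qed
  define \<alpha>' where "\<alpha>' = (\<lambda>g z. \<Phi> (\<alpha> g (inv_into E \<Phi> z)))"
  have act: "galois_action G (\<Phi> ` E) (pure_field (r - 1)) \<alpha>'"
    unfolding \<alpha>'_def pure[symmetric] by (rule E.galois_action_image[OF \<Phi>(1)])
  interpret A: galois_action G "\<Phi> ` E" "pure_field (r - 1)" \<alpha>' by (rule act)
  define K where "K = A.fixed_field (group_center G)"
  note gal = galois_quotient[OF act G.group_center_normal, folded K_def]
  have "K \<subseteq> \<Phi> ` E" by (auto simp: K_def A.fixed_field_def)
  hence "regular_extension const_field K" using reg by (auto simp: regular_extension_def)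
  moreover have "galois_group (pure_field (r - 1)) K \<cong> PSL r (GF (q ^ d) :: 'k alg_closure set)"
    using gal(2) unfolding PSL_def G_def Q_def .
  ultimately show ?thesis using gal(1) by blast
qed

theorem mainTheorem1:
  fixes p m q :: nat
  assumes "prime p" and "odd p" and "m > 0" and "q = p ^ m"
    and "CARD('k :: {field, finite}) = q"
  shows "\<forall>r d :: nat. r > 0 \<and> d > 0 \<and> even r \<and> gcd r (q ^ d - 1) = 2 \<longrightarrow>
    (\<exists>E :: 'k universe set.
       galois_extension (pure_field (r - 1)) E \<and>
       regular_extension const_field E \<and>
       galois_group (pure_field (r - 1)) E \<cong> PSL r (GF (q ^ d) :: 'k alg_closure set))"
  using PSL_regular_realization[OF assms(1,3,4,5)] by blast

end
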